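(* Let $\mathbf W\subset\mathbb R^{n+1}$ be closed, $\Omega=\mathbb R^{n+1}\setminus\mathbf W$, and $\mathcal C$ a spanning class for $\mathbf W$. Let $\varepsilon_j>0$, $\delta_j\in(1/2,1]$ with $\varepsilon_j\to\varepsilon_0$ and $\delta_j\to\delta_0$; let $u_j\in W^{1,2}(\Omega;[0,1])$ with $\sup_j\mathcal{AC}_{\varepsilon_j}(u_j;\Omega)<\infty$ and $u_j\to u$ in $L^1_{\rm loc}(\Omega)$, such that $\{u_j^*\ge t\}$ is $\mathcal C$-spanning $\mathbf W$ for every $t\in(1/2,\delta_j)$ and every $j$. If $\varepsilon_0>0$ and $\delta_0>1/2$ (with $\delta_0\le1$), then $u\in W^{1,2}_{\rm loc}(\Omega)$ and $\{u^*\ge t\}$ is $\mathcal C$-spanning $\mathbf W$ for every $t\in(1/2,\delta_0)$.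
   Context: $W\in C^{2,1}[0,1]$ satisfies $W(0)=W(1)=0$, $W>0$ on $(0,1)$, $W''(0),W''(1)>0$, $\int_0^1\sqrt W=1$; $\mathcal{AC}_\varepsilon(u;\Omega)=\int_\Omega\varepsilon|\nabla u|^2+W(u)/\varepsilon$. $u^*$ is the precise representative of $u$ ($u^*=u^+=u^-$ where $u^+(x)=\inf\{t:x\in\{u>t\}^{(0)}\}$ and $u^-(x)=\sup\{t:x\in\{u<t\}^{(0)}\}$ agree). Notation: $\mathcal H^n$ is $n$-dimensional Hausdorff measure, $|\cdot|$ Lebesgue measure; $A$ is $\mathcal H^n$-contained in $B$ if $\mathcal H^n(A\setminus B)=0$. For measurable $E$, $E^{(t)}$ = points of density $t$ of $E$, $\partial^eE=\mathbb R^{n+1}\setminus(E^{(0)}\cup E^{(1)})$. Spanning class: a family $\mathcal C$ of smooth embeddings $\gamma:\mathbb S^1\to\Omega$ such that $\Phi(\cdot,1)\in\mathcal C$ whenever $\Phi\in C^\infty(\mathbb S^1\times[0,1];\Omega)$, each $\Phi(\cdot,t)$ is a smooth embedding, and $\Phi(\cdot,0)\in\mathcal C$. $\mathcal T(\mathcal C)$ is the set of triples $(\gamma,\Phi,T)$ with $\gamma\in\mathcal C$, $T=\Phi(\mathbb S^1\times B_1^n)\subset\subset\Omega$, $\Phi:\mathbb S^1\times\overline{B^n_1}\to\overline T$ a diffeomorphism with $\Phi(s,0)=\gamma(s)$; $T[s]=\Phi(\{s\}\times B_1^n)$. A Borel $K$ essentially disconnects a Borel $G$ into $\{G_1,G_2\}$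 if $\{G_1,G_2\}$ is a Lebesgue partition of $G$ with $|G_1||G_2|>0$ and $G^{(1)}\cap\partial^eG_1\cap\partial^eG_2$ is $\mathcal H^n$-contained in $K$. A Borel $S\subset\Omega$ is $\mathcal C$-spanning $\mathbf W$ if for every $(\gamma,\Phi,T)\in\mathcal T(\mathcal C)$, for $\mathcal H^1$-a.e. $s\in\mathbb S^1$ and $\mathcal H^n$-a.e. $x\in T[s]$, there is a partition $\{T_1,T_2\}$ of $T$ with $x\in\partial^eT_1\cap\partial^eT_2$ such that $S\cup T[s]$ essentially disconnects $T$ into $\{T_1,T_2\}$. *)

theory Defs
  imports "HOL-Analysis.Analysis" "HOL-Library.FuncSet"
begin

definition pdiff :: "'a::euclidean_space \<Rightarrow> ('a \<Rightarrow> 'b::real_normed_vector) \<Rightarrow> 'a \<Rightarrow> 'b" where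
  "pdiff v f x = vector_derivative (\<lambda>t. f (x + t *\<^sub>R v)) (at 0)"

fun pdiffs :: "'a::euclidean_space list \<Rightarrow> ('a \<Rightarrow> 'b::real_normed_vector) \<Rightarrow> 'a \<Rightarrow> 'b" where
  "pdiffs [] f = f"
| "pdiffs (v # vs) f = pdiff v (pdiffs vs f)"

definition smooth_open :: "'a::euclidean_space set \<Rightarrow> ('a \<Rightarrow> 'b::real_normed_vector) \<Rightarrow> bool" where
  "smooth_open U f \<longleftrightarrow> open U \<and>
     (\<forall>vs. set vs \<subseteq> Basis \<longrightarrow> continuous_on U (pdiffs vs f) \<and>
        (\<forall>v\<in>Basis. \<forall>x\<in>U. ((\<lambda>t. pdiffs vs f (x + t *\<^sub>R v)) has_vector_derivative pdiffs (v # vs) f x) (at 0)))"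

definition smooth_on :: "'a::euclidean_space set \<Rightarrow> ('a \<Rightarrow> 'b::real_normed_vector) \<Rightarrow> bool" where
  "smooth_on S f \<longleftrightarrow> (\<exists>U g. S \<subseteq> U \<and> smooth_open U g \<and> (\<forall>x\<in>S. g x = f x))"

definition hausdorff :: "nat \<Rightarrow> 'a::metric_space set \<Rightarrow> ennreal" where
  "hausdorff m A = (SUP \<delta>\<in>{0<..}. INF C\<in>{C::nat \<Rightarrow> 'a set. A \<subseteq> (\<Union>i. C i) \<and> (\<forall>i. bounded (C i) \<and> diameter (C i) \<le> \<delta>)}.
        (\<Sum>i. ennreal (unit_ball_vol (real m) * (diameter (C i) / 2) ^ m)))"

definition dens_pts :: "'a::euclidean_space set \<Rightarrow> real \<Rightarrow> 'a set" where
  "dens_pts E t = {x. ((\<lambda>r. measure lebesgue (E \<inter> ball x r) / measure lebesgue (ball x r)) \<longlongrightarrow> t) (at_right 0)}"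

definition ess_bd :: "'a::euclidean_space set \<Rightarrow> 'a set" where
  "ess_bd E = UNIV - (dens_pts E 0 \<union> dens_pts E 1)"

definition leb_partition :: "'a::euclidean_space set \<Rightarrow> 'a set \<Rightarrow> 'a set \<Rightarrow> bool" where
  "leb_partition G G1 G2 \<longleftrightarrow> G1 \<in> sets lebesgue \<and> G2 \<in> sets lebesgue \<and> G1 \<subseteq> G \<and> G2 \<subseteq> G \<and>
     emeasure lebesgue (G - (G1 \<union> G2)) = 0 \<and> emeasure lebesgue (G1 \<inter> G2) = 0"

text \<open>K essentially disconnects G into {G1,G2}; the hypersurface dimension is n = DIM('a) - 1.\<close>
definition ess_disconnects :: "'a::euclidean_space set \<Rightarrow> 'a set \<Rightarrow> 'a set \<Rightarrow> 'a set \<Rightarrow> bool" where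
  "ess_disconnects K G G1 G2 \<longleftrightarrow> leb_partition G G1 G2 \<and>
     emeasure lebesgue G1 * emeasure lebesgue G2 > 0 \<and>
     hausdorff (DIM('a) - 1) ((dens_pts G 1 \<inter> ess_bd G1 \<inter> ess_bd G2) - K) = 0"

definition test_fn :: "'a::euclidean_space set \<Rightarrow> ('a \<Rightarrow> real) \<Rightarrow> bool" where
  "test_fn \<Omega> \<phi> \<longleftrightarrow> smooth_open UNIV \<phi> \<and> compact (closure {x. \<phi> x \<noteq> 0}) \<and> closure {x. \<phi> x \<noteq> 0} \<subseteq> \<Omega>"

definition weak_grad :: "'a::euclidean_space set \<Rightarrow> ('a \<Rightarrow> real) \<Rightarrow> ('a \<Rightarrow> 'a) \<Rightarrow> bool" where
  "weak_grad \<Omega> u g \<longleftrightarrow>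
     (\<forall>K. compact K \<and> K \<subseteq> \<Omega> \<longrightarrow> set_integrable lebesgue K u \<and> set_integrable lebesgue K g) \<and>
     (\<forall>\<phi>. test_fn \<Omega> \<phi> \<longrightarrow> (\<forall>b\<in>Basis.
        (LINT x:\<Omega>|lebesgue. u x * pdiff b \<phi> x) = - (LINT x:\<Omega>|lebesgue. (g x \<bullet> b) * \<phi> x)))"

definition wgrad :: "'a::euclidean_space set \<Rightarrow> ('a \<Rightarrow> real) \<Rightarrow> 'a \<Rightarrow> 'a" where
  "wgrad \<Omega> u = (SOME g. weak_grad \<Omega> u g)"

definition W12 :: "'a::euclidean_space set \<Rightarrow> ('a \<Rightarrow> real) \<Rightarrow> bool" where
  "W12 \<Omega> u \<longleftrightarrow> (\<exists>g. weak_grad \<Omega> u g \<and> set_integrable lebesgue \<Omega> (\<lambda>x. (u x)\<^sup>2) \<and>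
       set_integrable lebesgue \<Omega> (\<lambda>x. (norm (g x))\<^sup>2))"

definition W12_loc :: "'a::euclidean_space set \<Rightarrow> ('a \<Rightarrow> real) \<Rightarrow> bool" where
  "W12_loc \<Omega> u \<longleftrightarrow> (\<exists>g. weak_grad \<Omega> u g \<and> (\<forall>K. compact K \<and> K \<subseteq> \<Omega> \<longrightarrow>
       set_integrable lebesgue K (\<lambda>x. (u x)\<^sup>2) \<and> set_integrable lebesgue K (\<lambda>x. (norm (g x))\<^sup>2)))"

definition W12_unit :: "'a::euclidean_space set \<Rightarrow> ('a \<Rightarrow> real) \<Rightarrow> bool" where
  "W12_unit \<Omega> u \<longleftrightarrow> W12 \<Omega> u \<and> (AE x in lebesgue. x \<in> \<Omega> \<longrightarrow> u x \<in> {0..1})"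

definition AC :: "(real \<Rightarrow> real) \<Rightarrow> real \<Rightarrow> ('a::euclidean_space \<Rightarrow> real) \<Rightarrow> 'a set \<Rightarrow> ennreal" where
  "AC Wp \<epsilon> u \<Omega> = (\<integral>\<^sup>+ x. ennreal (\<epsilon> * (norm (wgrad \<Omega> u x))\<^sup>2 + Wp (u x) / \<epsilon>) * indicator \<Omega> x \<partial>lebesgue)"

definition L1loc_conv :: "'a::euclidean_space set \<Rightarrow> (nat \<Rightarrow> 'a \<Rightarrow> real) \<Rightarrow> ('a \<Rightarrow> real) \<Rightarrow> bool" where
  "L1loc_conv \<Omega> uj u \<longleftrightarrow> (\<forall>K. compact K \<and> K \<subseteq> \<Omega> \<longrightarrow>
      set_integrable lebesgue K u \<and> (\<forall>j. set_integrable lebesgue K (uj j)) \<and>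
      (\<lambda>j. LINT x:K|lebesgue. \<bar>uj j x - u x\<bar>) \<longlonglongrightarrow> 0)"

definition double_well :: "(real \<Rightarrow> real) \<Rightarrow> bool" where
  "double_well Wp \<longleftrightarrow>
     (\<exists>W1 W2 L. (\<forall>x\<in>{0..1}. (Wp has_real_derivative W1 x) (at x within {0..1}) \<and>
                             (W1 has_real_derivative W2 x) (at x within {0..1})) \<and>
               lipschitz_on L {0..1} W2 \<and> W2 0 > 0 \<and> W2 1 > 0) \<and>
     Wp 0 = 0 \<and> Wp 1 = 0 \<and> (\<forall>x\<in>{0<..<1}. Wp x > 0) \<and>
     integral {0..1} (\<lambda>s. sqrt (Wp s)) = 1"

definition u_plus :: "'a::euclidean_space set \<Rightarrow> ('a \<Rightarrow> real) \<Rightarrow> 'a \<Rightarrow> real" where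
  "u_plus \<Omega> u x = Inf {t. x \<in> dens_pts {y\<in>\<Omega>. u y > t} 0}"

definition u_minus :: "'a::euclidean_space set \<Rightarrow> ('a \<Rightarrow> real) \<Rightarrow> 'a \<Rightarrow> real" where
  "u_minus \<Omega> u x = Sup {t. x \<in> dens_pts {y\<in>\<Omega>. u y < t} 0}"

text \<open>{u* \<ge> t}: points of \<Omega> where the precise representative is defined and is \<ge> t\<close>
definition prec_ge :: "'a::euclidean_space set \<Rightarrow> ('a \<Rightarrow> real) \<Rightarrow> real \<Rightarrow> 'a set" where
  "prec_ge \<Omega> u t = {x\<in>\<Omega>. u_plus \<Omega> u x = u_minus \<Omega> u x \<and> u_plus \<Omega> u x \<ge> t}"

abbreviation S1 :: "complex set" where "S1 \<equiv> sphere 0 1"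

definition smooth_emb :: "'a::euclidean_space set \<Rightarrow> (complex \<Rightarrow> 'a) \<Rightarrow> bool" where
  "smooth_emb \<Omega> \<gamma> \<longleftrightarrow> smooth_on S1 \<gamma> \<and> inj_on \<gamma> S1 \<and> \<gamma> ` S1 \<subseteq> \<Omega> \<and>
     (\<forall>\<theta>. \<exists>v. v \<noteq> 0 \<and> ((\<lambda>\<theta>. \<gamma> (cis \<theta>)) has_vector_derivative v) (at \<theta>))"

text \<open>Curves are represented as functions on S1 (extensional: undefined off S1).\<close>
definition spanning_class :: "'a::euclidean_space set \<Rightarrow> (complex \<Rightarrow> 'a) set \<Rightarrow> bool" where
  "spanning_class Wb C \<longleftrightarrow> (\<forall>\<gamma>\<in>C. \<gamma> \<in> extensional S1 \<and> smooth_emb (- Wb) \<gamma>) \<and>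
     (\<forall>\<Phi> :: complex \<times> real \<Rightarrow> 'a. smooth_on (S1 \<times> {0..1}) \<Phi> \<and> \<Phi> ` (S1 \<times> {0..1}) \<subseteq> - Wb \<and>
        (\<forall>t\<in>{0..1}. smooth_emb (- Wb) (\<lambda>s. \<Phi> (s, t))) \<and> restrict (\<lambda>s. \<Phi> (s, 0)) S1 \<in> C
        \<longrightarrow> restrict (\<lambda>s. \<Phi> (s, 1)) S1 \<in> C)"

text \<open>Tubes (\<gamma>,\<Phi>,T) in \<T>(C); 'b plays the role of R^n, the ambient 'a of R^(n+1).\<close>
definition tube :: "(complex \<Rightarrow> 'a::euclidean_space) set \<Rightarrow> 'a set \<Rightarrow> (complex \<Rightarrow> 'a) \<Rightarrow>
    (complex \<times> 'b::euclidean_space \<Rightarrow> 'a) \<Rightarrow> 'a set \<Rightarrow> bool" where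
  "tube C Wb \<gamma> \<Phi> T \<longleftrightarrow> \<gamma> \<in> C \<and> T = \<Phi> ` (S1 \<times> ball 0 1) \<and>
     compact (closure T) \<and> closure T \<subseteq> - Wb \<and>
     bij_betw \<Phi> (S1 \<times> cball 0 1) (closure T) \<and>
     smooth_on (S1 \<times> cball 0 1) \<Phi> \<and> smooth_on (closure T) (inv_into (S1 \<times> cball 0 1) \<Phi>) \<and>
     (\<forall>s\<in>S1. \<Phi> (s, 0) = \<gamma> s)"

definition slice :: "(complex \<times> 'b::euclidean_space \<Rightarrow> 'a) \<Rightarrow> complex \<Rightarrow> 'a set" where
  "slice \<Phi> s = \<Phi> ` ({s} \<times> ball 0 1)"

definition spanning :: "'b::euclidean_space itself \<Rightarrow> (complex \<Rightarrow> 'a::euclidean_space) set \<Rightarrow> 'a set \<Rightarrow> 'a set \<Rightarrow> bool" where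
  "spanning _ C Wb S \<longleftrightarrow> S \<in> sets borel \<and> S \<subseteq> - Wb \<and>
     (\<forall>\<gamma> (\<Phi> :: complex \<times> 'b \<Rightarrow> 'a) T. tube C Wb \<gamma> \<Phi> T \<longrightarrow>
        hausdorff 1 {s\<in>S1. \<not> (hausdorff DIM('b)
            {x\<in>slice \<Phi> s. \<not> (\<exists>T1 T2. x \<in> ess_bd T1 \<inter> ess_bd T2 \<and>
                                    ess_disconnects (S \<union> slice \<Phi> s) T T1 T2)} = 0)} = 0)"

end

theory Submission
  imports Defs "HOL-Computational_Algebra.Polynomial" "HOL-Library.Diagonal_Subsequence"
begin

text \<open>Weak derivatives enter only through upper gradients, i.e. bounds for the oscillation of a function along
almost every segment. The uniform gradient bound passes to the limit by Mazur's lemma, which gives the Sobolev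
regularity of the limit u.

For the spanning condition fix a tube T, a slice T[s] and t, and put f_j = max 0 (t - u_j). If
{u_j* >= t} and T[s] essentially disconnect T along A_j, then outside T[s] the function f_j vanishes
(as a trace) on the essential boundary of A_j up to an H^n-null set, so f_j 1_{A_j} keeps the upper gradient of f_j:
it may jump across T[s] only. Hence Rellich compactness applies in T - T[s], with a limit f 1_B. At almost every x
of T[s] the energies in small balls around x are controlled along a subsequence, so that f_j 1_{A_j} has traces at x on
cones on both sides of T[s], uniformly in j. These traces are 0 and f_j(x) since x lies on the essential
boundary of A_j, and so the limit has traces 0 and f(x) on the two sides: if u*(x) < t then x lies on the essential
boundary of B, and B disconnects. If u*(x) >= t, one cuts {u >= t} along T[s] instead.\<close>

text \<open>No perimeter bound for A_j is available: its essential boundary is controlled only where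
  f_j has positive trace. That f_j 1_{A_j} does not jump off T[s] is therefore proved on lines,
  without BV theory. On a segment where f_j has positive traces, the points of density 1 and of
  density 0 form countable unions of closed sets (\<open>fat\<close>), so by Baire a change between
  them forces a point where the set is uniformly dense and beside which the line misses it on a
  one-sided interval. Almost every line has no such point (\<open>AE_not_fat_cut\<close>). Traces
  are taken at dyadic scales 2^-k. Where the mean of the gradient over balls of radius 2^-k is
  O((3/2)^k), Poincare bounds the oscillation by O((3/4)^k), which is summable. The ratio 3/2 lies
  below 2 for this reason, above 1 so that almost every point qualifies, and above sqrt 2 so that an
  L^2 energy bound excludes only an H^n-null set. Fatou yields such bounds only for infinitely many
  j, depending on x. This is harmless since the partition asked for in the spanning condition may
  depend on x as well.\<close>

text \<open>Lebesgue integrals of nonnegative functions are written LI x. f x and LI x:S. f x.\<close>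

abbreviation (input) lebint :: "('a::euclidean_space \<Rightarrow> ennreal) \<Rightarrow> ennreal" (binder "LI " 10) where
  "lebint f \<equiv> nn_integral lborel f"

syntax "_SLI" :: "pttrn \<Rightarrow> 'a set \<Rightarrow> ennreal \<Rightarrow> ennreal" ("(3LI _:_./ _)" [0, 51, 10] 10)
translations "LI x:S. f" \<rightharpoonup> "CONST set_nn_integral (CONST lborel) S (\<lambda>x. f)"

abbreviation (input) "dev S f a \<equiv> LI x:S. ennreal \<bar>f x - a\<bar>"
abbreviation (input) "dist1 S f g \<equiv> LI x:S. ennreal \<bar>f x - g x\<bar>"
abbreviation (input) "vol \<equiv> emeasure lborel"
abbreviation (input) "BM \<equiv> borel_measurable borel"
abbreviation (input) "ind \<equiv> indicat_real"
abbreviation (input) "chi \<equiv> indicator"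
abbreviation (input) "en \<equiv> ennreal"
type_synonym en = ennreal
abbreviation (input) "sq \<equiv> sequentially"
abbreviation (input) hp :: "nat \<Rightarrow> real" where "hp k \<equiv> (1/2) ^ k"
notation (input) scaleR (infixr "*R" 75)
notation (input) LIMSEQ ("((_)/ ----> (_))" [60, 60] 60)

section \<open>Integration on Euclidean space\<close>

lemma nn_integral_affine:
 fixes f :: "'a::euclidean_space => en"
 assumes [measurable]: "f \<in> BM" and c: "c \<noteq> 0"
 shows "(LI x. f x) = en (\<bar>c\<bar>^DIM('a))*(LI x. f (t + c *R x))"
 by (subst lborel_affine[OF c, of t])
   (simp add: nn_integral_density nn_integral_distr nn_integral_cmult)

lemma nn_integral_translate:
 fixes f :: "'a::euclidean_space => en"
 assumes "f \<in> BM"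
 shows "(LI x. f (x + t)) = (LI x. f x)"
 using nn_integral_affine[OF assms, of 1 t] by (simp add: add.commute)

lemma AE_translate:
 fixes P :: "'a::euclidean_space => bool"
 assumes "AE p in lborel. P p" shows "AE p in lborel. P (p + h)"
proof -
 obtain N where N: "N \<in> null_sets lborel" "{p. ~ P p} \<subseteq> N"
  using assms by (auto elim!: AE_E simp: null_sets_def)
 have [measurable]: "N \<in> sets borel" using N by auto
 have "(LI p. chi N (p + h)) = 0"
  using nn_integral_translate[of "chi N" h] N by auto
 then have "AE p in lborel. chi N (p + h) = (0::en)"
  by (subst (asm) nn_integral_0_iff_AE) auto
 then show ?thesis using N by (auto elim!: eventually_mono simp: indicator_def split: if_splits)
qed

lemma AE_along_lines:
 fixes P :: "'a::euclidean_space => bool"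
 assumes "AE p in lborel. P p"
 shows "AE p in lborel. AE ta in lborel. P (p + ta *R h)"
proof -
 obtain N where N: "N \<in> null_sets lborel" "{p. ~ P p} \<subseteq> N"
  using assms by (auto elim!: AE_E simp: null_sets_def)
 have [measurable]: "N \<in> sets borel" using N by auto
 have "(LI p. LI ta. chi N (p + ta *R h))
   = (LI ta. LI p. chi N (p + ta *R h))"
  by (rule lborel_pair.Fubini') simp
 also have "... = 0"
  using N by (simp add: nn_integral_translate null_setsD1)
 finally have "AE p in lborel. (LI ta. chi N (p + ta *R h)) = 0"
  by (subst (asm) nn_integral_0_iff_AE) auto
 then show ?thesis
 proof eventually_elim
  case (elim p)
  then have "AE ta in lborel. chi N (p + ta *R h) = (0::en)"
   by (subst (asm) nn_integral_0_iff_AE) auto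
  then show ?case using N by (auto elim!: eventually_mono simp: indicator_def split: if_splits)
 qed
qed

text \<open>Translating S by \<open>ta *R h\<close> and averaging over ta in [0,1] leaves its
  measure unchanged, and Fubini turns the average into line integrals. This avoids splitting the
  space into a line and its complement.\<close>

lemma null_if_null_along_lines:
 fixes S :: "'a::euclidean_space set"
 assumes [measurable]: "S \<in> sets borel" and "!!p. (LI ta. chi S (p + ta *R h)) = 0"
 shows "S \<in> null_sets lborel"
proof -
 have "vol S = (LI ta. chi {0..1::real} ta * vol S)"
  by (simp add: nn_integral_multc)
 also have "... = (LI ta. chi {0..1::real} ta*(LI p. chi S (p + ta *R h)))"
  by (simp add: nn_integral_translate)
 also have "... <= (LI ta. (LI p. chi S (p + ta *R h)))"
  by (intro nn_integral_mono) (auto simp: indicator_def)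
 also have "... = (LI p. LI ta. chi S (p + ta *R h))"
  by (rule lborel_pair.Fubini') simp
 also have "... = 0" by (simp add: assms(2))
 finally show ?thesis by (auto simp: null_sets_def)
qed

text \<open>Along a subsequence with summable integrals the series of the functions is finite almost
  everywhere, so its terms tend to 0.\<close>

lemma AE_subseq_if_nn_integral_tendsto_0:
 fixes D :: "nat => 'a => en"
 assumes [measurable]: "!!k. D k \<in> borel_measurable M"
  and lim: "(%k. \<integral>\<^sup>+x. D k x \<partial>M) ----> 0"
 shows "\<exists>s. strict_mono s & (AE x in M. (%k. D (s k) x) ----> 0)"
proof -
 have ex: "\<exists>n>m. (\<integral>\<^sup>+x. D n x \<partial>M) < en ((1/2)^k)" for k m
 proof -
  have "eventually (%n. (\<integral>\<^sup>+x. D n x \<partial>M) < en ((1/2)^k)) sq"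
   using order_tendstoD(2)[OF lim, of "en ((1/2)^k)"] by simp
  then have "eventually (%n. m < n & (\<integral>\<^sup>+x. D n x \<partial>M) < en ((1/2)^k)) sq"
   by (intro eventually_conj eventually_gt_at_top)
  then show ?thesis using eventually_happens'[OF sequentially_bot] by blast
 qed
 have "\<exists>s. \<forall>k. (\<integral>\<^sup>+x. D (s k) x \<partial>M) < en ((1/2)^k) & s k < s (Suc k)"
 proof (rule dependent_nat_choice)
  show "\<exists>x. (\<integral>\<^sup>+y. D x y \<partial>M) < en ((1/2)^0)" using ex[of 0 0] by blast
  show "\<exists>y. (\<integral>\<^sup>+z. D y z \<partial>M) < en ((1/2)^Suc k) & x < y" for x k
   using ex[of x "Suc k"] by blast
 qed
 then obtain s where s: "!!k. (\<integral>\<^sup>+x. D (s k) x \<partial>M) < en ((1/2)^k)" "!!k. s k < s (Suc k)"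
  by blast
 have "(\<integral>\<^sup>+x. (\<Sum>k. D (s k) x) \<partial>M) = (\<Sum>k. \<integral>\<^sup>+x. D (s k) x \<partial>M)"
  by (rule nn_integral_suminf) simp
 also have "... <= (\<Sum>k. en ((1/2)^k))"
  by (intro suminf_le) (auto intro: less_imp_le s)
 also have "... = en (\<Sum>k. (1/2)^k)"
  by (rule suminf_ennreal2) (auto simp: summable_geometric)
 finally have "(\<integral>\<^sup>+x. (\<Sum>k. D (s k) x) \<partial>M) \<noteq> \<infinity>" by (auto simp: top_unique)
 then have "AE x in M. (\<Sum>k. D (s k) x) \<noteq> \<infinity>" by (intro nn_integral_PInf_AE) auto
 then have "AE x in M. (%k. D (s k) x) ----> 0"
 proof eventually_elim
  case (elim x)
  then have fin: "D (s k) x < top" for k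
   using ennreal_suminf_lessD[of "%k. D (s k) x" top] by (auto simp: less_top)
  then have eq: "D (s k) x = en (enn2real (D (s k) x))" for k by simp
  have "summable (%k. enn2real (D (s k) x))"
   by (rule summable_suminf_not_top) (use elim eq in auto)
  then have "(%k. en (enn2real (D (s k) x))) ----> en 0"
   by (intro tendsto_ennrealI summable_LIMSEQ_zero)
  then show ?case using eq by simp
 qed
 then show ?thesis using s(2) strict_mono_Suc_iff by blast
qed

section \<open>Continuity of translations in L^1\<close>

definition trdiff :: "('a::euclidean_space => real) => 'a => en" where
 "trdiff F v = (LI p. en \<bar>F (p + v) - F p\<bar>)"

lemma trdiff_measurable [measurable]:
 assumes [measurable]: "F \<in> BM"
 shows "trdiff F \<in> BM"
proof -
 have "(%v. LI p. en \<bar>F (p + v) - F p\<bar>) \<in> borel_measurable lborel"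
  by measurable
 then show ?thesis unfolding trdiff_def[abs_def] by simp
qed

lemma trdiff_triangle:
 assumes [measurable]: "F \<in> BM" "H \<in> BM"
 shows "trdiff F v <= trdiff H v + 2*(LI p. en \<bar>F p - H p\<bar>)"
proof -
 have "trdiff F v <= (LI p. en \<bar>H (p + v) - H p\<bar> + (en \<bar>F (p+v) - H (p+v)\<bar> + en \<bar>F p - H p\<bar>))"
  unfolding trdiff_def by (intro nn_integral_mono) (auto simp flip: ennreal_plus intro!: ennreal_leI)
 also have "... = trdiff H v + ((LI p. en \<bar>F (p+v) - H (p+v)\<bar>) + (LI p. en \<bar>F p - H p\<bar>))"
  by (simp add: nn_integral_add trdiff_def)
 also have "(LI p. en \<bar>F (p+v) - H (p+v)\<bar>) = (LI p. en \<bar>F p - H p\<bar>)"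
  using nn_integral_translate[of "%p. en \<bar>F p - H p\<bar>" v] by simp
 finally show ?thesis by (simp add: mult_2)
qed


text \<open>The inner boundary layers \<open>D n\<close> of U decrease to the empty set, and finite
  measure makes them small. A translation shorter than 1/(n+1) moves points out of U only from
  \<open>D n\<close>; the points entering U are counted by the opposite translation.\<close>

lemma trdiff_small_open:
 fixes U :: "'a::euclidean_space set"
 assumes U: "open U" and fin: "vol U < \<infinity>" and e: "e > 0"
 shows "\<exists>d>0. \<forall>v. norm v < d --> trdiff (chi U) v <= en e"
proof -
 have [measurable]: "U \<in> sets borel" using U by simp
 define V where "V r = {p. ball p r \<subseteq> U}" for r
 have V: "V r = - (\<Union>q\<in>-U. ball q r)" for r
  by (auto simp: V_def dist_commute)
 have [measurable]: "V r \<in> sets borel" for r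
  unfolding V by (intro borel_comp borel_open open_UN) auto
 define D where "D n = U - V (1/Suc n)" for n :: nat
 have "(%n. vol (D n)) ----> vol (\<Inter>n. D n)"
 proof (rule Lim_emeasure_decseq)
  show "decseq D" unfolding decseq_def
  proof (intro allI impI)
   fix m n :: nat assume "m <= n"
   then have "1/real (Suc n) <= 1/real (Suc m)" by (intro divide_left_mono) auto
   then have "ball p (1/real (Suc n)) \<subseteq> ball p (1/real (Suc m))" for p :: 'a
    by (rule subset_ball)
   then show "D n \<subseteq> D m" unfolding D_def V_def by blast
  qed
  show "vol (D i) \<noteq> \<infinity>" for i
   using emeasure_mono[of "D i" U lborel] fin by (auto simp: D_def top_unique)
 qed (auto simp: D_def)
 moreover have "(\<Inter>n. D n) = {}"
 proof -
  have "p \<notin> (\<Inter>n. D n)" for p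
  proof (cases "p \<in> U")
   case True
   then obtain r where "r > 0" "ball p r \<subseteq> U" using U by (meson open_contains_ball)
   moreover obtain n where "1/Suc n < r" using nat_approx_posE[OF \<open>r > 0\<close>] by blast
   ultimately have "p \<in> V (1/Suc n)" unfolding V_def by (auto simp: subset_iff)
   then show ?thesis by (auto simp: D_def)
  qed (auto simp: D_def)
  then show ?thesis by blast
 qed
 ultimately have "(%n. vol (D n)) ----> 0" by simp
 then have "eventually (%n. vol (D n) < en (e/2)) sq"
  by (rule order_tendstoD) (use e in simp)
 then obtain n where n: "vol (D n) < en (e/2)"
  by (meson eventually_happens sequentially_bot)
 have half: "(LI p. chi U p*chi (-U) (p + v)) <= en (e/2)" 
  if v: "norm v < 1/Suc n" for v
 proof -
  have "(LI p. chi U p*chi (-U) (p + v)) <= (LI p. chi (D n) p)"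
   by (intro nn_integral_mono) (use v in \<open>auto simp: D_def V_def indicator_def dist_norm subset_iff\<close>)
  then show ?thesis using less_imp_le[OF n] by (simp add: D_def)
 qed
 show ?thesis
 proof (intro exI[of _ "1/Suc n"] conjI allI impI)
  fix v :: 'a assume v: "norm v < 1/Suc n"
  have "trdiff (chi U) v <= (LI p. chi U p*chi (-U) (p + v) + chi U (p + v)*chi (-U) p)"
   unfolding trdiff_def by (intro nn_integral_mono) (auto simp: indicator_def)
  also have "... = (LI p. chi U p*chi (-U) (p + v))
    + (LI p. chi U (p + v)*chi (-U) p)"
   by (simp add: nn_integral_add)
  also have "(LI p. chi U (p + v)*chi (-U) p)
   = (LI p. chi U p*chi (-U) (p + - v))"
   using nn_integral_translate[of "%p. chi U p*chi (-U) (p + - v)" v] by simp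
  also have "(LI p. chi U p*chi (-U) (p + v))
    + (LI p. chi U p*chi (-U) (p + - v)) <= en (e/2) + en (e/2)"
   by (intro add_mono half) (use v in auto)
  finally show "trdiff (chi U) v <= en e" using e by (simp flip: ennreal_plus)
 qed auto
qed

lemma trdiff_small_approx:
 assumes [measurable]: "F \<in> BM" and e: "e > 0"
  and "!!e'::real. e' > 0 ==> \<exists>H. H \<in> BM &
    (LI p. en \<bar>F p - H p\<bar>) <= en e' &
    (\<exists>d>0. \<forall>v. norm v < d --> trdiff H v <= en e')"
 shows "\<exists>d>0. \<forall>v. norm v < d --> trdiff F v <= en e"
proof -
 have "e/4 > 0" using e by simp
 from assms(3)[OF this] obtain H d where [measurable]: "H \<in> BM"
  and H: "(LI p. en \<bar>F p - H p\<bar>) <= en (e/4)"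
  and d: "d > 0" "!!v. norm v < d ==> trdiff H v <= en (e/4)" by blast
 have "trdiff F v <= en e" if "norm v < d" for v
 proof -
  have "trdiff F v <= en (e/4) + 2*en (e/4)"
   by (rule order_trans[OF trdiff_triangle[of F H]]) (auto intro!: add_mono mult_left_mono d that H)
  also have "... <= en e"
   using e by (simp flip: ennreal_plus ennreal_numeral ennreal_mult)
  finally show ?thesis .
 qed
 then show ?thesis using d by blast
qed

text \<open>Outer regularity reduces indicators of Borel sets to open sets of finite measure; sums
  and dominated limits do the rest, since an L^1 error enters a translation difference only
  twice.\<close>

lemma trdiff_small:
 fixes F :: "'a::euclidean_space => real"
 assumes "integrable lborel F" and "e > 0"
 shows "\<exists>d>0. \<forall>v. norm v < d --> trdiff F v <= en e"
 using assms
proof (induction arbitrary: e rule: integrable_induct)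
 case (base A c)
 then have [measurable]: "A \<in> sets borel" by simp
 have "\<exists>d>0. \<forall>v. norm v < d --> trdiff (chi A) v <= en e" if e: "e > 0" for e
 proof (rule trdiff_small_approx[OF _ e])
  fix e' :: real assume e': "e' > 0"
  obtain U where U: "open U" "A \<subseteq> U" "vol (U - A) < e'"
   using outer_regular_lborel[of A e'] e' by auto
  have [measurable]: "U \<in> sets borel" using U by simp
  have "vol U <= vol A + vol (U - A)"
   using U by (subst plus_emeasure) (auto simp: Un_absorb1 intro!: emeasure_mono)
  also have "... < \<infinity>" using base U(3) by (auto simp: less_top[symmetric] top_unique)
  finally have fin: "vol U < \<infinity>" .
  have "(LI p. en \<bar>chi A p - chi U p\<bar>) = (LI p. chi (U - A) p)"
   using U by (intro nn_integral_cong) (auto simp: indicator_def)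
  also have "... <= en e'" using U by simp
  finally show "\<exists>H. H \<in> BM & (LI p. en \<bar>chi A p - H p\<bar>) <= en e' &
    (\<exists>d>0. \<forall>v. norm v < d --> trdiff H v <= en e')"
   using trdiff_small_open[OF U(1) fin e'] by (intro exI[of _ "chi U"]) auto
 qed simp
 note ind = this
 show ?case
 proof -
  have "e/(\<bar>c\<bar> + 1) > 0" using base by simp
  from ind[OF this] obtain d where d: "d > 0" "!!v. norm v < d ==> trdiff (chi A) v <= en (e/(\<bar>c\<bar> + 1))"
   by blast
  have "trdiff (%x. chi A x *R c) v <= en e" if "norm v < d" for v
  proof -
   have "trdiff (%x. chi A x *R c) v = (LI p. en \<bar>c\<bar>*en \<bar>chi A (p + v) - chi A p\<bar>)"
    unfolding trdiff_def by (intro nn_integral_cong) (auto simp: indicator_def)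
   also have "... = en \<bar>c\<bar>*trdiff (chi A) v"
    unfolding trdiff_def by (rule nn_integral_cmult) simp
   also have "... <= en \<bar>c\<bar>*en (e/(\<bar>c\<bar> + 1))"
    by (intro mult_left_mono d that) auto
   also have "... <= en e"
    using base by (auto simp flip: ennreal_mult intro!: ennreal_leI simp: field_simps)
   finally show ?thesis .
  qed
  then show ?thesis using d by blast
 qed
next
 case (add f g)
 have [measurable]: "f \<in> BM" "g \<in> BM"
  using add by auto
 have "e/2 > 0" using add by simp
 from add(3)[OF this] add(4)[OF this] obtain d d' where d: "d > 0" "d' > 0"
   "!!v. norm v < d ==> trdiff f v <= en (e/2)" "!!v. norm v < d' ==> trdiff g v <= en (e/2)"
  by blast
 have "trdiff (%x. f x + g x) v <= en e" if "norm v < min d d'" for v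
 proof -
  have "trdiff (%x. f x + g x) v <= (LI p. en \<bar>f (p + v) - f p\<bar> + en \<bar>g (p + v) - g p\<bar>)"
   unfolding trdiff_def by (intro nn_integral_mono) (auto simp flip: ennreal_plus intro!: ennreal_leI)
  also have "... = trdiff f v + trdiff g v"
   by (simp add: trdiff_def nn_integral_add)
  also have "... <= en (e/2) + en (e/2)" using that by (intro add_mono d) auto
  also have "... = en e" using add by (simp flip: ennreal_plus)
  finally show ?thesis .
 qed
 then show ?case using d by (intro exI[of _ "min d d'"]) auto
next
 case (lim f s)
 have [measurable]: "f \<in> BM" "!!i. s i \<in> BM"
  using lim by auto
 show ?case
 proof (rule trdiff_small_approx[OF _ lim(6)])
  fix e' :: real assume e': "e' > 0"
  have "(%i. LI x. norm (f x - s i x)) ----> 0"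
  proof (rule nn_integral_dominated_convergence_norm[where w="%x. 2*norm (f x)"])
   show "(LI x. en (2*norm (f x))) < \<infinity>"
    using lim(4) by (subst ennreal_mult) (auto simp: nn_integral_cmult integrable_iff_bounded ennreal_mult_less_top)
  qed (use lim in auto)
  then have "eventually (%i. (LI x. norm (f x - s i x)) < en e') sq"
   by (rule order_tendstoD) (use e' in simp)
  then obtain i where "(LI x. norm (f x - s i x)) < en e'"
   by (meson eventually_happens sequentially_bot)
  then show "\<exists>H. H \<in> BM & (LI p. en \<bar>f p - H p\<bar>) <= en e' &
    (\<exists>d>0. \<forall>v. norm v < d --> trdiff H v <= en e')"
   using lim(5)[OF e', of i] by (intro exI[of _ "s i"]) auto
 qed simp
qed

section \<open>Hausdorff null sets\<close>

text \<open>A measure on pairs (centre, radius): the sum of r^m over a family of balls is the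
  measure of the family, so that subadditivity and monotonicity of such sums are those of a
  measure.\<close>

definition pow_measure :: "nat => ('a::euclidean_space \<times> real) measure" where
 "pow_measure m = density (count_space UNIV) (%(c, r). en (r^m))"

text \<open>Nullity for H^m expressed by closed balls of positive radius. No bound on the radii is
  imposed: a total below e forces r^m <= e, so for m >= 1 the balls are small automatically.\<close>

definition hnull :: "nat => 'a::euclidean_space set => bool" where
 "hnull m A \<longleftrightarrow> (\<forall>e>0. \<exists>C. countable C & (\<forall>(c, r)\<in>C. 0 < r) & A \<subseteq> (\<Union>(c, r)\<in>C. cball c r) &
   emeasure (pow_measure m) C <= en e)"

lemma sets_pow_measure [simp, measurable_cong]: "sets (pow_measure m) = UNIV"
 by (simp add: pow_measure_def)

lemma emeasure_pow_measure:
 "emeasure (pow_measure m) C = (\<integral>\<^sup>+x. en (snd x^m)*chi C x \<partial>count_space UNIV)"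
 unfolding pow_measure_def by (subst emeasure_density) (auto simp: case_prod_beta)

lemma emeasure_pow_measure_singleton: "emeasure (pow_measure m) {(c, r)} = en (r^m)"
 unfolding emeasure_pow_measure
 by (subst nn_integral_count_space'[of "{(c, r)}"]) (auto simp: indicator_def)

lemma hnull_mono: "hnull m B ==> A \<subseteq> B ==> hnull m A"
 unfolding hnull_def
proof (intro allI impI)
 fix e :: real assume *: "\<forall>e>0. \<exists>C. countable C & (\<forall>(c, r)\<in>C. 0 < r) & B \<subseteq> (\<Union>(c, r)\<in>C. cball c r) &
   emeasure (pow_measure m) C <= en e" and "A \<subseteq> B" "e > 0"
 from *[rule_format, OF \<open>e > 0\<close>] obtain C where "countable C" "\<forall>(c, r)\<in>C. 0 < r"
  "B \<subseteq> (\<Union>(c, r)\<in>C. cball c r)" "emeasure (pow_measure m) C <= en e" by (elim exE conjE)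
 moreover from this have "A \<subseteq> (\<Union>(c, r)\<in>C. cball c r)" using \<open>A \<subseteq> B\<close> by (metis subset_trans)
 ultimately show "\<exists>C. countable C & (\<forall>(c, r)\<in>C. 0 < r) & A \<subseteq> (\<Union>(c, r)\<in>C. cball c r) &
   emeasure (pow_measure m) C <= en e"
  by (intro exI[of _ C] conjI) 
qed

lemma hnull_UN:
 fixes A :: "nat => 'a::euclidean_space set"
 assumes "!!i. hnull m (A i)" shows "hnull m (\<Union>i. A i)"
 unfolding hnull_def
proof (intro allI impI)
 fix e :: real assume e: "e > 0"
 have "\<exists>C. countable C & (\<forall>(c, r)\<in>C. 0 < r) & A i \<subseteq> (\<Union>(c, r)\<in>C. cball c r) &
   emeasure (pow_measure m) C <= en (e*(1/2)^Suc i)" for i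
  using assms[of i] e unfolding hnull_def by auto
 then obtain C where C: "!!i. countable (C i)" "!!i. \<forall>(c, r)\<in>C i. 0 < r" "!!i. A i \<subseteq> (\<Union>(c, r)\<in>C i. cball c r)"
   "!!i. emeasure (pow_measure m) (C i) <= en (e*(1/2)^Suc i)" by metis
 have "emeasure (pow_measure m) (\<Union>i. C i) <= (\<Sum>i. emeasure (pow_measure m) (C i))"
  by (intro emeasure_subadditive_countably) auto
 also have "... <= (\<Sum>i. en (e*(1/2)^Suc i))"
  by (intro suminf_le C) auto
 also have "... = en (\<Sum>i. e*(1/2)^Suc i)"
  using e by (intro suminf_ennreal2) (auto intro!: summable_mult summable_geometric simp del: power_Suc simp: summable_Suc_iff)
 also have "(\<Sum>i. e*(1/2)^Suc i) = e"
  using sums_mult[OF power_half_series, of e] by (simp add: sums_iff)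
 finally show "\<exists>C. countable C & (\<forall>(c, r)\<in>C. 0 < r) & (\<Union>i. A i) \<subseteq> (\<Union>(c, r)\<in>C. cball c r) &
   emeasure (pow_measure m) C <= en e"
  using C(1-3) by (intro exI[of _ "\<Union>i. C i"]) (fastforce dest!: subsetD)
qed

lemma hnull_Un: "hnull m A ==> hnull m B ==> hnull m (A \<union> B)"
 using hnull_UN[of m "%i. if i = 0 then A else B"] by (rule hnull_mono) (auto split: if_splits)

lemma pow_add_small:
 fixes a b :: real
 assumes "0 <= a" "0 <= b" shows "(a + b)^m <= 2^m*(a^m + b^m)"
proof -
 have "(a + b)^m <= (2*max a b)^m" using assms by (intro power_mono) auto
 also have "... = 2^m*(max a b)^m" by (simp add: power_mult_distrib)
 also have "(max a b)^m <= a^m + b^m" using assms by (auto simp: max_def)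
 finally show ?thesis by simp
qed

text \<open>Coverings at the single scale 1 suffice. A covering set of diameter d goes into a ball
  of radius d plus a positive summable term, because d may vanish while \<open>hnull\<close> asks
  for positive radii.\<close>

lemma hnull_if_hausdorff_zero:
 fixes A :: "'a::euclidean_space set"
 assumes "hausdorff m A = 0" "m >= 1"
 shows "hnull m A"
 unfolding hnull_def
proof (intro allI impI)
 fix e :: real assume e: "e > 0"
 define w where "w = unit_ball_vol (real m)"
 have w: "w > 0" by (simp add: w_def)
 define e1 where "e1 = min 1 (e/(2*2^m))"
 have e1: "0 < e1" "e1 <= 1" "2^m*(e1 + e1) <= e" using e by (auto simp: e1_def min_def field_simps)
 define I where "I = (INF C\<in>{C::nat => 'a set. A \<subseteq> (\<Union>i. C i) & (\<forall>i. bounded (C i) & diameter (C i) <= 1)}.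
    (\<Sum>i. en (w*(diameter (C i)/2)^m)))"
 have "I <= hausdorff m A" unfolding hausdorff_def I_def w_def by (rule SUP_upper) auto
 also have "... < en (w*(e1/2^m))" using assms e1 w by simp
 finally obtain C where C: "A \<subseteq> (\<Union>i. C i)" "!!i::nat. bounded (C i)"
   "(\<Sum>i. en (w*(diameter (C i)/2)^m)) < en (w*(e1/2^m))"
  unfolding I_def INF_less_iff by auto
 define d where "d i = diameter (C i)" for i
 have d: "0 <= d i" for i using C(2) by (simp add: d_def diameter_ge_0)
 define r where "r i = d i + e1*(1/2)^Suc i" for i
 have r: "r i > 0" for i using d[of i] e1 by (simp add: r_def add_nonneg_pos)
 \<comment> \<open>For an empty \<open>C i\<close> this is an arbitrary point, which is
   harmless.\<close>
 define c where "c i = (SOME x. x \<in> C i)" for i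
 have cov: "C i \<subseteq> cball (c i) (r i)" for i
 proof
  fix x assume x: "x \<in> C i"
  then have "c i \<in> C i" unfolding c_def by (rule someI)
  then have "dist (c i) x <= d i" unfolding d_def using x C(2) by (intro diameter_bounded_bound)
  then show "x \<in> cball (c i) (r i)" using e1 by (auto simp: r_def intro: add_increasing2)
 qed
 have bnd: "en (r i^m) <= en (2^m*e1*(1/2)^Suc i) + en (2^m*d i^m)" for i
 proof -
  have "(e1*(1/2)^Suc i)^m <= (e1*(1/2)^Suc i)^1"
   using e1 assms(2) by (intro power_decreasing) (auto intro!: mult_le_one power_le_one simp del: power_Suc)
  then have "r i^m <= 2^m*(d i^m + e1*(1/2)^Suc i)"
   unfolding r_def using d e1
   by (intro order_trans[OF pow_add_small[of "d i" "e1*(1/2)^Suc i" m]] mult_left_mono add_left_mono) auto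
  then show ?thesis using d e1 by (simp flip: ennreal_plus add: algebra_simps ennreal_leI)
 qed
 let ?C = "range (%i. (c i, r i))"
 have "emeasure (pow_measure m) ?C <= (\<Sum>i. emeasure (pow_measure m) {(c i, r i)})"
  using emeasure_subadditive_countably[of "%i. {(c i, r i)}" "pow_measure m"] by (simp add: UNION_singleton_eq_range)
 also have "... = (\<Sum>i. en (r i^m))" by (simp add: emeasure_pow_measure_singleton)
 also have "... <= (\<Sum>i. en (2^m*e1*(1/2)^Suc i) + en (2^m*d i^m))"
  by (intro suminf_le bnd) auto
 also have "... = (\<Sum>i. en (2^m*e1*(1/2)^Suc i)) + (\<Sum>i. en (2^m*d i^m))"
  by (rule suminf_add[symmetric]) auto
 also have "(\<Sum>i. en (2^m*e1*(1/2)^Suc i)) = en (2^m*e1)"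
 proof -
  have "(%i. 2^m*e1*(1/2)^Suc i) sums (2^m*e1)"
   using sums_mult[OF power_half_series, of "2^m*e1"] by simp
  then show ?thesis using e1 by (subst suminf_ennreal2) (auto simp: sums_iff)
 qed
 also have "(\<Sum>i. en (2^m*d i^m)) = (\<Sum>i. en (4^m/w)*en (w*(d i/2)^m))"
 proof (intro suminf_cong)
  fix i
  have "(2::real)^m*2^m = 4^m" by (simp flip: power_mult_distrib)
  then have "2^m*d i^m = 4^m/w*(w*(d i/2)^m)" using w by (simp add: power_divide field_simps)
  then show "en (2^m*d i^m) = en (4^m/w)*en (w*(d i/2)^m)"
   using w d by (simp flip: ennreal_mult)
 qed
 also have "... = en (4^m/w)*(\<Sum>i. en (w*(d i/2)^m))"
  by (rule ennreal_suminf_cmult)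
 also have "... <= en (4^m/w)*en (w*(e1/2^m))"
  using C(3) by (intro mult_left_mono) (auto simp: d_def)
 also have "... = en (2^m*e1)"
 proof -
  have "(2::real)^m*2^m = 4^m" by (simp flip: power_mult_distrib)
  then have "4^m/w*(w*(e1/2^m)) = 2^m*e1" using w by (simp add: field_simps)
  then show ?thesis using w e1 by (simp flip: ennreal_mult)
 qed
 finally have "emeasure (pow_measure m) ?C <= en (2^m*e1) + en (2^m*e1)" by simp
 also have "... <= en e" using e1 by (simp flip: ennreal_plus add: algebra_simps ennreal_leI)
 finally show "\<exists>C. countable C & (\<forall>(c, r)\<in>C. 0 < r) & A \<subseteq> (\<Union>(c, r)\<in>C. cball c r) &
   emeasure (pow_measure m) C <= en e"
 proof (intro exI[of _ ?C] conjI)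
  show "A \<subseteq> (\<Union>(c, r)\<in>?C. cball c r)" using C(1) cov by (fastforce dest: subsetD)
 qed (use r in auto)
qed

lemma hausdorff_zero_if_hnull:
 fixes A :: "'a::euclidean_space set"
 assumes "hnull m A" "m >= 1"
 shows "hausdorff m A = 0"
proof -
 define w where "w = unit_ball_vol (real m)"
 have w: "w > 0" by (simp add: w_def)
 have "(INF C\<in>{C::nat => 'a set. A \<subseteq> (\<Union>i. C i) & (\<forall>i. bounded (C i) & diameter (C i) <= de)}.
    (\<Sum>i. en (w*(diameter (C i)/2)^m))) <= 0" (is "Inf (?S ` ?P) <= 0") if "de > 0" for de
 proof (rule ennreal_le_epsilon)
  fix e :: real assume e: "e > 0"
  \<comment> \<open>The second entry forces every radius to be at most \<open>de/2\<close>, which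
    makes the covering admissible at scale \<open>de\<close>.\<close>
  define e1 where "e1 = min (e/w) ((de/2)^m)"
  have "e1 > 0" using e w that by (auto simp: e1_def)
  from assms(1)[unfolded hnull_def, rule_format, OF this] obtain C where C: "countable C" "\<forall>(c, r)\<in>C. 0 < r"
    "A \<subseteq> (\<Union>(c, r)\<in>C. cball c r)" "emeasure (pow_measure m) C <= en e1"
   by (elim exE conjE)
  have rb: "2*r <= de" if "(c, r) \<in> C" for c r
  proof -
   have "emeasure (pow_measure m) {(c, r)} <= en e1"
    using emeasure_mono[of "{(c, r)}" C "pow_measure m"] that C(4) by auto
   then have "r^m <= e1" using \<open>e1 > 0\<close> by (simp add: emeasure_pow_measure_singleton)
   also have "... <= (de/2)^m" by (simp add: e1_def)
   finally have "r <= de/2" using \<open>de > 0\<close> assms(2) by (subst (asm) power_mono_iff) (use C(2) that in auto)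
   then show ?thesis by simp
  qed
  \<comment> \<open>Indices outside the enumeration of C get the empty set, of diameter 0; it
    contributes nothing because m >= 1.\<close>
  define D where "D i = (if i \<in> to_nat_on C ` C then (case from_nat_into C i of (c, r) => cball c r) else {})" for i
  have D_in: "\<exists>c r. (c, r) \<in> C & D i = cball c r & from_nat_into C i = (c, r)" if "i \<in> to_nat_on C ` C" for i
   using that C(1) unfolding D_def by (auto split: prod.split)
  have diam: "diameter (D i)/2 <= r" if "i \<in> to_nat_on C ` C" "from_nat_into C i = (c, r)" for i c r
  proof -
   have "r > 0" using D_in[OF that(1)] that(2) C(2) by auto
   then show ?thesis using that by (simp add: D_def)
  qed
  have DP: "D \<in> ?P"
  proof (safe)
   fix x assume "x \<in> A"
   then obtain c r where "(c, r) \<in> C" "x \<in> cball c r" using C(3) by auto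
   then show "x \<in> (\<Union>i. D i)" using C(1) by (intro UN_I[of "to_nat_on C (c, r)"]) (auto simp: D_def)
  next
   fix i
   show "bounded (D i)" by (auto simp: D_def split: prod.split)
   show "diameter (D i) <= de"
   proof (cases "i \<in> to_nat_on C ` C")
    case True
    then obtain c r where "(c, r) \<in> C" "D i = cball c r" using D_in by blast
    then show ?thesis using rb[of c r] C(2) by auto
   qed (use \<open>de > 0\<close> in \<open>auto simp: D_def\<close>)
  qed
  have "?S D <= (\<Sum>i. en w*(chi (to_nat_on C ` C) i*en (snd (from_nat_into C i)^m)))"
  proof (intro suminf_le)
   fix i
   show "en (w*(diameter (D i)/2)^m) <= en w*(chi (to_nat_on C ` C) i*en (snd (from_nat_into C i)^m))"
   proof (cases "i \<in> to_nat_on C ` C")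
    case True
    then obtain c r where cr: "(c, r) \<in> C" "D i = cball c r" "from_nat_into C i = (c, r)" using D_in by blast
    have r0: "r > 0" using cr(1) C(2) by auto
    have "diameter (D i) >= 0" using cr(2) r0 by simp
    then have "(diameter (D i)/2)^m <= r^m"
     using diam[OF True cr(3)] by (intro power_mono) auto
    then have "en (w*(diameter (D i)/2)^m) <= en (w*r^m)"
     using w by (intro ennreal_leI mult_left_mono) auto
    also have "... = en w*(chi (to_nat_on C ` C) i*en (snd (from_nat_into C i)^m))"
     unfolding cr(3) indicator_simps(1)[OF True] using w r0 by (simp add: ennreal_mult)
    finally show ?thesis .
   next
    case False
    then show ?thesis using assms(2) by (auto simp: D_def power_0_left)
   qed
  qed auto
  also have "... = en w*(\<integral>\<^sup>+i. chi (to_nat_on C ` C) i*en (snd (from_nat_into C i)^m) \<partial>count_space UNIV)"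
   by (simp add: ennreal_suminf_cmult nn_integral_count_space_nat)
  also have "(\<integral>\<^sup>+i. chi (to_nat_on C ` C) i*en (snd (from_nat_into C i)^m) \<partial>count_space UNIV)
   = (\<integral>\<^sup>+i. en (snd (from_nat_into C i)^m) \<partial>count_space (to_nat_on C ` C))"
   by (subst nn_integral_count_space_indicator) (auto simp: mult.commute)
  also have "... = (\<integral>\<^sup>+x. en (snd x^m) \<partial>count_space C)"
   by (subst nn_integral_bij_count_space[symmetric, where g="to_nat_on C" and A=C])
     (auto simp: bij_betw_def C(1) intro!: nn_integral_cong)
  also have "... = emeasure (pow_measure m) C"
   unfolding emeasure_pow_measure by (subst nn_integral_count_space_indicator) auto
  also have "en w*... <= en w*en e1" by (intro mult_left_mono C) auto
  also have "... <= en e"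
  proof -
   have "w*e1 <= w*(e/w)" unfolding e1_def using w by (intro mult_left_mono) auto
   then show ?thesis using w \<open>e1 > 0\<close> by (simp flip: ennreal_mult add: ennreal_leI)
  qed
  finally have "?S D <= en e" .
  then show "Inf (?S ` ?P) <= 0 + en e" using DP by (auto intro: INF_lower2)
 qed
 then show ?thesis unfolding hausdorff_def w_def by (auto simp: SUP_eq_iff intro!: antisym SUP_least)
qed

section \<open>Coverings by balls\<close>

lemma emeasure_pow_measure_image_le:
 fixes g :: "'i => 'a::euclidean_space \<times> real"
 shows "emeasure (pow_measure m) (g ` C) <= (\<integral>\<^sup>+p. en (snd (g p)^m) \<partial>count_space C)"
proof -
 obtain C0 where C0: "C0 \<subseteq> C" "inj_on g C0" "g ` C = g ` C0" by (metis subset_image_inj subset_refl)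
 have "emeasure (pow_measure m) (g ` C) = (\<integral>\<^sup>+x. en (snd x^m) \<partial>count_space (g ` C0))"
  unfolding emeasure_pow_measure C0(3) by (subst nn_integral_count_space_indicator) auto
 also have "... = (\<integral>\<^sup>+p. en (snd (g p)^m) \<partial>count_space C0)"
  by (subst nn_integral_bij_count_space[symmetric, where g=g and A=C0]) (auto simp: bij_betw_def C0)
 also have "... <= (\<integral>\<^sup>+p. en (snd (g p)^m) \<partial>count_space C)"
  using C0(1) by (auto simp: nn_integral_count_space_indicator indicator_def intro!: nn_integral_mono)
 finally show ?thesis .
qed

lemma emeasure_UN_le_count_space:
 assumes "countable I" "!!i. i \<in> I ==> X i \<in> sets M"
 shows "emeasure M (\<Union>i\<in>I. X i) <= (\<integral>\<^sup>+i. emeasure M (X i) \<partial>count_space I)"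
proof -
 have "emeasure M (\<Union>i\<in>I. X i) = (\<integral>\<^sup>+x. chi (\<Union>i\<in>I. X i) x \<partial>M)"
  using assms by (intro nn_integral_indicator[symmetric]) auto
 also have "... <= (\<integral>\<^sup>+x. \<integral>\<^sup>+i. chi (X i) x \<partial>count_space I \<partial>M)"
 proof (intro nn_integral_mono)
  fix x
  show "chi (\<Union>i\<in>I. X i) x <= (\<integral>\<^sup>+i. chi (X i) x \<partial>count_space I :: en)"
  proof (cases "x \<in> (\<Union>i\<in>I. X i)")
   case True
   then obtain j where j: "j \<in> I" "x \<in> X j" by blast
   have "1 = (\<integral>\<^sup>+i. chi {j} i \<partial>count_space I :: en)" using j by simp
   also have "... <= (\<integral>\<^sup>+i. chi (X i) x \<partial>count_space I)"
    using j by (intro nn_integral_mono) (auto simp: indicator_def)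
   finally show ?thesis using True by simp
  qed simp
 qed
 also have "... = (\<integral>\<^sup>+i. \<integral>\<^sup>+x. chi (X i) x \<partial>M \<partial>count_space I)"
  using assms by (intro nn_integral_count_space_nn_integral) auto
 also have "... = (\<integral>\<^sup>+i. emeasure M (X i) \<partial>count_space I)"
  using assms by (intro nn_integral_cong) auto
 finally show ?thesis .
qed

lemma vitali_cover:
 fixes S :: "'a::euclidean_space set"
 assumes "!!p. p \<in> S ==> 0 < r p & r p <= B"
 obtains C where "countable C" "C \<subseteq> S" "disjoint_family_on (%p. cball p (r p)) C"
  "S \<subseteq> (\<Union>p\<in>C. cball p (5*r p))"
proof -
 obtain C where C: "countable C" "C \<subseteq> S" "pairwise (%i j. disjnt (cball i (r i)) (cball j (r j))) C"
  "!!i. i \<in> S ==> \<exists>j. j \<in> C & ~ disjnt (cball i (r i)) (cball j (r j)) & cball i (r i) \<subseteq> ball j (5*r j)"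
  using Vitali_covering_lemma_cballs_balls[of S r B "%x. x", OF assms] by blast
 show ?thesis
 proof (rule that[OF C(1,2)])
  show "disjoint_family_on (%p. cball p (r p)) C"
   using C(3) by (auto simp: disjoint_family_on_def pairwise_def disjnt_def)
  show "S \<subseteq> (\<Union>p\<in>C. cball p (5*r p))"
  proof
   fix p assume p: "p \<in> S"
   then obtain j where "j \<in> C" "cball p (r p) \<subseteq> ball j (5*r j)" using C(4) by blast
   moreover have "p \<in> cball p (r p)" using assms[OF p] by simp
   ultimately show "p \<in> (\<Union>p\<in>C. cball p (5*r p))" using ball_subset_cball by blast
  qed
 qed
qed

text \<open>N lies in an open set of small measure. Disjoint Vitali balls inside that set have small
  total volume, and the images of their fivefold enlargements lie in balls of comparable
  radius.\<close>

lemma hnull_lipschitz_image: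
 fixes f :: "'b::euclidean_space => 'a::euclidean_space"
 assumes N: "negligible N" and f: "!!x y. x \<in> N ==> y \<in> N ==> dist (f x) (f y) <= L*dist x y"
 shows "hnull DIM('b) (f ` N)"
 unfolding hnull_def
proof (intro allI impI)
 fix e :: real assume e: "e > 0"
 define L1 where "L1 = max L 1"
 have L1: "L1 > 0" "L <= L1" by (auto simp: L1_def)
 define w where "w = unit_ball_vol (real DIM('b))"
 have w: "w > 0" by (simp add: w_def)
 \<comment> \<open>Cancels the ratio between the powers of the image radii
   \<open>5 * L1 * r p\<close> and the volumes of the balls of radius \<open>r p\<close>.\<close>
 define e1 where "e1 = e*w/(5*L1)^DIM('b)"
 have e1: "e1 > 0" using e w L1 by (simp add: e1_def)
 have Nn: "N \<in> null_sets lebesgue" using N by (simp add: negligible_iff_null_sets)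
 then have "N \<in> sets lebesgue" by auto
 from sets_lebesgue_outer_open[OF this e1] obtain U where U: "open U" "N \<subseteq> U" "emeasure lebesgue (U - N) < en e1"
  by metis
 have "emeasure lebesgue U = emeasure lebesgue (U - N)"
  using Nn U(1) by (intro emeasure_Diff_null_set[symmetric]) (auto intro: borel_open)
 then have mU: "vol U <= en e1"
  using U by (simp add: less_imp_le)
 have "\<exists>r. 0 < r & r <= 1 & cball p r \<subseteq> U" if "p \<in> N" for p
 proof -
  have "p \<in> U" using that U(2) by auto
  with U(1) obtain r where "0 < r" "cball p r \<subseteq> U" by (auto simp: open_contains_cball)
  moreover have "cball p (min r 1) \<subseteq> cball p r" by (rule subset_cball) simp
  ultimately show ?thesis by (intro exI[of _ "min r 1"]) auto
 qed
 then obtain r where r: "!!p. p \<in> N ==> 0 < r p" "!!p. p \<in> N ==> r p <= 1" "!!p. p \<in> N ==> cball p (r p) \<subseteq> U"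
  by metis
 obtain C where C: "countable C" "C \<subseteq> N" "disjoint_family_on (%p. cball p (r p)) C"
  "N \<subseteq> (\<Union>p\<in>C. cball p (5*r p))"
  using vitali_cover[of N r 1] r by auto
 let ?g = "%p. (f p, L1*(5*r p))"
 have "emeasure (pow_measure DIM('b)) (?g ` C) <= (\<integral>\<^sup>+p. en ((L1*(5*r p))^DIM('b)) \<partial>count_space C)"
  using emeasure_pow_measure_image_le[of "DIM('b)" ?g C] by simp
 also have "... = (\<integral>\<^sup>+p. en ((5*L1)^DIM('b)/w) * vol (cball p (r p)) \<partial>count_space C)"
 proof (intro nn_integral_cong)
  fix p assume "p \<in> space (count_space C)"
  then have rp: "r p > 0" using r C by auto
  then show "en ((L1*(5*r p))^DIM('b)) = en ((5*L1)^DIM('b)/w) * vol (cball p (r p))"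
   using w L1 by (simp add: emeasure_cball w_def[symmetric] power_mult_distrib flip: ennreal_mult)
 qed
 also have "... = en ((5*L1)^DIM('b)/w)*(\<integral>\<^sup>+p. vol (cball p (r p)) \<partial>count_space C)"
  by (simp add: nn_integral_cmult)
 also have "(\<integral>\<^sup>+p. vol (cball p (r p)) \<partial>count_space C) = vol (\<Union>p\<in>C. cball p (r p))"
  using C by (intro emeasure_UN_countable[symmetric]) auto
 also have "... <= vol U"
 proof (rule emeasure_mono)
  show "(\<Union>p\<in>C. cball p (r p)) \<subseteq> U" using C(2) r(3) by blast
 qed (use U(1) in simp)
 also have "... <= en e1" by (rule mU)
 also have "en ((5*L1)^DIM('b)/w)*en e1 = en e"
  using w L1 e by (simp flip: ennreal_mult add: e1_def)
 finally have "emeasure (pow_measure DIM('b)) (?g ` C) <= en e" by (simp add: mult_left_mono)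
 moreover have "f ` N \<subseteq> (\<Union>(c, r)\<in>?g ` C. cball c r)"
 proof
  fix y assume "y \<in> f ` N"
  then obtain x where x: "x \<in> N" "y = f x" by blast
  then obtain p where p: "p \<in> C" "dist p x <= 5*r p" using C(4) by auto
  have "dist (f p) (f x) <= L*dist p x" using f p x C by auto
  also have "... <= L1*(5*r p)" using L1 p by (intro mult_mono) auto
  finally show "y \<in> (\<Union>(c, r)\<in>?g ` C. cball c r)" using p x by auto
 qed
 ultimately show "\<exists>C. countable C & (\<forall>(c, r)\<in>C. 0 < r) & f ` N \<subseteq> (\<Union>(c, r)\<in>C. cball c r) &
   emeasure (pow_measure DIM('b)) C <= en e"
  using C r L1 by (intro exI[of _ "?g ` C"]) auto
qed

text \<open>The base points whose line meets a ball of radius r at a time in [-R, R] fill a tube of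
  volume O(r^(N-1)), where N = \<open>DIM('a)\<close>. Summing over coverings makes the set of bad
  base points null for every R.\<close>

lemma AE_line_avoids_hnull:
 fixes S :: "'a::euclidean_space set"
 assumes S: "hnull (DIM('a) - 1) S" and dim: "DIM('a) >= 2" and h: "h \<noteq> 0"
 shows "AE p in lborel. \<forall>ta. p + ta *R h \<notin> S"
proof -
 define w where "w = unit_ball_vol (real DIM('a))"
 have w: "w > 0" by (simp add: w_def)
 define tub where "tub R c r = {x + y | x y. x \<in> cball c r & y \<in> (%ta. - ta *R h) ` {-R..R}}" for R r :: real and c :: 'a
 have cpt: "compact (tub R c r)" for R c r
  unfolding tub_def by (intro compact_sums compact_continuous_image continuous_intros) auto
 have tub: "vol (tub R c r) <= en ((2 * R*norm h + 1)*w*2^DIM('a))*en (r^(DIM('a) - 1))"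
  if r: "0 < r" "r <= 1" and R: "R >= 0" for R c r
 proof -
  \<comment> \<open>The axis of the tube is divided into pieces of length r; balls of radius 2r
    about the nodes then cover the tube, and there are O(1/r) of them.\<close>
  define J where "J = nat \<lfloor>2 * R*norm h/r\<rfloor>"
  define ta where "ta j = - R + real j*r/norm h" for j
  have "tub R c r \<subseteq> (\<Union>j\<le>J. cball (c - ta j *R h) (2*r))"
  proof
   fix p assume "p \<in> tub R c r"
   then obtain x s where x: "dist c x <= r" "-R <= s" "s <= R" "p = x - s *R h"
    by (auto simp: tub_def)
   define j where "j = nat \<lfloor>(s + R)*norm h/r\<rfloor>"
   have nn: "0 <= (s + R)*norm h/r" using x r by simp
   have "(s + R)*norm h/r <= 2 * R*norm h/r"
    using x r by (intro divide_right_mono mult_right_mono) auto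
   then have "j <= J" unfolding j_def J_def by (intro nat_mono floor_mono)
   have "real j <= (s + R)*norm h/r" "(s + R)*norm h/r <= real j + 1"
    using nn unfolding j_def by (auto simp: of_nat_nat intro: less_imp_le)
   then have "real j*r <= (s + R)*norm h" "(s + R)*norm h <= real j*r + r"
    using r by (auto simp: field_simps)
   moreover have "(s - ta j)*norm h = (s + R)*norm h - real j*r"
    using h by (simp add: ta_def field_simps)
   ultimately have "\<bar>(s - ta j)*norm h\<bar> <= r" by linarith
   then have "\<bar>s - ta j\<bar>*norm h <= r" by (simp add: abs_mult)
   then have "norm ((s - ta j) *R h) <= r" by simp
   moreover have "norm ((c - ta j *R h) - p) <= norm (c - x) + norm ((s - ta j) *R h)"
    using norm_triangle_ineq[of "c - x" "(s - ta j) *R h"] by (simp add: x algebra_simps)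
   ultimately have "p \<in> cball (c - ta j *R h) (2*r)" using x by (simp add: dist_norm)
   then show "p \<in> (\<Union>j\<le>J. cball (c - ta j *R h) (2*r))" using \<open>j <= J\<close> by blast
  qed
  then have "vol (tub R c r) <= vol (\<Union>j\<le>J. cball (c - ta j *R h) (2*r))"
   by (intro emeasure_mono) auto
  also have "... <= (\<Sum>j\<le>J. vol (cball (c - ta j *R h) (2*r)))"
   by (intro emeasure_subadditive_finite) auto
  also have "... = en ((real J + 1)*(w*(2*r)^DIM('a)))"
   using r by (simp add: emeasure_cball w_def ennreal_mult' ennreal_of_nat_eq_real_of_nat ennreal_plus flip: ennreal_1)
     (simp add: add.commute)
  also have "... <= en (((2 * R*norm h + 1)/r)*(w*(2*r)^DIM('a)))"
  proof -
   have "real J <= 2 * R*norm h/r" using r R unfolding J_def by (simp add: of_nat_nat)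
   moreover have "1 <= 1/r" using r by simp
   ultimately have "real J + 1 <= (2 * R*norm h + 1)/r" by (simp add: add_divide_distrib)
   then show ?thesis using r w by (intro ennreal_leI mult_right_mono) auto
  qed
  also have "((2 * R*norm h + 1)/r)*(w*(2*r)^DIM('a)) = (2 * R*norm h + 1)*w*2^DIM('a)*r^(DIM('a) - 1)"
   using r dim by (cases "DIM('a)") (auto simp: power_mult_distrib field_simps)
  finally show ?thesis using r R w by (simp add: ennreal_mult)
 qed
 have bad: "\<exists>M\<in>null_sets lborel. {p. \<exists>ta\<in>{-real R..real R}. p + ta *R h \<in> S} \<subseteq> M" for R :: nat
 proof -
  define K where "K = (2 * R*norm h + 1)*w*2^DIM('a)"
  have K: "K > 0" unfolding K_def using w by (intro mult_pos_pos) (auto simp: add_nonneg_pos)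
  have ex: "\<exists>M. M \<in> sets borel & {p. \<exists>ta\<in>{-real R..real R}. p + ta *R h \<in> S} \<subseteq> M & vol M <= en (1/Suc i)" for i
  proof -
   \<comment> \<open>The bound 1 keeps the radii at most 1, as the estimate \<open>tub\<close>
     requires.\<close>
   define e where "e = min 1 (1/(K * Suc i))"
   have "K*e <= K*(1/(K * Suc i))" using K unfolding e_def by (intro mult_left_mono) auto
   then have e: "e > 0" "e <= 1" "K*e <= 1/Suc i" using K by (auto simp: e_def simp del: of_nat_Suc)
   from S[unfolded hnull_def, rule_format, OF e(1)] obtain C where C: "countable C" "\<forall>(c, r)\<in>C. 0 < r"
    "S \<subseteq> (\<Union>(c, r)\<in>C. cball c r)" "emeasure (pow_measure (DIM('a) - 1)) C <= en e"
    by (elim exE conjE)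
   have r1: "0 < r" "r <= 1" if "(c, r) \<in> C" for c r
   proof -
    show "0 < r" using C(2) that by auto
    have "emeasure (pow_measure (DIM('a) - 1)) {(c, r)} <= en e"
     using emeasure_mono[of "{(c, r)}" C "pow_measure (DIM('a) - 1)"] that C(4) by auto
    then have "r^(DIM('a) - 1) <= 1^(DIM('a) - 1)"
     using e by (simp add: emeasure_pow_measure_singleton)
    then show "r <= 1" using \<open>0 < r\<close> dim by (subst (asm) power_mono_iff) auto
   qed
   let ?M = "\<Union>(c, r)\<in>C. tub R c r"
   have "vol ?M <= (\<integral>\<^sup>+x. vol (case x of (c, r) => tub R c r) \<partial>count_space C)"
    using C(1) cpt by (intro emeasure_UN_le_count_space) (auto split: prod.split intro!: borel_compact)
   also have "... <= (\<integral>\<^sup>+x. en K*en (snd x^(DIM('a) - 1)) \<partial>count_space C)"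
    using tub r1 unfolding K_def by (intro nn_integral_mono) (auto split: prod.split)
   also have "... = en K*emeasure (pow_measure (DIM('a) - 1)) C"
    unfolding emeasure_pow_measure
    by (simp add: nn_integral_cmult nn_integral_count_space_indicator)
   also have "... <= en K*en e" by (intro mult_left_mono C) auto
   also have "... <= en (1/Suc i)" using K e by (simp flip: ennreal_mult del: of_nat_Suc add: ennreal_leI)
   finally have "vol ?M <= en (1/Suc i)" .
   moreover have "?M \<in> sets borel"
    using C(1) cpt by (intro sets.countable_UN') (auto split: prod.split intro!: borel_compact)
   moreover have "{p. \<exists>ta\<in>{-real R..real R}. p + ta *R h \<in> S} \<subseteq> ?M"
   proof (safe)
    fix p ta assume "ta \<in> {-real R..real R}" "p + ta *R h \<in> S"
    then obtain c r where cr: "(c, r) \<in> C" "p + ta *R h \<in> cball c r" using C(3) by blast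
    have "p = (p + ta *R h) + - ta *R h" by simp
    moreover have "- ta *R h \<in> (%ta. - ta *R h) ` {-real R..real R}"
     using \<open>ta \<in> {-real R..real R}\<close> by (rule imageI)
    ultimately have "p \<in> tub R c r" unfolding tub_def mem_Collect_eq using cr(2)
     by (intro exI[of _ "p + ta *R h"] exI[of _ "- ta *R h"] conjI)
    then show "p \<in> ?M" using cr(1) by blast
   qed
   ultimately show ?thesis by blast
  qed
  from choice[OF allI[OF ex]] obtain M where MM: "\<forall>i::nat. M i \<in> sets borel &
    {p. \<exists>ta\<in>{-real R..real R}. p + ta *R h \<in> S} \<subseteq> M i & vol (M i) <= en (1/Suc i)" ..
  then have M: "!!i::nat. M i \<in> sets borel" "!!i. {p. \<exists>ta\<in>{-real R..real R}. p + ta *R h \<in> S} \<subseteq> M i"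
    "!!i. vol (M i) <= en (1/Suc i)" by blast+
  have "vol (\<Inter>i. M i) <= en (1/Suc i)" for i
   using M by (intro order_trans[OF emeasure_mono[of "\<Inter>i. M i" "M i" lborel]]) auto
  moreover have "(%i. en (1/Suc i)) ----> en 0"
   by (intro tendsto_ennrealI lim_1_over_n[THEN LIMSEQ_Suc])
  ultimately have "vol (\<Inter>i. M i) <= 0"
   by (intro tendsto_lowerbound[of "%i. en (1/Suc i)" _ sequentially]) auto
  then show ?thesis using M by (intro bexI[of _ "\<Inter>i. M i"]) auto
 qed
 have "AE p in lborel. \<forall>R::nat. ~ (\<exists>ta\<in>{-real R..real R}. p + ta *R h \<in> S)"
  unfolding AE_all_countable
 proof
  fix R :: nat
  from bad[of R] obtain M where "M \<in> null_sets lborel" "{p. \<exists>ta\<in>{-real R..real R}. p + ta *R h \<in> S} \<subseteq> M" ..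
  then show "AE p in lborel. ~ (\<exists>ta\<in>{-real R..real R}. p + ta *R h \<in> S)"
   by (intro AE_I'[of M]) auto
 qed
 then show ?thesis
 proof eventually_elim
  case (elim p)
  show ?case
  proof
   fix ta
   obtain R :: nat where "\<bar>ta\<bar> <= real R" using real_arch_simple by blast
   then have "ta \<in> {-real R..real R}" by auto
   then show "p + ta *R h \<notin> S" using elim by blast
  qed
 qed
qed

section \<open>Upper gradients along segments\<close>

text \<open>The null set of base points may depend on h: mollification delivers no more, and Fubini
  in (p, h) does not see it. Only segments contained in Q are tested, so jumps across a removed
  hypersurface are allowed. Negative values of G are cut off by \<open>ennreal\<close>.\<close>

definition upgrad :: "'a::euclidean_space set => ('a => real) => ('a => real) => bool" where
 "upgrad Q w G \<longleftrightarrow> w \<in> BM & G \<in> BM &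
   (\<forall>h. AE p in lborel. closed_segment p (p + h) \<subseteq> Q -->
    en \<bar>w (p + h) - w p\<bar> <= en (norm h)*(LI ta:{0..1}. en (G (p + ta *R h))))"

lemma nn_integral_affine_le:
 fixes F :: "'a::euclidean_space => en"
 assumes [measurable]: "F \<in> BM" and c: "c >= 1/2"
 shows "(LI q. F (t + c *R q)) <= en (2^DIM('a))*(LI q. F q)"
proof -
 have "1^DIM('a) <= (2*c)^DIM('a)" using c by (intro power_mono) auto
 then have "1 <= 2^DIM('a)*\<bar>c\<bar>^DIM('a)" using c by (simp add: power_mult_distrib)
 then have "en 1 <= en (2^DIM('a))*en (\<bar>c\<bar>^DIM('a))"
  by (simp flip: ennreal_mult ennreal_1)
 then have "1*(LI q. F (t + c *R q)) <= (en (2^DIM('a))*en (\<bar>c\<bar>^DIM('a)))*(LI q. F (t + c *R q))"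
  by (intro mult_right_mono) auto
 also have "... = en (2^DIM('a))*(LI q. F q)"
  using nn_integral_affine[OF assms(1), of c t] c by (simp add: mult.assoc)
 finally show ?thesis by simp
qed

abbreviation osc2 :: "'a::euclidean_space set => ('a => real) => en" where
 "osc2 K w \<equiv> (LI p:K. (dev K w (w p)))"

text \<open>The intermediate point of p and q = p + h depends on q with factor t and on p with
  factor 1 - t. One of the two is at least 1/2; integrating first in that variable costs a Jacobian
  of at most \<open>2^DIM('a)\<close>, and convexity keeps the point in K.\<close>

lemma poincare_aux:
 fixes K :: "'a::euclidean_space set" and G :: "'a => real"
 assumes [measurable]: "K \<in> sets borel" "G \<in> BM" and K: "convex K" and t: "0 <= t" "t <= 1"
 shows "(LI h. LI p. chi K p*chi K (p + h)*en (G (p + t *R h)))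
   <= vol K*(en (2^DIM('a))*(LI x:K. en (G x)))"
  (is "?L <= _*(_*?I)")
proof -
 define F where "F x = chi K x*en (G x)" for x
 have [measurable]: "F \<in> BM" unfolding F_def by measurable
 have IF: "(LI x. F x) = ?I" by (auto simp: F_def mult.commute intro!: nn_integral_cong)
 have "?L = (LI p. LI h. chi K p*chi K (p + h)*en (G (p + t *R h)))"
  by (rule lborel_pair.Fubini') simp
 also have "... = (LI p. LI q. chi K p*chi K q*en (G (p + t *R (q - p))))"
 proof (rule nn_integral_cong)
  fix p
  show "(LI h. chi K p*chi K (p + h)*en (G (p + t *R h)))
   = (LI q. chi K p*chi K q*en (G (p + t *R (q - p))))"
   using nn_integral_translate[of "%q. chi K p*chi K q*en (G (p + t *R (q - p)))" p] 
   by (simp add: add.commute)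
 qed
 finally have L: "?L = (LI p. LI q. chi K p*chi K q*en (G (p + t *R (q - p))))" .
 have in_K: "(1 - t) *R p + t *R q \<in> K" if "p \<in> K" "q \<in> K" for p q
  using K that t by (simp add: convex_alt)
 have pt: "chi K p*chi K q*en (G (p + t *R (q - p))) <= chi K p * F ((1 - t) *R p + t *R q)"
   "chi K p*chi K q*en (G (p + t *R (q - p))) <= chi K q * F (t *R q + (1 - t) *R p)" for p q
  using in_K[of p q] by (auto simp: F_def indicator_def algebra_simps)
 show ?thesis
 proof (cases "t >= 1/2")
  case True
  have "?L <= (LI p. chi K p*(LI q. F ((1 - t) *R p + t *R q)))"
   unfolding L by (subst nn_integral_cmult[symmetric]) (auto intro!: nn_integral_mono pt)
  also have "... <= (LI p. chi K p*(en (2^DIM('a))*?I))"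
   unfolding IF[symmetric] using True by (intro nn_integral_mono mult_left_mono nn_integral_affine_le) auto
  also have "... = vol K*(en (2^DIM('a))*?I)"
   by (simp add: nn_integral_multc)
  finally show ?thesis .
 next
  case False
  have "?L = (LI q. LI p. chi K p*chi K q*en (G (p + t *R (q - p))))"
   unfolding L by (rule lborel_pair.Fubini') simp
  also have "... <= (LI q. chi K q*(LI p. F (t *R q + (1 - t) *R p)))"
   by (subst nn_integral_cmult[symmetric]) (auto intro!: nn_integral_mono pt)
  also have "... <= (LI p. chi K p*(en (2^DIM('a))*?I))"
   unfolding IF[symmetric] using False by (intro nn_integral_mono mult_left_mono nn_integral_affine_le) auto
  also have "... = vol K*(en (2^DIM('a))*?I)"
   by (simp add: nn_integral_multc)
  finally show ?thesis .
 qed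
qed

text \<open>With q = p + h and h integrated last, the inequality for fixed h applies to almost every
  p; d bounds the length of h and convexity keeps the segment in K.\<close>

lemma upgrad_poincare:
 fixes K :: "'a::euclidean_space set"
 assumes up: "upgrad Q w G" and K[measurable]: "K \<in> sets borel" and cK: "convex K" "K \<subseteq> Q"
  and d: "!!p q. p \<in> K ==> q \<in> K ==> dist p q <= d"
 shows "osc2 K w <= en (d*2^DIM('a))*(vol K*(LI x:K. en (G x)))"
proof (cases "K = {}")
 case False
 then have d0: "d >= 0" using d zero_le_dist order_trans by blast
 have [measurable]: "w \<in> BM" "G \<in> BM" using up by (auto simp: upgrad_def)
 have "osc2 K w = (LI p. LI q. en \<bar>w q - w p\<bar>*chi K q*chi K p)"
  by (simp add: nn_integral_multc)
 also have "... = (LI p. LI h. en \<bar>w (p + h) - w p\<bar>*chi K (p + h)*chi K p)"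
 proof (rule nn_integral_cong)
  fix p
  show "(LI q. en \<bar>w q - w p\<bar>*chi K q*chi K p)
   = (LI h. en \<bar>w (p + h) - w p\<bar>*chi K (p + h)*chi K p)"
   using nn_integral_translate[of "%q. en \<bar>w q - w p\<bar>*chi K q*chi K p" p] 
   by (simp add: add.commute)
 qed
 also have "... = (LI h. LI p. en \<bar>w (p + h) - w p\<bar>*chi K (p + h)*chi K p)"
  by (rule lborel_pair.Fubini') simp
 also have "... <= (LI h. LI p. LI ta. en d*chi {0..1} ta*(chi K p*chi K (p + h)*en (G (p + ta *R h))))"
 proof (rule nn_integral_mono, rule nn_integral_mono_AE)
  fix h :: 'a
  have "AE p in lborel. closed_segment p (p + h) \<subseteq> Q -->
    en \<bar>w (p + h) - w p\<bar> <= en (norm h)*(LI ta:{0..1}. en (G (p + ta *R h)))"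
   using up unfolding upgrad_def by blast
  then show "AE p in lborel. en \<bar>w (p + h) - w p\<bar>*chi K (p + h)*chi K p \<le>
    (LI ta. en d*chi {0..1} ta*(chi K p*chi K (p + h)*en (G (p + ta *R h))))"
  proof eventually_elim
   case (elim p)
   show ?case
   proof (cases "p \<in> K & p + h \<in> K")
    case True
    then have "closed_segment p (p + h) \<subseteq> Q" using cK by (meson closed_segment_subset subset_trans)
    then have "en \<bar>w (p + h) - w p\<bar> <= en (norm h)*(LI ta:{0..1}. en (G (p + ta *R h)))"
     using elim by blast
    also have "... <= en d*(LI ta:{0..1}. en (G (p + ta *R h)))"
     using d[of p "p + h"] True by (intro mult_right_mono ennreal_leI) (auto simp: dist_norm)
    also have "... = (LI ta. en d*chi {0..1} ta*(chi K p*chi K (p + h)*en (G (p + ta *R h))))"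
     using True by (subst nn_integral_cmult[symmetric]) (auto intro!: nn_integral_cong simp: mult_ac)
    finally show ?thesis using True by simp
   qed auto
  qed
 qed
 also have "... = (LI h. LI ta. LI p. en d*chi {0..1} ta*(chi K p*chi K (p + h)*en (G (p + ta *R h))))"
  by (intro nn_integral_cong lborel_pair.Fubini') simp
 also have "... = (LI ta. LI h. LI p. en d*chi {0..1} ta*(chi K p*chi K (p + h)*en (G (p + ta *R h))))"
  by (intro lborel_pair.Fubini') simp
 also have "... = (LI ta. en d*chi {0..1} ta*(LI h. LI p. chi K p*chi K (p + h)*en (G (p + ta *R h))))"
  by (simp add: nn_integral_cmult)
 also have "... <= (\<integral>\<^sup>+ta. en d*chi {0..1} ta*(vol K*(en (2^DIM('a))*(LI x:K. en (G x)))) \<partial>(lborel :: real measure))"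
 proof (intro nn_integral_mono)
  fix ta :: real
  show "en d*chi {0..1} ta*(LI h. LI p. chi K p*chi K (p + h)*en (G (p + ta *R h)))
    <= en d*chi {0..1} ta*(vol K*(en (2^DIM('a))*(LI x:K. en (G x))))"
   using cK by (cases "ta \<in> {0..1}") (auto intro!: mult_left_mono poincare_aux)
 qed
 also have "... = en d*(vol K*(en (2^DIM('a))*(LI x:K. en (G x))))"
  by (simp add: nn_integral_multc nn_integral_cmult)
 also have "... = en (d*2^DIM('a))*(vol K*(LI x:K. en (G x)))"
  using d0 by (simp add: ennreal_mult mult_ac)
 finally show ?thesis .
qed simp

lemma osc2_triangle:
 assumes [measurable]: "K \<in> sets borel" "w \<in> BM" "v \<in> BM"
 shows "osc2 K w <= osc2 K v + 2*(vol K*(dist1 K v w))"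
proof -
 let ?e = "%x. en \<bar>v x - w x\<bar>"
 have "osc2 K w <= (LI p:K. (LI q:K. (en \<bar>v q - v p\<bar> + (?e q + ?e p))))"
  by (intro nn_integral_mono mult_right_mono) (auto simp flip: ennreal_plus intro!: ennreal_leI)
 also have "... = (LI p:K. ((dev K v (v p)) + ((LI q:K. ?e q) + ?e p * vol K)))"
  by (simp add: distrib_right nn_integral_add nn_integral_cmult)
 also have "... = osc2 K v + ((LI q:K. ?e q) * vol K + (LI p. (?e p*chi K p) * vol K))"
 proof -
  have "(LI p:K. ((dev K v (v p)) + ((LI q:K. ?e q) + ?e p * vol K)))
   = (LI p. (dev K v (v p))*chi K p
      + ((LI q:K. ?e q)*chi K p + (?e p*chi K p) * vol K))"
   by (rule nn_integral_cong) (auto simp: indicator_def)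
  then show ?thesis by (simp add: nn_integral_add nn_integral_cmult)
 qed
 also have "(LI p. (?e p*chi K p) * vol K) = (LI p:K. ?e p) * vol K"
  by (rule nn_integral_multc) simp
 finally show ?thesis by (simp add: mult_2 mult.commute distrib_left)
qed

section \<open>Traces at a point along dyadic dilations of a set\<close>

text \<open>This is the set p + 2^-k K, written as a preimage so that measurability, inclusions and
  convexity are inherited from K.\<close>

definition sc :: "'a::euclidean_space => nat => 'a set => 'a set" where
 "sc p k K = {q. 2^k *R (q - p) \<in> K}"

text \<open>Up to the factor |K| this is the mean of |w - a| over p + 2^-k K. The unit ball gives
  the approximate limit at p, a cone gives a one-sided trace.\<close>

definition trc :: "'a::euclidean_space set => ('a => real) => 'a => real => bool" where
 "trc K w p a \<longleftrightarrow> (%k. en (2^(k*DIM('a)))*(dev (sc p k K) w a)) ----> 0"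

abbreviation (input) "aplim \<equiv> trc (ball  0 1)"

lemma sets_sc [measurable]: "K \<in> sets borel ==> sc p k K \<in> sets borel"
 unfolding sc_def using measurable_sets_borel[of "%q. 2^k *R (q - p)" borel K] by (simp add: vimage_def)

lemma sc_ball: "sc p k (ball 0 1) = ball p (hp k)"
proof -
 have "norm (2^k *R (q - p)) < 1 \<longleftrightarrow> dist p q < hp k" for q
 proof -
  have "norm (2^k *R (q - p)) = 2^k*norm (q - p)" by simp
  then show ?thesis by (simp add: dist_norm norm_minus_commute power_one_over field_simps del: norm_scaleR)
 qed
 then show ?thesis unfolding sc_def ball_def by auto
qed

lemma sc_mono: "K \<subseteq> K' ==> sc p k K \<subseteq> sc p k K'"
 by (auto simp: sc_def)

lemma emeasure_sc:
 fixes K :: "'a::euclidean_space set"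
 assumes [measurable]: "K \<in> sets borel"
 shows "en (2^(k*DIM('a))) * vol (sc p k K) = vol K"
proof -
 have "vol K = (LI x. chi K x)" by simp
 also have "... = en (\<bar>2^k\<bar>^DIM('a))*(LI x. chi K (- (2^k *R p) + 2^k *R x))"
  by (rule nn_integral_affine) auto
 also have "(LI x. chi K (- (2^k *R p) + 2^k *R x)) = (LI x. chi (sc p k K) x)"
  by (intro nn_integral_cong) (auto simp: sc_def indicator_def algebra_simps)
 finally show ?thesis by (simp add: power_mult)
qed

lemma emeasure_sc':
 fixes K :: "'a::euclidean_space set"
 assumes [measurable]: "K \<in> sets borel"
 shows "vol (sc p k K) = en (hp (k*DIM('a))) * vol K"
proof -
 have "en (hp (k*DIM('a))) * vol K = (en (hp (k*DIM('a)))*en (2^(k*DIM('a)))) * vol (sc p k K)"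
  by (simp add: emeasure_sc mult.assoc)
 also have "en (hp (k*DIM('a)))*en (2^(k*DIM('a))) = 1"
  by (simp flip: ennreal_mult power_mult_distrib)
 finally show ?thesis by simp
qed

lemma convex_sc:
 assumes "convex K" shows "convex (sc p k K)"
 unfolding convex_alt
proof (intro ballI allI impI)
 fix x y and u :: real assume "x \<in> sc p k K" "y \<in> sc p k K" "0 <= u & u <= 1"
 then have "(1 - u) *R (2^k *R (x - p)) + u *R (2^k *R (y - p)) \<in> K"
  using assms[unfolded convex_alt] unfolding sc_def mem_Collect_eq by blast
 also have "(1 - u) *R (2^k *R (x - p)) + u *R (2^k *R (y - p)) = 2^k *R (((1 - u) *R x + u *R y) - p)"
  by (simp add: algebra_simps)
 finally show "(1 - u) *R x + u *R y \<in> sc p k K" by (simp add: sc_def)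
qed

text \<open>Campanato's argument: near-optimal constants at consecutive scales differ by a
  geometrically small amount, since the smaller set fills a fixed fraction of the larger one; hence
  they converge. The property \<open>star\<close> makes the dilated sets nested.\<close>

lemma trc_exists:
 fixes K :: "'a::euclidean_space set"
 assumes K[measurable]: "K \<in> sets borel" and mK: "0 < vol K" "vol K < \<infinity>"
  and star: "!!v. v \<in> K ==> (1/2) *R v \<in> K"
  and w[measurable]: "w \<in> BM" and L: "L > 0"
  and osc: "!!k. k >= k0 ==> osc2 (sc p k K) w <= en (L*(3/4)^k)*(vol (sc p k K) * vol (sc p k K))"
 shows "\<exists>a. \<forall>k\<ge>k0. (dev (sc p k K) w a)
   <= en (L*(10 + 8*2^DIM('a))*(3/4)^k) * vol (sc p k K)"
proof -
 define s where "s k = measure lborel (sc p k K)" for k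
 have fin: "vol (sc p k K) < \<infinity>" for k
  using mK by (simp add: emeasure_sc' ennreal_mult_less_top)
 have es: "vol (sc p k K) = en (s k)" for k
  unfolding s_def using fin by (simp add: emeasure_eq_ennreal_measure less_top)
 have s_pos: "s k > 0" for k
 proof -
  have "vol (sc p k K) > 0" using mK by (simp add: emeasure_sc' ennreal_zero_less_mult_iff)
  then show ?thesis by (simp add: es)
 qed
 have s_Suc: "s k = 2^DIM('a) * s (Suc k)" for k
 proof -
  have "en (s k) = en (2^DIM('a))*en (s (Suc k))"
   unfolding es[symmetric] emeasure_sc'[OF K] mult.assoc[symmetric]
   by (subst ennreal_mult[symmetric]) (auto simp: power_add power_one_over)
  then show ?thesis using s_pos[of k] s_pos[of "Suc k"] by (simp flip: ennreal_mult)
 qed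
 have nest: "sc p (Suc k) K \<subseteq> sc p k K" for k
 proof
  fix q assume "q \<in> sc p (Suc k) K"
  then have "(1/2) *R (2^Suc k *R (q - p)) \<in> K" using star unfolding sc_def by blast
  then show "q \<in> sc p k K" by (simp add: sc_def)
 qed
 \<comment> \<open>Pigeonhole over the constants \<open>w x\<close>: if each of them were worse than
   twice the mean oscillation, the double integral would exceed its bound.\<close>
 have ex: "\<exists>m. k >= k0 --> (dev (sc p k K) w m) <= en (2*(L*(3/4)^k) * s k)" for k
 proof (cases "k >= k0")
  case k: True
  show ?thesis
  proof (rule ccontr)
   assume "~ ?thesis"
   then have "en (2*(L*(3/4)^k) * s k) <= (dev (sc p k K) w (w x))" for x
    by (auto simp: not_le intro: less_imp_le)
   then have "(LI x:sc p k K. en (2*(L*(3/4)^k) * s k)) <= osc2 (sc p k K) w"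
    by (intro nn_integral_mono mult_right_mono) auto
   also have "... <= en (L*(3/4)^k)*(en (s k)*en (s k))"
    using osc[OF k] by (simp add: es)
   also have "(LI x:sc p k K. en (2*(L*(3/4)^k) * s k)) = en (2*(L*(3/4)^k) * s k)*en (s k)"
    by (subst nn_integral_cmult_indicator) (auto simp: es)
   finally have "en (2*(L*(3/4)^k) * s k * s k) <= en (L*(3/4)^k * s k * s k)"
    using s_pos[of k] L by (simp flip: ennreal_mult add: mult.assoc)
   then have "2*(L*(3/4)^k) * s k * s k <= L*(3/4)^k * s k * s k"
    using s_pos[of k] L by (subst (asm) ennreal_le_iff) auto
   then show False using s_pos[of k] L by simp
  qed
 qed simp
 have "\<exists>m. \<forall>k. k >= k0 --> (dev (sc p k K) w (m k)) <= en (2*(L*(3/4)^k) * s k)"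
  by (intro choice allI ex)
 then obtain m where
  m: "!!k. k >= k0 ==> (dev (sc p k K) w (m k)) <= en (2*(L*(3/4)^k) * s k)" by blast
 \<comment> \<open>Both scales contribute 2*L, the coarser one multiplied by the volume ratio
   \<open>2^DIM('a)\<close>.\<close>
 define B where "B = 2*L*(1 + 2^DIM('a))"
 have B: "B > 0" using L by (simp add: B_def add_pos_pos)
 have step: "\<bar>m (Suc k) - m k\<bar> <= B*(3/4)^k" if k: "k >= k0" for k
 proof -
  have "en (\<bar>m (Suc k) - m k\<bar> * s (Suc k)) = (LI q:sc p (Suc k) K. en \<bar>m (Suc k) - m k\<bar>)"
   using s_pos[of "Suc k"] by (simp add: nn_integral_cmult es ennreal_mult)
  also have "... <= (LI q. en \<bar>w q - m (Suc k)\<bar>*chi (sc p (Suc k) K) q + en \<bar>w q - m k\<bar>*chi (sc p k K) q)"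
   using nest[of k] by (intro nn_integral_mono) (auto simp: indicator_def simp flip: ennreal_plus intro!: ennreal_leI)
  also have "... = (dev (sc p (Suc k) K) w (m (Suc k))) + (dev (sc p k K) w (m k))"
   by (rule nn_integral_add) auto
  also have "... <= en (2*(L*(3/4)^Suc k) * s (Suc k)) + en (2*(L*(3/4)^k) * s k)"
   using k by (intro add_mono m) auto
  also have "... = en (2*(L*(3/4)^Suc k) * s (Suc k) + 2*(L*(3/4)^k) * s k)"
   using L s_pos[of k] s_pos[of "Suc k"] by (intro ennreal_plus[symmetric]) auto
  finally have "\<bar>m (Suc k) - m k\<bar> * s (Suc k) <= 2*(L*(3/4)^Suc k) * s (Suc k) + 2*(L*(3/4)^k) * s k"
   using L s_pos[of k] s_pos[of "Suc k"] by (subst (asm) ennreal_le_iff) auto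
  also have "... <= 2*(L*(3/4)^k) * s (Suc k) + 2*(L*(3/4)^k) * s k"
   using L s_pos[of "Suc k"] by simp
  also have "... = B*(3/4)^k * s (Suc k)" unfolding s_Suc[of k] B_def by (simp add: algebra_simps)
  finally show ?thesis using s_pos[of "Suc k"] by simp
 qed
 \<comment> \<open>The factor 4 = 1/(1 - 3/4) sums the geometric series; keeping the subtracted term
   lets the induction close.\<close>
 have tele: "\<bar>m (k + i) - m k\<bar> <= 4*B*((3/4)^k - (3/4)^(k + i))" if k: "k >= k0" for k i
 proof (induction i)
  case (Suc i)
  have "\<bar>m (k + Suc i) - m k\<bar> <= B*(3/4)^(k + i) + 4*B*((3/4)^k - (3/4)^(k + i))"
   using Suc step[of "k + i"] k by simp
  then show ?case by (simp add: algebra_simps)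
 qed simp
 have tele': "\<bar>m (k + i) - m k\<bar> <= 4*B*(3/4)^k" if k: "k >= k0" for k i
  using tele[OF k, of i] B by (smt (verit) mult_left_mono zero_le_power zero_le_divide_iff)
 have "Cauchy m"
 proof (rule metric_CauchyI)
  fix e :: real assume e: "e > 0"
  have "(%k. 8*B*(3/4)^k) ----> 8*B*0" by (intro tendsto_intros LIMSEQ_power_zero) auto
  then have "eventually (%k. k >= k0 & 8*B*(3/4)^k < e) sq"
   using e by (intro eventually_conj eventually_ge_at_top order_tendstoD(2)) auto
  from eventually_happens'[OF sequentially_bot this] obtain k where k: "k >= k0" "8*B*(3/4)^k < e" by blast
  have "dist (m i) (m j) < e" if "i >= k" "j >= k" for i j
   using tele'[OF k(1), of "i - k"] tele'[OF k(1), of "j - k"] that k(2) by (simp add: dist_real_def)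
  then show "\<exists>M. \<forall>i\<ge>M. \<forall>j\<ge>M. dist (m i) (m j) < e" by blast
 qed
 then obtain a where a: "m ----> a" using Cauchy_convergent convergent_def by blast
 have ma: "\<bar>m k - a\<bar> <= 4*B*(3/4)^k" if k: "k >= k0" for k
 proof -
  have "(%i. \<bar>m (i + k) - m k\<bar>) ----> \<bar>a - m k\<bar>"
   using a by (intro tendsto_intros LIMSEQ_ignore_initial_segment)
  then have "\<bar>a - m k\<bar> <= 4*B*(3/4)^k"
   by (rule tendsto_upperbound) (use tele'[OF k] in \<open>auto simp: add.commute\<close>)
  then show ?thesis by (simp add: abs_minus_commute)
 qed
 show ?thesis
 proof (intro exI[of _ a] allI impI)
  fix k assume k: "k0 <= k"
  have "(dev (sc p k K) w a) <= (LI q. en \<bar>w q - m k\<bar>*chi (sc p k K) q + en \<bar>m k - a\<bar>*chi (sc p k K) q)"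
   by (intro nn_integral_mono) (auto simp: indicator_def simp flip: ennreal_plus intro!: ennreal_leI)
  also have "... = (dev (sc p k K) w (m k)) + en \<bar>m k - a\<bar>*en (s k)"
   by (simp add: nn_integral_add nn_integral_cmult es)
  also have "... <= en (2*(L*(3/4)^k) * s k) + en (4*B*(3/4)^k)*en (s k)"
   by (intro add_mono m k mult_right_mono ennreal_leI ma) auto
  also have "... = en (2*(L*(3/4)^k) * s k + 4*B*(3/4)^k * s k)"
   using L B s_pos[of k] by (simp add: ennreal_mult)
  \<comment> \<open>The constant of the statement is 2 + 4*B/L.\<close>
  also have "2*(L*(3/4)^k) * s k + 4*B*(3/4)^k * s k = (L*(10 + 8*2^DIM('a))*(3/4)^k) * s k"
   by (simp add: B_def algebra_simps)
  also have "en ... = en (L*(10 + 8*2^DIM('a))*(3/4)^k) * vol (sc p k K)"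
   using L s_pos[of k] by (simp add: es ennreal_mult)
  finally show "(dev (sc p k K) w a) <= ..." .
 qed
qed

lemma trc_if_bound:
 fixes K :: "'a::euclidean_space set"
 assumes K[measurable]: "K \<in> sets borel" and fin: "vol K < \<infinity>"
  and b: "!!k. k >= k0 ==> (dev (sc p k K) w a) <= en (L*(3/4)^k) * vol (sc p k K)"
 shows "trc K w p a"
 unfolding trc_def
proof (rule tendsto_sandwich[of "%_. 0" _ _ "%k. en (L*(3/4)^k) * vol K"])
 show "\<forall>\<^sub>F k in sq. en (2^(k*DIM('a)))*(dev (sc p k K) w a)
  <= en (L*(3/4)^k) * vol K"
  using eventually_ge_at_top[of k0]
 proof eventually_elim
  case (elim k)
  have "en (2^(k*DIM('a)))*(dev (sc p k K) w a)
    <= en (2^(k*DIM('a)))*(en (L*(3/4)^k) * vol (sc p k K))"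
   by (intro mult_left_mono b elim) auto
  also have "... = en (L*(3/4)^k)*(en (2^(k*DIM('a))) * vol (sc p k K))"
   by (simp add: mult_ac)
  finally show ?case by (simp add: emeasure_sc)
 qed
 have "(%k. en (L*(3/4)^k)) ----> en (L*0)"
  by (intro tendsto_ennrealI tendsto_intros LIMSEQ_power_zero) auto
 then have "(%k. vol K*en (L*(3/4)^k)) ----> vol K*en (L*0)"
  using fin by (intro ennreal_tendsto_cmult) auto
 then show "(%k. en (L*(3/4)^k) * vol K) ----> 0" by (simp add: mult.commute)
qed auto

text \<open>Only small scales matter, so a comparison in some neighbourhood U of p is
  enough.\<close>

lemma trc_dominated:
 fixes K :: "'a::euclidean_space set"
 assumes K: "K \<subseteq> K'" "K' \<subseteq> ball 0 1" and m[measurable]: "K' \<in> sets borel" "w1 \<in> BM" "w2 \<in> BM"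
  and t: "trc K' w1 p a1" "trc K' w2 p a2" and U: "open U" "p \<in> U"
  and le: "!!q. q \<in> U ==> \<bar>w q - a\<bar> <= c*(\<bar>w1 q - a1\<bar> + \<bar>w2 q - a2\<bar>)"
 shows "trc K w p a"
 unfolding trc_def
proof -
 define I1 where "I1 k = en (2^(k*DIM('a)))*(dev (sc p k K') w1 a1)" for k
 define I2 where "I2 k = en (2^(k*DIM('a)))*(dev (sc p k K') w2 a2)" for k
 obtain r where r: "r > 0" "ball p r \<subseteq> U" using U by (auto simp: open_contains_ball)
 have "eventually (%k. hp k < r) sq"
  using r by (intro order_tendstoD(2)[OF LIMSEQ_power_zero]) auto
 then have ev: "eventually (%k. en (2^(k*DIM('a)))*(dev (sc p k K) w a) <= en \<bar>c\<bar>*(I1 k + I2 k)) sq"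
 proof eventually_elim
  case (elim k)
  have sub: "sc p k K \<subseteq> U"
   using sc_mono[OF order_trans[OF K], of p k] elim r(2) subset_ball[of "(1/2)^k" r p] unfolding sc_ball by auto
  have "(dev (sc p k K) w a)
    <= (LI q. en \<bar>c\<bar>*(en \<bar>w1 q - a1\<bar>*chi (sc p k K') q + en \<bar>w2 q - a2\<bar>*chi (sc p k K') q))"
  proof (rule nn_integral_mono)
   fix q
   show "en \<bar>w q - a\<bar>*chi (sc p k K) q <= en \<bar>c\<bar>*(en \<bar>w1 q - a1\<bar>*chi (sc p k K') q + en \<bar>w2 q - a2\<bar>*chi (sc p k K') q)"
   proof (cases "q \<in> sc p k K")
    case True
    then have "\<bar>w q - a\<bar> <= c*(\<bar>w1 q - a1\<bar> + \<bar>w2 q - a2\<bar>)" using le sub by auto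
    also have "... <= \<bar>c\<bar>*(\<bar>w1 q - a1\<bar> + \<bar>w2 q - a2\<bar>)" by (intro mult_right_mono) auto
    finally show ?thesis using True sc_mono[OF K(1), of p k]
     by (auto simp flip: ennreal_plus ennreal_mult intro!: ennreal_leI simp: indicator_def)
   qed simp
  qed
  also have "... = en \<bar>c\<bar>*((dev (sc p k K') w1 a1) + (dev (sc p k K') w2 a2))"
   by (simp add: nn_integral_cmult nn_integral_add)
  finally have "en (2^(k*DIM('a)))*(dev (sc p k K) w a) <= en (2^(k*DIM('a)))*..."
   by (intro mult_left_mono) auto
  then show ?case by (simp add: I1_def I2_def distrib_left mult_ac)
 qed
 have "(%k. en \<bar>c\<bar>*(I1 k + I2 k)) ----> en \<bar>c\<bar>*(0 + 0)"
  using t unfolding trc_def I1_def[symmetric] I2_def[symmetric]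
  by (intro ennreal_tendsto_cmult tendsto_add) auto
 then show "(%k. en (2^(k*DIM('a)))*(dev (sc p k K) w a)) ----> 0"
  using tendsto_sandwich[OF _ ev tendsto_const, of 0] by simp
qed

lemma trc_unique:
 fixes K :: "'a::euclidean_space set"
 assumes m[measurable]: "K \<in> sets borel" "w \<in> BM" and K: "vol K > 0"
  and t: "trc K w p a" "trc K w p b"
 shows "a = b"
proof -
 let ?I = "%a k. en (2^(k*DIM('a)))*(dev (sc p k K) w a)"
 have le: "en \<bar>a - b\<bar> * vol K <= ?I a k + ?I b k" for k
 proof -
  have "en \<bar>a - b\<bar> * vol K = en (2^(k*DIM('a)))*(LI q:sc p k K. en \<bar>a - b\<bar>)"
   by (simp add: nn_integral_cmult emeasure_sc[OF m(1), of k p, symmetric] mult_ac)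
  also have "... <= en (2^(k*DIM('a)))*(LI q. en \<bar>w q - a\<bar>*chi (sc p k K) q + en \<bar>w q - b\<bar>*chi (sc p k K) q)"
   by (intro nn_integral_mono mult_left_mono) (auto simp: indicator_def simp flip: ennreal_plus intro!: ennreal_leI)
  finally show ?thesis by (simp add: nn_integral_add distrib_left)
 qed
 have "(%k. ?I a k + ?I b k) ----> 0 + 0" using t unfolding trc_def by (intro tendsto_add)
 then have "en \<bar>a - b\<bar> * vol K <= 0"
  using le by (intro tendsto_lowerbound[of "%k. ?I a k + ?I b k" _ sequentially]) auto
 then show ?thesis using K by auto
qed

section \<open>Density points and traces\<close>

text \<open>Up to the factor C, the value at r is controlled by the value at the next larger dyadic
  radius.\<close>

lemma tendsto_at_right_iff_dyadic:
 fixes f :: "real => real"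
 assumes nn: "!!r. 0 < r ==> 0 <= f r" and C: "C > 0"
  and cmp: "!!r s. 0 < r ==> r <= s ==> s <= 2*r ==> f r <= C*f s"
 shows "(f \<longlongrightarrow> 0) (at_right 0) \<longleftrightarrow> (%k. f (hp k)) ----> 0"
proof
 assume f: "(f \<longlongrightarrow> 0) (at_right 0)"
 have "filterlim (%k. hp k) (at_right 0) sq"
  unfolding filterlim_at by (auto intro!: LIMSEQ_power_zero)
 from filterlim_compose[OF f this] show "(%k. f (hp k)) ----> 0" .
next
 assume f: "(%k. f (hp k)) ----> 0"
 show "(f \<longlongrightarrow> 0) (at_right 0)"
 proof (rule tendstoI)
  fix e :: real assume e: "e > 0"
  then have "eventually (%k. f (hp k) < e/C) sq"
   using f C by (intro order_tendstoD(2)) auto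
  then obtain k0 where k0: "!!k. k >= k0 ==> f (hp k) < e/C" by (auto simp: eventually_sequentially)
  have "f r < e" if r: "0 < r" "r < hp k0" for r
  proof -
   obtain n where n: "hp n < r" using real_arch_pow_inv[of r "1/2"] r by auto
   \<comment> \<open>The first dyadic radius below r; its predecessor lies in [r, 2r), where
     \<open>cmp\<close> applies.\<close>
   define m where "m = (LEAST n. hp n < r)"
   have m: "(1/2)^m < r" unfolding m_def using n by (rule LeastI)
   have "~ m <= k0"
   proof
    assume "m <= k0"
    then have "hp k0 <= (1/2)^m" by (intro power_decreasing) auto
    then show False using m r by linarith
   qed
   then obtain k where k: "m = Suc k" "k >= k0" by (cases m) auto
   have "~ hp k < r" using not_less_Least[of k "%n. hp n < r"] k by (simp add: m_def)
   then have "f r <= C*f (hp k)" using r m k by (intro cmp) auto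
   also have "... < e" using k0[OF k(2)] C by (simp add: field_simps)
   finally show ?thesis .
  qed
  then show "\<forall>\<^sub>F r in at_right 0. dist (f r) 0 < e"
   unfolding eventually_at_right_field using nn
   by (intro exI[of _ "hp k0"]) (auto simp: dist_real_def)
 qed
qed

lemma measure_lebesgue_borel: "A \<in> sets borel ==> measure lebesgue A = measure lborel A"
 by (simp add: measure_completion)

lemma dens_pts_0_iff_trc:
 fixes E :: "'a::euclidean_space set"
 assumes E[measurable]: "E \<in> sets borel"
 shows "p \<in> dens_pts E 0 \<longleftrightarrow> aplim (chi E) p 0"
proof -
 define w where "w = unit_ball_vol (real DIM('a))"
 have w: "w > 0" by (simp add: w_def)
 define f where "f r = measure lborel (E \<inter> ball p r)/measure lborel (ball p r)" for r
 have mb: "measure lborel (ball p r) = w*r^DIM('a)" if "r > 0" for r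
  using that content_ball[of r p] by (simp add: w_def)
 have fm: "E \<inter> ball p r \<in> fmeasurable lborel" for r
 proof (rule fmeasurableI)
  have "vol (E \<inter> ball p r) <= vol (ball p r)" by (intro emeasure_mono) auto
  also have "... < \<infinity>" by (rule emeasure_lborel_ball_finite)
  finally show "vol (E \<inter> ball p r) < \<infinity>" .
 qed simp
 have cmp: "f r <= 2^DIM('a)*f s" if "0 < r" "r <= s" "s <= 2*r" for r s
 proof -
  have le: "measure lborel (E \<inter> ball p r) <= measure lborel (E \<inter> ball p s)"
   using fm subset_ball[of r s p] that by (intro measure_mono_fmeasurable) (auto dest: fmeasurableD)
  have "s^DIM('a) <= (2*r)^DIM('a)" using that by (intro power_mono) auto
  then have le2: "w * s^DIM('a) <= 2^DIM('a)*(w*r^DIM('a))" using w by (simp add: power_mult_distrib)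
  have "measure lborel (E \<inter> ball p r)*(w * s^DIM('a)) <= measure lborel (E \<inter> ball p s)*(2^DIM('a)*(w*r^DIM('a)))"
   by (rule mult_mono[OF le le2]) (use w that in auto)
  then show ?thesis unfolding f_def using that w by (simp add: mb field_simps)
 qed
 have "p \<in> dens_pts E 0 \<longleftrightarrow> (f \<longlongrightarrow> 0) (at_right 0)"
  unfolding dens_pts_def mem_Collect_eq f_def[abs_def] by (simp add: measure_lebesgue_borel)
 also have "... \<longleftrightarrow> (%k. f (hp k)) ----> 0"
  by (rule tendsto_at_right_iff_dyadic[where C="2^DIM('a)"]) (rule cmp | simp add: f_def)+
 also have "... \<longleftrightarrow> (%k. w*f (hp k)) ----> 0"
  using w tendsto_mult_left_iff[of w "%k. f (hp k)" 0 sequentially] by simp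
 also have "... \<longleftrightarrow> (%k. en (w*f (hp k))) ----> en 0"
  using w by (intro tendsto_ennreal_iff[symmetric]) (auto simp: f_def intro!: always_eventually)
 also have "(%k. en (w*f (hp k))) = (%k. en (2^(k*DIM('a)))*(dev (sc p k (ball 0 1)) (chi E) 0))"
 proof
  fix k
  have "(dev (sc p k (ball 0 1)) (chi E) 0) = (LI q. chi (E \<inter> ball p (hp k)) q)"
   by (intro nn_integral_cong) (auto simp: indicator_def sc_ball)
  also have "... = en (measure lborel (E \<inter> ball p (hp k)))"
   using fm by (simp add: emeasure_eq_measure2)
  finally show "en (w*f (hp k)) = en (2^(k*DIM('a)))*(dev (sc p k (ball 0 1)) (chi E) 0)"
   using w by (simp add: f_def mb power_mult[symmetric] power_one_over field_simps flip: ennreal_mult)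
 qed
 finally show ?thesis by (simp add: trc_def)
qed

lemma dens_pts_1_iff:
 fixes E :: "'a::euclidean_space set"
 assumes E: "E \<in> sets lebesgue"
 shows "p \<in> dens_pts E 1 \<longleftrightarrow> p \<in> dens_pts (- E) 0"
proof -
 have eq: "measure lebesgue (- E \<inter> ball p r)/measure lebesgue (ball p r) = 1 - measure lebesgue (E \<inter> ball p r)/measure lebesgue (ball p r)"
  if r: "r > 0" for r
 proof -
  have fm: "E \<inter> ball p r \<in> lmeasurable" using E lmeasurable_ball[of p r] by (metis Int_commute fmeasurable_Int_fmeasurable)
  have "measure lebesgue (- E \<inter> ball p r) = measure lebesgue (ball p r - E \<inter> ball p r)"
   by (rule arg_cong[where f="measure lebesgue"]) auto
  also have "... = measure lebesgue (ball p r) - measure lebesgue (E \<inter> ball p r)"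
   using fm by (intro measurable_measure_Diff) auto
  finally show ?thesis using r content_ball_pos[OF r, of p] by (simp add: diff_divide_distrib)
 qed
 have "p \<in> dens_pts (- E) 0 \<longleftrightarrow> ((%r. 1 - measure lebesgue (E \<inter> ball p r)/measure lebesgue (ball p r)) \<longlongrightarrow> 0) (at_right 0)"
  unfolding dens_pts_def mem_Collect_eq
  by (intro filterlim_cong refl) (use eq in \<open>auto simp: eventually_at_right_field simp del: measure_completion intro!: exI[of _ 1]\<close>)
 also have "... \<longleftrightarrow> ((%r. measure lebesgue (E \<inter> ball p r)/measure lebesgue (ball p r)) \<longlongrightarrow> 1) (at_right 0)"
  (is "(?h \<longlongrightarrow> 0) ?F \<longleftrightarrow> (?f \<longlongrightarrow> 1) ?F")
 proof
  assume "(?h \<longlongrightarrow> 0) ?F"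
  from tendsto_diff[OF tendsto_const[of 1] this] show "(?f \<longlongrightarrow> 1) ?F" by simp
 next
  assume "(?f \<longlongrightarrow> 1) ?F"
  from tendsto_diff[OF tendsto_const[of 1] this] show "(?h \<longlongrightarrow> 0) ?F" by simp
 qed
 finally show ?thesis by (simp add: dens_pts_def)
qed

section \<open>Traces from bounds on the gradient\<close>

lemmas [measurable] = borel_open[OF open_ball]

text \<open>A diameter of 2*2^-k times a mean gradient of order (3/2)^k is of order (3/4)^k.\<close>

lemma osc2_upgrad_sc:
 fixes K :: "'a::euclidean_space set"
 assumes up: "upgrad Q w G" and K[measurable]: "K \<in> sets borel" and cK: "convex K" "K \<subseteq> ball 0 1"
  and sub: "sc p k K \<subseteq> Q" and mK: "vol K < \<infinity>" "vol K > 0"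
  and G: "(LI x:sc p k K. en (G x)) <= en (B*(3/2)^k) * vol (sc p k K)" and B: "B >= 0"
 shows "osc2 (sc p k K) w <= en (2^Suc DIM('a)*B*(3/4)^k)*(vol (sc p k K) * vol (sc p k K))"
proof -
 have d: "dist x y <= 2*hp k" if "x \<in> sc p k K" "y \<in> sc p k K" for x y
 proof -
  have "dist p x < hp k" "dist p y < hp k" using that sc_mono[OF cK(2), of p k] by (auto simp: sc_ball)
  then show ?thesis using dist_triangle[of x y p] by (simp add: dist_commute)
 qed
 have "osc2 (sc p k K) w <= en (2*hp k*2^DIM('a))*(vol (sc p k K)*(LI x:sc p k K. en (G x)))"
  by (rule upgrad_poincare[OF up _ convex_sc sub d]) (use cK in auto)
 also have "... <= en (2*hp k*2^DIM('a))*(vol (sc p k K)*(en (B*(3/2)^k) * vol (sc p k K)))"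
  by (intro mult_left_mono G) auto
 also have "... = en (2*hp k*2^DIM('a))*en (B*(3/2)^k)*(vol (sc p k K) * vol (sc p k K))"
  by (simp add: mult_ac)
 also have "en (2*hp k*2^DIM('a))*en (B*(3/2)^k) = en (2^Suc DIM('a)*B*(3/4)^k)"
 proof -
  have "(3/4::real)^k = hp k*(3/2)^k" by (simp flip: power_mult_distrib)
  then show ?thesis using B by (simp flip: ennreal_mult)
 qed
 finally show ?thesis .
qed

text \<open>At a fixed scale the Poincare bound passes to w0 by L^1 convergence, for which
  infinitely many good indices j suffice; these may be different at each scale. With a constant
  sequence this is the trace theorem for one function.\<close>

lemma trc_exists_limit:
 fixes K :: "'a::euclidean_space set"
 assumes up: "!!j. upgrad Q (w j) (G j)" and K[measurable]: "K \<in> sets borel" and cK: "convex K" "K \<subseteq> ball 0 1"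
  and star: "!!v. v \<in> K ==> (1/2) *R v \<in> K"
  and mK: "vol K < \<infinity>" "vol K > 0"
  and sub: "!!k. k >= k0 ==> sc p k K \<subseteq> Q" and B: "B > 0"
  and G: "!!k. k >= k0 ==> frequently (%j. (LI x:sc p k K. en (G j x)) <= en (B*(3/2)^k) * vol (sc p k K)) sq"
  and w0[measurable]: "w0 \<in> BM" and lim: "(%j. LI x:Q. en \<bar>w j x - w0 x\<bar>) ----> 0"
 shows "\<exists>a. \<forall>k\<ge>k0. (dev (sc p k K) w0 a)
   <= en ((2^Suc DIM('a)*B)*(10 + 8*2^DIM('a))*(3/4)^k) * vol (sc p k K)"
proof (rule trc_exists[OF K mK(2,1) star w0])
 fix k assume k: "k >= k0"
 have [measurable]: "w j \<in> BM" for j using up[of j] by (simp add: upgrad_def)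
 let ?S = "sc p k K"
 let ?R = "en (2^Suc DIM('a)*B*(3/4)^k)*(vol ?S * vol ?S)"
 have fin: "vol ?S < \<infinity>" using mK by (simp add: emeasure_sc' ennreal_mult_less_top)
 have ls: "(%j. ?R + 2*(vol ?S*(dist1 Q (w j) w0))) ----> ?R + 2*(vol ?S*0)"
  using fin by (intro tendsto_add tendsto_const ennreal_tendsto_cmult lim) auto
 have le: "osc2 ?S w0 <= ?R + 2*(vol ?S*(dist1 Q (w j) w0))"
  if "(LI x:?S. en (G j x)) <= en (B*(3/2)^k) * vol ?S" for j
 proof -
  have "osc2 ?S w0 <= osc2 ?S (w j) + 2*(vol ?S*(dist1 ?S (w j) w0))"
   by (rule osc2_triangle) auto
  also have "... <= ?R + 2*(vol ?S*(dist1 Q (w j) w0))"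
   using sub[OF k] B mK cK
   by (intro add_mono mult_left_mono osc2_upgrad_sc[OF up] that nn_integral_mono) (auto simp: indicator_def)
  finally show ?thesis .
 qed
 show "osc2 ?S w0 <= ?R"
 proof (rule ccontr)
  assume "~ ?thesis"
  then have "eventually (%j. ?R + 2*(vol ?S*(dist1 Q (w j) w0)) < osc2 ?S w0) sq"
   using order_tendstoD(2)[OF ls, of "osc2 ?S w0"] by (simp add: not_le)
  from frequently_ex[OF frequently_eventually_conj[OF G[OF k] this]] obtain j where
   "(LI x:?S. en (G j x)) <= en (B*(3/2)^k) * vol ?S"
   "?R + 2*(vol ?S*(dist1 Q (w j) w0)) < osc2 ?S w0" by blast
  with le[of j] show False by (simp add: not_le[symmetric])
 qed
qed (use B in auto)

text \<open>Disjoint Vitali balls of radii r with energy at least L*r^n in the limit: Fatou for the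
  sum over the balls bounds L times the sum of r^n by the common bound M. As L is arbitrary, the
  coverings can be made as small as desired.\<close>

lemma hnull_energy_concentration:
 fixes G :: "nat => 'a::euclidean_space => real"
 assumes G[measurable]: "!!j. G j \<in> BM"
  and E: "!!j. (LI x. en ((G j x)^2)) <= en M" and M: "M >= 0"
 shows "hnull n {y. \<forall>L k0. \<exists>k\<ge>k0. liminf (%j. LI x:ball y (hp k). en ((G j x)^2)) > en (L*(1/2)^(k*n))}"
  (is "hnull n ?Z")
 unfolding hnull_def
proof (intro allI impI)
 fix e :: real assume e: "e > 0"
 define nu where "nu j = density lborel (%x. en ((G j x)^2))" for j
 have nu: "emeasure (nu j) A = (LI x:A. en ((G j x)^2))" if "A \<in> sets borel" for j A
  unfolding nu_def using that by (subst emeasure_density) auto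
 \<comment> \<open>The factor 5^n pays for the enlargement in the covering; M + 1 avoids division by
   zero when M = 0.\<close>
 define L where "L = 5^n*(M + 1)/e"
 have L: "L > 0" using e M by (simp add: L_def)
 have ex: "\<exists>k. y \<in> ?Z --> en (L*(1/2)^(k*n)) < liminf (%j. emeasure (nu j) (ball y (hp k)))" for y
  by (auto simp: nu dest!: spec[of _ L])
 have "\<exists>k. \<forall>y. y \<in> ?Z --> en (L*(1/2)^(k y*n)) < liminf (%j. emeasure (nu j) (ball y ((1/2)^k y)))"
  by (intro choice allI ex)
 then obtain k where k: "!!y. y \<in> ?Z ==> en (L*(1/2)^(k y*n)) < liminf (%j. emeasure (nu j) (ball y ((1/2)^k y)))"
  by blast
 define r where "r y = (1/2::real)^k y" for y
 have r: "0 < r y" "r y <= 1" for y by (auto simp: r_def power_le_one)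
 obtain C where C: "countable C" "C \<subseteq> ?Z" "disjoint_family_on (%p. cball p (r p)) C"
  "?Z \<subseteq> (\<Union>p\<in>C. cball p (5*r p))"
 proof (rule vitali_cover[of ?Z r 1])
  show "0 < r p & r p <= 1" for p using r by blast
 qed
 have "(\<integral>\<^sup>+p. en (L*r p^n) \<partial>count_space C) <= (\<integral>\<^sup>+p. liminf (%j. emeasure (nu j) (cball p (r p))) \<partial>count_space C)"
 proof (rule nn_integral_mono)
  fix p assume "p \<in> space (count_space C)"
  then have "en (L*r p^n) <= liminf (%j. emeasure (nu j) (ball p (r p)))"
   using k[of p] C(2) unfolding r_def by (auto simp: power_mult less_imp_le)
  also have "... <= liminf (%j. emeasure (nu j) (cball p (r p)))"
   by (intro Liminf_mono always_eventually allI emeasure_mono) (auto simp: nu_def)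
  finally show "en (L*r p^n) <= liminf (%j. emeasure (nu j) (cball p (r p)))" .
 qed
 also have "... <= liminf (%j. \<integral>\<^sup>+p. emeasure (nu j) (cball p (r p)) \<partial>count_space C)"
  by (rule nn_integral_liminf) simp
 also have "(%j. \<integral>\<^sup>+p. emeasure (nu j) (cball p (r p)) \<partial>count_space C) = (%j. emeasure (nu j) (\<Union>p\<in>C. cball p (r p)))"
  using C by (intro ext emeasure_UN_countable[symmetric]) (auto simp: nu_def)
 also have "liminf ... <= liminf (%j. en M)"
 proof (intro Liminf_mono always_eventually allI)
  fix j
  have "emeasure (nu j) (\<Union>p\<in>C. cball p (r p)) <= emeasure (nu j) UNIV"
   by (intro emeasure_mono) (auto simp: nu_def)
  also have "... <= en M" using E by (simp add: nu)
  finally show "emeasure (nu j) (\<Union>p\<in>C. cball p (r p)) <= en M" .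
 qed
 also have "... = en M" by (simp add: Liminf_const)
 finally have sum: "(\<integral>\<^sup>+p. en (L*r p^n) \<partial>count_space C) <= en M" .
 let ?C = "(%p. (p, 5*r p)) ` C"
 have "emeasure (pow_measure n) ?C <= (\<integral>\<^sup>+p. en ((5*r p)^n) \<partial>count_space C)"
  using emeasure_pow_measure_image_le[of n "%p. (p, 5*r p)" C] by simp
 also have "... = (\<integral>\<^sup>+p. en (5^n/L)*en (L*r p^n) \<partial>count_space C)"
  using L less_imp_le[OF r(1)] by (intro nn_integral_cong) (simp add: power_mult_distrib flip: ennreal_mult)
 also have "... = en (5^n/L)*(\<integral>\<^sup>+p. en (L*r p^n) \<partial>count_space C)"
  by (rule nn_integral_cmult) simp
 also have "... <= en (5^n/L)*en M" by (intro mult_left_mono sum) auto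
 also have "... = en (e*(M/(M + 1)))" using L M e by (simp add: L_def flip: ennreal_mult)
 also have "... <= en e" using M e by (intro ennreal_leI) (auto simp: field_simps)
 finally have "emeasure (pow_measure n) ?C <= en e" .
 then show "\<exists>C. countable C & (\<forall>(c, r)\<in>C. 0 < r) & ?Z \<subseteq> (\<Union>(c, r)\<in>C. cball c r) & emeasure (pow_measure n) C <= en e"
 proof (intro exI[of _ ?C] conjI)
  show "?Z \<subseteq> (\<Union>(c, r)\<in>?C. cball c r)" using C(4) by auto
 qed (use C r in auto)
qed

text \<open>Off the concentration set of the L^2 energy with exponent N - 1, where N =
  \<open>DIM('a)\<close>, small balls of radius r have energy O(r^(N-1)) for infinitely many j. By
  Young's inequality the mean of the gradient is then O((3/2)^k) at r = 2^-k, and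
  \<open>trc_exists_limit\<close> applies.\<close>

lemma hnull_no_trace_limit:
 fixes w :: "nat => 'a::euclidean_space => real"
 assumes O: "open Q" and up: "!!j. upgrad Q (w j) (G j)"
  and E: "!!j. (LI x. en ((G j x)^2)) <= en M" and M: "M >= 0"
  and w0[measurable]: "w0 \<in> BM" and lim: "(%j. LI x:Q. en \<bar>w j x - w0 x\<bar>) ----> 0"
 shows "hnull (DIM('a) - 1) {y\<in>Q. ~ (\<exists>a. aplim w0 y a)}"
proof (rule hnull_mono[OF hnull_energy_concentration[OF _ E M]])
 have Gm[measurable]: "G j \<in> BM" for j using up[of j] by (simp add: upgrad_def)
 show "G j \<in> BM" for j by simp
 show "{y\<in>Q. ~ (\<exists>a. aplim w0 y a)} \<subseteq> {y. \<forall>L k0. \<exists>k\<ge>k0. en (L*(1/2)^(k*(DIM('a) - 1))) <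
   liminf (%j. LI x:ball y (hp k). en ((G j x)^2))}"
 proof (intro subsetI CollectI allI, rule ccontr)
  fix y L k0 assume "y \<in> {y\<in>Q. ~ (\<exists>a. aplim w0 y a)}"
   and L0: "~ (\<exists>k\<ge>k0. en (L*(1/2)^(k*(DIM('a) - 1))) <
   liminf (%j. LI x:ball y (hp k). en ((G j x)^2)))"
  then have y: "y \<in> Q" and no: "!!a. ~ aplim w0 y a" by auto
  define N where "N = DIM('a)"
  have N: "N = Suc (N - 1)" by (simp add: N_def)
  \<comment> \<open>Strictly above L, so that a liminf of at most L * r^(N-1) yields infinitely many
    indices below L1 * r^(N-1).\<close>
  define L1 where "L1 = max L 0 + 1"
  have L1: "L1 > 0" "L < L1" by (auto simp: L1_def)
  obtain r where r: "r > 0" "ball y r \<subseteq> Q" using O y by (auto simp: open_contains_ball)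
  have "eventually (%k. hp k < r) sq"
   using r by (intro order_tendstoD(2)[OF LIMSEQ_power_zero]) auto
  then obtain k1 where k1: "!!k. k >= k1 ==> hp k < r" by (auto simp: eventually_sequentially)
  define om where "om = unit_ball_vol (real DIM('a))"
  have om: "om > 0" by (simp add: om_def)
  define B where "B = 1 + L1/om"
  have B: "B > 0" using L1 om by (simp add: B_def add_pos_pos)
  have mb: "vol (ball y (hp k)) = en (om*(1/2)^(k*N))" for k
   by (simp add: emeasure_ball om_def N_def power_mult)
  have fr: "\<exists>\<^sub>F j in sq. (LI x:sc y k (ball 0 1). en (G j x)) <= en (B*(3/2)^k) * vol (sc y k (ball 0 1))"
   if k: "k >= max k0 k1" for k
  proof -
   let ?S = "ball y (hp k)"
   have "liminf (%j. LI x:?S. en ((G j x)^2)) <= en (L*(1/2)^(k*(N - 1)))"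
    using L0 k by (auto simp: not_less N_def)
   also have "... < en (L1*(1/2)^(k*(N - 1)))"
    using L1 by (intro ennreal_lessI) auto
   finally have "\<exists>\<^sub>F j in sq. (LI x:?S. en ((G j x)^2)) < en (L1*(1/2)^(k*(N - 1)))"
   proof (rule contrapos_pp)
    assume "~ (\<exists>\<^sub>F j in sq. (LI x:?S. en ((G j x)^2)) < en (L1*(1/2)^(k*(N - 1))))"
    then have "\<forall>\<^sub>F j in sq. en (L1*(1/2)^(k*(N - 1))) <= (LI x:?S. en ((G j x)^2))"
     by (simp add: not_frequently not_less)
    from Liminf_bounded[OF this]
    show "~ liminf (%j. LI x:?S. en ((G j x)^2)) < en (L1*(1/2)^(k*(N - 1)))"
     by (simp add: not_less)
   qed
   then show ?thesis
   proof (rule frequently_elim1)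
    fix j assume j: "(LI x:?S. en ((G j x)^2)) < en (L1*(1/2)^(k*(N - 1)))"
    \<comment> \<open>The weight is balanced: the energy exceeds the volume by a factor of order
      2^k, and (2/3)^k * 2^k = (4/3)^k is still below (3/2)^k.\<close>
    have pw: "g <= (3/2)^k + (2/3)^k*g\<^sup>2" for g :: real
    proof -
     have "(3/2::real)^k*(2/3)^k = 1" by (simp flip: power_mult_distrib)
     then have c: "(2/3::real)^k = 1/(3/2)^k" by (simp add: field_simps)
     have "0 <= (g - (3/2)^k)^2" by simp
     moreover have "0 <= g\<^sup>2" "0 <= ((3/2::real)^k)^2" by auto
     ultimately have "g*(3/2)^k <= ((3/2)^k)^2 + g\<^sup>2"
      unfolding power2_diff by linarith
     then show ?thesis unfolding c by (simp add: field_simps power2_eq_square)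
    qed
    have "(LI x:?S. en (G j x)) <= (LI x. en ((3/2)^k)*chi ?S x + en ((2/3)^k)*(en ((G j x)^2)*chi ?S x))"
     by (intro nn_integral_mono) (use pw in \<open>auto simp: indicator_def simp flip: ennreal_plus ennreal_mult intro!: ennreal_leI\<close>)
    also have "... = en ((3/2)^k) * vol ?S + en ((2/3)^k)*(LI x:?S. en ((G j x)^2))"
     by (simp add: nn_integral_add nn_integral_cmult)
    also have "... <= en ((3/2)^k) * vol ?S + en ((2/3)^k)*en (L1*(1/2)^(k*(N - 1)))"
     using j by (intro add_left_mono mult_left_mono) auto
    also have "... = en ((3/2)^k*(om*(1/2)^(k*N)) + (2/3)^k*(L1*(1/2)^(k*(N - 1))))"
     using om L1 by (simp add: mb ennreal_mult)
    also have "... <= en (B*(3/2)^k*(om*(1/2)^(k*N)))"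
    proof (rule ennreal_leI)
     have "(1/2::real)^(k*(N - 1)) = 2^k*(1/2)^(k*N)"
      by (subst (2) N) (simp add: power_add flip: power_mult_distrib)
     then have "(2/3)^k*(L1*(1/2)^(k*(N - 1))) = L1*(1/2)^(k*N)*((2/3)^k*2^k)"
      by simp
     also have "... <= L1*(1/2)^(k*N)*(3/2)^k"
     proof (rule mult_left_mono)
      have "(2/3::real)^k*2^k = (4/3)^k" by (simp flip: power_mult_distrib)
      also have "... <= (3/2)^k" by (intro power_mono) auto
      finally show "(2/3::real)^k*2^k <= (3/2)^k" .
     qed (use L1 in simp)
     finally have *: "(2/3)^k*(L1*(1/2)^(k*(N - 1))) <= L1*(1/2)^(k*N)*(3/2)^k" .
     show "(3/2)^k*(om*(1/2)^(k*N)) + (2/3)^k*(L1*(1/2)^(k*(N - 1))) <= B*(3/2)^k*(om*(1/2)^(k*N))"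
     proof -
      have "B * om = om + L1" using om by (simp add: B_def field_simps)
      then have "B*(3/2)^k*(om*(1/2)^(k*N)) = (om + L1)*((3/2)^k*(1/2)^(k*N))"
       by (metis mult.commute mult.assoc)
      with * show ?thesis by (simp only: distrib_right mult_ac)
     qed
    qed
    also have "... = en (B*(3/2)^k) * vol ?S"
     using B om by (simp add: mb ennreal_mult)
    finally show "(LI x:sc y k (ball 0 1). en (G j x)) <= en (B*(3/2)^k) * vol (sc y k (ball 0 1))"
     by (simp add: sc_ball)
   qed
  qed
  have "\<exists>a. \<forall>k\<ge>max k0 k1. (dev (sc y k (ball 0 1)) w0 a)
   <= en ((2^Suc DIM('a)*B)*(10 + 8*2^DIM('a))*(3/4)^k) * vol (sc y k (ball 0 1))"
  proof (rule trc_exists_limit[OF up _ _ _ _ _ _ _ B fr w0 lim])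
   show "sc y k (ball 0 1) \<subseteq> Q" if "max k0 k1 <= k" for k
    using r(2) k1[of k] that subset_ball[of "hp k" r y] by (auto simp: sc_ball)
  qed (auto simp: emeasure_ball)
  then obtain a where bd: "!!k. k >= max k0 k1 ==> (dev (sc y k (ball 0 1)) w0 a)
   <= en ((2^Suc DIM('a)*B)*(10 + 8*2^DIM('a))*(3/4)^k) * vol (sc y k (ball 0 1))" by blast
  have "aplim w0 y a" by (rule trc_if_bound) (simp, simp add: emeasure_ball, rule bd, assumption)
  then show False using no by blast
 qed
qed

lemma tendsto_0_if_all_le:
 fixes f :: "nat => en"
 assumes "!!e::real. e > 0 ==> eventually (%k. f k <= en e) sq"
 shows "f ----> 0"
proof (rule order_tendstoI)
 fix a :: ennreal assume "0 < a"
 then obtain b where b: "0 < b" "b < a" using dense by blast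
 then have "b < top" using order.strict_trans2 top_greatest by blast
 then have "b = en (enn2real b)" "enn2real b > 0" using b by (auto simp: enn2real_positive_iff)
 with assms[of "enn2real b"] have "eventually (%k. f k <= b) sq" by simp
 then show "eventually (%k. f k < a) sq" by eventually_elim (use b in auto)
qed simp

section \<open>Approximate continuity along a sequence of scales\<close>

lemma emeasure_ball_dyadic:
 "vol (ball (p::'a::euclidean_space) (hp k)) = en (unit_ball_vol (real DIM('a))*hp (k*DIM('a)))"
 by (simp add: emeasure_ball power_mult)

lemma nn_integral_ball_shift:
 fixes F :: "'a::euclidean_space => en"
 assumes [measurable]: "F \<in> BM"
 shows "(LI q:ball p r. F q) = (LI v:ball 0 r. F (p + v))"
proof -
 have "(LI q:ball p r. F q) = (LI v. F (v + p)*chi (ball p r) (v + p))"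
  using nn_integral_translate[of "%q. F q*chi (ball p r) q" p] by simp
 also have "... = (LI v:ball 0 r. F (p + v))"
  by (intro nn_integral_cong) (auto simp: indicator_def dist_norm add.commute)
 finally show ?thesis .
qed

text \<open>Deviation from the pointwise value F p, not from a free constant as in
  \<open>trc\<close>; \<open>AE_trc_eq\<close> ties the two notions together almost
  everywhere.\<close>

definition mean_osc :: "nat => ('a::euclidean_space => real) => 'a => en" where
 "mean_osc k F p = en (2^(k*DIM('a)))*(dev (ball p (hp k)) F (F p))"

lemma mean_osc_shift:
 assumes [measurable]: "F \<in> BM"
 shows "mean_osc k F (p::'a::euclidean_space) = en (2^(k*DIM('a)))*(LI v:ball 0 (hp k). en \<bar>F (p + v) - F p\<bar>)"
 unfolding mean_osc_def by (subst nn_integral_ball_shift) auto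

lemma mean_osc_measurable [measurable]:
 assumes [measurable]: "F \<in> BM"
 shows "mean_osc k F \<in> BM"
proof -
 have "(%p. en (2^(k*DIM('a)))*(LI v:ball 0 (hp k). en \<bar>F (p + v) - F p\<bar>)) \<in> borel_measurable lborel"
  by measurable
 then show ?thesis by (simp add: mean_osc_shift[OF assms, abs_def])
qed

text \<open>Exchanging the integrals leaves \<open>trdiff F v\<close> averaged over vectors v
  shorter than 2^-k.\<close>

lemma mean_osc_tendsto_0:
 fixes F :: "'a::euclidean_space => real"
 assumes F: "integrable lborel F"
 shows "(%k. LI p. mean_osc k F p) ----> 0"
proof -
 have [measurable]: "F \<in> BM" using F by auto
 define om where "om = unit_ball_vol (real DIM('a))"
 have om: "om > 0" by (simp add: om_def)
 show ?thesis
 proof (rule tendsto_0_if_all_le)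
  fix e :: real assume e: "e > 0"
  have "e/om > 0" using e om by simp
  from trdiff_small[OF F this] obtain d where d: "d > 0" "!!v. norm v < d ==> trdiff F v <= en (e/om)" by blast
  have "eventually (%k. hp k < d) sq"
   using d by (intro order_tendstoD(2)[OF LIMSEQ_power_zero]) auto
  then show "eventually (%k. (LI p. mean_osc k F p) <= en e) sq"
  proof eventually_elim
   case (elim k)
   have "(LI p. mean_osc k F p) = en (2^(k*DIM('a)))*(LI p. (LI v:ball 0 (hp k). en \<bar>F (p + v) - F p\<bar>))"
    by (simp add: mean_osc_shift nn_integral_cmult)
   also have "(LI p. (LI v:ball 0 (hp k). en \<bar>F (p + v) - F p\<bar>)) =
    (LI v. LI p. en \<bar>F (p + v) - F p\<bar>*chi (ball 0 (hp k)) v)"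
    by (rule lborel_pair.Fubini') measurable
   also have "... = (LI v:ball 0 (hp k). trdiff F v)"
    by (simp add: trdiff_def nn_integral_multc)
   also have "... <= (\<integral>\<^sup>+v\<in>ball 0 (hp k). en (e/om) \<partial>(lborel :: 'a measure))"
    using elim d by (intro nn_integral_mono) (auto simp: indicator_def)
   also have "... = en (e/om)*en (om*hp (k*DIM('a)))"
    by (simp add: nn_integral_cmult emeasure_ball_dyadic om_def)
   finally have "(LI p. mean_osc k F p) <= en (2^(k*DIM('a)))*(en (e/om)*en (om*hp (k*DIM('a))))"
    by (simp add: mult_left_mono)
   also have "... = en (2^(k*DIM('a))*(e/om*(om*hp (k*DIM('a)))))"
    using e om by (simp flip: ennreal_mult)
   also have "2^(k*DIM('a))*(e/om*(om*hp (k*DIM('a)))) = e"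
    using om by (simp add: power_one_over)
   finally show ?case .
  qed
 qed
qed

text \<open>A form of Lebesgue's differentiation theorem along a subsequence of scales. It suffices
  because convergence at all scales comes from trace estimates.\<close>

lemma AE_mean_osc_subseq:
 fixes F :: "'a::euclidean_space => real"
 assumes F: "integrable lborel F"
 shows "\<exists>s. strict_mono s & (AE p in lborel. (%k. mean_osc (s k) F p) ----> 0)"
proof (rule AE_subseq_if_nn_integral_tendsto_0[OF _ mean_osc_tendsto_0[OF F]])
 have [measurable]: "F \<in> BM" using F by auto
 show "mean_osc k F \<in> borel_measurable lborel" for k by simp
qed

text \<open>A trace takes all scales into account, in particular those along which F is concentrated
  at the value F p.\<close>

lemma AE_trc_eq:
 fixes F :: "'a::euclidean_space => real"
 assumes F: "integrable lborel F"
 shows "AE p in lborel. \<forall>a. aplim F p a --> F p = a"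
proof -
 have [measurable]: "F \<in> BM" using F by auto
 obtain s where s: "strict_mono s" "AE p in lborel. (%k. mean_osc (s k) F p) ----> 0"
  using AE_mean_osc_subseq[OF F] by blast
 from s(2) show ?thesis
 proof eventually_elim
  case (elim p)
  show ?case
  proof (intro allI impI)
   fix a assume t: "aplim F p a"
   define I where "I k = en (2^(k*DIM('a)))*(dev (ball p (hp k)) F a)" for k
   have I: "I ----> 0" using t unfolding trc_def I_def by (simp add: sc_ball)
   define om where "om = unit_ball_vol (real DIM('a))"
   have om: "om > 0" by (simp add: om_def)
   have le: "en \<bar>F p - a\<bar>*en om <= mean_osc k F p + I k" for k
   proof -
    have "en \<bar>F p - a\<bar>*en om = en (2^(k*DIM('a)))*(LI q:ball p (hp k). en \<bar>F p - a\<bar>)"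
    proof -
     have "en (2^(k*DIM('a)))*(LI q:ball p (hp k). en \<bar>F p - a\<bar>)
       = en (2^(k*DIM('a))*(\<bar>F p - a\<bar>*(om*hp (k*DIM('a)))))"
      using om by (simp add: nn_integral_cmult emeasure_ball_dyadic om_def[symmetric] ennreal_mult)
     then show ?thesis using om by (simp add: power_one_over ennreal_mult)
    qed
    also have "... <= en (2^(k*DIM('a)))*(LI q. en \<bar>F q - F p\<bar>*chi (ball p (hp k)) q + en \<bar>F q - a\<bar>*chi (ball p (hp k)) q)"
     by (intro nn_integral_mono mult_left_mono) (auto simp: indicator_def simp flip: ennreal_plus intro!: ennreal_leI)
    also have "... = mean_osc k F p + I k"
     by (simp add: nn_integral_add distrib_left mean_osc_def I_def)
    finally show ?thesis .
   qed
   have "(%k. mean_osc (s k) F p + I (s k)) ----> 0 + 0"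
    using elim LIMSEQ_subseq_LIMSEQ[OF I s(1)] by (intro tendsto_add) (auto simp: o_def)
   then have "en \<bar>F p - a\<bar>*en om <= 0"
    using le by (intro tendsto_lowerbound[of "%k. mean_osc (s k) F p + I (s k)" _ sequentially]) auto
   then show "F p = a" using om by auto
  qed
 qed
qed

section \<open>Almost every point is not a local minimum in measure\<close>

text \<open>Suppose that near each point p of a set S, at all small scales, at most a quarter of the
  ball satisfies H q <= H p. Of two points of S one is below the other in H, so by symmetry the
  nearby pairs in S make up at most half of |S| times the ball volume. But for small radii almost
  all pairs starting in S stay in S, by continuity of translations; hence S is null.\<close>

lemma AE_not_minimum_in_measure:
 fixes H :: "'a::euclidean_space => en"
 assumes H[measurable]: "H \<in> BM"
 shows "AE p in lborel. \<forall>k. \<exists>m\<ge>k. vol (ball p ((1/2)^m)) < 4 * vol {q\<in>ball p ((1/2)^m). H q <= H p}"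
proof -
 define B where "B m = ball (0::'a) ((1/2)^m)" for m :: nat
 have [measurable]: "B m \<in> sets borel" for m by (simp add: B_def)
 have ball_eq: "vol (ball p ((1/2)^m)) = vol (B m)" for p :: 'a and m
  by (simp add: B_def emeasure_ball_dyadic)
 define c where "c m p = (LI v. (if v \<in> B m & H (p + v) <= H p then 1 else 0))" for m and p :: 'a
 have cm[measurable]: "c m \<in> BM" for m
 proof -
  have "(%p. LI v. (if v \<in> B m & H (p + v) <= H p then 1 else 0)) \<in> borel_measurable lborel"
   by measurable
  then show ?thesis by (simp add: c_def[abs_def])
 qed
 have c_eq: "vol {q\<in>ball p ((1/2)^m). H q <= H p} = c m p" for m p
 proof -
  have "vol {q\<in>ball p ((1/2)^m). H q <= H p} = (LI q:ball p ((1/2)^m). chi {q. H q <= H p} q)"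
  proof -
   have "vol {q\<in>ball p ((1/2)^m). H q <= H p} = (LI q. chi {q\<in>ball p ((1/2)^m). H q <= H p} q)"
    by (rule nn_integral_indicator[symmetric]) measurable
   also have "... = (LI q:ball p ((1/2)^m). chi {q. H q <= H p} q)"
    by (intro nn_integral_cong) (auto simp: indicator_def)
   finally show ?thesis .
  qed
  also have "... = c m p"
   unfolding c_def by (subst nn_integral_ball_shift) (auto intro!: nn_integral_cong simp: indicator_def B_def)
  finally show ?thesis .
 qed
 define E where "E k = {p. \<forall>m\<ge>k. 4*c m p <= vol (B m)}" for k
 have [measurable]: "E k \<in> sets borel" for k unfolding E_def by measurable
 have null: "vol (E k \<inter> ball 0 (real R)) = 0" for k R :: nat
 proof -
  define S where "S = E k \<inter> ball 0 (real R)"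
  have [measurable]: "S \<in> sets borel" by (simp add: S_def)
  have finS: "vol S < \<infinity>"
   using emeasure_mono[of S "ball 0 (real R)" lborel] emeasure_lborel_ball_finite[of "0::'a" "real R"] by (auto simp: S_def)
  define s where "s = measure lborel S"
  have s: "vol S = en s" using finS by (simp add: s_def emeasure_eq_ennreal_measure less_top)
  have intS: "integrable lborel (ind S)" using finS by (simp add: integrable_indicator_iff)
  have le2: "s <= 2*e" if e: "e > 0" for e
  proof -
   obtain d where d: "d > 0" "!!v. norm v < d ==> trdiff (ind S) v <= en e"
    using trdiff_small[OF intS e] by blast
   have "eventually (%m. (1/2::real)^m < d & m >= k) sq"
    using d by (intro eventually_conj eventually_ge_at_top order_tendstoD(2)[OF LIMSEQ_power_zero]) auto
   from eventually_happens'[OF sequentially_bot this] obtain m where m: "(1/2::real)^m < d" "m >= k" by blast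
   define b where "b = unit_ball_vol (real DIM('a))*(1/2)^(m*DIM('a))"
   have b: "b > 0" "vol (B m) = en b" unfolding b_def B_def by (auto simp: emeasure_ball_dyadic)
   define i :: "'a => en" where "i = chi S"
   have [measurable]: "i \<in> BM" by (simp add: i_def)
   have i1: "i x <= 1" for x by (simp add: i_def indicator_def)
   \<comment> \<open>\<open>I\<close> counts the pairs that stay in S and \<open>J\<close> those
     that leave it; \<open>J\<close> is small by the choice of m.\<close>
   define I where "I = (LI p. LI v. i p * i (p + v)*chi (B m) v)"
   define J where "J = (LI p. LI v. i p*(1 - i (p + v))*chi (B m) v)"
   have "en b*en s = (LI p. LI v. i p*chi (B m) v)"
    by (simp add: nn_integral_cmult nn_integral_multc b i_def s mult.commute)
   also have "... = (LI p. LI v. i p * i (p + v)*chi (B m) v + i p*(1 - i (p + v))*chi (B m) v)"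
    by (intro nn_integral_cong) (auto simp: i_def indicator_def)
   also have "... = I + J" by (simp add: nn_integral_add I_def J_def)
   finally have bs: "en b*en s = I + J" .
   have "J = (LI v. LI p. i p*(1 - i (p + v))*chi (B m) v)"
    unfolding J_def by (rule lborel_pair.Fubini') measurable
   also have "... <= (LI v. en e*chi (B m) v)"
   proof (rule nn_integral_mono)
    fix v :: 'a
    have "(LI p. i p*(1 - i (p + v))*chi (B m) v) = (LI p. i p*(1 - i (p + v)))*chi (B m) v"
     by (rule nn_integral_multc) measurable
    also have "... <= trdiff (ind S) v * chi (B m) v"
     unfolding trdiff_def by (intro mult_right_mono nn_integral_mono) (auto simp: i_def indicator_def)
    also have "... <= en e*chi (B m) v"
     using d(2)[of v] m by (auto simp: B_def indicator_def)
    finally show "(LI p. i p*(1 - i (p + v))*chi (B m) v) <= en e*chi (B m) v" .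
   qed
   also have "... = en (e * b)" using b e by (simp add: nn_integral_cmult ennreal_mult)
   finally have J: "J <= en (e * b)" .
   define l :: "'a => 'a => en" where "l p q = chi {(p, q). H q <= H p} (p, q)" for p q
   have [measurable]: "(%(p, q). l p q) \<in> borel_measurable (borel \<Otimes>\<^sub>M borel)"
    unfolding l_def by (simp add: case_prod_beta') 
   have [measurable (raw)]: "(%x. l (f x) (g x)) \<in> borel_measurable M" if "f \<in> M \<rightarrow>\<^sub>M borel" "g \<in> M \<rightarrow>\<^sub>M borel" for f g and M :: "'z measure"
    using that unfolding l_def by measurable
   \<comment> \<open>The two orderings of a pair are exchanged by (p, v) -> (p + v, -v), under which
     the ball is symmetric.\<close>
   have I_half: "(LI p. LI v. i p * i (p + v) * l (p + v) p*chi (B m) v)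
    = (LI p. LI v. i p * i (p + v) * l p (p + v)*chi (B m) v)" (is "?L = ?R")
   proof -
    have "?L = (LI v. LI p. i p * i (p + v) * l (p + v) p*chi (B m) v)"
     by (rule lborel_pair.Fubini') measurable
    also have "... = (LI v. LI p. i (p + - v) * i p * l p (p + - v)*chi (B m) v)"
    proof (rule nn_integral_cong)
     fix v
     show "(LI p. i p * i (p + v) * l (p + v) p*chi (B m) v) = (LI p. i (p + - v) * i p * l p (p + - v)*chi (B m) v)"
      using nn_integral_translate[of "%p. i p * i (p + v) * l (p + v) p*chi (B m) v" "- v"] by simp
    qed
    also have "... = (LI v. LI p. i (p + v) * i p * l p (p + v)*chi (B m) v)"
     using nn_integral_affine[of "%v. LI p. i (p + - v) * i p * l p (p + - v)*chi (B m) v" "-1" 0]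
     by (simp add: B_def indicator_def cong: if_cong)
    also have "... = (LI p. LI v. i (p + v) * i p * l p (p + v)*chi (B m) v)"
     by (rule lborel_pair.Fubini') measurable
    finally show ?thesis by (simp add: mult_ac)
   qed
   have "I <= (LI p. LI v. i p * i (p + v) * l p (p + v)*chi (B m) v + i p * i (p + v) * l (p + v) p*chi (B m) v)"
    unfolding I_def by (intro nn_integral_mono) (auto simp: i_def l_def indicator_def)
   also have "... = 2*(LI p. LI v. i p * i (p + v) * l p (p + v)*chi (B m) v)"
    by (simp add: nn_integral_add I_half mult_2)
   also have "... <= 2*(LI p. i p*c m p)"
   proof (intro mult_left_mono nn_integral_mono)
    fix p
    have "(LI v. i p * i (p + v) * l p (p + v)*chi (B m) v) <= (LI v. i p*(if v \<in> B m & H (p + v) <= H p then 1 else 0))"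
     by (intro nn_integral_mono) (auto simp: i_def l_def indicator_def)
    also have "... = i p*c m p" unfolding c_def by (rule nn_integral_cmult) measurable
    finally show "(LI v. i p * i (p + v) * l p (p + v)*chi (B m) v) <= i p*c m p" .
   qed simp
   finally have "2*I <= 2*(2*(LI p. i p*c m p))" by (rule mult_left_mono) simp
   also have "... = (LI p. i p*(4*c m p))"
   proof -
    have "(LI p. i p*(4*c m p)) = (LI p. 4*(i p*c m p))" by (simp add: mult_ac)
    also have "... = 4*(LI p. i p*c m p)" by (rule nn_integral_cmult) measurable
    finally show ?thesis by (simp add: mult.assoc[symmetric])
   qed
   also have "... <= (LI p. i p*en b)"
    using m(2) b by (intro nn_integral_mono) (auto simp: i_def indicator_def S_def E_def)
   also have "... = en b*en s" by (subst nn_integral_multc) (auto simp: i_def s mult.commute)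
   finally have "2*I <= en b*en s" .
   then have "2*(I + J) <= en b*en s + 2*en (e * b)"
    unfolding distrib_left using J by (intro add_mono mult_left_mono) auto
   then have "en (2*(b * s)) <= en (b * s + 2*(e * b))"
    unfolding bs[symmetric] using b e by (simp add: ennreal_mult s_def)
   then have "2*(b * s) <= b * s + 2*(e * b)" using b e by (subst (asm) ennreal_le_iff) (auto simp: s_def)
   then have "b * s <= b*(2*e)" by (simp add: mult_ac)
   then show ?thesis using b by simp
  qed
  have "s <= 0 + e" if "e > 0" for e using le2[of "e/2"] that by simp
  then have "s <= 0" by (rule field_le_epsilon)
  then show ?thesis unfolding S_def[symmetric] s by (simp add: ennreal_neg)
 qed
 have "AE p in lborel. \<forall>k. p \<notin> E k"
  unfolding AE_all_countable
 proof
  fix k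
  have "E k = (\<Union>R::nat. E k \<inter> ball 0 (real R))" 
  proof -
   have "\<exists>R::nat. x \<in> ball 0 (real R)" for x :: 'a using reals_Archimedean2[of "norm x"] by simp
   then show ?thesis by blast
  qed
  moreover have "(\<Union>R::nat. E k \<inter> ball 0 (real R)) \<in> null_sets lborel"
   using null by (intro null_sets_UN) (auto simp: null_sets_def)
  ultimately show "AE p in lborel. p \<notin> E k" by (metis AE_not_in)
 qed
 then show ?thesis
 proof eventually_elim
  case (elim p)
  then show ?case unfolding E_def c_eq ball_eq by (auto simp: not_le)
 qed
qed

section \<open>Sets of full density along lines\<close>

text \<open>At every radius 2r among the scales from k on, the defect is at most a quarter of the
  ball of radius r: the factor \<open>2^DIM('a)\<close> compares the two balls, the factor 4 matches
  \<open>AE_not_minimum_in_measure\<close>. Fixing k and using a weak inequality makes the condition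
  closed in p.\<close>

definition fat :: "'a::euclidean_space set => nat => 'a => bool" where
 "fat A k p \<longleftrightarrow> (\<forall>m\<ge>k. 4*(2^DIM('a) * vol (ball p ((1/2)^m) - A)) <= vol (ball p ((1/2)^m)))"

text \<open>Let H be the essential supremum of the heights below \<open>be\<close> at which a line
  meets A. On a line with a gap above a fat point it is at most the height of that point, whereas
  fatness makes most neighbouring lines meet A slightly higher. So p would be a minimum of H in
  measure. Rational \<open>al\<close> and \<open>be\<close> leave only countably many functions
  H.\<close>

lemma AE_not_fat_cut:
 fixes A :: "'a::euclidean_space set"
 assumes A[measurable]: "A \<in> sets borel" and h: "norm h = 1"
 shows "AE p in lborel. ~ (\<exists>ta et k. et > 0 & fat A k (p + ta *R h) &
   (LI si:{ta<..<ta + et}. chi A (p + si *R h)) = 0)"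
proof -
 have hh: "h \<bullet> h = 1" using h by (simp add: dot_square_norm)
 \<comment> \<open>The foot of the line through q, so that functions of \<open>base q\<close> are
   constant along lines; heights are inner products with h.\<close>
 define base where "base q = q - (q \<bullet> h) *R h" for q
 have base_inv: "base (q + si *R h) = base q" for q si
  by (simp add: base_def inner_add_left hh algebra_simps)
 have [measurable]: "base \<in> BM" unfolding base_def by measurable
 define F where "F be q s = (LI si. (if s < si & si < be then chi A (base q + si *R h) else 0))" for be s :: real and q
 have F_inv: "F be (q + si *R h) s = F be q s" for be q si s unfolding F_def base_inv ..
 have F_meas: "(%(q, s). F be q s) \<in> borel_measurable (borel \<Otimes>\<^sub>M borel)" for be
 proof -
  have "(%x. LI si. (if snd x < si & si < be then chi A (base (fst x) + si *R h) else 0)) \<in> borel_measurable (borel \<Otimes>\<^sub>M borel)"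
   by measurable
  then show ?thesis by (simp add: F_def case_prod_beta')
 qed
 have F_meas'[measurable (raw)]: "(%x. F be (f x) (g x)) \<in> borel_measurable M"
  if "f \<in> M \<rightarrow>\<^sub>M borel" "g \<in> M \<rightarrow>\<^sub>M borel" for be f g and M :: "'z measure"
  using measurable_compose[OF measurable_Pair[OF that] F_meas[of be]] by simp
 have F_mono: "F be q s <= F be q s'" if "s' <= s" for be q s s'
  unfolding F_def using that by (intro nn_integral_mono) auto
 have F_shift: "F be q s = (LI ta. (if s < ta + q \<bullet> h & ta + q \<bullet> h < be then chi A (q + ta *R h) else 0))" for be q s
 proof -
  have "F be q s = (LI ta. (if s < ta + q \<bullet> h & ta + q \<bullet> h < be then chi A (base q + (ta + q \<bullet> h) *R h) else 0))"
   unfolding F_def by (subst nn_integral_translate[of _ "q \<bullet> h", symmetric]) auto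
  moreover have eq: "base q + (ta + q \<bullet> h) *R h = q + ta *R h" for ta by (simp add: base_def algebra_simps)
  ultimately show ?thesis unfolding eq by simp
 qed
 \<comment> \<open>\<open>F\<close> measures A on the line between the heights s and
   \<open>be\<close> and decreases in s. Hence this is the essential supremum of the heights of A
   below \<open>be\<close>, counted from \<open>al\<close> and cut off at 0.\<close>
 define H where "H al be q = (LI s. (if al < s & s < be & F be q s \<noteq> 0 then 1 else 0))" for al be :: real and q
 have [measurable]: "H al be \<in> BM" for al be
 proof -
  have "(%q. LI s. (if al < s & s < be & F be q s \<noteq> 0 then 1 else 0)) \<in> BM"
   by measurable
  then show ?thesis by (simp add: H_def[abs_def])
 qed
 have H_inv: "H al be (q + si *R h) = H al be q" for al be q si by (simp add: H_def F_inv)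
 \<comment> \<open>Points of A lying in a stretch of their line that carries no length of A:
   exceptional, and null because each line meets them in length 0.\<close>
 define N where "N s be = {q\<in>A. s < q \<bullet> h & q \<bullet> h < be & F be q s = 0}" for s be
 have [measurable]: "N s be \<in> sets borel" for s be unfolding N_def by measurable
 have N_null: "N s be \<in> null_sets lborel" for s be
 proof (rule null_if_null_along_lines[where h=h])
  fix q
  show "(LI ta. chi (N s be) (q + ta *R h)) = 0"
  proof (cases "F be q s = 0")
   case True
   have "(LI ta. chi (N s be) (q + ta *R h)) <= F be q s"
    unfolding F_shift by (intro nn_integral_mono) (auto simp: N_def indicator_def inner_add_left hh add.commute)
   then show ?thesis using True by simp
  next
   case False
   then have "(LI ta. chi (N s be) (q + ta *R h)) = (LI (ta::real). 0)"
    by (intro nn_integral_cong) (auto simp: N_def F_inv)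
   then show ?thesis by simp
  qed
 qed simp
 define NN where "NN = (\<Union>s\<in>\<rat>. \<Union>be\<in>\<rat>. N s be)"
 have NN: "NN \<in> null_sets lborel"
  unfolding NN_def by (intro null_sets_UN' N_null countable_rat)
 then have [measurable]: "NN \<in> sets borel" by auto
 have "AE p in lborel. \<forall>al\<in>\<rat>. \<forall>be\<in>\<rat>. \<forall>k. \<exists>m\<ge>k. vol (ball p ((1/2)^m)) < 4 * vol {q\<in>ball p ((1/2)^m). H al be q <= H al be p}"
  by (intro AE_ball_countable' countable_rat AE_not_minimum_in_measure) simp
 then show ?thesis
 proof eventually_elim
  case (elim p)
  show ?case
  proof
   assume "\<exists>ta et k. et > 0 & fat A k (p + ta *R h) & (LI si:{ta<..<ta + et}. chi A (p + si *R h)) = 0"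
   then obtain ta et k where et: "et > 0" and fat: "fat A k (p + ta *R h)"
    and nul: "(LI si:{ta<..<ta + et}. chi A (p + si *R h)) = 0" by blast
   define hz where "hz = p \<bullet> h + ta"
   obtain al where al: "al \<in> \<rat>" "al < hz" using Rats_dense_in_real[of "hz - 1" hz] by auto
   obtain be where be: "be \<in> \<rat>" "hz < be" "be < hz + et" using Rats_dense_in_real[of hz "hz + et"] et by auto
   have F0: "F be p hz = 0"
   proof -
    have "F be p hz <= (LI si:{ta<..<ta + et}. chi A (p + si *R h))"
     unfolding F_shift using be by (intro nn_integral_mono) (auto simp: hz_def indicator_def)
    then show ?thesis using nul by simp
   qed
   have Hp: "H al be p <= en (hz - al)"
   proof -
    have "F be p s = 0" if "hz <= s" for s using F_mono[OF that, of be p] F0 by simp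
    then have "H al be p <= (LI s. chi {al..hz} s)"
     unfolding H_def by (intro nn_integral_mono) (auto simp: indicator_def not_le intro!: less_imp_le)
    then show ?thesis using al by simp
   qed
   have Hq: "H al be p < H al be q" if q: "q \<in> A" "q \<notin> NN" "hz < q \<bullet> h" "q \<bullet> h < be" for q
   proof -
    have nz: "F be q s \<noteq> 0" if s: "s < q \<bullet> h" for s
    proof -
     obtain s' where s': "s' \<in> \<rat>" "s < s'" "s' < q \<bullet> h" using Rats_dense_in_real[OF s] by auto
     then have "F be q s' \<noteq> 0" using q be(1) unfolding NN_def N_def by blast
     then show ?thesis using F_mono[of s s' be q] s' by auto
    qed
    have "en (hz - al) < en (q \<bullet> h - al)" using q al by (intro ennreal_lessI) auto
    also have "... = (LI s. chi {al<..<q \<bullet> h} s)" using q al by simp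
    also have "... <= H al be q" unfolding H_def using nz q
     by (intro nn_integral_mono) (auto simp: indicator_def)
    finally show ?thesis using Hp by (rule le_less_trans[rotated])
   qed
   obtain k1 where k1: "(1/2::real)^k1 < (be - hz)/2"
    using real_arch_pow_inv[of "(be - hz)/2" "1/2"] be by auto
   obtain m where m: "m >= max k1 (Suc k)"
     "vol (ball p ((1/2)^m)) < 4 * vol {q\<in>ball p ((1/2)^m). H al be q <= H al be p}"
    using elim al(1) be(1) by blast
   obtain m' where m': "m = Suc m'" "m' >= k" using m(1) by (cases m) auto
   define r where "r = (1/2::real)^m"
   have r: "r > 0" "2*r < be - hz" "(1/2)^m' = 2*r"
   proof -
    have "r <= (1/2)^k1" unfolding r_def using m(1) by (intro power_decreasing) auto
    then show "2*r < be - hz" using k1 by simp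
   qed (auto simp: r_def m')
   define z where "z = p + ta *R h"
   have "vol {q\<in>ball p r. H al be q <= H al be p} = (LI q. chi {q\<in>ball p r. H al be q <= H al be p} q)"
    by (rule nn_integral_indicator[symmetric]) measurable
   \<comment> \<open>The shift by \<open>ta + r\<close> takes the ball about p into the part of
     \<open>ball z (2*r)\<close> above the height \<open>hz\<close>, where every point of A outside
     \<open>NN\<close> has a larger value of H than p.\<close>
   also have "... <= (LI q. chi ((ball z (2*r) - A) \<union> NN) (q + (ta + r) *R h))"
   proof (rule nn_integral_mono)
    fix q
    show "chi {q\<in>ball p r. H al be q <= H al be p} q <= (chi ((ball z (2*r) - A) \<union> NN) (q + (ta + r) *R h) :: en)"
    proof (cases "q \<in> ball p r & H al be q <= H al be p")
     case True
     define q' where "q' = q + (ta + r) *R h"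
     have "z - q' = (p - q) + (- r) *R h" by (simp add: z_def q'_def algebra_simps)
     then have "norm (z - q') <= norm (p - q) + norm ((- r) *R h)" by (simp only: norm_triangle_ineq)
     then have d: "q' \<in> ball z (2*r)" using True h r by (simp add: dist_norm)
     have "\<bar>(q - p) \<bullet> h\<bar> <= norm (q - p)*norm h" by (rule Cauchy_Schwarz_ineq2)
     then have qp: "\<bar>q \<bullet> h - p \<bullet> h\<bar> < r" using True h by (simp add: inner_diff_left dist_norm norm_minus_commute)
     have "q' \<bullet> h = q \<bullet> h + ta + r" by (simp add: q'_def inner_add_left hh)
     then have "hz < q' \<bullet> h" "q' \<bullet> h < be" using qp r by (auto simp: hz_def)
     moreover have "~ H al be p < H al be q'" using True by (simp add: q'_def H_inv not_less)
     ultimately have "q' \<in> NN \<or> q' \<notin> A" using Hq[of q'] by blast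
     then show ?thesis using d by (auto simp: q'_def[symmetric] indicator_def)
    qed (auto simp: indicator_def)
   qed
   also have "... = (LI q. chi ((ball z (2*r) - A) \<union> NN) q)"
    by (rule nn_integral_translate) measurable
   also have "... = vol ((ball z (2*r) - A) \<union> NN)" by simp
   also have "... = vol (ball z (2*r) - A)" using NN by (intro emeasure_Un_null_set) auto
   finally have le: "vol {q\<in>ball p r. H al be q <= H al be p} <= vol (ball z (2*r) - A)" .
   have "4*(2^DIM('a) * vol (ball z (2*r) - A)) <= vol (ball z (2*r))"
    using fat m'(2) unfolding fat_def z_def[symmetric] r(3)[symmetric] by blast
   also have "... = en (2^DIM('a)) * vol (ball p r)"
    using r by (simp add: emeasure_ball power_mult_distrib mult_ac flip: ennreal_mult)
   finally have "en (2^DIM('a))*(4 * vol (ball z (2*r) - A)) <= en (2^DIM('a)) * vol (ball p r)"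
    by (simp add: mult_ac flip: ennreal_power)
   then have "4 * vol (ball z (2*r) - A) <= vol (ball p r)"
    by (subst (asm) ennreal_mult_le_mult_iff) auto
   with mult_left_mono[OF le, of 4] have "4 * vol {q\<in>ball p r. H al be q <= H al be p} <= vol (ball p r)"
    by (simp add: order_trans)
   then show False using m(2) by (simp add: r_def[symmetric])
  qed
 qed
qed

lemma AE_not_fat_cut_left:
 fixes A :: "'a::euclidean_space set"
 assumes A[measurable]: "A \<in> sets borel" and h: "norm h = 1"
 shows "AE p in lborel. ~ (\<exists>ta et k. et > 0 & fat A k (p + ta *R h) &
   (LI si:{ta - et<..<ta}. chi A (p + si *R h)) = 0)"
proof -
 have "norm (- h) = 1" using h by simp
 from AE_not_fat_cut[OF A this] show ?thesis
 proof eventually_elim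
  case (elim p)
  show ?case
  proof
   assume "\<exists>ta et k. et > 0 & fat A k (p + ta *R h) & (LI si:{ta - et<..<ta}. chi A (p + si *R h)) = 0"
   then obtain ta et k where *: "et > 0" "fat A k (p + ta *R h)" "(LI si:{ta - et<..<ta}. chi A (p + si *R h)) = 0" by blast
   have "(LI si:{-ta<..<-ta + et}. chi A (p + si *R (- h))) = (LI si. chi A (p + (-si) *R (- h))*chi {-ta<..<-ta + et} (- si))"
    using nn_integral_real_affine[of "%si. chi A (p + si *R (- h))*chi {-ta<..<-ta + et} si" "-1" 0] by simp
   also have "... = (LI si:{ta - et<..<ta}. chi A (p + si *R h))"
    by (intro nn_integral_cong) (auto simp: indicator_def)
   finally have "(LI si:{-ta<..<-ta + et}. chi A (p + si *R (- h))) = 0" using * by simp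
   then show False using elim * by (metis scaleR_minus_left scaleR_minus_right minus_minus)
  qed
 qed
qed

section \<open>A Baire argument on an interval\<close>

text \<open>Starting from s, take a nearby point e of E and the frontier point z between them that
  is closest to e. The open stretch from z to e meets no frontier point, hence by connectedness it
  lies in E.\<close>

lemma frontier_gap_aux:
 fixes D E :: "real set"
 assumes cov: "{a..b} \<subseteq> D \<union> E" "D \<inter> E = {}" "D \<subseteq> {a..b}" "E \<subseteq> {a..b}"
  and s: "s \<in> closure E" "s \<in> D" and d: "d > 0" and S: "!!x. dist s x < d ==> x \<in> closure D ==> x \<in> closure E ==> x \<in> S & x \<in> D"
 shows "\<exists>ta et. et > 0 & ta \<in> S & ta \<in> {a..b} & ({ta<..<ta + et} \<subseteq> E \<or> {ta - et<..<ta} \<subseteq> E)"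
proof -
 let ?F = "closure D \<inter> closure E"
 have clI: "closure D \<subseteq> {a..b}" using cov(3) by (simp add: closure_minimal)
 obtain e where e: "e \<in> E" "dist e s < d" using s(1) d by (auto simp: closure_approachable)
 have es: "e \<noteq> s" using e s cov by auto
 have eF: "x \<notin> ?F" if "x \<in> E" "dist s x < d" for x using S[of x] that cov by auto
 have sF: "s \<in> ?F" using s closure_subset by auto
 have conn: "J \<subseteq> E" if J: "connected J" "J \<subseteq> {a..b}" "e \<in> J" "J \<inter> ?F = {}" for J
 proof (rule ccontr)
  assume "~ J \<subseteq> E"
  then obtain x where "x \<in> J" "x \<in> D" using J cov by auto
  moreover have "closure D \<inter> J = {} \<or> closure E \<inter> J = {}"
   by (rule connected_closedD) (use J cov closure_subset[of D] closure_subset[of E] in auto)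
  ultimately show False using J e(1) closure_subset[of D] closure_subset[of E] by blast
 qed
 have eI: "e \<in> {a..b}" "s \<in> {a..b}" using e s cov by auto
 consider "s < e" | "e < s" using es by linarith
 then show ?thesis
 proof cases
  case 1
  have "compact ({s..e} \<inter> ?F)" by (intro compact_Int_closed compact_Icc closed_Int closed_closure)
  moreover have "{s..e} \<inter> ?F \<noteq> {}" using sF 1 by (intro ex_in_conv[THEN iffD1] exI[of _ s]) auto
  ultimately obtain z where "z \<in> {s..e} \<inter> ?F" "\<forall>y\<in>{s..e} \<inter> ?F. y <= z"
   using compact_attains_sup[of "{s..e} \<inter> ?F"] by blast
  then have z: "z \<in> ?F" "s <= z" "z <= e" "!!y. y \<in> ?F ==> s <= y ==> y <= e ==> y <= z"
   by auto
  have "z \<noteq> e" using eF[of e] e z by (auto simp: dist_commute)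
  then have ze: "z < e" using z by simp
  have "dist s z < d" using z e 1 by (auto simp: dist_real_def)
  then have "z \<in> S" using S z by auto
  moreover have "{z<..e} \<subseteq> E"
  proof (rule conn)
   show "{z<..e} \<inter> ?F = {}" using z(2,4) by force
  qed (use z ze eI in auto)
  ultimately show ?thesis using ze z eI by - (rule exI[of _ z], rule exI[of _ "e - z"], auto)
 next
  case 2
  have "compact ({e..s} \<inter> ?F)" by (intro compact_Int_closed compact_Icc closed_Int closed_closure)
  moreover have "{e..s} \<inter> ?F \<noteq> {}" using sF 2 by (intro ex_in_conv[THEN iffD1] exI[of _ s]) auto
  ultimately obtain z where "z \<in> {e..s} \<inter> ?F" "\<forall>y\<in>{e..s} \<inter> ?F. z <= y"
   using compact_attains_inf[of "{e..s} \<inter> ?F"] by blast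
  then have z: "z \<in> ?F" "e <= z" "z <= s" "!!y. y \<in> ?F ==> e <= y ==> y <= s ==> z <= y"
   by auto
  have "z \<noteq> e" using eF[of e] e z by (auto simp: dist_commute)
  then have ze: "e < z" using z by simp
  have "dist s z < d" using z e 2 by (auto simp: dist_real_def)
  then have "z \<in> S" using S z by auto
  moreover have "{e..<z} \<subseteq> E"
  proof (rule conn)
   show "{e..<z} \<inter> ?F = {}" using z(3,4) by force
  qed (use z ze eI in auto)
  then have "{z - (z - e)<..<z} \<subseteq> E" by auto
  ultimately have "0 < z - e & z \<in> S & z \<in> {a..b} & ({z<..<z + (z - e)} \<subseteq> E \<or> {z - (z - e)<..<z} \<subseteq> E)"
   using ze z eI by auto
  then show ?thesis by blast
 qed
qed

text \<open>The common frontier of D and E is nonempty because the interval is connected, and it is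
  compact. It is covered by the closed sets \<open>S k\<close> and \<open>T k\<close>, so by Baire
  one of them contains a relatively open piece of it, at which \<open>frontier_gap_aux\<close>
  applies.\<close>

lemma frontier_gap:
 fixes D E :: "real set"
 assumes cov: "{a..b} \<subseteq> D \<union> E" "D \<inter> E = {}" "D \<subseteq> {a..b}" "E \<subseteq> {a..b}" and ne: "D \<noteq> {}" "E \<noteq> {}"
  and S: "!!k::nat. closed (S k)" "!!k. closed (T k)" "D \<subseteq> (\<Union>k. S k)" "E \<subseteq> (\<Union>k. T k)" "!!k. S k \<inter> {a..b} \<subseteq> D" "!!k. T k \<inter> {a..b} \<subseteq> E"
 shows "\<exists>ta et k. et > 0 & ta \<in> {a..b} & (ta \<in> S k & ({ta<..<ta + et} \<subseteq> E \<or> {ta - et<..<ta} \<subseteq> E) \<or>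
   ta \<in> T k & ({ta<..<ta + et} \<subseteq> D \<or> {ta - et<..<ta} \<subseteq> D))"
proof -
 let ?F = "closure D \<inter> closure E"
 have FI: "?F \<subseteq> {a..b}" using closure_minimal[of D "{a..b}"] cov by auto
 have "?F \<noteq> {}"
 proof
  assume F: "?F = {}"
  have "closure D \<inter> {a..b} = {} \<or> closure E \<inter> {a..b} = {}"
   by (rule connected_closedD) (use F cov closure_subset[of D] closure_subset[of E] in auto)
  then show False using cov ne closure_subset[of D] closure_subset[of E] by blast
 qed
 define P where "P n = (if even n then S (n div 2) else T (n div 2))" for n
 have P_closed: "closed (P n)" for n using S by (auto simp: P_def)
 have FP: "?F \<subseteq> (\<Union>n. P n)"
 proof
  fix x assume "x \<in> ?F"
  then consider k where "x \<in> S k" | k where "x \<in> T k" using FI cov(1) S(3,4) by blast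
  then show "x \<in> (\<Union>n. P n)"
  proof cases
   case 1 then show ?thesis by (intro UN_I[of "2 * k"]) (auto simp: P_def)
  next
   case 2 then show ?thesis by (intro UN_I[of "2 * k + 1"]) (auto simp: P_def)
  qed
 qed
 \<comment> \<open>Otherwise all complements of the \<open>P n\<close> would be open and dense in
   the frontier, with empty intersection.\<close>
 have "\<exists>n. ~ ?F \<subseteq> closure (?F - P n)"
 proof (rule ccontr)
  assume "~ ?thesis"
  then have dense: "?F \<subseteq> closure (?F - P n)" for n by blast
  have F: "?F \<subseteq> closure (\<Inter>(range (%n. ?F - P n)))"
  proof (rule Baire)
   show "openin (top_of_set ?F) U & ?F \<subseteq> closure U" if "U \<in> range (%n. ?F - P n)" for U
   proof -
    from that obtain n where U: "U = ?F - P n" by blast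
    then have "U = ?F \<inter> - P n" by blast
    then show ?thesis using U dense[of n] P_closed[of n] by (metis open_Compl openin_open_Int)
   qed
  qed auto
  have "\<Inter>(range (%n. ?F - P n)) = {}" using FP by auto
  from F[unfolded this] show False using \<open>?F \<noteq> {}\<close> by simp
 qed
 then obtain n s where s: "s \<in> ?F" "s \<notin> closure (?F - P n)" by blast
 then obtain d where d: "d > 0" "!!x. x \<in> ?F ==> dist x s < d ==> x \<in> P n"
  unfolding closure_approachable by (meson DiffI)
 have sI: "s \<in> {a..b}" and sP: "s \<in> P n" using s FI d by auto
 show ?thesis
 proof (cases "even n")
  case True
  have "\<exists>ta et. et > 0 & ta \<in> S (n div 2) & ta \<in> {a..b} & ({ta<..<ta + et} \<subseteq> E \<or> {ta - et<..<ta} \<subseteq> E)"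
  proof (rule frontier_gap_aux[OF cov, of s d])
   show "s \<in> closure E" "s \<in> D" "d > 0" using s sP sI S(5)[of "n div 2"] d True by (auto simp: P_def)
   fix x assume "dist s x < d" "x \<in> closure D" "x \<in> closure E"
   then have "x \<in> P n" "x \<in> {a..b}" using d FI by (auto simp: dist_commute)
   then show "x \<in> S (n div 2) & x \<in> D" using S(5)[of "n div 2"] True by (auto simp: P_def)
  qed
  then show ?thesis by blast
 next
  case False
  have "\<exists>ta et. et > 0 & ta \<in> T (n div 2) & ta \<in> {a..b} & ({ta<..<ta + et} \<subseteq> D \<or> {ta - et<..<ta} \<subseteq> D)"
  proof (rule frontier_gap_aux[of a b E D s d])
   show "s \<in> closure D" "s \<in> E" "d > 0" using s sP sI S(6)[of "n div 2"] d False by (auto simp: P_def)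
   fix x assume "dist s x < d" "x \<in> closure E" "x \<in> closure D"
   then have "x \<in> P n" "x \<in> {a..b}" using d FI by (auto simp: dist_commute)
   then show "x \<in> T (n div 2) & x \<in> E" using S(6)[of "n div 2"] False by (auto simp: P_def)
  qed (use cov in auto)
  then show ?thesis by blast
 qed
qed

section \<open>Restricting a function with gradient to a set of full density on its support\<close>

text \<open>\<open>upgrad\<close> excludes a null set of base points for each single h, while here
  all pairs of times on a line are needed at once. The inequality is averaged over shifts of the
  segment by small v: the ends converge to the traces, and the gradient term converges because its
  mean oscillation tends to 0 in L^1 of almost every line, along a subsequence of scales.\<close>

lemma AE_precise_along_line:
 fixes f G :: "'a::euclidean_space => real"
 assumes Q: "open Q" and up: "upgrad Q f G" and G: "integrable lborel G" and e: "norm e = 1"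
 shows "AE p in lborel. \<forall>s t a b. s <= t --> (\<forall>ta\<in>{s..t}. p + ta *R e \<in> Q) -->
   aplim f (p + s *R e) a --> aplim f (p + t *R e) b -->
   en \<bar>a - b\<bar> <= (LI si:{s..t}. en (G (p + si *R e)))"
proof -
 have [measurable]: "f \<in> BM" "G \<in> BM" using up by (auto simp: upgrad_def)
 define om where "om = unit_ball_vol (real DIM('a))"
 have om: "om > 0" by (simp add: om_def)
 \<comment> \<open>The mean oscillation of G integrated over the stretch [-n, n] of the line. It
   bounds the cost of replacing G on shifted segments by G on the line, for all s and t in [-n, n]
   simultaneously.\<close>
 define D where "D n k p = (LI si. mean_osc k G (p + si *R e)*chi {- real n..real n} si)" for n k p
 have Dm[measurable]: "D n k \<in> BM" for n k
 proof -
  have "(%p. LI si. mean_osc k G (p + si *R e)*chi {- real n..real n} si) \<in> BM"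
   by measurable
  then show ?thesis by (simp add: D_def[abs_def])
 qed
 have "\<exists>r. strict_mono r & (AE p in lborel. (%k. D n (r k) p) ----> 0)" for n
 proof (rule AE_subseq_if_nn_integral_tendsto_0)
  show "D n k \<in> borel_measurable lborel" for k by simp
  have "(LI p. D n k p) = en (2*real n)*(LI p. mean_osc k G p)" for k
  proof -
   have "(LI p. D n k p) = (LI si. LI p. mean_osc k G (p + si *R e)*chi {- real n..real n} si)"
    unfolding D_def by (rule lborel_pair.Fubini') measurable
   also have "... = (LI si. (LI p. mean_osc k G p)*chi {- real n..real n} si)"
    by (simp add: nn_integral_multc nn_integral_translate)
   finally show ?thesis by (simp add: nn_integral_cmult mult.commute)
  qed
  moreover have "(%k. en (2*real n)*(LI p. mean_osc k G p)) ----> en (2*real n)*0"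
   by (intro ennreal_tendsto_cmult mean_osc_tendsto_0 G) auto
  ultimately show "(%k. LI p. D n k p) ----> 0" by simp
 qed
 then have "AE p in lborel. \<forall>n. \<exists>r. strict_mono r & (%k. D n (r k) p) ----> 0"
  unfolding AE_all_countable by (blast intro: eventually_mono)
 then show ?thesis
 proof eventually_elim
  case (elim p)
  show ?case
  proof (intro allI impI)
   fix s t a b :: real
   assume st: "s <= t" and seg: "\<forall>ta\<in>{s..t}. p + ta *R e \<in> Q"
    and a: "aplim f (p + s *R e) a" and b: "aplim f (p + t *R e) b"
   define ps pt where "ps = p + s *R e" and "pt = p + t *R e"
   define IG where "IG = (LI si:{s..t}. en (G (p + si *R e)))"
   obtain n :: nat where n: "max \<bar>s\<bar> \<bar>t\<bar> <= real n" using real_arch_simple by blast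
   obtain r where r: "strict_mono r" "(%k. D n (r k) p) ----> 0" using elim by blast
   have "compact ((%ta. p + ta *R e) ` {s..t})" by (intro compact_continuous_image continuous_intros) auto
   moreover have "(%ta. p + ta *R e) ` {s..t} \<subseteq> Q" using seg by auto
   ultimately obtain d where d: "d > 0" "(\<Union>x\<in>(%ta. p + ta *R e) ` {s..t}. cball x d) \<subseteq> Q"
    by (rule compact_subset_open_imp_cball_epsilon_subset[OF _ Q])
   define Ia where "Ia k = en (2^(k*DIM('a)))*(LI v:ball 0 (hp k). en \<bar>f (ps + v) - a\<bar>)" for k
   define Ib where "Ib k = en (2^(k*DIM('a)))*(LI v:ball 0 (hp k). en \<bar>f (pt + v) - b\<bar>)" for k
   have Ia: "Ia ----> 0" using a unfolding trc_def sc_ball Ia_def ps_def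
    by (subst (asm) nn_integral_ball_shift) auto
   have Ib: "Ib ----> 0" using b unfolding trc_def sc_ball Ib_def pt_def
    by (subst (asm) nn_integral_ball_shift) auto
   have key: "en om*en \<bar>a - b\<bar> <= Ia k + Ib k + (D n k p + en om*IG)" if k: "hp k < d" for k
   proof -
    let ?B = "ball (0::'a) (hp k)"
    have c1: "en (2^(k*DIM('a))) * vol ?B = en om"
     using om by (simp add: emeasure_ball_dyadic om_def[symmetric] flip: ennreal_mult) (simp add: power_one_over)
    have up': "AE v in lborel. v \<in> ?B --> en \<bar>f (pt + v) - f (ps + v)\<bar> <= (LI si:{s..t}. en (G (p + si *R e + v)))"
    proof (cases "s = t")
     case False
     define h where "h = (t - s) *R e"
     have "AE q in lborel. closed_segment q (q + h) \<subseteq> Q -->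
       en \<bar>f (q + h) - f q\<bar> <= en (norm h)*(LI ta:{0..1}. en (G (q + ta *R h)))"
      using up unfolding upgrad_def by blast
     from AE_translate[OF this, of ps] show ?thesis
     proof eventually_elim
      case (elim v)
      show ?case
      proof
       assume v: "v \<in> ?B"
       have "closed_segment (v + ps) (v + ps + h) \<subseteq> Q"
       proof
        fix x assume "x \<in> closed_segment (v + ps) (v + ps + h)"
        then obtain u where u: "0 <= u" "u <= 1" "x = (1 - u) *R (v + ps) + u *R (v + ps + h)"
         by (auto simp: closed_segment_def)
        define ta where "ta = s + u*(t - s)"
        have x: "x = (p + ta *R e) + v" by (simp add: u ps_def h_def ta_def algebra_simps)
        have "u*(t - s) <= 1*(t - s)" "0 <= u*(t - s)" using u st mult_right_mono[of u 1 "t - s"] by auto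
        then have "ta \<in> {s..t}" by (auto simp: ta_def)
        moreover have "x \<in> cball (p + ta *R e) d" using v k by (simp add: x dist_norm)
        ultimately show "x \<in> Q" using d(2) by blast
       qed
       then have "en \<bar>f (v + ps + h) - f (v + ps)\<bar> <= en (norm h)*(LI ta:{0..1}. en (G (v + ps + ta *R h)))"
        using elim by blast
       also have "v + ps + h = pt + v" by (simp add: h_def ps_def pt_def algebra_simps)
       also have "en (norm h)*(LI ta:{0..1}. en (G (v + ps + ta *R h)))
         = (LI si:{s..t}. en (G (p + si *R e + v)))"
       proof -
        have "(LI si:{s..t}. en (G (p + si *R e + v)))
         = en \<bar>t - s\<bar>*(LI ta. en (G (p + (s + (t - s) * ta) *R e + v))*chi {s..t} (s + (t - s) * ta))"
         using False by (intro nn_integral_real_affine) auto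
        also have "(%ta. en (G (p + (s + (t - s) * ta) *R e + v))*chi {s..t} (s + (t - s) * ta)) = (%ta. en (G (v + ps + ta *R h))*chi {0..1} ta)"
        proof
         fix ta :: real
         have A: "p + (s + (t - s) * ta) *R e + v = v + ps + ta *R h" by (simp add: ps_def h_def algebra_simps)
         have B: "s + (t - s) * ta \<in> {s..t} \<longleftrightarrow> ta \<in> {0..1}"
         proof -
          have pos: "0 < t - s" using st False by simp
          have "s + (t - s) * ta \<in> {s..t} \<longleftrightarrow> 0 <= (t - s) * ta & (t - s) * ta <= t - s" by auto
          also have "... \<longleftrightarrow> ta \<in> {0..1}"
           using mult_le_cancel_left_pos[OF pos, of ta 1] pos by (simp add: zero_le_mult_iff)
          finally show ?thesis .
         qed
         show "en (G (p + (s + (t - s) * ta) *R e + v))*chi {s..t} (s + (t - s) * ta) = en (G (v + ps + ta *R h))*chi {0..1} ta"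
          unfolding A indicator_def B ..
        qed
        also have "\<bar>t - s\<bar> = norm h" using e by (simp add: h_def)
        finally show ?thesis by simp
       qed
       finally show "en \<bar>f (pt + v) - f (ps + v)\<bar> <= (LI si:{s..t}. en (G (p + si *R e + v)))" by (simp add: add.commute)
      qed
     qed
    qed (simp add: ps_def pt_def)
    have "en om*en \<bar>a - b\<bar> = en (2^(k*DIM('a)))*(LI v:?B. en \<bar>a - b\<bar>)"
     by (simp add: nn_integral_cmult c1[symmetric] mult_ac)
    also have "... <= en (2^(k*DIM('a)))*(LI v. en \<bar>f (ps + v) - a\<bar>*chi ?B v + (en \<bar>f (pt + v) - b\<bar>*chi ?B v
       + (LI si:{s..t}. en (G (p + si *R e + v)))*chi ?B v))"
    proof (intro mult_left_mono nn_integral_mono_AE)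
     show "AE v in lborel. en \<bar>a - b\<bar>*chi ?B v <= en \<bar>f (ps + v) - a\<bar>*chi ?B v + (en \<bar>f (pt + v) - b\<bar>*chi ?B v
       + (LI si:{s..t}. en (G (p + si *R e + v)))*chi ?B v)"
      using up'
     proof eventually_elim
      case (elim v)
      have "en \<bar>a - b\<bar> <= en \<bar>f (ps + v) - a\<bar> + (en \<bar>f (pt + v) - b\<bar> + en \<bar>f (pt + v) - f (ps + v)\<bar>)"
       by (simp flip: ennreal_plus add: ennreal_leI)
      then show ?case using elim by (cases "v \<in> ?B") (auto intro: order_trans add_left_mono)
     qed
    qed simp
    also have "... = Ia k + (Ib k + en (2^(k*DIM('a)))*(LI v. (LI si:{s..t}. en (G (p + si *R e + v)))*chi ?B v))"
     by (simp add: nn_integral_add distrib_left Ia_def Ib_def)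
    also have "en (2^(k*DIM('a)))*(LI v. (LI si:{s..t}. en (G (p + si *R e + v)))*chi ?B v)
      <= D n k p + en om*IG"
    proof -
     have "(LI v. (LI si:{s..t}. en (G (p + si *R e + v)))*chi ?B v)
      = (LI v. LI si. en (G (p + si *R e + v))*chi {s..t} si*chi ?B v)"
      by (simp add: nn_integral_multc)
     also have "... = (LI si. LI v. en (G (p + si *R e + v))*chi {s..t} si*chi ?B v)"
      by (rule lborel_pair.Fubini') measurable
     also have "... <= (LI si. LI v. (en (\<bar>G (p + si *R e + v) - G (p + si *R e)\<bar>)*chi ?B v)*chi {-real n..real n} si
        + en (G (p + si *R e))*chi {s..t} si*chi ?B v)"
     proof (intro nn_integral_mono)
      fix si and v :: 'a
      have "en (G (p + si *R e + v)) <= en (\<bar>G (p + si *R e + v) - G (p + si *R e)\<bar> + max 0 (G (p + si *R e)))"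
       by (intro ennreal_leI) auto
      also have "... = en (\<bar>G (p + si *R e + v) - G (p + si *R e)\<bar>) + en (G (p + si *R e))"
       by (subst ennreal_plus) (auto simp: max_def ennreal_neg)
      finally show "en (G (p + si *R e + v))*chi {s..t} si*chi ?B v <= (en (\<bar>G (p + si *R e + v) - G (p + si *R e)\<bar>)*chi ?B v)*chi {-real n..real n} si
        + en (G (p + si *R e))*chi {s..t} si*chi ?B v"
       using n by (auto simp: indicator_def)
     qed
     also have "... = (LI si. (LI v. (en (\<bar>G (p + si *R e + v) - G (p + si *R e)\<bar>)*chi ?B v))*chi {-real n..real n} si
        + en (G (p + si *R e))*chi {s..t} si * vol ?B)"
      by (simp add: nn_integral_add nn_integral_multc nn_integral_cmult)
     also have "... = (LI si. (LI v. (en (\<bar>G (p + si *R e + v) - G (p + si *R e)\<bar>)*chi ?B v))*chi {-real n..real n} si)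
        + IG * vol ?B"
      by (simp add: nn_integral_add nn_integral_multc IG_def)
     finally have "en (2^(k*DIM('a)))*(LI v. (LI si:{s..t}. en (G (p + si *R e + v)))*chi ?B v)
      <= en (2^(k*DIM('a)))*..." by (rule mult_left_mono) simp
     also have "... = D n k p + IG*(en (2^(k*DIM('a))) * vol ?B)"
     proof -
      have "D n k p = (LI si. en (2^(k*DIM('a)))*((LI v. (en (\<bar>G (p + si *R e + v) - G (p + si *R e)\<bar>)*chi ?B v))*chi {-real n..real n} si))"
       unfolding D_def by (simp add: mean_osc_shift mult.assoc)
      also have "... = en (2^(k*DIM('a)))*(LI si. (LI v. (en (\<bar>G (p + si *R e + v) - G (p + si *R e)\<bar>)*chi ?B v))*chi {-real n..real n} si)"
       by (rule nn_integral_cmult) measurable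
      finally show ?thesis by (simp add: distrib_left mult_ac)
     qed
     finally show ?thesis unfolding c1 by (simp add: mult.commute)
    qed
    finally show ?thesis by (simp add: add_left_mono add.assoc)
   qed
   have ev: "eventually (%k. hp k < d) sq"
    using d by (intro order_tendstoD(2)[OF LIMSEQ_power_zero]) auto
   have "eventually (%k. (1/2)^r k < d) sq"
    using eventually_compose_filterlim[OF ev filterlim_subseq[OF r(1)]] .
   then have "eventually (%k. en om*en \<bar>a - b\<bar> <= Ia (r k) + Ib (r k) + (D n (r k) p + en om*IG)) sq"
    by eventually_elim (rule key)
   moreover have "(%k. Ia (r k) + Ib (r k) + (D n (r k) p + en om*IG)) ----> 0 + 0 + (0 + en om*IG)"
    using LIMSEQ_subseq_LIMSEQ[OF Ia r(1)] LIMSEQ_subseq_LIMSEQ[OF Ib r(1)] r(2)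
    by (intro tendsto_add tendsto_const) (auto simp: o_def)
   ultimately have "en om*en \<bar>a - b\<bar> <= 0 + 0 + (0 + en om*IG)"
    by (intro tendsto_lowerbound[of _ _ sequentially]) auto
   then have "en om*en \<bar>a - b\<bar> <= en om*IG" by simp
   then show "en \<bar>a - b\<bar> <= (LI si:{s..t}. en (G (p + si *R e)))"
    unfolding IG_def[symmetric] using om by (subst (asm) ennreal_mult_le_mult_iff) auto
  qed
 qed
qed

text \<open>The volume that a ball of fixed radius leaves outside A depends continuously on the
  centre, by continuity of translations for the indicator of the ball.\<close>

lemma closed_fat:
 fixes A :: "'a::euclidean_space set"
 assumes [measurable]: "A \<in> sets borel"
 shows "closed {p. fat A k p}"
proof -
 have "continuous_on UNIV (%p. enn2real (vol (ball p ((1/2)^m) - A)))" for m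
 proof -
  have fin: "vol (ball p ((1/2)^m) - A) < \<infinity>" for p
   using emeasure_mono[of "ball p ((1/2)^m) - A" "ball p ((1/2)^m)" lborel] emeasure_lborel_ball_finite[of p "(1/2)^m"] by auto
  have int: "integrable lborel (ind (ball (0::'a) ((1/2)^m)))"
   using emeasure_lborel_ball_finite[of "0::'a" "(1/2)^m"] by (simp add: integrable_indicator_iff)
  have tri: "vol (ball p ((1/2)^m) - A) <= vol (ball q ((1/2)^m) - A) + trdiff (ind (ball (0::'a) ((1/2)^m))) (p - q)" for p q
  proof -
   have "trdiff (ind (ball (0::'a) ((1/2)^m))) (p - q) = (LI x. en \<bar>chi (ball q ((1/2)^m)) x - chi (ball p ((1/2)^m)) x\<bar>)"
    unfolding trdiff_def
    by (subst nn_integral_translate[of _ "-p", symmetric])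
      (auto intro!: nn_integral_cong simp: indicator_def dist_norm norm_minus_commute)
   moreover have "vol (ball p ((1/2)^m) - A) = (LI x. chi (ball p ((1/2)^m) - A) x)" for p
    by simp
   ultimately show ?thesis
    by (simp only:) (subst nn_integral_add[symmetric], auto intro!: nn_integral_mono simp: indicator_def)
  qed
  show ?thesis
   unfolding continuous_on_iff
  proof (intro ballI allI impI)
   fix p :: 'a and e :: real assume e: "e > 0"
   then have "e/2 > 0" by simp
   from trdiff_small[OF int this] obtain d where d: "d > 0" "!!v. norm v < d ==> trdiff (ind (ball (0::'a) ((1/2)^m))) v <= en (e/2)" by blast
   have "enn2real (vol (ball p ((1/2)^m) - A)) <= enn2real (vol (ball q ((1/2)^m) - A)) + e/2"
    if "norm (p - q) < d" for p q
   proof -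
    have "vol (ball p ((1/2)^m) - A) <= vol (ball q ((1/2)^m) - A) + en (e/2)"
     using tri[of p q] d(2)[OF that] by (meson add_left_mono order_trans)
    also have "... = en (enn2real (vol (ball q ((1/2)^m) - A)) + e/2)"
     using fin[of q] e by (simp add: ennreal_plus)
    finally show ?thesis using e by (intro enn2real_leI) auto
   qed
   then have "\<forall>q\<in>UNIV. dist q p < d --> dist (enn2real (vol (ball q ((1/2)^m) - A))) (enn2real (vol (ball p ((1/2)^m) - A))) < e"
    using e by (force simp: dist_real_def dist_norm norm_minus_commute abs_if)
   then show "\<exists>d>0. \<forall>q\<in>UNIV. dist q p < d --> dist (enn2real (vol (ball q ((1/2)^m) - A))) (enn2real (vol (ball p ((1/2)^m) - A))) < e"
    using d(1) by blast
  qed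
 qed
 note cont = this
 define b where "b m = unit_ball_vol (real DIM('a))*(1/2)^(m*DIM('a))" for m
 have b: "b m > 0" for m by (simp add: b_def)
 have "{p. fat A k p} = (\<Inter>m\<in>{k..}. {p. 4*(2^DIM('a)*enn2real (vol (ball p ((1/2)^m) - A))) <= b m})"
 proof -
  have "4*(2^DIM('a) * vol (ball p ((1/2)^m) - A)) <= vol (ball p ((1/2)^m))
   \<longleftrightarrow> 4*(2^DIM('a)*enn2real (vol (ball p ((1/2)^m) - A))) <= b m" for p m
  proof -
   have "vol (ball p ((1/2)^m) - A) < \<infinity>"
    using emeasure_mono[of "ball p ((1/2)^m) - A" "ball p ((1/2)^m)" lborel] emeasure_lborel_ball_finite[of p "(1/2)^m"] by auto
   then obtain x where x: "x >= 0" "vol (ball p ((1/2)^m) - A) = en x" by (cases "vol (ball p ((1/2)^m) - A)") auto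
   have "4*(2^DIM('a)*en x) = en (4*(2^DIM('a)*x))" using x by (simp add: ennreal_mult flip: ennreal_power)
   then show ?thesis using x b[of m] by (simp add: emeasure_ball_dyadic b_def[symmetric])
  qed
  then show ?thesis by (auto simp: fat_def)
 qed
 also have "closed ..."
  by (intro closed_INT ballI closed_Collect_le continuous_on_mult continuous_on_const cont)
 finally show ?thesis .
qed

lemma fat_if_trc_1:
 fixes A :: "'a::euclidean_space set"
 assumes [measurable]: "A \<in> sets borel" and t: "aplim (ind A) p 1"
 shows "\<exists>k. fat A k p"
proof -
 have eq: "(dev (sc p k (ball 0 1)) (chi A) 1) = vol (ball p (hp k) - A)" for k
 proof -
  have "(dev (sc p k (ball 0 1)) (chi A) 1) = (LI q. chi (ball p (hp k) - A) q)"
   by (intro nn_integral_cong) (auto simp: indicator_def sc_ball)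
  then show ?thesis by simp
 qed
 define om where "om = unit_ball_vol (real DIM('a))"
 have om: "om > 0" by (simp add: om_def)
 have "eventually (%k. en (2^(k*DIM('a))) * vol (ball p (hp k) - A) < en (om/(4*2^DIM('a)))) sq"
  using t unfolding trc_def eq by (rule order_tendstoD) (use om in simp)
 then obtain k where k: "!!m. m >= k ==> en (2^(m*DIM('a))) * vol (ball p ((1/2)^m) - A) < en (om/(4*2^DIM('a)))"
  by (auto simp: eventually_sequentially)
 have "fat A k p"
  unfolding fat_def
 proof (intro allI impI)
  fix m assume m: "k <= m"
  have "vol (ball p ((1/2)^m) - A) < \<infinity>"
   using emeasure_mono[of "ball p ((1/2)^m) - A" "ball p ((1/2)^m)" lborel] emeasure_lborel_ball_finite[of p "(1/2)^m"] by auto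
  then obtain x where x: "x >= 0" "vol (ball p ((1/2)^m) - A) = en x" by (cases "vol (ball p ((1/2)^m) - A)") auto
  have "2^(m*DIM('a))*x < om/(4*2^DIM('a))"
   using k[OF m] x by (simp add: ennreal_less_iff flip: ennreal_mult)
  then have "4*(2^DIM('a)*x) <= om*(1/2)^(m*DIM('a))"
   by (simp add: field_simps power_one_over)
  then have "en (4*(2^DIM('a)*x)) <= vol (ball p ((1/2)^m))"
   unfolding emeasure_ball_dyadic om_def[symmetric] by (rule ennreal_leI)
  moreover have "4*(2^DIM('a)*en x) = en (4*(2^DIM('a)*x))"
   using x by (simp add: ennreal_mult flip: ennreal_power)
  ultimately show "4*(2^DIM('a) * vol (ball p ((1/2)^m) - A)) <= vol (ball p ((1/2)^m))"
   using x by simp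
 qed
 then show ?thesis by blast
qed

text \<open>Density 0 makes the complement fat; at a common scale both A and its complement would
  miss at most a quarter of the ball.\<close>

lemma not_fat_if_trc_0:
 fixes A :: "'a::euclidean_space set"
 assumes [measurable]: "A \<in> sets borel" and t: "aplim (ind A) p 0"
 shows "~ fat A k p"
proof
 assume fat: "fat A k p"
 have "ind (- A) = (%q. 1 - ind A q)" by (auto simp: indicator_def)
 then have "aplim (ind (- A)) p 1" using t by (simp add: trc_def)
 from fat_if_trc_1[OF _ this] obtain k' where k': "fat (- A) k' p" by auto
 define m where "m = max k k'"
 let ?b = "vol (ball p ((1/2)^m))"
 have le: "4 * vol (ball p ((1/2)^m) - X) <= ?b" if "fat X k p \<or> fat X k' p" for X
 proof -
  have "4*(2^DIM('a) * vol (ball p ((1/2)^m) - X)) <= ?b"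
   using that by (auto simp: fat_def m_def)
  moreover have "4*(1 * vol (ball p ((1/2)^m) - X)) <= 4*(2^DIM('a) * vol (ball p ((1/2)^m) - X))"
   by (intro mult_left_mono mult_right_mono) (auto simp: one_le_power)
  ultimately show ?thesis by simp
 qed
 have "?b <= vol (ball p ((1/2)^m) - A) + vol (ball p ((1/2)^m) - - A)"
  by (subst plus_emeasure) (auto intro!: emeasure_mono)
 then have "4*?b <= 4 * vol (ball p ((1/2)^m) - A) + 4 * vol (ball p ((1/2)^m) - - A)"
  by (metis distrib_left mult_left_mono zero_le)
 also have "... <= ?b + ?b" using le[of A] le[of "- A"] fat k' by (intro add_mono) blast+
 finally have "4*?b <= 2*?b" by (simp add: mult_2)
 moreover have "unit_ball_vol (real DIM('a))*(1/2)^(m*DIM('a)) > 0" by simp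
 then obtain x where "x > 0" "?b = en x" unfolding emeasure_ball_dyadic by blast
 ultimately show False by (simp add: ennreal_mult[symmetric] flip: ennreal_numeral)
qed

lemma trc_nonneg:
 fixes f :: "'a::euclidean_space => real"
 assumes [measurable]: "f \<in> BM" and f: "!!x. 0 <= f x" and t: "aplim f p a"
 shows "0 <= a"
proof (rule ccontr)
 assume "~ 0 <= a"
 have "aplim f p 0"
 proof (rule trc_dominated[OF _ _ _ _ _ t t open_UNIV])
  show "\<bar>f q - 0\<bar> <= 1*(\<bar>f q - a\<bar> + \<bar>f q - a\<bar>)" for q
   using f[of q] \<open>~ 0 <= a\<close> by (simp add: abs_if)
 qed auto
 then have "a = 0" by (rule trc_unique[rotated -1]) (use t in \<open>auto simp: emeasure_ball\<close>)
 then show False using \<open>~ 0 <= a\<close> by simp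
qed

text \<open>On almost every line f has traces obeying the gradient inequality, and where the trace
  is positive A has density 0 or 1. If the trace vanishes somewhere on a segment, both ends are
  compared with the value 0 there; otherwise the density cannot change along the segment and the
  inequality for f itself applies.\<close>

lemma upgrad_mult_indicator:
 fixes f G :: "'a::euclidean_space => real"
 assumes Q: "open Q" and up: "upgrad Q f G" and G: "integrable lborel G" and f: "integrable lborel f" "!!x. 0 <= f x"
  and dim: "DIM('a) >= 2" and A: "A \<in> sets borel" "vol A < \<infinity>"
  and hn: "hnull (DIM('a) - 1) {y\<in>Q. ~ (\<exists>a. aplim f y a &
   (a = 0 \<or> aplim (ind A) y 0 \<or> aplim (ind A) y 1))}"
 shows "upgrad Q (%x. f x*chi A x) G"
 unfolding upgrad_def
proof (intro conjI allI)
 have [measurable]: "f \<in> BM" "G \<in> BM" using up by (auto simp: upgrad_def)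
 note A(1)[measurable]
 show "(%x. f x*chi A x) \<in> BM" by measurable
 show "G \<in> BM" by simp
 fix h :: 'a
 define B where "B = ball (0::'a) 1"
 define d0 where "d0 y \<longleftrightarrow> trc B (ind A) y 0" for y
 define d1 where "d1 y \<longleftrightarrow> trc B (ind A) y 1" for y
 have d01: "~ (d0 y & d1 y)" for y
  using trc_unique[of B "ind A" y 0 1] by (auto simp: d0_def d1_def B_def emeasure_ball)
 show "AE p in lborel. closed_segment p (p + h) \<subseteq> Q -->
    en \<bar>f (p + h)*chi A (p + h) - f p*chi A p\<bar> <= en (norm h)*(LI ta:{0..1}. en (G (p + ta *R h)))"
 proof (cases "h = 0")
  case False
  define e where "e = h /\<^sub>R norm h"
  have e: "norm e = 1" "h = norm h *R e" using False by (auto simp: e_def)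
  have nh: "norm h > 0" using False by simp
  have intA: "integrable lborel (ind A)" using A by (simp add: integrable_indicator_iff)
  have intG: "(LI x. en \<bar>G x\<bar>) < \<infinity>" using G by (simp add: integrable_iff_bounded)
  \<comment> \<open>Where traces exist the pointwise values agree with them. This is required at
    both ends of the segment and at almost every point of the line.\<close>
  define eqs where "eqs q \<longleftrightarrow> (\<forall>a. trc B f q a --> f q = a) & (\<forall>a. trc B (ind A) q a --> ind A q = a)" for q
  have eqs: "AE q in lborel. eqs q"
   using AE_trc_eq[OF f(1)] AE_trc_eq[OF intA] unfolding eqs_def B_def by eventually_elim blast
  have line_int: "AE p in lborel. \<forall>n::nat. (LI si:{-real n..real n}. en \<bar>G (p + si *R e)\<bar>) \<noteq> \<infinity>"
   unfolding AE_all_countable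
  proof
   fix n :: nat
   have "(LI p. (LI si:{-real n..real n}. en \<bar>G (p + si *R e)\<bar>))
     = (LI si. LI p. en \<bar>G (p + si *R e)\<bar>*chi {-real n..real n} si)"
    by (rule lborel_pair.Fubini') measurable
   also have "... = (LI x. en \<bar>G x\<bar>)*en (2*real n)"
    using nn_integral_translate[of "%x. en \<bar>G x\<bar>"] by (simp add: nn_integral_multc nn_integral_cmult)
   also have "... \<noteq> \<infinity>" using intG by (simp add: ennreal_mult_eq_top_iff less_top[symmetric])
   finally show "AE p in lborel. (LI si:{-real n..real n}. en \<bar>G (p + si *R e)\<bar>) \<noteq> \<infinity>"
    by (intro nn_integral_PInf_AE) measurable
  qed
  have cut: "AE p in lborel. ~ (\<exists>ta et k. et > 0 & fat X k (p + ta *R e) & ((LI si:{ta<..<ta + et}. chi X (p + si *R e)) = 0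
    \<or> (LI si:{ta - et<..<ta}. chi X (p + si *R e)) = 0))" if "X \<in> sets borel" for X
   using AE_not_fat_cut[OF that e(1)] AE_not_fat_cut_left[OF that e(1)] by eventually_elim blast
  have cA: "- A \<in> sets borel" by measurable
  have e0: "e \<noteq> 0" using e by auto
  show ?thesis
   using eqs AE_translate[OF eqs, of h] AE_along_lines[OF eqs, of e] line_int cut[OF A(1)] cut[OF cA]
    AE_line_avoids_hnull[OF hn dim e0] AE_precise_along_line[OF Q up G e(1)]
  proof eventually_elim
   case (elim p)
   note eq0 = elim(1) and eq1 = elim(2) and eql = elim(3) and li = elim(4) and cutA = elim(5) and cutA' = elim(6)
    and av = elim(7)
   note pl = elim(8)[rule_format, folded B_def]
   show ?case
   proof
    assume seg: "closed_segment p (p + h) \<subseteq> Q"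
    define x where "x ta = p + ta *R e" for ta
    define T where "T = norm h"
    have x0: "x 0 = p" and xT: "x T = p + h" using e by (auto simp: x_def T_def)
    have xQ: "x ta \<in> Q" if "ta \<in> {0..T}" for ta
    proof -
     have "x ta = (1 - ta/T) *R p + (ta/T) *R (p + h)"
     proof -
      have "ta *R e = (ta/T) *R h" by (simp add: e_def T_def divide_inverse)
      then show ?thesis by (simp add: x_def algebra_simps)
     qed
     then have "x ta \<in> closed_segment p (p + h)" unfolding closed_segment_def using that nh
      by (auto intro!: exI[of _ "ta/T"] simp: T_def)
     then show ?thesis using seg by blast
    qed
    have ex: "\<exists>a. trc B f (x ta) a & (a = 0 \<or> d0 (x ta) \<or> d1 (x ta))" if "ta \<in> {0..T}" for ta
     using av xQ[OF that] unfolding x_def B_def d0_def d1_def by blast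
    define \<phi> where "\<phi> ta = (THE a. trc B f (x ta) a)" for ta
    have uniq: "a = b" if "trc B f y a" "trc B f y b" for y a b
     by (rule trc_unique[OF _ _ _ that]) (auto simp: B_def emeasure_ball)
    have \<phi>_eq: "\<phi> ta = a" if "trc B f (x ta) a" for ta a
     unfolding \<phi>_def using that uniq by (intro the_equality)
    have \<phi>: "trc B f (x ta) (\<phi> ta)" "\<phi> ta = 0 \<or> d0 (x ta) \<or> d1 (x ta)" "\<phi> ta >= 0" if "ta \<in> {0..T}" for ta
    proof -
     from ex[OF that] obtain a where a: "trc B f (x ta) a" "a = 0 \<or> d0 (x ta) \<or> d1 (x ta)" by blast
     moreover have "a >= 0" using a(1) unfolding B_def by (rule trc_nonneg[rotated 2]) (use f in auto)
     ultimately show "trc B f (x ta) (\<phi> ta)" "\<phi> ta = 0 \<or> d0 (x ta) \<or> d1 (x ta)" "\<phi> ta >= 0" using \<phi>_eq[OF a(1)] by auto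
    qed
    define I where "I s t = (LI si:{s..t}. en (G (x si)))" for s t
    have I: "en \<bar>\<phi> s - \<phi> t\<bar> <= I s t" if "0 <= s" "s <= t" "t <= T" for s t
     unfolding I_def x_def using that \<phi>(1)[of s] \<phi>(1)[of t] xQ
     by (intro pl) (auto simp: x_def)
    have I_mono: "I s t <= I s' t'" if "s' <= s" "t <= t'" for s t s' t'
     unfolding I_def using that by (intro nn_integral_mono) (auto simp: indicator_def)
    have I_add: "I s t + I t r <= I s r" if "s <= t" "t <= r" for s t r
    proof -
     have "I s t + I t r = (LI si. en (G (x si))*chi {s..t} si + en (G (x si))*chi {t..r} si)"
      unfolding I_def x_def by (rule nn_integral_add[symmetric]) measurable
     also have "... <= I s r"
      unfolding I_def using that AE_lborel_singleton[of t]
      by (intro nn_integral_mono_AE) (auto elim!: eventually_mono simp: indicator_def)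
     finally show ?thesis .
    qed
    \<comment> \<open>As long as the trace is nonzero the two densities partition the segment. A
      change would give, by \<open>frontier_gap\<close>, a fat point of A or of its complement next
      to an interval without that set.\<close>
    have status: "d1 (x s) \<longleftrightarrow> d1 (x t)" if st: "0 <= s" "s <= t" "t <= T" and pos: "!!ta. ta \<in> {s..t} ==> \<phi> ta \<noteq> 0" for s t
    proof (rule ccontr)
     assume neq: "~ ?thesis"
     define D where "D = {ta\<in>{s..t}. d1 (x ta)}"
     define E where "E = {ta\<in>{s..t}. d0 (x ta)}"
     have DE: "{s..t} \<subseteq> D \<union> E" "D \<inter> E = {}" "D \<subseteq> {s..t}" "E \<subseteq> {s..t}"
     proof -
      have "d0 (x ta) \<or> d1 (x ta)" if "ta \<in> {s..t}" for ta
       using pos[OF that] \<phi>(2)[of ta] st that by auto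
      then show "{s..t} \<subseteq> D \<union> E" unfolding D_def E_def by blast
     qed (use d01 in \<open>auto simp: D_def E_def\<close>)
     have ne: "D \<noteq> {}" "E \<noteq> {}" using neq DE st by (auto simp: D_def)
     define S where "S X k = {ta. fat X k (x ta)}" for X k
     have clS: "closed (S X k)" if "X \<in> sets borel" for X k
     proof -
      have "closed (x -` {p. fat X k p})"
       by (intro continuous_closed_vimage closed_fat that) (auto simp: x_def[abs_def] intro!: continuous_intros)
      then show ?thesis by (simp add: S_def vimage_def)
     qed
     have d0': "trc B (ind (- A)) y 1 \<longleftrightarrow> d0 y" for y
     proof -
      have "\<bar>ind (- A) q - 1\<bar> = \<bar>ind A q - 0\<bar>" for q by (auto simp: indicator_def)
      then show ?thesis by (simp add: trc_def d0_def)
     qed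
     have d1': "trc B (ind (- A)) y 0 \<longleftrightarrow> d1 y" for y
     proof -
      have "\<bar>ind (- A) q - 0\<bar> = \<bar>ind A q - 1\<bar>" for q by (auto simp: indicator_def)
      then show ?thesis by (simp add: trc_def d1_def)
     qed
     have "\<exists>ta et k. et > 0 & ta \<in> {s..t} & (ta \<in> S A k & ({ta<..<ta + et} \<subseteq> E \<or> {ta - et<..<ta} \<subseteq> E) \<or>
       ta \<in> S (- A) k & ({ta<..<ta + et} \<subseteq> D \<or> {ta - et<..<ta} \<subseteq> D))"
     proof (rule frontier_gap[OF DE ne clS[OF A(1)] clS[OF cA]])
      show "D \<subseteq> (\<Union>k. S A k)" using fat_if_trc_1[OF A(1)] by (auto simp: D_def S_def d1_def B_def)
      show "E \<subseteq> (\<Union>k. S (- A) k)" using fat_if_trc_1[OF cA] d0' by (auto simp: E_def S_def B_def)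
      show "S A k \<inter> {s..t} \<subseteq> D" for k
      proof
       fix ta assume t: "ta \<in> S A k \<inter> {s..t}"
       then have "~ d0 (x ta)" using not_fat_if_trc_0[OF A(1), of "x ta" k] by (auto simp: S_def d0_def B_def)
       then show "ta \<in> D" using t DE(1) by (auto simp: E_def)
      qed
      show "S (- A) k \<inter> {s..t} \<subseteq> E" for k
      proof
       fix ta assume t: "ta \<in> S (- A) k \<inter> {s..t}"
       then have "~ d1 (x ta)" using not_fat_if_trc_0[OF cA, of "x ta" k] d1' by (auto simp: S_def B_def)
       then show "ta \<in> E" using t DE(1) by (auto simp: D_def)
      qed
     qed
     then obtain ta et k where et: "et > 0" and alt: "ta \<in> S A k & ({ta<..<ta + et} \<subseteq> E \<or> {ta - et<..<ta} \<subseteq> E) \<or>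
       ta \<in> S (- A) k & ({ta<..<ta + et} \<subseteq> D \<or> {ta - et<..<ta} \<subseteq> D)" by blast
     \<comment> \<open>At almost every point of the line membership in A agrees with the density, so
       an interval of density-0 points carries no length of A, and dually for the
       complement.\<close>
     have nul: "(LI si:J. chi X (p + si *R e)) = 0"
      if J: "J \<subseteq> E & X = A \<or> J \<subseteq> D & X = - A" and [measurable]: "J \<in> sets borel" "X \<in> sets borel" for J X
     proof (subst nn_integral_0_iff_AE)
      show "AE si in lborel. chi X (p + si *R e)*chi J si = (0::en)"
       using eql
      proof eventually_elim
       case (elim si)
       show ?case
       proof (cases "si \<in> J")
        case True
        then have "d0 (x si) & X = A \<or> d1 (x si) & X = - A" using J by (auto simp: D_def E_def)
        then have "x si \<notin> X" using elim unfolding eqs_def x_def[symmetric] d0_def d1_def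
         by (auto simp: indicator_def split: if_splits)
        then show ?thesis by (simp add: x_def)
       qed simp
      qed
     qed measurable
     from alt show False
     proof
      assume "ta \<in> S A k & ({ta<..<ta + et} \<subseteq> E \<or> {ta - et<..<ta} \<subseteq> E)"
      then have "fat A k (p + ta *R e)" "(LI si:{ta<..<ta + et}. chi A (p + si *R e)) = 0
        \<or> (LI si:{ta - et<..<ta}. chi A (p + si *R e)) = 0"
       using nul A(1) by (auto simp: S_def x_def)
      then show False using cutA et by blast
     next
      assume "ta \<in> S (- A) k & ({ta<..<ta + et} \<subseteq> D \<or> {ta - et<..<ta} \<subseteq> D)"
      then have "fat (- A) k (p + ta *R e)" "(LI si:{ta<..<ta + et}. chi (- A) (p + si *R e)) = 0
        \<or> (LI si:{ta - et<..<ta}. chi (- A) (p + si *R e)) = 0"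
       using nul cA by (auto simp: S_def x_def)
      then show False using cutA' et by blast
     qed
    qed
    have w: "f (x ta)*chi A (x ta) = (if d1 (x ta) then \<phi> ta else 0)" if "ta \<in> {0..T}" "eqs (x ta)" for ta
     using \<phi>[OF that(1)] that(2) d01[of "x ta"] unfolding eqs_def d0_def[symmetric] d1_def
     by (auto simp: d0_def indicator_def split: if_splits)
    have T0: "0 \<in> {0..T}" "T \<in> {0..T}" by (auto simp: T_def)
    have w0: "f p*chi A p = (if d1 (x 0) then \<phi> 0 else 0)" using w[OF T0(1)] eq0 by (simp add: x0)
    have wT: "f (p + h)*chi A (p + h) = (if d1 (x T) then \<phi> T else 0)" using w[OF T0(2)] eq1 by (simp add: xT)
    have "en \<bar>f (p + h)*chi A (p + h) - f p*chi A p\<bar> <= I 0 T"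
    proof (cases "\<exists>z\<in>{0..T}. \<phi> z = 0")
     case True
     then obtain z where z: "0 <= z" "z <= T" "\<phi> z = 0" by auto
     have "\<bar>f (p + h)*chi A (p + h) - f p*chi A p\<bar> <= \<bar>\<phi> 0 - \<phi> z\<bar> + \<bar>\<phi> z - \<phi> T\<bar>"
      unfolding w0 wT z(3) by auto
     then have "en \<bar>f (p + h)*chi A (p + h) - f p*chi A p\<bar> <= en \<bar>\<phi> 0 - \<phi> z\<bar> + en \<bar>\<phi> z - \<phi> T\<bar>"
      by (simp flip: ennreal_plus add: ennreal_leI)
     also have "... <= I 0 z + I z T" using z by (intro add_mono I) auto
     also have "... <= I 0 T" using z by (intro I_add)
     finally show ?thesis .
    next
     case False
     then have "d1 (x 0) \<longleftrightarrow> d1 (x T)" using T0 by (intro status) auto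
     then have "\<bar>f (p + h)*chi A (p + h) - f p*chi A p\<bar> <= \<bar>\<phi> 0 - \<phi> T\<bar>"
      unfolding w0 wT by auto
     then have "en \<bar>f (p + h)*chi A (p + h) - f p*chi A p\<bar> <= en \<bar>\<phi> 0 - \<phi> T\<bar>" by (rule ennreal_leI)
     also have "... <= I 0 T" using T0 by (intro I) auto
     finally show ?thesis .
    qed
    also have "I 0 T = en \<bar>T\<bar>*(LI ta. en (G (p + (0 + T * ta) *R e))*chi {0..T} (0 + T * ta))"
     unfolding I_def x_def using nh by (intro nn_integral_real_affine) (auto simp: T_def)
    also have "(%ta. en (G (p + (0 + T * ta) *R e))*chi {0..T} (0 + T * ta)) = (%ta. en (G (p + ta *R h))*chi {0..1} ta)"
    proof
     fix ta :: real
     have "p + (0 + T * ta) *R e = p + ta *R h" by (subst e(2)) (simp add: T_def mult.commute)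
     moreover have "0 + T * ta \<in> {0..T} \<longleftrightarrow> ta \<in> {0..1}" using nh by (auto simp: T_def zero_le_mult_iff)
     ultimately show "en (G (p + (0 + T * ta) *R e))*chi {0..T} (0 + T * ta) = en (G (p + ta *R h))*chi {0..1} ta"
      by (simp only: indicator_def)
    qed
    finally show "en \<bar>f (p + h)*chi A (p + h) - f p*chi A p\<bar> <= en (norm h)*(LI ta:{0..1}. en (G (p + ta *R h)))"
     by (simp add: T_def)
   qed
  qed
 qed simp
qed

section \<open>Smooth functions\<close>

lemma smooth_open_partial:
 assumes "smooth_open U f" "x \<in> U" "b \<in> Basis"
 shows "((%t. f (x + t *R b)) has_vector_derivative pdiff b f x) (at 0)"
 using assms[unfolded smooth_open_def] by (auto dest!: spec[of _ "[]"])

text \<open>\<open>smooth_open\<close> provides only continuous partial derivatives. Changing one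
  coordinate at a time and applying the mean value inequality to each step gives
  differentiability.\<close>

lemma smooth_open_has_derivative:
 fixes f :: "'a::euclidean_space => 'b::real_normed_vector"
 assumes sm: "smooth_open U f" and x: "x \<in> U"
 shows "(f has_derivative (%v. \<Sum>b\<in>Basis. (v \<bullet> b) *R pdiff b f x)) (at x)"
proof -
 have U: "open U" using sm by (simp add: smooth_open_def)
 have cont: "continuous_on U (pdiff b f)" if "b \<in> Basis" for b
  using sm that unfolding smooth_open_def by (auto dest!: spec[of _ "[b]"])
 have lin: "bounded_linear (%v. \<Sum>b\<in>Basis. (v \<bullet> b) *R pdiff b f x)"
  by (intro bounded_linear_sum bounded_linear_scaleR_left[THEN bounded_linear_compose] bounded_linear_inner_left)
 define N where "N = real DIM('a)"
 have N: "N >= 1" using DIM_positive[where 'a='a] by (simp add: N_def Suc_le_eq)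
 show ?thesis
  unfolding has_derivative_at_alt
 proof (intro conjI lin allI impI)
  fix e :: real assume e: "e > 0"
  have "\<exists>d>0. \<forall>y. dist y x < d --> y \<in> U & dist (pdiff b f y) (pdiff b f x) < e/N" if b: "b \<in> Basis" for b
  proof -
   have "isCont (pdiff b f) x" using cont[OF b] U x continuous_on_eq_continuous_at by blast
   then obtain d1 where "d1 > 0" "\<forall>y. dist y x < d1 --> dist (pdiff b f y) (pdiff b f x) < e/N"
    using e N unfolding continuous_at_eps_delta by (metis divide_pos_pos less_le_trans zero_less_one)
   moreover obtain d2 where "d2 > 0" "\<forall>y. dist y x < d2 --> y \<in> U" using U x unfolding open_dist by blast
   ultimately show ?thesis by (intro exI[of _ "min d1 d2"]) auto
  qed
  then obtain D where D: "!!b. b \<in> Basis ==> D b > 0"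
   "!!b y. b \<in> Basis ==> dist y x < D b ==> y \<in> U & dist (pdiff b f y) (pdiff b f x) < e/N" by metis
  define d where "d = Min (D ` Basis)"
  have d: "d > 0" "!!b. b \<in> Basis ==> d <= D b" using D(1) by (auto simp: d_def)
  \<comment> \<open>The intermediate corner points are at distance at most N * |y - x| from x, hence
    the radius d/N.\<close>
  have "norm (f y - f x - (\<Sum>b\<in>Basis. ((y - x) \<bullet> b) *R pdiff b f x)) <= e*norm (y - x)" if y: "norm (y - x) < d/N" for y
  proof -
   define v where "v = y - x"
   define vB where "vB B = (\<Sum>b\<in>B. (v \<bullet> b) *R b)" for B
   have nv: "norm (vB B + t *R b) <= real (Suc (card B))*norm v" if "B \<subseteq> Basis" "b \<in> Basis" "\<bar>t\<bar> <= \<bar>v \<bullet> b\<bar>" for B b t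
   proof -
    have "norm (vB B) <= (\<Sum>b\<in>B. norm v)" unfolding vB_def
     by (rule sum_norm_le) (use that(1) Basis_le_norm[of _ v] in auto)
    moreover have "norm (t *R b) <= norm v" using that Basis_le_norm[of b v] by simp
    ultimately show ?thesis using norm_triangle_ineq[of "vB B" "t *R b"] by (simp add: algebra_simps)
   qed
   have "norm (f (x + vB B) - f x - (\<Sum>b\<in>B. (v \<bullet> b) *R pdiff b f x)) <= real (card B)*(e/N*norm v)" if "finite B" "B \<subseteq> Basis" for B
    using that
   proof (induction B)
    case (insert b B)
    then have b: "b \<in> Basis" "B \<subseteq> Basis" by auto
    have card: "Suc (card B) <= DIM('a)" using insert card_mono[of "Basis::'a set" "insert b B"] by simp
    define c where "c = v \<bullet> b"
    define z where "z = x + vB B"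
    have seg: "dist (z + t *R b) x < d" if "t \<in> closed_segment 0 c" for t
    proof -
     have "\<bar>t\<bar> <= \<bar>v \<bullet> b\<bar>" using that by (auto simp: closed_segment_eq_real_ivl c_def split: if_splits)
     from nv[OF b(2,1) this] have "norm (vB B + t *R b) <= real (Suc (card B))*norm v" .
     also have "... <= N*norm v" unfolding N_def using card by (intro mult_right_mono) auto
     also have "... < d" using y N by (simp add: v_def field_simps)
     finally show ?thesis by (simp add: z_def dist_norm add.assoc)
    qed
    define g where "g t = f (z + t *R b) - t *R pdiff b f x" for t
    have dg: "(g has_derivative (%s. s *R (pdiff b f (z + t *R b) - pdiff b f x))) (at t within closed_segment 0 c)"
     if t: "t \<in> closed_segment 0 c" for t
    proof -
     have "z + t *R b \<in> U" using D(2)[OF b(1), of "z + t *R b"] seg[OF t] d(2)[OF b(1)] by auto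
     from smooth_open_partial[OF sm this b(1)]
     have d1: "((%s. f (z + t *R b + s *R b)) has_derivative (%s. s *R pdiff b f (z + t *R b))) (at (t - t))"
      by (simp add: has_vector_derivative_def)
     have d2: "((%s. s - t) has_derivative (%s. s)) (at t)" by (auto intro!: derivative_eq_intros)
     have "((%s. f (z + t *R b + (s - t) *R b)) has_derivative (%s. s *R pdiff b f (z + t *R b))) (at t)"
      by (rule has_derivative_compose[OF d2 d1])
     also have "(%s. f (z + t *R b + (s - t) *R b)) = (%s. f (z + s *R b))"
      by (simp add: algebra_simps)
     finally have "((%s. f (z + s *R b)) has_derivative (%s. s *R pdiff b f (z + t *R b))) (at t)" .
     from has_derivative_diff[OF this bounded_linear_imp_has_derivative[OF bounded_linear_scaleR_left, of "pdiff b f x"]]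
     show ?thesis unfolding g_def[abs_def] scaleR_diff_right by (rule has_derivative_at_withinI)
    qed
    have "norm (g c - g 0) <= (e/N)*norm (c - 0)"
    proof (rule differentiable_bound[OF _ dg])
     fix t assume t: "t \<in> closed_segment 0 c"
     have "norm (pdiff b f (z + t *R b) - pdiff b f x) <= e/N"
      using D(2)[OF b(1), of "z + t *R b"] seg[OF t] d(2)[OF b(1)] by (auto simp: dist_norm)
     then show "onorm (%s. s *R (pdiff b f (z + t *R b) - pdiff b f x)) <= e/N"
     proof (intro onorm_bound)
      show "0 <= e/N" using e N by simp
      show "norm (s *R (pdiff b f (z + t *R b) - pdiff b f x)) <= e/N*norm s"
       if "norm (pdiff b f (z + t *R b) - pdiff b f x) <= e/N" for s
       using mult_right_mono[OF that, of "norm s"] by (simp add: mult.commute)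
     qed
    qed auto
    also have "e/N*norm (c - 0) <= e/N*norm v"
     using Basis_le_norm[OF b(1), of v] e N by (intro mult_left_mono) (auto simp: c_def)
    finally have 1: "norm (g c - g 0) <= e/N*norm v" .
    have eq: "f (x + vB (insert b B)) - f x - (\<Sum>b\<in>insert b B. (v \<bullet> b) *R pdiff b f x)
     = (g c - g 0) + (f (x + vB B) - f x - (\<Sum>b\<in>B. (v \<bullet> b) *R pdiff b f x))"
     using insert(1,2) by (simp add: g_def vB_def z_def c_def algebra_simps)
    have "norm (f (x + vB (insert b B)) - f x - (\<Sum>b\<in>insert b B. (v \<bullet> b) *R pdiff b f x))
     <= e/N*norm v + real (card B)*(e/N*norm v)"
     unfolding eq by (rule order_trans[OF norm_triangle_ineq add_mono[OF 1 insert.IH[OF b(2)]]])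
    also have "... = real (card (insert b B))*(e/N*norm v)" using insert(1,2) by (simp add: distrib_right add_divide_distrib)
    finally show ?case .
   qed (simp add: vB_def)
   from this[of Basis] have "norm (f (x + v) - f x - (\<Sum>b\<in>Basis. (v \<bullet> b) *R pdiff b f x)) <= N*(e/N*norm v)"
    by (simp add: vB_def euclidean_representation N_def)
   then show ?thesis using N by (simp add: v_def)
  qed
  then show "\<exists>d>0. \<forall>y. norm (y - x) < d --> norm (f y - f x - (\<Sum>b\<in>Basis. ((y - x) \<bullet> b) *R pdiff b f x)) <= e*norm (y - x)"
   using d(1) N by (intro exI[of _ "d/N"]) auto
 qed
qed

text \<open>All iterated partial derivatives stay in a family that is closed under partial
  differentiation, so continuity of its members suffices.\<close>

lemma smooth_openI_closed_family:
 fixes f :: "'a::euclidean_space => 'b::real_normed_vector"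
 assumes X: "!!f. f \<in> X ==> continuous_on UNIV f"
  and dX: "!!f b. f \<in> X ==> b \<in> Basis ==> \<exists>F\<in>X. \<forall>x. ((%t. f (x + t *R b)) has_vector_derivative F x) (at 0)"
  and f: "f \<in> X"
 shows "smooth_open UNIV f"
proof -
 have pd: "pdiff b f \<in> X & (\<forall>x. ((%t. f (x + t *R b)) has_vector_derivative pdiff b f x) (at 0))" if "f \<in> X" "b \<in> Basis" for f b
 proof -
  obtain F where F: "F \<in> X" "!!x. ((%t. f (x + t *R b)) has_vector_derivative F x) (at 0)" using dX[OF \<open>f \<in> X\<close> \<open>b \<in> Basis\<close>] by blast
  have "pdiff b f = F" unfolding pdiff_def by (intro ext vector_derivative_at F)
  then show ?thesis using F by simp
 qed
 have in_X: "pdiffs vs f \<in> X" if "set vs \<subseteq> Basis" for vs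
  using that f pd by (induction vs) auto
 show ?thesis unfolding smooth_open_def using in_X X pd by auto
qed

section \<open>A smooth bump function\<close>

text \<open>With z = 1/y one has d/dy = -z^2 d/dz, so the i-th derivative of exp(-1/y) is the
  polynomial \<open>flat_poly i\<close> at z times exp(-z).\<close>

fun flat_poly :: "nat => real poly" where
 "flat_poly 0 = 1"
| "flat_poly (Suc i) = [:0, 0, 1:]*(flat_poly i - pderiv (flat_poly i))"

definition flat :: "nat => real => real" where
 "flat i y = (if y > 0 then poly (flat_poly i) (1/y)*exp (- (1/y)) else 0)"

lemma poly_exp_tendsto_0: "((%z::real. poly p z*exp (- z)) \<longlongrightarrow> 0) at_top"
proof -
 have "((%z. \<Sum>i\<le>degree p. coeff p i*(z^i/exp z)) \<longlongrightarrow> (\<Sum>i\<le>degree p. coeff p i*0)) at_top"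
  by (intro tendsto_intros tendsto_power_div_exp_0)
 then show ?thesis by (simp add: poly_altdef exp_minus sum_distrib_right sum_divide_distrib field_simps)
qed

lemma flat_deriv: "(flat i has_real_derivative flat (Suc i) y) (at y)"
proof -
 consider "y > 0" | "y < 0" | "y = 0" by linarith
 then show ?thesis
 proof cases
  case 1
  have "((%y. poly (flat_poly i) (1/y)*exp (- (1/y))) has_real_derivative flat (Suc i) y) (at y)"
   using 1 by (auto intro!: derivative_eq_intros simp: flat_def) (simp add: field_simps power2_eq_square)
  then show ?thesis
   by (rule has_field_derivative_transform_within_open[of _ _ _ "{0<..}"]) (use 1 in \<open>auto simp: flat_def\<close>)
 next
  case 2
  have "((%y. 0) has_real_derivative flat (Suc i) y) (at y)" using 2 by (simp add: flat_def)
  then show ?thesis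
   by (rule has_field_derivative_transform_within_open[of _ _ _ "{..<0}"]) (use 2 in \<open>auto simp: flat_def\<close>)
 next
  case 3
  have "((%y. flat i y/y) \<longlongrightarrow> 0) (at_right 0)"
  proof -
   have "((%y. poly q (1/y)*exp (- (1/y))) \<longlongrightarrow> 0) (at_right (0::real))" for q
    using filterlim_compose[OF poly_exp_tendsto_0[of q] filterlim_inverse_at_top_right] by (simp add: inverse_eq_divide)
   from this[of "[:0, 1:]*flat_poly i"]
   have "((%y. poly ([:0, 1:]*flat_poly i) (1/y)*exp (- (1/y))) \<longlongrightarrow> 0) (at_right (0::real))" .
   then show ?thesis
    by (rule Lim_transform_eventually) (auto simp: eventually_at_right_field flat_def intro!: exI[of _ 1])
  qed
  moreover have "((%y. flat i y/y) \<longlongrightarrow> 0) (at_left 0)"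
   by (rule Lim_transform_eventually[OF tendsto_const]) (auto simp: eventually_at_left_field flat_def intro!: exI[of _ "-1"])
  ultimately have "((%y. flat i y/y) \<longlongrightarrow> 0) (at 0)" by (simp add: filterlim_split_at)
  then show ?thesis using 3 by (simp add: has_field_derivative_iff flat_def)
 qed
qed

text \<open>A family closed under partial differentiation that contains the bump functions; the
  index i of \<open>flat\<close> absorbs the derivatives.\<close>

inductive_set tfun :: "('a::euclidean_space => real) set" where
 base: "b \<in> Basis ==> (%x. flat i (c + s*(x \<bullet> b))) \<in> tfun"
| const: "(%_. c) \<in> tfun"
| add: "f \<in> tfun ==> g \<in> tfun ==> (%x. f x + g x) \<in> tfun"
| mult: "f \<in> tfun ==> g \<in> tfun ==> (%x. f x*g x) \<in> tfun"

lemma tfun_prod: "finite B ==> (!!b. b \<in> B ==> f b \<in> tfun) ==> (%x. \<Prod>b\<in>B. f b x) \<in> tfun"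
 by (induction B rule: finite_induct) (auto intro: tfun.intros)

lemma tfun_smooth:
 fixes f :: "'a::euclidean_space => real"
 assumes "f \<in> tfun" shows "smooth_open UNIV f"
proof (rule smooth_openI_closed_family[OF _ _ assms])
 have flat_cont: "continuous_on S (flat i)" for S i
  using DERIV_continuous[OF flat_deriv] by (simp add: continuous_at_imp_continuous_on)
 show "continuous_on UNIV f" if "f \<in> tfun" for f :: "'a => real"
  using that by induction (auto intro!: continuous_intros continuous_on_compose2[OF flat_cont[of UNIV]])
 show "\<exists>F\<in>tfun. \<forall>x. ((%t. f (x + t *R b)) has_vector_derivative F x) (at 0)" if "f \<in> tfun" "b \<in> Basis" for f :: "'a => real" and b
  using that(1)
 proof induction
  case (base b' i c s)
  have "((%t. flat i (c + s*((x + t *R b) \<bullet> b'))) has_vector_derivative flat (Suc i) (c + s*(x \<bullet> b'))*(s*(b \<bullet> b'))) (at 0)" for x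
   unfolding has_real_derivative_iff_has_vector_derivative[symmetric]
   by (rule DERIV_chain'[OF _ flat_deriv, THEN DERIV_cong]) (auto intro!: derivative_eq_intros simp: inner_add_left)
  moreover have "(%x. flat (Suc i) (c + s*(x \<bullet> b'))*(s*(b \<bullet> b'))) \<in> tfun" using base by (intro tfun.intros)
  ultimately show ?case by (intro bexI[of _ "%x. flat (Suc i) (c + s*(x \<bullet> b'))*(s*(b \<bullet> b'))"] allI)
 next
  case (const c)
  show ?case by (intro bexI[of _ "%_. 0"] tfun.const) simp
 next
  case (add f g)
  then obtain F G where "F \<in> tfun" "G \<in> tfun" "!!x. ((%t. f (x + t *R b)) has_vector_derivative F x) (at 0)"
   "!!x. ((%t. g (x + t *R b)) has_vector_derivative G x) (at 0)" by blast
  then show ?case by (intro bexI[of _ "%x. F x + G x"] tfun.add allI has_vector_derivative_add)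
 next
  case (mult f g)
  then obtain F G where FG: "F \<in> tfun" "G \<in> tfun" "!!x. ((%t. f (x + t *R b)) has_vector_derivative F x) (at 0)"
   "!!x. ((%t. g (x + t *R b)) has_vector_derivative G x) (at 0)" by blast
  have "((%t. f (x + t *R b)*g (x + t *R b)) has_vector_derivative f x*G x + F x*g x) (at 0)" for x
   using has_vector_derivative_mult[OF FG(3,4)[of x]] by simp
  moreover have "(%x. f x*G x + F x*g x) \<in> tfun" using FG mult by (intro tfun.intros)
  ultimately show ?case by (intro bexI[of _ "%x. f x*G x + F x*g x"] allI)
 qed
qed

text \<open>The two flat factors for b vanish unless the coordinate of x - p along b is below r in
  modulus, so the support is a cube, contained in the ball of radius \<open>DIM('a)*r\<close>. The
  total mass is not normalised.\<close>

definition bump :: "real => 'a::euclidean_space => 'a => real" where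
 "bump r p x = (\<Prod>b\<in>Basis. flat 0 (1 + (x - p) \<bullet> b/r)*flat 0 (1 - (x - p) \<bullet> b/r))"

lemma flat_0_bounds: "0 <= flat 0 y" "flat 0 y <= 1" by (auto simp: flat_def)

lemma bump_bounds: "0 <= bump r p x" "bump r p x <= 1"
 unfolding bump_def by (auto intro!: prod_nonneg prod_le_1 mult_le_one mult_nonneg_nonneg flat_0_bounds)

lemma bump_scale: "bump r p x = bump 1 0 ((1/r) *R (x - p))"
 by (simp add: bump_def)

lemma bump_pos: "bump r p p > 0"
 by (auto simp: bump_def flat_def intro!: prod_pos)

lemma bump_support:
 fixes p :: "'a::euclidean_space" and r :: real
 assumes "bump r p x \<noteq> 0" "r > 0" shows "x \<in> ball p (DIM('a)*r)"
proof -
 have "\<bar>(x - p) \<bullet> b\<bar> < r" if b: "b \<in> Basis" for b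
 proof -
  have "flat 0 (1 + (x - p) \<bullet> b/r)*flat 0 (1 - (x - p) \<bullet> b/r) \<noteq> 0" using assms(1) b by (auto simp: bump_def)
  then have "0 < 1 + (x - p) \<bullet> b/r" "0 < 1 - (x - p) \<bullet> b/r" by (auto simp: flat_def split: if_splits)
  then show ?thesis using assms(2) by (auto simp: field_simps abs_less_iff)
 qed
 then have "(\<Sum>b\<in>Basis. \<bar>(x - p) \<bullet> b\<bar>) < (\<Sum>b\<in>(Basis::'a set). r)" by (intro sum_strict_mono) auto
 then have "norm (x - p) < DIM('a)*r" using norm_le_l1[of "x - p"] by simp
 then show ?thesis by (simp add: dist_norm norm_minus_commute)
qed

lemma bump_tfun: "bump r p \<in> tfun"
proof -
 have "(%x. flat 0 (1 + (x - p) \<bullet> b/r)*flat 0 (1 - (x - p) \<bullet> b/r)) \<in> tfun" if b: "b \<in> Basis" for b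
 proof -
  have "(%x. flat 0 ((1 - p \<bullet> b/r) + (1/r)*(x \<bullet> b))*flat 0 ((1 + p \<bullet> b/r) + (- (1/r))*(x \<bullet> b))) \<in> tfun"
   by (intro tfun.mult tfun.base b)
  then show ?thesis by (simp add: inner_diff_left diff_divide_distrib algebra_simps)
 qed
 then show ?thesis unfolding bump_def[abs_def] by (intro tfun_prod) auto
qed

lemma bump_test_fn:
 fixes p :: "'a::euclidean_space" and r :: real
 assumes "r > 0" "cball p (DIM('a)*r) \<subseteq> Om" shows "test_fn Om (bump r p)"
proof -
 have "{x. bump r p x \<noteq> 0} \<subseteq> cball p (DIM('a)*r)" using bump_support[of r p] assms(1) by force
 then have "closure {x. bump r p x \<noteq> 0} \<subseteq> cball p (DIM('a)*r)" by (intro closure_minimal) auto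
 then show ?thesis unfolding test_fn_def using tfun_smooth[OF bump_tfun] assms(2)
  by (metis bounded_cball bounded_subset closed_closure compact_eq_bounded_closed order_trans)
qed

section \<open>Weak gradients are upper gradients\<close>

lemma bump_measurable [measurable]: "(%x. bump r (f x) (g x)) \<in> borel_measurable M"
 if "f \<in> borel_measurable M" "g \<in> borel_measurable M"
proof -
 have [measurable]: "flat 0 \<in> BM"
  using DERIV_continuous[OF flat_deriv] by (intro borel_measurable_continuous_onI) (simp add: continuous_at_imp_continuous_on)
 show ?thesis using that unfolding bump_def by measurable
qed

lemma sum_Basis_inner:
 fixes b :: "'a::euclidean_space" and F :: "'a => 'b::real_vector"
 assumes "b \<in> Basis" shows "(\<Sum>c\<in>Basis. (b \<bullet> c) *R F c) = F b"
proof -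
 have "(\<Sum>c\<in>Basis. (b \<bullet> c) *R F c) = (\<Sum>c\<in>Basis. if c = b then F c else 0)"
  using assms by (intro sum.cong) (auto simp: inner_Basis)
 then show ?thesis using assms by simp
qed

lemma bump_derivative:
 fixes x :: "'a::euclidean_space"
 shows "(bump r p has_derivative (%v. \<Sum>b\<in>Basis. (v \<bullet> b) *R pdiff b (bump r p) x)) (at x)"
 by (rule smooth_open_has_derivative[OF tfun_smooth[OF bump_tfun]]) simp

lemma pdiff_bump:
 fixes x :: "'a::euclidean_space" and r :: real
 assumes b: "b \<in> Basis" and r: "r > 0"
 shows "pdiff b (bump r p) x = (1/r)*pdiff b (bump 1 0) ((1/r) *R (x - p))"
proof -
 let ?L = "%x v. \<Sum>b\<in>Basis. (v \<bullet> b) *R pdiff b (bump 1 (0::'a)) x"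
 have "((%x. (1/r) *R (x - p)) has_derivative (%v. (1/r) *R v)) (at x)"
  by (auto intro!: derivative_eq_intros)
 note d = this
 have eq: "bump r p = (%x. bump 1 0 ((1/r) *R (x - p)))" by (rule ext) (rule bump_scale)
 have "(bump r p has_derivative (%v. ?L ((1/r) *R (x - p)) ((1/r) *R v))) (at x)"
  unfolding eq by (rule has_derivative_compose[OF d bump_derivative[of 1 0]])
 from has_derivative_unique[OF bump_derivative this]
 have "(\<Sum>c\<in>Basis. (b \<bullet> c) *R pdiff c (bump r p) x) = ?L ((1/r) *R (x - p)) ((1/r) *R b)" by meson
 also have "... = (1/r)*(\<Sum>c\<in>Basis. (b \<bullet> c)*pdiff c (bump 1 (0::'a)) ((1/r) *R (x - p)))"
  by (simp add: sum_distrib_left mult.assoc)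
 finally show ?thesis using sum_Basis_inner[OF b, of "%c. pdiff c (bump r p) x"]
   sum_Basis_inner[OF b, of "%c. pdiff c (bump 1 (0::'a)) ((1/r) *R (x - p))"] by simp
qed

lemma pdiff_bump_cont: "b \<in> Basis ==> continuous_on UNIV (pdiff b (bump r p))"
 using tfun_smooth[OF bump_tfun, of r p] unfolding smooth_open_def by (auto dest!: spec[of _ "[b]"])

lemma pdiff_bump_0:
 fixes x :: "'a::euclidean_space" and r :: real
 assumes b: "b \<in> Basis" and r: "r > 0" and x: "x \<notin> cball p (DIM('a)*r)"
 shows "pdiff b (bump r p) x = 0"
proof -
 have z: "bump r p y = 0" if "y \<in> - cball p (DIM('a)*r)" for y
  using bump_support[of r p y] r that by force
 have "(bump r p has_derivative (%v. 0)) (at x)"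
 proof (rule has_derivative_transform_within_open[OF has_derivative_const[of 0]])
  show "open (- cball p (DIM('a)*r))" by auto
 qed (use x z in auto)
 from has_derivative_unique[OF bump_derivative this]
 have "(\<Sum>c\<in>Basis. (b \<bullet> c) *R pdiff c (bump r p) x) = 0" by meson
 then show ?thesis using sum_Basis_inner[OF b, of "%c. pdiff c (bump r p) x"] by simp
qed

lemma pdiff_bump_bounded:
 assumes b: "b \<in> (Basis :: 'a::euclidean_space set)"
 obtains C where "!!x. \<bar>pdiff b (bump 1 (0::'a)) x\<bar> <= C"
proof -
 have "compact (pdiff b (bump 1 (0::'a)) ` cball 0 (DIM('a)*1))"
  using continuous_on_subset[OF pdiff_bump_cont[OF b]] by (intro compact_continuous_image) auto
 from compact_imp_bounded[OF this] obtain C where "\<forall>y\<in>pdiff b (bump 1 (0::'a)) ` cball 0 (DIM('a)*1). norm y <= C"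
  unfolding bounded_iff by blast
 then have C: "\<bar>pdiff b (bump 1 (0::'a)) x\<bar> <= C" if "x \<in> cball 0 (DIM('a)*1)" for x using that by auto
 have "\<bar>pdiff b (bump 1 (0::'a)) x\<bar> <= max C 0" for x
  using C[of x] pdiff_bump_0[OF b, of 1 x 0] by (cases "x \<in> cball 0 (DIM('a)*1)") (auto simp: max_def)
 then show ?thesis using that by blast
qed

lemma bump_line_derivative:
 fixes x p h :: "'a::euclidean_space"
 assumes r: "r > 0"
 shows "((%ta. bump r (p + ta *R h) x) has_real_derivative - (\<Sum>b\<in>Basis. (h \<bullet> b)*pdiff b (bump r (p + ta *R h)) x)) (at ta within S)"
proof -
 let ?L = "%x v. \<Sum>b\<in>Basis. (v \<bullet> b) *R pdiff b (bump 1 (0::'a)) x"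
 have "((%ta. (1/r) *R (x - (p + ta *R h))) has_derivative (%s. (1/r) *R (- s *R h))) (at ta)"
  by (auto intro!: derivative_eq_intros)
 then have "((%ta. bump r (p + ta *R h) x) has_derivative (%s. ?L ((1/r) *R (x - (p + ta *R h))) ((1/r) *R (- s *R h)))) (at ta)"
  unfolding bump_scale[of r _ x] by (rule has_derivative_compose[OF _ bump_derivative[of 1 0]])
 also have "(%s. ?L ((1/r) *R (x - (p + ta *R h))) ((1/r) *R (- s *R h))) = (*) (- (\<Sum>b\<in>Basis. (h \<bullet> b)*pdiff b (bump r (p + ta *R h)) x))"
  by (auto simp: fun_eq_iff pdiff_bump[OF _ r] sum_distrib_left sum_negf[symmetric] mult_ac intro!: sum.cong)
 finally show ?thesis unfolding has_field_derivative_def by (rule has_derivative_at_withinI)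
qed

text \<open>The integral of v against the bump, as a function of its centre, has as derivative the
  integral of G against the bump. The increment from p to p + h is obtained by the fundamental
  theorem along the segment, Fubini, and the weak gradient identity for each intermediate
  bump.\<close>

lemma weak_grad_mollified:
 fixes v :: "'a::euclidean_space => real" and G :: "'a => 'a"
 assumes v[measurable]: "integrable lborel v" and G[measurable]: "integrable lborel G" and r: "r > 0"
  and weak: "!!ta b. ta \<in> {0..1} ==> b \<in> Basis ==>
   (LINT x|lborel. v x*pdiff b (bump r (p + ta *R h)) x) = - (LINT x|lborel. (G x \<bullet> b) * bump r (p + ta *R h) x)"
 shows "en \<bar>(LINT x|lborel. v x * bump r (p + h) x) - (LINT x|lborel. v x * bump r p x)\<bar>
  <= en (norm h)*(LI ta:{0..1}. (LI x. en (norm (G x) * bump r (p + ta *R h) x)))"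
proof -
 have [measurable]: "v \<in> BM" "G \<in> BM" using v G by auto
 define D where "D ta x = (\<Sum>b\<in>Basis. (h \<bullet> b)*pdiff b (bump r (p + ta *R h)) x)" for ta x
 have pm: "pdiff b (bump 1 (0::'a)) \<in> BM" if "b \<in> Basis" for b
  using pdiff_bump_cont[OF that] by (rule borel_measurable_continuous_onI)
 have D_eq: "D = (%ta x. (\<Sum>b\<in>Basis. (h \<bullet> b)*((1/r)*pdiff b (bump 1 0) ((1/r) *R (x - (p + ta *R h))))))"
  unfolding D_def by (intro ext sum.cong refl) (simp add: pdiff_bump[OF _ r])
 have Dm: "(%z. D (fst z) (snd z)) \<in> borel_measurable (borel \<Otimes>\<^sub>M borel)"
 proof -
  have "(%z. pdiff b (bump 1 (0::'a)) ((1/r) *R (snd z - (p + fst z *R h)))) \<in> borel_measurable (borel \<Otimes>\<^sub>M borel)" if "b \<in> Basis" for b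
   by (rule measurable_compose[OF _ pm[OF that]]) measurable
  then show ?thesis unfolding D_eq by (intro borel_measurable_sum borel_measurable_times borel_measurable_const)
 qed
 have "\<exists>C. \<forall>ta x. \<bar>D ta x\<bar> <= C"
 proof -
  have "\<exists>C. \<forall>x. \<bar>pdiff b (bump 1 (0::'a)) x\<bar> <= C" if "b \<in> Basis" for b using pdiff_bump_bounded[OF that] by metis
  then obtain C where C: "!!b x. b \<in> Basis ==> \<bar>pdiff b (bump 1 (0::'a)) x\<bar> <= C b" by metis
  have "\<bar>D ta x\<bar> <= (\<Sum>b\<in>Basis. \<bar>h \<bullet> b\<bar>*((1/r)*C b))" for ta x
   unfolding D_eq by (rule order_trans[OF sum_abs]) (use C r in \<open>auto simp: abs_mult intro!: sum_mono mult_left_mono divide_right_mono\<close>)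
  then show ?thesis by blast
 qed
 then obtain C where C: "!!ta x. \<bar>D ta x\<bar> <= C" by blast
 then have C0: "C >= 0" by (meson abs_ge_zero order_trans)
 have FTC: "bump r (p + h) x - bump r p x = - (LINT ta:{0..1}|lborel. D ta x)" for x
 proof -
  have cont: "continuous_on {0..1} (%ta. - D ta x)"
   unfolding D_eq
   by (intro continuous_intros continuous_on_compose2[OF pdiff_bump_cont[of _ 1 0]]) auto
  have "(LINT ta|lborel. chi {0..1} ta *R (- D ta x)) = bump r (p + 1 *R h) x - bump r (p + 0 *R h) x"
  proof (rule integral_FTC_Icc[OF _ _ cont])
   show "((%ta. bump r (p + ta *R h) x) has_vector_derivative - D ta x) (at ta within {0..1})" for ta
    using bump_line_derivative[OF r, of p h x] unfolding D_def has_real_derivative_iff_has_vector_derivative .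
  qed simp
  then show ?thesis by (simp add: set_lebesgue_integral_def)
 qed
 define F where "F x ta = v x*(chi {0..1} ta*D ta x)" for x ta
 have Fm: "case_prod F \<in> borel_measurable (lborel \<Otimes>\<^sub>M lborel)"
 proof -
  have "(%z. v (fst z)*(chi {0..1::real} (snd z)*D (fst (snd z, fst z)) (snd (snd z, fst z)))) \<in> borel_measurable (lborel \<Otimes>\<^sub>M lborel)"
   by (intro borel_measurable_times measurable_compose[OF _ Dm]) measurable
  then show ?thesis by (simp add: F_def case_prod_beta')
 qed
 have Fi: "integrable (lborel \<Otimes>\<^sub>M lborel) (case_prod F)"
 proof (rule integrableI_bounded[OF Fm])
  have "(\<integral>\<^sup>+z. en (norm (case_prod F z)) \<partial>(lborel \<Otimes>\<^sub>M lborel)) = (LI x. LI ta. en (norm (F x ta)))"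
   using Fm by (subst lborel.nn_integral_fst[symmetric]) auto
  also have "... <= (LI x. LI ta. en \<bar>v x\<bar>*en C*chi {0..1::real} ta)"
   by (intro nn_integral_mono) (use C C0 in \<open>auto simp: F_def abs_mult indicator_def simp flip: ennreal_mult intro!: ennreal_leI mult_left_mono\<close>)
  also have "... = (LI x. en \<bar>v x\<bar>)*en C"
   by (simp add: nn_integral_cmult nn_integral_multc)
  also have "... < \<infinity>" using v by (auto simp: integrable_iff_bounded ennreal_mult_less_top)
  finally show "(\<integral>\<^sup>+z. en (norm (case_prod F z)) \<partial>(lborel \<Otimes>\<^sub>M lborel)) < \<infinity>" .
 qed
 have vb: "integrable lborel (%x. v x * bump r q x)" for q
  by (rule Bochner_Integration.integrable_bound[OF v]) (auto simp: abs_mult bump_bounds intro!: mult_left_le)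
 have Gb: "integrable lborel (%x. (G x \<bullet> b) * bump r q x)" for q b
 proof (rule Bochner_Integration.integrable_bound[of _ "%x. norm b*norm (G x)"])
  show "AE x in lborel. norm ((G x \<bullet> b) * bump r q x) <= norm (norm b*norm (G x))"
  proof (intro AE_I2)
   fix x
   have "norm ((G x \<bullet> b) * bump r q x) <= norm (G x \<bullet> b)" by (auto simp: abs_mult bump_bounds intro!: mult_left_le)
   also have "... <= norm (norm b*norm (G x))" using Cauchy_Schwarz_ineq2[of "G x" b] by (simp add: mult.commute)
   finally show "norm ((G x \<bullet> b) * bump r q x) <= norm (norm b*norm (G x))" .
  qed
 qed (use G in auto)
 have vp: "integrable lborel (%x. v x*pdiff b (bump r q) x)" if b: "b \<in> Basis" for q b
 proof -
  obtain C where C: "!!x. \<bar>pdiff b (bump 1 (0::'a)) x\<bar> <= C" using pdiff_bump_bounded[OF b] by blast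
  have "pdiff b (bump r q) \<in> BM" using pdiff_bump_cont[OF b] by (rule borel_measurable_continuous_onI)
  note [measurable] = this
  show ?thesis
  proof (rule Bochner_Integration.integrable_bound[of _ "%x. (1/r*C) * v x"])
   show "AE x in lborel. norm (v x*pdiff b (bump r q) x) <= norm ((1/r*C) * v x)"
   proof (rule AE_I2)
    fix x
    have "\<bar>pdiff b (bump r q) x\<bar> <= 1/r*C"
     using C[of "(1/r) *R (x - q)"] r by (simp add: pdiff_bump[OF b r] abs_mult divide_right_mono)
    then have "\<bar>v x\<bar>*\<bar>pdiff b (bump r q) x\<bar> <= \<bar>v x\<bar>*\<bar>1/r*C\<bar>"
     by (intro mult_left_mono[OF order_trans[OF _ abs_ge_self]]) auto
    then show "norm (v x*pdiff b (bump r q) x) <= norm ((1/r*C) * v x)"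
     unfolding real_norm_def abs_mult by (simp only: mult.commute)
   qed
  qed (use v in auto)
 qed
 have inner: "(LINT x|lborel. F x ta) = - (chi {0..1} ta*(LINT x|lborel. (G x \<bullet> h) * bump r (p + ta *R h) x))" for ta
 proof (cases "ta \<in> {0..1}")
  case True
  have "(LINT x|lborel. F x ta) = (LINT x|lborel. (\<Sum>b\<in>Basis. (h \<bullet> b)*(v x*pdiff b (bump r (p + ta *R h)) x)))"
   using True by (intro Bochner_Integration.integral_cong refl) (simp add: F_def D_def sum_distrib_left mult_ac)
  also have "... = (\<Sum>b\<in>Basis. (h \<bullet> b)*(LINT x|lborel. v x*pdiff b (bump r (p + ta *R h)) x))"
   using vp by (subst Bochner_Integration.integral_sum) auto
  also have "... = (\<Sum>b\<in>Basis. - ((h \<bullet> b)*(LINT x|lborel. (G x \<bullet> b) * bump r (p + ta *R h) x)))"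
   using weak[OF True] by (intro sum.cong) auto
  also have "... = - (LINT x|lborel. (\<Sum>b\<in>Basis. (h \<bullet> b)*((G x \<bullet> b) * bump r (p + ta *R h) x)))"
   using Gb by (subst Bochner_Integration.integral_sum) (auto simp: sum_negf)
  also have "... = - (LINT x|lborel. (G x \<bullet> h) * bump r (p + ta *R h) x)"
  proof -
   have "(\<Sum>b\<in>Basis. (h \<bullet> b)*((G x \<bullet> b)*c)) = (G x \<bullet> h)*c" for x c
    unfolding euclidean_inner[of "G x" h] by (simp add: sum_distrib_left sum_distrib_right mult_ac)
   then show ?thesis by simp
  qed
  finally show ?thesis using True by simp
 qed (simp add: F_def)
 have "(LINT x|lborel. v x * bump r (p + h) x) - (LINT x|lborel. v x * bump r p x) = (LINT x|lborel. v x*(bump r (p + h) x - bump r p x))"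
  using vb by (simp add: right_diff_distrib)
 also have "... = (LINT x|lborel. - (LINT ta|lborel. F x ta))"
  unfolding FTC F_def by (simp add: set_lebesgue_integral_def)
 also have "... = - (LINT x|lborel. LINT ta|lborel. F x ta)" by simp
 also have "(LINT x|lborel. LINT ta|lborel. F x ta) = (LINT ta|lborel. LINT x|lborel. F x ta)"
  by (rule lborel_pair.Fubini_integral[symmetric]) (rule Fi)
 also have "- ... = (LINT ta|lborel. chi {0..1} ta*(LINT x|lborel. (G x \<bullet> h) * bump r (p + ta *R h) x))"
  unfolding inner by simp
 finally have eq: "(LINT x|lborel. v x * bump r (p + h) x) - (LINT x|lborel. v x * bump r p x) = ..." .
 \<comment> \<open>A non-integrable function has Bochner integral 0, which covers the second
   case.\<close>
 have "en \<bar>...\<bar> <= (LI ta. en \<bar>chi {0..1} ta*(LINT x|lborel. (G x \<bullet> h) * bump r (p + ta *R h) x)\<bar>)"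
  using integral_norm_bound_ennreal[of lborel "%ta. chi {0..1} ta*(LINT x|lborel. (G x \<bullet> h) * bump r (p + ta *R h) x)"]
  by (cases "integrable lborel (%ta. chi {0..1} ta*(LINT x|lborel. (G x \<bullet> h) * bump r (p + ta *R h) x))")
    (auto simp: not_integrable_integral_eq)
 also have "... <= (LI ta. en (norm h)*((LI x. en (norm (G x) * bump r (p + ta *R h) x))*chi {0..1} ta))"
 proof (rule nn_integral_mono)
  fix ta :: real
  have "en \<bar>LINT x|lborel. (G x \<bullet> h) * bump r (p + ta *R h) x\<bar> <= (LI x. en \<bar>(G x \<bullet> h) * bump r (p + ta *R h) x\<bar>)"
   using integral_norm_bound_ennreal[OF Gb[of h "p + ta *R h"]] by simp
  also have "... <= (LI x. en (norm h)*en (norm (G x) * bump r (p + ta *R h) x))"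
  proof (rule nn_integral_mono)
   fix x
   have "\<bar>(G x \<bullet> h) * bump r (p + ta *R h) x\<bar> <= (norm (G x)*norm h) * bump r (p + ta *R h) x"
    using Cauchy_Schwarz_ineq2[of "G x" h] by (simp add: abs_mult bump_bounds mult_right_mono)
   then show "en \<bar>(G x \<bullet> h) * bump r (p + ta *R h) x\<bar> <= en (norm h)*en (norm (G x) * bump r (p + ta *R h) x)"
    by (simp flip: ennreal_mult add: ennreal_leI bump_bounds mult_ac)
  qed
  also have "... = en (norm h)*(LI x. en (norm (G x) * bump r (p + ta *R h) x))"
   by (rule nn_integral_cmult) measurable
  finally show "en \<bar>chi {0..1} ta*(LINT x|lborel. (G x \<bullet> h) * bump r (p + ta *R h) x)\<bar>
    <= en (norm h)*((LI x. en (norm (G x) * bump r (p + ta *R h) x))*chi {0..1} ta)"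
   by (auto simp: indicator_def)
 qed
 also have "... = en (norm h)*(LI ta:{0..1}. (LI x. en (norm (G x) * bump r (p + ta *R h) x)))"
  by (rule nn_integral_cmult) measurable
 finally show ?thesis unfolding eq .
qed

lemma rep_integrable:
 fixes f :: "'a::euclidean_space => 'b::euclidean_space"
 assumes K[measurable]: "K \<in> sets borel" and KOm: "K \<subseteq> Om" and f: "set_integrable lebesgue K f"
  and v[measurable]: "v \<in> BM" and eq: "AE x in lborel. x \<in> Om --> v x = f x"
 shows "integrable lborel (%x. ind K x *R v x)"
proof -
 have leb: "AE x in lebesgue. x \<in> Om --> v x = f x" using eq by (auto intro: AE_completion)
 have "integrable lebesgue (%x. ind K x *R v x)"
  using f unfolding set_integrable_def
  by (rule integrable_cong_AE_imp) (use leb KOm in \<open>auto elim!: eventually_mono simp: indicator_def intro: measurable_completion\<close>)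
 then show ?thesis by (subst (asm) integrable_completion) auto
qed

lemma LINT_rep:
 fixes f v \<psi> :: "'a::euclidean_space => real"
 assumes K[measurable]: "K \<in> sets borel" and KOm: "K \<subseteq> Om" and f: "set_integrable lebesgue K f"
  and v[measurable]: "v \<in> BM" and eq: "AE x in lborel. x \<in> Om --> v x = f x"
  and \<psi>[measurable]: "\<psi> \<in> BM" and \<psi>0: "!!x. x \<notin> K ==> \<psi> x = 0"
 shows "(LINT x:Om|lebesgue. f x*\<psi> x) = (LINT x|lborel. v x*\<psi> x)"
proof -
 have leb: "AE x in lebesgue. x \<in> Om --> v x = f x" using eq by (auto intro: AE_completion)
 have mf: "(%x. ind K x *R f x) \<in> borel_measurable lebesgue"
  using f unfolding set_integrable_def by (rule borel_measurable_integrable)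
 have "(LINT x:Om|lebesgue. f x*\<psi> x) = (LINT x|lebesgue. (ind K x *R f x)*\<psi> x)"
  unfolding set_lebesgue_integral_def
  by (intro Bochner_Integration.integral_cong refl) (use \<psi>0 KOm in \<open>auto simp: indicator_def\<close>)
 also have "... = (LINT x|lebesgue. v x*\<psi> x)"
 proof (rule integral_cong_AE)
  show "AE x in lebesgue. (ind K x *R f x)*\<psi> x = v x*\<psi> x"
   using leb by eventually_elim (use KOm \<psi>0 in \<open>auto simp: indicator_def\<close>)
  show "(%x. (ind K x *R f x)*\<psi> x) \<in> borel_measurable lebesgue"
   by (intro borel_measurable_times mf measurable_completion) simp
  show "(%x. v x*\<psi> x) \<in> borel_measurable lebesgue" by (intro measurable_completion) simp
 qed
 also have "... = (LINT x|lborel. v x*\<psi> x)" by (intro integral_completion) auto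
 finally show ?thesis .
qed

lemma ennreal_bump_integral:
 fixes F :: "'a::euclidean_space => real"
 assumes [measurable]: "F \<in> BM" and nn: "!!x. 0 <= F x"
 shows "(LI x. en (F x * bump r q x)) <= en (F q)*(LI x. en (bump r q x))
   + (LI x. en \<bar>F x - F q\<bar>*en (bump r q x))"
proof -
 have "(LI x. en (F x * bump r q x)) <= (LI x. en (F q)*en (bump r q x) + en \<bar>F x - F q\<bar>*en (bump r q x))"
 proof (rule nn_integral_mono)
  fix x
  have "F x * bump r q x <= (F q + \<bar>F x - F q\<bar>) * bump r q x" by (intro mult_right_mono bump_bounds) auto
  then show "en (F x * bump r q x) <= en (F q)*en (bump r q x) + en \<bar>F x - F q\<bar>*en (bump r q x)"
   using nn[of q] by (simp flip: ennreal_mult ennreal_plus add: bump_bounds ennreal_leI distrib_right)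
 qed
 also have "... = en (F q)*(LI x. en (bump r q x)) + (LI x. en \<bar>F x - F q\<bar>*en (bump r q x))"
  by (simp add: nn_integral_add nn_integral_cmult)
 finally show ?thesis .
qed

text \<open>The mollified inequality differs from the pointwise one by mean oscillations at the two
  ends and along the segment. Integrated over p these tend to 0, so for each h they vanish at almost
  every p along a subsequence of scales.\<close>

lemma upgrad_if_weak_grad:
 fixes u v :: "'a::euclidean_space => real" and g G :: "'a => 'a"
 assumes wg: "weak_grad Om u g" and Om: "open Om" and Q: "compact Q" "Q \<subseteq> Om"
  and v: "v \<in> BM" "AE x in lborel. x \<in> Om --> v x = u x"
  and G: "G \<in> BM" "AE x in lborel. x \<in> Om --> G x = g x"
 shows "upgrad Q v (%x. norm (G x))"
proof -
 note v(1)[measurable] G(1)[measurable]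
 obtain d where d: "d > 0" "(\<Union>x\<in>Q. cball x d) \<subseteq> Om"
  using compact_subset_open_imp_cball_epsilon_subset[OF Q(1) Om Q(2)] by blast
 \<comment> \<open>A compact neighbourhood of Q in the domain. Cutting off to it makes v and G
   globally integrable and leaves every bump of small radius centred in Q unaffected.\<close>
 define K where "K = {x + y | x y. x \<in> Q & y \<in> cball 0 d}"
 have K: "compact K" unfolding K_def by (intro compact_sums Q) auto
 have QK: "cball x d \<subseteq> K" if "x \<in> Q" for x
 proof
  fix z assume "z \<in> cball x d"
  then have "z = x + (z - x)" "z - x \<in> cball 0 d" by (auto simp: dist_norm norm_minus_commute)
  then show "z \<in> K" unfolding K_def using that by blast
 qed
 have KOm: "K \<subseteq> Om"
 proof
  fix z assume "z \<in> K"
  then obtain x y where "x \<in> Q" "y \<in> cball 0 d" "z = x + y" by (auto simp: K_def)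
  then have "z \<in> cball x d" by (simp add: dist_norm)
  then show "z \<in> Om" using d(2) \<open>x \<in> Q\<close> by blast
 qed
 have [measurable]: "K \<in> sets borel" using K by (intro borel_compact)
 have loc: "set_integrable lebesgue K u" "set_integrable lebesgue K g" using wg K KOm unfolding weak_grad_def by auto
 define v1 where "v1 x = chi K x * v x" for x
 define G1 where "G1 x = ind K x *R G x" for x
 have [measurable]: "v1 \<in> BM" "G1 \<in> BM" unfolding v1_def G1_def by auto
 have iv: "integrable lborel v1" using rep_integrable[OF _ KOm loc(1) v] by (simp add: v1_def[abs_def])
 have iG: "integrable lborel G1" using rep_integrable[OF _ KOm loc(2) G] by (simp add: G1_def[abs_def])
 define N where "N = real DIM('a)"
 have N: "N > 0" by (simp add: N_def)
 define m where "m = (\<integral>\<^sup>+x. en (bump 1 0 x) \<partial>(lborel::'a measure))"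
 have m_fin: "m < \<infinity>"
 proof -
  have "m <= (\<integral>\<^sup>+x. chi (cball 0 N) x \<partial>(lborel::'a measure))"
   unfolding m_def
  proof (rule nn_integral_mono)
   fix x :: 'a
   show "en (bump 1 0 x) <= chi (cball 0 N) x"
   proof (cases "bump 1 0 x = 0")
    case False
    then have "x \<in> cball 0 N" using bump_support[of 1 "0::'a" x] by (simp add: N_def)
    then show ?thesis using bump_bounds[of 1 "0::'a" x] by simp
   qed simp
  qed
  also have "... < \<infinity>" using emeasure_bounded_finite[of "cball (0::'a) N"] by simp
  finally show ?thesis .
 qed
 have m_pos: "m > 0"
 proof -
  define c where "c = bump 1 (0::'a) 0/2"
  have c: "c > 0" "c < bump 1 (0::'a) 0" using bump_pos[of 1 "0::'a"] by (auto simp: c_def)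
  have "isCont (bump 1 (0::'a)) 0" by (rule has_derivative_continuous[OF bump_derivative])
  then have "eventually (%x. c < bump 1 (0::'a) x) (at 0)" using c unfolding isCont_def by (intro order_tendstoD(1)) auto
  then obtain rh where rh: "rh > 0" "!!x::'a. x \<noteq> 0 ==> dist x 0 < rh ==> c < bump 1 0 x" by (auto simp: eventually_at)
  have "0 < en c * vol (ball (0::'a) rh)"
   using c rh by (simp add: emeasure_ball ennreal_zero_less_mult_iff)
  also have "... = (\<integral>\<^sup>+x\<in>ball 0 rh. en c \<partial>(lborel::'a measure))" by (simp add: nn_integral_cmult)
  also have "... <= m" unfolding m_def
  proof (rule nn_integral_mono)
   fix x :: 'a
   show "en c*chi (ball 0 rh) x <= en (bump 1 0 x)"
    using rh(2)[of x] c by (cases "x = 0") (auto simp: indicator_def dist_commute intro!: ennreal_leI)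
  qed
  finally show ?thesis .
 qed
 define m' where "m' = enn2real m"
 have m': "m = en m'" "m' > 0" using m_fin m_pos by (auto simp: m'_def enn2real_positive_iff)
 \<comment> \<open>The support of the bump of radius \<open>r k\<close> then lies in the ball of
   radius 2^-k.\<close>
 define r where "r k = hp k/N" for k :: nat
 have r: "r k > 0" "N*r k = hp k" for k using N by (auto simp: r_def)
 have M: "(LI x. en (bump (r k) q x)) = en (r k^DIM('a))*m" for k and q :: 'a
 proof -
  have "(LI x. en (bump (r k) q x)) = en (\<bar>r k\<bar>^DIM('a))*(LI x. en (bump (r k) q (q + r k *R x)))"
   using r(1)[of k] by (intro nn_integral_affine) auto
  also have "(%x. bump (r k) q (q + r k *R x)) = bump 1 0"
   using r(1)[of k] by (intro ext) (subst bump_scale, simp)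
  finally show ?thesis using r(1)[of k] by (simp add: m_def)
 qed
 \<comment> \<open>Chosen so that the mass of the bump times C times 2^(k*\<open>DIM('a)\<close>)
   equals 1, which expresses weighted oscillations by \<open>mean_osc\<close>.\<close>
 define C where "C = en (N^DIM('a)/m')"
 have C_fin: "C < \<infinity>" by (simp add: C_def)
 have osc: "(LI x. en \<bar>F x - F q\<bar>*en (bump (r k) q x)) <= (en (r k^DIM('a))*m)*(C*mean_osc k F q)"
  if [measurable]: "F \<in> BM" for F :: "'a => real" and q k
 proof -
  have "(LI x. en \<bar>F x - F q\<bar>*en (bump (r k) q x)) <= (dev (ball q (hp k)) F (F q))"
  proof (intro nn_integral_mono)
   fix x
   show "en \<bar>F x - F q\<bar>*en (bump (r k) q x) <= en \<bar>F x - F q\<bar>*chi (ball q (hp k)) x"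
    using bump_support[of "r k" q x] r[of k] bump_bounds[of "r k" q x]
    by (intro mult_left_mono) (auto simp: N_def indicator_def)
  qed
  also have "... = (en (r k^DIM('a))*m)*(C*mean_osc k F q)"
  proof -
   have e1: "m*C = en (N^DIM('a))" using m' N by (simp add: C_def flip: ennreal_mult)
   have "r k^DIM('a)*(N^DIM('a)*2^(k*DIM('a))) = 1"
    using N by (simp add: r_def power_divide power_mult power_mult_distrib power_one_over)
   then have e2: "en (r k^DIM('a))*(en (N^DIM('a))*en (2^(k*DIM('a)))) = 1"
    using N r(1)[of k] by (simp flip: ennreal_mult)
   have "(en (r k^DIM('a))*m)*(C*en (2^(k*DIM('a)))) = en (r k^DIM('a))*((m*C)*en (2^(k*DIM('a))))"
    by (simp only: mult_ac)
   then have "(en (r k^DIM('a))*m)*(C*en (2^(k*DIM('a)))) = 1" unfolding e1 e2 .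
   then have "(dev (ball q (hp k)) F (F q)) = ((en (r k^DIM('a))*m)*(C*en (2^(k*DIM('a)))))*(dev (ball q (hp k)) F (F q))"
    by simp
   then show ?thesis unfolding mean_osc_def by (simp add: mult_ac)
  qed
  finally show ?thesis .
 qed
 define nG where "nG x = norm (G1 x)" for x
 have [measurable]: "nG \<in> BM" unfolding nG_def by measurable
 have inG: "integrable lborel nG" unfolding nG_def using iG by (rule integrable_norm)
 have key: "en \<bar>v1 (p + h) - v1 p\<bar> <= C*mean_osc k v1 p + C*mean_osc k v1 (p + h)
   + en (norm h)*((LI ta:{0..1}. en (nG (p + ta *R h))) + C*(LI ta:{0..1}. mean_osc k nG (p + ta *R h)))"
  if seg: "closed_segment p (p + h) \<subseteq> Q" and k: "hp k < d" for p h k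
 proof -
  define mu where "mu = en (r k^DIM('a))*m"
  have mu: "mu \<noteq> 0" "mu \<noteq> \<infinity>" "mu < \<infinity>" unfolding mu_def using r(1)[of k] m_pos m_fin
   by (auto simp: ennreal_mult_eq_top_iff ennreal_mult_less_top)
  have ibump: "integrable lborel (bump (r k) q)" for q :: 'a
   by (rule integrableI_bounded) (use M[of k q] mu in \<open>auto simp: mu_def[symmetric] bump_bounds\<close>)
  have segQ: "p + ta *R h \<in> Q" if "ta \<in> {0..1}" for ta
  proof -
   have "p + ta *R h = (1 - ta) *R p + ta *R (p + h)" by (simp add: algebra_simps)
   then have "p + ta *R h \<in> closed_segment p (p + h)" using that by (auto simp: closed_segment_def)
   then show ?thesis using seg by blast
  qed
  have weak: "(LINT x|lborel. v1 x*pdiff b (bump (r k) (p + ta *R h)) x) = - (LINT x|lborel. (G1 x \<bullet> b) * bump (r k) (p + ta *R h) x)"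
   if ta: "ta \<in> {0..1}" and b: "b \<in> Basis" for ta b
  proof -
   let ?q = "p + ta *R h"
   have sub: "cball ?q (DIM('a)*r k) \<subseteq> K"
    using QK[OF segQ[OF ta]] subset_cball[of "hp k" d ?q] k r(2)[of k] unfolding N_def by auto
   have zero: "bump (r k) ?q x = 0" "pdiff b (bump (r k) ?q) x = 0" if "x \<notin> K" for x
    using that sub bump_support[OF _ r(1), of k ?q x] pdiff_bump_0[OF b r(1), of x ?q k] ball_subset_cball[of ?q "DIM('a)*r k"] by blast+
   have pm: "pdiff b (bump (r k) ?q) \<in> BM" by (rule borel_measurable_continuous_onI[OF pdiff_bump_cont[OF b]])
   have "set_integrable lebesgue K (%x. g x \<bullet> b)"
    using integrable_inner_left[OF loc(2)[unfolded set_integrable_def], of b] unfolding set_integrable_def by simp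
   moreover have "AE x in lborel. x \<in> Om --> G x \<bullet> b = g x \<bullet> b" using G(2) by eventually_elim auto
   ultimately have g: "(LINT x:Om|lebesgue. (g x \<bullet> b) * bump (r k) ?q x) = (LINT x|lborel. (G x \<bullet> b) * bump (r k) ?q x)"
    by (intro LINT_rep[OF _ KOm]) (use zero in auto)
   have "test_fn Om (bump (r k) ?q)" using sub KOm by (intro bump_test_fn r(1)) auto
   then have "(LINT x:Om|lebesgue. u x*pdiff b (bump (r k) ?q) x) = - (LINT x:Om|lebesgue. (g x \<bullet> b) * bump (r k) ?q x)"
    using wg b unfolding weak_grad_def by blast
   also have "(LINT x:Om|lebesgue. u x*pdiff b (bump (r k) ?q) x) = (LINT x|lborel. v x*pdiff b (bump (r k) ?q) x)"
    by (rule LINT_rep[OF _ KOm loc(1) v pm]) (use zero in auto)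
   also have "... = (LINT x|lborel. v1 x*pdiff b (bump (r k) ?q) x)"
    by (intro Bochner_Integration.integral_cong) (use zero in \<open>auto simp: v1_def indicator_def\<close>)
   also have "(LINT x:Om|lebesgue. (g x \<bullet> b) * bump (r k) ?q x) = (LINT x|lborel. (G1 x \<bullet> b) * bump (r k) ?q x)"
    unfolding g by (intro Bochner_Integration.integral_cong) (use zero in \<open>auto simp: G1_def indicator_def\<close>)
   finally show ?thesis .
  qed
  define U where "U q = (LINT x|lborel. v1 x * bump (r k) q x)" for q
  have Udiff: "en \<bar>U (p + h) - U p\<bar> <= en (norm h)*(LI ta:{0..1}. (LI x. en (nG x * bump (r k) (p + ta *R h) x)))"
   unfolding U_def nG_def by (rule weak_grad_mollified[OF iv iG r(1) weak])
  define b where "b q = (LINT x|lborel. bump (r k) q x)" for q :: 'a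
  have b: "en (b q) = mu" for q
   unfolding b_def using M[of k q] ibump[of q] by (subst nn_integral_eq_integral[symmetric]) (auto simp: bump_bounds mu_def)
  have bn: "b q >= 0" for q unfolding b_def by (intro Bochner_Integration.integral_nonneg bump_bounds)
  have bb: "b q = b p" for q using b[of q] b[of p] bn[of q] bn[of p] ennreal_inj by metis
  have Uv: "en \<bar>U q - b q * v1 q\<bar> <= mu*(C*mean_osc k v1 q)" for q
  proof -
   have i1: "integrable lborel (%x. v1 x * bump (r k) q x)"
    by (rule Bochner_Integration.integrable_bound[OF iv]) (auto simp: abs_mult bump_bounds intro!: mult_left_le)
   have "U q - b q * v1 q = (LINT x|lborel. (v1 x - v1 q) * bump (r k) q x)"
    unfolding U_def b_def using i1 ibump by (simp add: left_diff_distrib mult.commute)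
   then have "en \<bar>U q - b q * v1 q\<bar> <= (LI x. en \<bar>(v1 x - v1 q) * bump (r k) q x\<bar>)"
    using integral_norm_bound_ennreal[of lborel "%x. (v1 x - v1 q) * bump (r k) q x"] i1 ibump by (simp add: left_diff_distrib)
   also have "... = (LI x. en \<bar>v1 x - v1 q\<bar>*en (bump (r k) q x))"
    by (simp add: abs_mult bump_bounds ennreal_mult)
   also have "... <= mu*(C*mean_osc k v1 q)" unfolding mu_def by (rule osc) measurable
   finally show ?thesis .
  qed
  have "mu*en \<bar>v1 (p + h) - v1 p\<bar> = en \<bar>b (p + h) * v1 (p + h) - b p * v1 p\<bar>"
   unfolding b[of p, symmetric] bb[of "p + h"] using bn[of p] by (simp flip: ennreal_mult right_diff_distrib add: abs_mult)
  also have "... <= en \<bar>U p - b p * v1 p\<bar> + en \<bar>U (p + h) - b (p + h) * v1 (p + h)\<bar> + en \<bar>U (p + h) - U p\<bar>"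
   by (simp flip: ennreal_plus add: ennreal_leI)
  also have "... <= mu*(C*mean_osc k v1 p) + mu*(C*mean_osc k v1 (p + h)) + en (norm h)*(LI ta:{0..1}. (mu*en (nG (p + ta *R h)) + mu*(C*mean_osc k nG (p + ta *R h))))"
  proof (intro add_mono Uv order_trans[OF Udiff] mult_left_mono nn_integral_mono mult_right_mono)
   fix ta
   let ?q = "p + ta *R h"
   have "(LI x. en (nG x * bump (r k) ?q x)) <= en (nG ?q) * mu + mu*(C*mean_osc k nG ?q)"
    using ennreal_bump_integral[of nG "r k" ?q] osc[of nG ?q k] unfolding M mu_def[symmetric]
    by (auto simp: nG_def[abs_def] intro: order_trans add_left_mono)
   then show "(LI x. en (nG x * bump (r k) ?q x)) <= mu*en (nG ?q) + mu*(C*mean_osc k nG ?q)" by (simp add: mult.commute)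
  qed auto
  also have "(LI ta:{0..1}. (mu*en (nG (p + ta *R h)) + mu*(C*mean_osc k nG (p + ta *R h))))
   = mu*((LI ta:{0..1}. en (nG (p + ta *R h))) + C*(LI ta:{0..1}. mean_osc k nG (p + ta *R h)))"
  proof -
   have "(LI ta:{0..1}. (mu*en (nG (p + ta *R h)) + mu*(C*mean_osc k nG (p + ta *R h))))
    = (LI ta. mu*(en (nG (p + ta *R h))*chi {0..1} ta) + (mu*C)*(mean_osc k nG (p + ta *R h)*chi {0..1} ta))"
    by (intro nn_integral_cong) (auto simp: indicator_def mult_ac)
   also have "... = mu*(LI ta:{0..1}. en (nG (p + ta *R h))) + (mu*C)*(LI ta:{0..1}. mean_osc k nG (p + ta *R h))"
    by (simp add: nn_integral_add nn_integral_cmult)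
   finally show ?thesis by (simp add: distrib_left mult.assoc)
  qed
  finally have "mu*en \<bar>v1 (p + h) - v1 p\<bar> <= mu*(C*mean_osc k v1 p + C*mean_osc k v1 (p + h)
   + en (norm h)*((LI ta:{0..1}. en (nG (p + ta *R h))) + C*(LI ta:{0..1}. mean_osc k nG (p + ta *R h))))"
   by (simp add: distrib_left mult_ac)
  then show ?thesis using mu by (subst (asm) ennreal_mult_le_mult_iff) auto
 qed
 show ?thesis
  unfolding upgrad_def
 proof (intro conjI allI)
  fix h :: 'a
  define D where "D k p = mean_osc k v1 p + mean_osc k v1 (p + h) + (LI ta:{0..1}. mean_osc k nG (p + ta *R h))" for k p
  have "\<exists>s. strict_mono s & (AE p in lborel. (%k. D (s k) p) ----> 0)"
  proof (rule AE_subseq_if_nn_integral_tendsto_0)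
   show "D k \<in> borel_measurable lborel" for k
   proof -
    have "(%p. mean_osc k v1 p + mean_osc k v1 (p + h) + (LI ta:{0..1}. mean_osc k nG (p + ta *R h))) \<in> borel_measurable lborel" by measurable
    then show ?thesis by (simp add: D_def[abs_def])
   qed
   have "(LI p. D k p) = 2*(LI p. mean_osc k v1 p) + (LI p. mean_osc k nG p)" for k
   proof -
    have "(LI p. (LI ta:{0..1}. mean_osc k nG (p + ta *R h))) = (LI ta. LI p. mean_osc k nG (p + ta *R h)*chi {0..1} ta)"
     by (rule lborel_pair.Fubini') measurable
    also have "... = (LI p. mean_osc k nG p)"
     by (simp add: nn_integral_multc nn_integral_translate nn_integral_cmult)
    finally have 1: "(LI p. (LI ta:{0..1}. mean_osc k nG (p + ta *R h))) = (LI p. mean_osc k nG p)" .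
    have "(LI p. D k p) = (LI p. mean_osc k v1 p + mean_osc k v1 (p + h)) + (LI p. (LI ta:{0..1}. mean_osc k nG (p + ta *R h)))"
     unfolding D_def by (rule nn_integral_add) measurable
    then show ?thesis unfolding 1 by (simp add: nn_integral_add nn_integral_translate mult_2)
   qed
   moreover have "(%k. 2*(LI p. mean_osc k v1 p) + (LI p. mean_osc k nG p)) ----> 2*0 + 0"
    by (intro tendsto_add ennreal_tendsto_cmult mean_osc_tendsto_0 iv inG) auto
   ultimately show "(%k. LI p. D k p) ----> 0" by simp
  qed
  then obtain s where s: "strict_mono s" "AE p in lborel. (%k. D (s k) p) ----> 0" by blast
  from s(2) show "AE p in lborel. closed_segment p (p + h) \<subseteq> Q -->
   en \<bar>v (p + h) - v p\<bar> <= en (norm h)*(LI ta:{0..1}. en (norm (G (p + ta *R h))))"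
  proof eventually_elim
   case (elim p)
   show ?case
   proof
    assume seg: "closed_segment p (p + h) \<subseteq> Q"
    define I where "I = (LI ta:{0..1}. en (nG (p + ta *R h)))"
    have "eventually (%k. hp k < d) sq"
     using d by (intro order_tendstoD(2)[OF LIMSEQ_power_zero]) auto
    from eventually_compose_filterlim[OF this filterlim_subseq[OF s(1)]]
    have ev: "eventually (%k. en \<bar>v1 (p + h) - v1 p\<bar> <= en (norm h)*I + (C + en (norm h)*C)*D (s k) p) sq"
    proof eventually_elim
     case (elim k)
     have "en \<bar>v1 (p + h) - v1 p\<bar> <= C*mean_osc (s k) v1 p + C*mean_osc (s k) v1 (p + h)
      + en (norm h)*(I + C*(LI ta:{0..1}. mean_osc (s k) nG (p + ta *R h)))"
      unfolding I_def by (rule key[OF seg elim])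
     also have "... <= C*D (s k) p + en (norm h)*(I + C*D (s k) p)"
     proof -
      have "mean_osc (s k) v1 p + mean_osc (s k) v1 (p + h) <= D (s k) p"
       "(LI ta:{0..1}. mean_osc (s k) nG (p + ta *R h)) <= D (s k) p"
       unfolding D_def by (auto intro: add_increasing)
      then show ?thesis unfolding distrib_left[of C, symmetric] by (intro add_mono mult_left_mono order_refl) auto
     qed
     also have "... = en (norm h)*I + (C + en (norm h)*C)*D (s k) p"
      by (simp add: distrib_left distrib_right mult_ac add_ac)
     finally show ?case .
    qed
    have "(%k. en (norm h)*I + (C + en (norm h)*C)*D (s k) p) ----> en (norm h)*I + (C + en (norm h)*C)*0"
     using C_fin by (intro tendsto_add tendsto_const ennreal_tendsto_cmult elim) (auto simp: ennreal_mult_less_top)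
    then have A: "en \<bar>v1 (p + h) - v1 p\<bar> <= en (norm h)*I + (C + en (norm h)*C)*0"
     using ev by (intro tendsto_lowerbound) auto
    have B: "v1 (p + h) = v (p + h)" "v1 p = v p"
    proof -
     have "p \<in> Q" "p + h \<in> Q" using seg by auto
     then have "p \<in> K" "p + h \<in> K" using QK d(1) by (meson centre_in_cball less_imp_le subsetD)+
     then show "v1 (p + h) = v (p + h)" "v1 p = v p" by (auto simp: v1_def)
    qed
    have "I <= (LI ta:{0..1}. en (norm (G (p + ta *R h))))"
     unfolding I_def nG_def G1_def by (intro nn_integral_mono mult_right_mono) (auto simp: indicator_def)
    then have "en (norm h)*I <= en (norm h)*(LI ta:{0..1}. en (norm (G (p + ta *R h))))"
     by (rule mult_left_mono) simp
    with A show "en \<bar>v (p + h) - v p\<bar> <= en (norm h)*(LI ta:{0..1}. en (norm (G (p + ta *R h))))"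
     unfolding B by simp
   qed
  qed
 qed auto
qed

section \<open>Convex combinations converging strongly in the mean square\<close>

definition energy2 :: "('a::euclidean_space => 'b::euclidean_space) => en" where
 "energy2 X = (LI x. en ((norm (X x))^2))"

definition conv_tail :: "(nat => 'a::euclidean_space => 'b::euclidean_space) => nat => (nat => real) set" where
 "conv_tail g m = {c. (\<forall>i. 0 <= c i) & (\<forall>i<m. c i = 0) & (\<exists>n. (\<forall>i\<ge>n. c i = 0) & (\<Sum>i<n. c i) = 1)}"

definition comb :: "(nat => real) => (nat => 'a => 'b::real_vector) => 'a => 'b" where
 "comb c g x = (\<Sum>i\<in>{i. c i \<noteq> 0}. c i *R g i x)"

lemma conv_tailD:
 assumes "c \<in> conv_tail g m"
 shows "finite {i. c i \<noteq> 0}" "(\<Sum>i\<in>{i. c i \<noteq> 0}. c i) = 1" "!!i. 0 <= c i" "!!i. c i \<noteq> 0 ==> m <= i"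
proof -
 obtain n where n: "!!i. i >= n ==> c i = 0" "(\<Sum>i<n. c i) = 1" using assms unfolding conv_tail_def by blast
 have sub: "{i. c i \<noteq> 0} \<subseteq> {..<n}" using n(1) by (auto simp: not_le[symmetric])
 then show "finite {i. c i \<noteq> 0}" using finite_subset by blast
 show "(\<Sum>i\<in>{i. c i \<noteq> 0}. c i) = 1" unfolding n(2)[symmetric] using sub by (intro sum.mono_neutral_left) auto
qed (use assms in \<open>auto simp: conv_tail_def not_less[symmetric]\<close>)

lemma comb_eq_sum: "(!!i. i >= n ==> c i = 0) ==> comb c g x = (\<Sum>i<n. c i *R g i x)"
 unfolding comb_def by (intro sum.mono_neutral_left) (auto simp: not_le[symmetric])

lemma comb_measurable [measurable]:
 fixes g :: "nat => 'a::euclidean_space => 'b::euclidean_space"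
 shows "(!!i. g i \<in> BM) ==> comb c g \<in> BM"
 unfolding comb_def[abs_def] by measurable

lemma conv_tail_midpoint:
 assumes c: "c \<in> conv_tail g m" and d: "d \<in> conv_tail g l" and ml: "m <= l"
 shows "(%i. (c i + d i)/2) \<in> conv_tail g m"
  "comb (%i. (c i + d i)/2) g x = (1/2) *R (comb c g x + comb d g x)"
proof -
 obtain n1 where n1: "!!i. i >= n1 ==> c i = 0" "(\<Sum>i<n1. c i) = 1" using c unfolding conv_tail_def by blast
 obtain n2 where n2: "!!i. i >= n2 ==> d i = 0" "(\<Sum>i<n2. d i) = 1" using d unfolding conv_tail_def by blast
 define n where "n = max n1 n2"
 have "(\<Sum>i<n. c i) = (\<Sum>i<n1. c i)" "(\<Sum>i<n. d i) = (\<Sum>i<n2. d i)"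
  using n1(1) n2(1) by (intro sum.mono_neutral_right; auto simp: n_def not_less)+
 then have s: "(\<Sum>i<n. c i) = 1" "(\<Sum>i<n. d i) = 1" by (simp_all add: n1(2) n2(2))
 have z: "!!i. i >= n ==> c i = 0" "!!i. i >= n ==> d i = 0" using n1 n2 by (auto simp: n_def)
 have "(\<Sum>i<n. (c i + d i)/2) = 1" using s by (simp add: sum.distrib sum_divide_distrib[symmetric])
 moreover have "\<forall>i. 0 <= (c i + d i)/2" "\<forall>i<m. (c i + d i)/2 = 0" "\<forall>i\<ge>n. (c i + d i)/2 = 0"
  using c d ml z unfolding conv_tail_def by auto
 ultimately show "(%i. (c i + d i)/2) \<in> conv_tail g m" unfolding conv_tail_def by blast
 show "comb (%i. (c i + d i)/2) g x = (1/2) *R (comb c g x + comb d g x)"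
  using z comb_eq_sum[of n c g x] comb_eq_sum[of n d g x] comb_eq_sum[of n "%i. (c i + d i)/2" g x]
  by (simp add: scaleR_sum_right sum.distrib[symmetric] scaleR_add_left scaleR_add_right add_divide_distrib)
qed

text \<open>The infimum of the energy over convex combinations of the tail from m on increases to a
  finite limit. By the parallelogram law near-minimisers form a Cauchy sequence, so a strong limit
  arises without weak compactness.\<close>

lemma mazur_L2:
 fixes g :: "nat => 'a::euclidean_space => 'b::euclidean_space"
 assumes g[measurable]: "!!j. g j \<in> BM" and E: "!!j. energy2 (g j) <= en M"
 shows "\<exists>c g0. (\<forall>k. c k \<in> conv_tail g k) & g0 \<in> BM & energy2 g0 < \<infinity> & (%k. energy2 (%x. comb (c k) g x - g0 x)) ----> 0"
proof -
 define e where "e c = energy2 (comb c g)" for c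
 define d where "d m = (INF c\<in>conv_tail g m. e c)" for m
 have single: "(%i. if i = m then 1 else 0) \<in> conv_tail g m" for m
  unfolding conv_tail_def by (auto intro!: exI[of _ "Suc m"])
 have dM: "d m <= en M" for m
 proof -
  have "d m <= e (%i. if i = m then 1 else 0)" unfolding d_def by (intro INF_lower single)
  also have "... = energy2 (g m)"
   unfolding e_def by (rule arg_cong[where f=energy2]) (auto simp: fun_eq_iff comb_eq_sum[of "Suc m"])
  finally show ?thesis using E order_trans by blast
 qed
 define D where "D m = enn2real (d m)" for m
 have dD: "d m = en (D m)" "D m >= 0" for m
  using le_less_trans[OF dM[of m] ennreal_less_top] by (auto simp: D_def)
 have Dmono: "mono D"
 proof (rule monoI)
  fix m l :: nat assume "m <= l"
  then have "conv_tail g l \<subseteq> conv_tail g m" unfolding conv_tail_def by auto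
  then have "d m <= d l" unfolding d_def by (rule INF_superset_mono) simp
  then show "D m <= D l" using dD by simp
 qed
 have "D m <= max M 0" for m using dM[of m] dD[of m] by (cases "M >= 0") (auto simp: ennreal_neg)
 then have "convergent D" using Dmono by (intro Bseq_mono_convergent) (auto simp: mono_def intro!: BseqI'[of _ "max M 0"] simp: dD)
 then obtain D0 where D0: "D ----> D0" by (auto simp: convergent_def)
 have DD0: "D m <= D0" for m using incseq_le[OF Dmono D0] .
 have "\<exists>c. c \<in> conv_tail g m & e c < en (D m + 1/Suc m)" for m
 proof -
  have "d m < en (D m + 1/Suc m)" unfolding dD(1) using dD(2)[of m] by (intro ennreal_lessI) (auto intro: add_nonneg_pos)
  then show ?thesis unfolding d_def INF_less_iff by blast
 qed
 then obtain c where c: "!!m. c m \<in> conv_tail g m" "!!m. e (c m) < en (D m + 1/Suc m)" by metis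
 define X where "X m = comb (c m) g" for m
 have [measurable]: "X m \<in> BM" for m unfolding X_def by measurable
 \<comment> \<open>The midpoint of two near-minimisers still has energy at least \<open>D m\<close>;
   the parallelogram law leaves 2 + 2 times the upper bound \<open>D0 + 1/Suc m\<close> minus 4
   times \<open>D m\<close>.\<close>
 define ep where "ep m = 4*(D0 - D m + 1/Suc m)" for m
 have ep0: "ep m >= 0" for m using DD0[of m] by (simp add: ep_def)
 have cauchy: "energy2 (%x. X m x - X l x) <= en (ep m)" if ml: "m <= l" for m l
 proof -
  have par: "(norm (a - b))^2 + 4*(norm ((1/2) *R (a + b)))^2 = 2*(norm a)^2 + 2*(norm b)^2" for a b :: 'b
   by (simp add: power_divide power2_norm_eq_inner) (simp add: inner_diff_left inner_diff_right inner_add_left inner_add_right inner_commute)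
  have e1: "energy2 (%x. X m x - X l x) + 4*energy2 (%x. (1/2) *R (X m x + X l x)) = 2*energy2 (X m) + 2*energy2 (X l)"
  proof -
   have "energy2 (%x. X m x - X l x) + 4*energy2 (%x. (1/2) *R (X m x + X l x))
    = (LI x. en ((norm (X m x - X l x))^2) + 4*en ((norm ((1/2) *R (X m x + X l x)))^2))"
    unfolding energy2_def by (simp add: nn_integral_add nn_integral_cmult)
   also have "... = (LI x. 2*en ((norm (X m x))^2) + 2*en ((norm (X l x))^2))"
   proof (rule nn_integral_cong)
    fix x
    show "en ((norm (X m x - X l x))^2) + 4*en ((norm ((1/2) *R (X m x + X l x)))^2) = 2*en ((norm (X m x))^2) + 2*en ((norm (X l x))^2)"
     using par[of "X m x" "X l x"] by (simp only: ennreal_numeral[symmetric] ennreal_mult[symmetric] ennreal_plus[symmetric] zero_le_power2 zero_le_numeral mult_nonneg_nonneg)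
   qed
   also have "... = 2*energy2 (X m) + 2*energy2 (X l)"
    unfolding energy2_def by (simp add: nn_integral_add nn_integral_cmult)
   finally show ?thesis .
  qed
  have e2: "en (D m) <= energy2 (%x. (1/2) *R (X m x + X l x))"
  proof -
   have "d m <= e (%i. (c m i + c l i)/2)" unfolding d_def by (intro INF_lower conv_tail_midpoint[OF c(1) c(1) ml])
   also have "... = energy2 (%x. (1/2) *R (X m x + X l x))"
    unfolding e_def X_def by (rule arg_cong[where f=energy2]) (intro ext conv_tail_midpoint(2)[OF c(1) c(1) ml])
   finally show ?thesis by (simp add: dD)
  qed
  have e3: "energy2 (X i) <= en (D0 + 1/Suc m)" if "m <= i" for i
  proof -
   have "energy2 (X i) <= en (D i + 1/Suc i)" using c(2)[of i] by (simp add: e_def X_def less_imp_le)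
   also have "... <= en (D0 + 1/Suc m)" using DD0[of i] that by (intro ennreal_leI add_mono divide_left_mono) auto
   finally show ?thesis .
  qed
  have "energy2 (%x. X m x - X l x) + 4*en (D m) <= energy2 (%x. X m x - X l x) + 4*energy2 (%x. (1/2) *R (X m x + X l x))"
   by (intro add_left_mono mult_left_mono e2) auto
  also have "... <= 2*en (D0 + 1/Suc m) + 2*en (D0 + 1/Suc m)"
   unfolding e1 by (intro add_mono mult_left_mono e3 ml order_refl) auto
  also have "... = en (ep m) + 4*en (D m)"
  proof -
   have "2*en (D0 + 1/Suc m) + 2*en (D0 + 1/Suc m) = en (4*(D0 + 1/Suc m))"
    using DD0[of m] dD(2)[of m] by (simp only: ennreal_numeral[symmetric] ennreal_mult[symmetric] ennreal_plus[symmetric] zero_le_numeral) (simp add: flip: ennreal_mult ennreal_plus ennreal_numeral)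
   also have "4*(D0 + 1/Suc m) = ep m + 4*D m" by (simp add: ep_def)
   finally show ?thesis using ep0[of m] dD(2)[of m] by (simp add: ennreal_plus ennreal_mult)
  qed
  finally show ?thesis by (simp add: ennreal_mult[symmetric] dD flip: ennreal_numeral add.commute)
 qed
 have "(%m. 4*(D0 - D m + 1/Suc m)) ----> 4*(D0 - D0 + 0)"
  by (intro tendsto_intros D0 LIMSEQ_Suc[OF lim_1_over_n])
 then have ep_lim: "ep ----> 0" by (simp add: ep_def[abs_def])
 \<comment> \<open>The rate 1/8 allows weights 4^k: the weighted squares are then summable, so
   almost everywhere consecutive differences are O(2^-k) and the sequence converges
   pointwise.\<close>
 have ex: "\<exists>n>m. ep n < (1/8)^k" for k m
 proof -
  have "eventually (%n. m < n & ep n < (1/8)^k) sq"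
   by (intro eventually_conj eventually_gt_at_top order_tendstoD(2)[OF ep_lim]) auto
  then show ?thesis using eventually_happens'[OF sequentially_bot] by blast
 qed
 have "\<exists>r. \<forall>k. ep (r k) < (1/8)^k & r k < r (Suc k)"
 proof (rule dependent_nat_choice)
  show "\<exists>x. ep x < (1/8)^0" using ex[of 0 0] by blast
  show "\<exists>y. ep y < (1/8)^Suc k & x < y" for x k using ex[of x "Suc k"] by blast
 qed
 then obtain r where r: "!!k. ep (r k) < (1/8)^k" "!!k. r k < r (Suc k)" by blast
 have sr: "strict_mono r" using r(2) strict_mono_Suc_iff by blast
 define Y where "Y k = X (r k)" for k
 have [measurable]: "Y k \<in> BM" for k by (simp add: Y_def)
 have Ycauchy: "energy2 (%x. Y k x - Y l x) <= en ((1/8)^k)" if "k <= l" for k l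
  unfolding Y_def using cauchy[of "r k" "r l"] r(1)[of k] that sr
  by (meson ennreal_leI less_imp_le order_trans strict_mono_less_eq)
 have "(LI x. (\<Sum>k. en (4^k)*en ((norm (Y k x - Y (Suc k) x))^2))) = (\<Sum>k. en (4^k)*energy2 (%x. Y k x - Y (Suc k) x))"
  unfolding energy2_def by (subst nn_integral_suminf) (auto simp: nn_integral_cmult)
 also have "... <= (\<Sum>k. en (hp k))"
 proof (intro suminf_le allI)
  fix k
  have "en (4^k)*energy2 (%x. Y k x - Y (Suc k) x) <= en (4^k)*en ((1/8)^k)"
   by (intro mult_left_mono Ycauchy) auto
  also have "... = en (hp k)" by (simp flip: ennreal_mult power_mult_distrib)
  finally show "en (4^k)*energy2 (%x. Y k x - Y (Suc k) x) <= en (hp k)" .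
 qed auto
 also have "... < \<infinity>" by (subst suminf_ennreal2) (auto simp: summable_geometric)
 finally have "AE x in lborel. (\<Sum>k. en (4^k)*en ((norm (Y k x - Y (Suc k) x))^2)) \<noteq> \<infinity>"
  by (intro nn_integral_PInf_AE) auto
 then have conv: "AE x in lborel. convergent (%k. Y k x)"
 proof eventually_elim
  case (elim x)
  then obtain B where B: "B >= 0" "(\<Sum>k. en (4^k)*en ((norm (Y k x - Y (Suc k) x))^2)) = en B"
   by (cases "(\<Sum>k. en (4^k)*en ((norm (Y k x - Y (Suc k) x))^2))") auto
  have "norm (Y (Suc k) x - Y k x) <= sqrt B*hp k" for k
  proof -
   have "en (4^k*(norm (Y k x - Y (Suc k) x))^2) <= en B"
    unfolding B(2)[symmetric] ennreal_mult'[OF zero_le_power[OF zero_le_numeral]]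
    using sum_le_suminf[of "%k. en (4^k)*en ((norm (Y k x - Y (Suc k) x))^2)" "{k}"] by simp
   then have "(2^k*norm (Y (Suc k) x - Y k x))^2 <= B"
    using B power_mult_distrib[of "2::real" 2 k] by (simp add: norm_minus_commute power2_eq_square mult_ac)
   then have "2^k*norm (Y (Suc k) x - Y k x) <= sqrt B" by (rule real_le_rsqrt)
   then show ?thesis by (simp add: field_simps power_one_over)
  qed
  then have nb: "!!k. 0 <= k ==> norm (Y (Suc k) x - Y k x) <= sqrt B*hp k" by blast
  have "summable (%k. sqrt B*hp k)" by (rule summable_mult[OF summable_geometric]) simp
  from summable_comparison_test'[OF this nb] have "summable (%k. Y (Suc k) x - Y k x)" .
  then have "convergent (%n. \<Sum>k<n. Y (Suc k) x - Y k x)" by (simp add: summable_iff_convergent)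
  then have "convergent (%n. Y n x - Y 0 x)" by (simp only: sum_lessThan_telescope[of "%k. Y k x"])
  from convergent_add[OF this convergent_const[of "Y 0 x"]] have "convergent (%n. (Y n x - Y 0 x) + Y 0 x)" .
  then show ?case by simp
 qed
 define g0 where "g0 x = lim (%k. Y k x)" for x
 have g0m[measurable]: "g0 \<in> BM" unfolding g0_def[abs_def] by (rule borel_measurable_lim_metric) simp
 have lim: "AE x in lborel. (%k. Y k x) ----> g0 x"
  using conv by eventually_elim (simp add: g0_def convergent_LIMSEQ_iff)
 have fin: "energy2 (%x. Y k x - g0 x) <= en ((1/8)^k)" for k
 proof -
  have "energy2 (%x. Y k x - g0 x) = (LI x. liminf (%l. en ((norm (Y k x - Y l x))^2)))"
   unfolding energy2_def
  proof (rule nn_integral_cong_AE)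
   show "AE x in lborel. en ((norm (Y k x - g0 x))^2) = liminf (%l. en ((norm (Y k x - Y l x))^2))"
    using lim
   proof eventually_elim
    case (elim x)
    then have "(%l. en ((norm (Y k x - Y l x))^2)) ----> en ((norm (Y k x - g0 x))^2)"
     by (intro tendsto_intros tendsto_ennrealI)
    from lim_imp_Liminf[OF _ this] show ?case by simp
   qed
  qed
  also have "... <= liminf (%l. energy2 (%x. Y k x - Y l x))"
   unfolding energy2_def by (rule nn_integral_liminf) measurable
  also have "... <= liminf (%l. en ((1/8)^k))"
   by (intro Liminf_mono eventually_mono[OF eventually_ge_at_top[of k]] Ycauchy)
  also have "... = en ((1/8)^k)" by (simp add: Liminf_const)
  finally show ?thesis .
 qed
 have g0fin: "energy2 g0 < \<infinity>"
 proof -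
  have par: "(norm b)^2 <= 2*(norm (a - b))^2 + 2*(norm a)^2" for a b :: 'b
  proof -
   have "norm b <= norm (a - b) + norm a" using norm_triangle_ineq4[of a "a - b"] by simp
   then have "(norm b)^2 <= (norm (a - b) + norm a)^2" by (rule power_mono) simp
   then show ?thesis using sum_squares_bound[of "norm (a - b)" "norm a"] by (simp add: power2_sum)
  qed
  have "energy2 g0 <= (LI x. 2*en ((norm (Y 0 x - g0 x))^2) + 2*en ((norm (Y 0 x))^2))"
   unfolding energy2_def
  proof (rule nn_integral_mono)
   fix x
   show "en ((norm (g0 x))^2) <= 2*en ((norm (Y 0 x - g0 x))^2) + 2*en ((norm (Y 0 x))^2)"
    using ennreal_leI[OF par[of "g0 x" "Y 0 x"]] by (simp add: ennreal_mult)
  qed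
  also have "... = 2*energy2 (%x. Y 0 x - g0 x) + 2*energy2 (Y 0)"
   unfolding energy2_def by (simp add: nn_integral_add nn_integral_cmult)
  also have "... < \<infinity>"
  proof -
   have "energy2 (%x. Y 0 x - g0 x) < \<infinity>" using le_less_trans[OF fin[of 0] ennreal_less_top] by simp
   moreover have "energy2 (Y 0) < \<infinity>"
    using less_trans[OF c(2)[of "r 0"] ennreal_less_top] by (simp add: Y_def X_def e_def)
   ultimately show ?thesis by (simp add: ennreal_mult_less_top)
  qed
  finally show ?thesis .
 qed
 have "(%k. en ((1/8)^k)) ----> en 0" by (intro tendsto_ennrealI LIMSEQ_power_zero) auto
 then have "(%k. en ((1/8)^k)) ----> 0" by simp
 then have "(%k. energy2 (%x. Y k x - g0 x)) ----> 0"
  using fin by (intro tendsto_sandwich[OF _ _ tendsto_const \<open>(%k. en ((1/8)^k)) ----> 0\<close>]) simp_all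
 moreover have "c (r k) \<in> conv_tail g k" for k
 proof -
  have "k <= r k" by (rule strict_mono_imp_increasing[OF sr])
  then have "conv_tail g (r k) \<subseteq> conv_tail g k" unfolding conv_tail_def by auto
  then show ?thesis using c(1) by blast
 qed
 ultimately have "(\<forall>k. c (r k) \<in> conv_tail g k) & g0 \<in> BM & energy2 g0 < \<infinity> & (%k. energy2 (%x. comb (c (r k)) g x - g0 x)) ----> 0"
  using g0m g0fin by (simp add: Y_def X_def)
 then show ?thesis by (intro exI[of _ "%k. c (r k)"] exI[of _ g0])
qed

section \<open>Borel representatives and the weak limit of gradients\<close>

lemma compact_exhaustion:
 fixes Om :: "'a::euclidean_space set"
 assumes "open Om"
 shows "\<exists>K. (\<forall>n. compact (K n)) & (\<forall>n. K n \<subseteq> Om) & \<Union>(range K) = Om & (\<forall>C. compact C --> C \<subseteq> Om --> (\<exists>N::nat. \<forall>n\<ge>N. C \<subseteq> K n))"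
 by (rule open_Union_compact_subsets[OF assms], rule exI, intro conjI allI impI) assumption+

lemma AE_open_if_compact:
 fixes Om :: "'a::euclidean_space set"
 assumes Om: "open Om" and P: "!!K. compact K ==> K \<subseteq> Om ==> AE x in M. x \<in> K --> P x"
 shows "AE x in M. x \<in> Om --> P x"
proof -
 obtain K :: "nat => 'a set" where K: "!!n. compact (K n)" "!!n. K n \<subseteq> Om" "\<Union>(range K) = Om"
  and KK: "!!C. compact C ==> C \<subseteq> Om ==> \<exists>N. \<forall>n\<ge>N. C \<subseteq> K n"
  using compact_exhaustion[OF Om] by blast
 have "AE x in M. \<forall>n::nat. x \<in> K n --> P x" unfolding AE_all_countable using P K by blast
 then show ?thesis by eventually_elim (use K(3) in blast)
qed

lemma borel_rep_real:
 fixes f :: "'a::euclidean_space => real"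
 assumes Om: "open Om" and f: "!!K. compact K ==> K \<subseteq> Om ==> set_integrable lebesgue K f"
 shows "\<exists>v. v \<in> BM & (\<forall>x. x \<notin> Om --> v x = 0) & (AE x in lborel. x \<in> Om --> v x = f x)"
proof -
 obtain K :: "nat => 'a set" where K: "!!n. compact (K n)" "!!n. K n \<subseteq> Om" "\<Union>(range K) = Om"
  and KK: "!!C. compact C ==> C \<subseteq> Om ==> \<exists>N. \<forall>n\<ge>N. C \<subseteq> K n"
  using compact_exhaustion[OF Om] by blast
 have "(%x. ind Om x *R f x) \<in> borel_measurable lebesgue"
 proof (rule borel_measurable_LIMSEQ_metric)
  show "(%x. ind (K n) x *R f x) \<in> borel_measurable lebesgue" for n
   using f[OF K(1,2)] unfolding set_integrable_def by (rule borel_measurable_integrable)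
  fix x :: 'a
  show "(%n. ind (K n) x *R f x) ----> ind Om x *R f x"
  proof (cases "x \<in> Om")
   case True
   then obtain N where "\<forall>n\<ge>N. {x} \<subseteq> K n" using KK[of "{x}"] by auto
   then show ?thesis using True by (intro tendsto_eventually) (auto simp: eventually_sequentially indicator_def intro!: exI[of _ N])
  next
   case False
   then have "x \<notin> K n" for n using K(2) by blast
   then show ?thesis using False by simp
  qed
 qed
 from completion_ex_borel_measurable_real[OF this]
 obtain w where w: "w \<in> BM" "AE x in lborel. ind Om x *R f x = w x" by auto
 have [measurable]: "w \<in> BM" "Om \<in> sets borel" using w Om by auto
 have "(%x. ind Om x*w x) \<in> BM" by measurable
 moreover have "AE x in lborel. x \<in> Om --> ind Om x*w x = f x"
  using w(2) by eventually_elim auto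
 ultimately show ?thesis by (intro exI[of _ "%x. ind Om x*w x"]) auto
qed

lemma borel_rep:
 fixes f :: "'a::euclidean_space => 'b::euclidean_space"
 assumes Om: "open Om" and f: "!!K. compact K ==> K \<subseteq> Om ==> set_integrable lebesgue K f"
 shows "\<exists>v. v \<in> BM & (\<forall>x. x \<notin> Om --> v x = 0) & (AE x in lborel. x \<in> Om --> v x = f x)"
proof -
 have "\<exists>v. v \<in> BM & (\<forall>x. x \<notin> Om --> v x = 0) & (AE x in lborel. x \<in> Om --> v x = f x \<bullet> b)" for b
 proof (rule borel_rep_real[OF Om])
  fix K assume "compact K" "K \<subseteq> Om"
  from f[OF this] have "integrable lebesgue (%x. (ind K x *R f x) \<bullet> b)"
   unfolding set_integrable_def by (rule integrable_inner_left)
  then show "set_integrable lebesgue K (%x. f x \<bullet> b)" unfolding set_integrable_def by simp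
 qed
 then have "\<forall>b. \<exists>v. v \<in> BM & (\<forall>x. x \<notin> Om --> v x = 0) & (AE x in lborel. x \<in> Om --> v x = f x \<bullet> b)" ..
 from choice[OF this] obtain v where v: "!!b. v b \<in> BM" "!!b x. x \<notin> Om ==> v b x = 0"
  "!!b. AE x in lborel. x \<in> Om --> v b x = f x \<bullet> b" by blast
 define w where "w x = (\<Sum>b\<in>Basis. v b x *R b)" for x
 have "w \<in> BM"
  unfolding w_def[abs_def] by (intro borel_measurable_sum borel_measurable_scaleR v borel_measurable_const)
 moreover have "AE x in lborel. \<forall>b\<in>Basis. x \<in> Om --> v b x = f x \<bullet> b"
  using v(3) by (subst AE_ball_countable) (auto simp: countable_finite)
 then have "AE x in lborel. x \<in> Om --> w x = f x"
  by eventually_elim (simp add: w_def euclidean_representation)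
 ultimately show ?thesis using v(2) by (intro exI[of _ w]) (auto simp: w_def)
qed

lemma L1_rep:
 fixes f g v w :: "'a::euclidean_space => real"
 assumes K[measurable]: "K \<in> sets borel" and KOm: "K \<subseteq> Om"
  and f: "set_integrable lebesgue K f" and g: "set_integrable lebesgue K g"
  and v[measurable]: "v \<in> BM" and eqv: "AE x in lborel. x \<in> Om --> v x = f x"
  and w[measurable]: "w \<in> BM" and eqw: "AE x in lborel. x \<in> Om --> w x = g x"
 shows "(dist1 K v w) = en (LINT x:K|lebesgue. \<bar>f x - g x\<bar>)"
proof -
 have "set_integrable lebesgue K (%x. \<bar>f x - g x\<bar>)"
  by (intro set_integrable_abs set_integral_diff f g)
 moreover have "AE x in lborel. x \<in> Om --> \<bar>v x - w x\<bar> = \<bar>f x - g x\<bar>" using eqv eqw by eventually_elim auto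
 ultimately have "(LINT x:Om|lebesgue. \<bar>f x - g x\<bar> * ind K x) = (LINT x|lborel. \<bar>v x - w x\<bar> * ind K x)"
  and i: "integrable lborel (%x. ind K x *R \<bar>v x - w x\<bar>)"
  using KOm by (intro LINT_rep[OF K KOm] rep_integrable[OF K KOm]; simp)+
 moreover have "(LINT x:Om|lebesgue. \<bar>f x - g x\<bar> * ind K x) = (LINT x:K|lebesgue. \<bar>f x - g x\<bar>)"
  unfolding set_lebesgue_integral_def
  by (intro Bochner_Integration.integral_cong refl) (use KOm in \<open>auto simp: indicator_def\<close>)
 ultimately have "en (LINT x:K|lebesgue. \<bar>f x - g x\<bar>) = en (LINT x|lborel. \<bar>v x - w x\<bar> * ind K x)" by simp
 also have "... = (LI x. en (\<bar>v x - w x\<bar> * ind K x))"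
  using i by (subst nn_integral_eq_integral) (auto simp: mult.commute)
 also have "... = (dist1 K v w)"
  by (intro nn_integral_cong) (auto simp: indicator_def)
 finally show ?thesis by simp
qed

section \<open>Passing to the limit in the weak gradient identity\<close>

lemma conv_tail_tendsto:
 fixes L :: "nat => real"
 assumes c: "!!k. c k \<in> conv_tail g k" and L: "L ----> l"
 shows "(%k. \<Sum>i\<in>{i. c k i \<noteq> 0}. c k i*L i) ----> l"
proof (rule LIMSEQ_I)
 fix r :: real assume r: "r > 0"
 then obtain N where N: "!!i. i >= N ==> \<bar>L i - l\<bar> < r/2" using LIMSEQ_D[OF L, of "r/2"] by auto
 have "norm ((\<Sum>i\<in>{i. c k i \<noteq> 0}. c k i*L i) - l) < r" if "k >= N" for k
 proof -
  note C = conv_tailD[OF c[of k]]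
  have "(\<Sum>i\<in>{i. c k i \<noteq> 0}. c k i*L i) - l = (\<Sum>i\<in>{i. c k i \<noteq> 0}. c k i*(L i - l))"
   using C(2) by (simp add: right_diff_distrib sum_subtractf flip: sum_distrib_right)
  also have "\<bar>...\<bar> <= (\<Sum>i\<in>{i. c k i \<noteq> 0}. c k i*(r/2))"
  proof (rule order_trans[OF sum_abs sum_mono])
   fix i assume "i \<in> {i. c k i \<noteq> 0}"
   then have "\<bar>L i - l\<bar> <= r/2" using N[of i] C(4)[of i] that by auto
   then show "\<bar>c k i*(L i - l)\<bar> <= c k i*(r/2)" using C(3)[of i] mult_left_mono[of "\<bar>L i - l\<bar>" "r/2" "c k i"] by (simp add: abs_mult)
  qed
  also have "... = r/2" unfolding sum_distrib_right[symmetric] C(2) by simp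
  finally show ?thesis using r by simp
 qed
 then show "\<exists>no. \<forall>n\<ge>no. norm ((\<Sum>i\<in>{i. c n i \<noteq> 0}. c n i*L i) - l) < r" by blast
qed

lemma LINT_tendsto_bounded:
 fixes F :: "nat => 'a::euclidean_space => real"
 assumes K[measurable]: "K \<in> sets borel" and F[measurable]: "!!k. F k \<in> BM" and F0[measurable]: "F0 \<in> BM"
  and i: "!!k. integrable lborel (%x. ind K x * F k x)" "integrable lborel (%x. ind K x * F0 x)"
  and \<psi>[measurable]: "\<psi> \<in> BM" and \<psi>0: "!!x. x \<notin> K ==> \<psi> x = 0" and B: "!!x. \<bar>\<psi> x\<bar> <= B"
  and lim: "(%k. LI x:K. en \<bar>F k x - F0 x\<bar>) ----> 0"
 shows "(%k. LINT x|lborel. F k x*\<psi> x) ----> (LINT x|lborel. F0 x*\<psi> x)"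
proof -
 have B0: "B >= 0" using order_trans[OF abs_ge_zero B] .
 have ii: "integrable lborel (%x. H x*\<psi> x)" if [measurable]: "H \<in> BM" and "integrable lborel (%x. ind K x * H x)" for H
 proof (rule Bochner_Integration.integrable_bound[OF integrable_mult_right[OF that(2), of B]])
  show "AE x in lborel. norm (H x*\<psi> x) <= norm (B*(ind K x * H x))"
  proof (rule AE_I2)
   fix x
   show "norm (H x*\<psi> x) <= norm (B*(ind K x * H x))"
    using \<psi>0[of x] B[of x] B0 by (cases "x \<in> K") (auto simp: abs_mult mult.commute[of B] intro: mult_left_mono)
  qed
 qed measurable
 have "(%k. en \<bar>(LINT x|lborel. F k x*\<psi> x) - (LINT x|lborel. F0 x*\<psi> x)\<bar>) ----> 0"
 proof (rule tendsto_sandwich[OF _ _ tendsto_const])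
  have "(%k. en B*(dist1 K (F k) F0)) ----> en B*0"
   by (intro ennreal_tendsto_cmult lim) simp
  then show "(%k. en B*(dist1 K (F k) F0)) ----> 0" by simp
  show "eventually (%k. en \<bar>(LINT x|lborel. F k x*\<psi> x) - (LINT x|lborel. F0 x*\<psi> x)\<bar> <= en B*(dist1 K (F k) F0)) sq"
  proof (rule always_eventually, rule allI)
   fix k
   have "(LINT x|lborel. F k x*\<psi> x) - (LINT x|lborel. F0 x*\<psi> x) = (LINT x|lborel. F k x*\<psi> x - F0 x*\<psi> x)"
    by (simp add: ii i)
   then have "en \<bar>(LINT x|lborel. F k x*\<psi> x) - (LINT x|lborel. F0 x*\<psi> x)\<bar> <= (LI x. en \<bar>F k x*\<psi> x - F0 x*\<psi> x\<bar>)"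
    using integral_norm_bound_ennreal[of lborel "%x. F k x*\<psi> x - F0 x*\<psi> x"] by (simp add: ii i)
   also have "... <= (LI x. en B*(en \<bar>F k x - F0 x\<bar>*chi K x))"
   proof (rule nn_integral_mono)
    fix x
    have "\<bar>F k x*\<psi> x - F0 x*\<psi> x\<bar> = \<bar>\<psi> x\<bar>*\<bar>F k x - F0 x\<bar>"
     unfolding left_diff_distrib[symmetric] abs_mult by (rule mult.commute)
    then show "en \<bar>F k x*\<psi> x - F0 x*\<psi> x\<bar> <= en B*(en \<bar>F k x - F0 x\<bar>*chi K x)"
     using \<psi>0[of x] B[of x] B0 by (cases "x \<in> K") (auto simp: ennreal_mult mult_right_mono)
   qed
   also have "... = en B*(dist1 K (F k) F0)" by (rule nn_integral_cmult) measurable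
   finally show "en \<bar>(LINT x|lborel. F k x*\<psi> x) - (LINT x|lborel. F0 x*\<psi> x)\<bar> <= en B*(dist1 K (F k) F0)" .
  qed
 qed simp
 then have "(%k. \<bar>(LINT x|lborel. F k x*\<psi> x) - (LINT x|lborel. F0 x*\<psi> x)\<bar>) ----> 0"
  by (simp add: tendsto_ennreal_iff[of _ _ 0, simplified])
 then show ?thesis using LIM_zero_cancel tendsto_rabs_zero_iff by blast
qed

lemma test_fnD:
 fixes \<phi> :: "'a::euclidean_space => real"
 assumes \<phi>: "test_fn Om \<phi>" and b: "b \<in> Basis"
 obtains K B where "compact K" "K \<subseteq> Om" "continuous_on UNIV \<phi>" "continuous_on UNIV (pdiff b \<phi>)"
  "!!x. x \<notin> K ==> \<phi> x = 0" "!!x. x \<notin> K ==> pdiff b \<phi> x = 0" "!!x. \<bar>\<phi> x\<bar> <= B" "!!x. \<bar>pdiff b \<phi> x\<bar> <= B"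
proof -
 define K where "K = closure {x. \<phi> x \<noteq> 0}"
 have K: "compact K" "K \<subseteq> Om" and sm: "smooth_open UNIV \<phi>" using \<phi> by (auto simp: test_fn_def K_def)
 have c: "continuous_on UNIV \<phi>" "continuous_on UNIV (pdiff b \<phi>)"
  using sm b unfolding smooth_open_def by (auto dest!: spec[of _ "[]"]) (use sm b in \<open>auto simp: smooth_open_def dest!: spec[of _ "[b]"]\<close>)
 have z: "\<phi> x = 0" if "x \<notin> K" for x using that closure_subset[of "{x. \<phi> x \<noteq> 0}"] by (auto simp: K_def)
 have zp: "pdiff b \<phi> x = 0" if x: "x \<notin> K" for x
 proof -
  have "open (- K)" using K(1) by (simp add: compact_imp_closed open_Compl)
  then obtain e where e: "e > 0" "ball x e \<subseteq> - K" using x by (auto simp: open_contains_ball)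
  have "((%t. \<phi> (x + t *R b)) has_vector_derivative 0) (at 0)"
  proof (rule has_vector_derivative_transform_within_open[of "%_. 0" _ _ "ball 0 e"])
   fix t :: real assume "t \<in> ball 0 e"
   then have "x + t *R b \<in> ball x e" using b by (simp add: dist_norm)
   then show "0 = \<phi> (x + t *R b)" using e z by auto
  qed (use e in auto)
  then show ?thesis unfolding pdiff_def by (rule vector_derivative_at)
 qed
 obtain B1 where B1: "!!x. x \<in> K ==> \<bar>\<phi> x\<bar> <= B1"
  using compact_imp_bounded[OF compact_continuous_image[OF continuous_on_subset[OF c(1)] K(1)]] by (auto simp: bounded_iff)
 obtain B2 where B2: "!!x. x \<in> K ==> \<bar>pdiff b \<phi> x\<bar> <= B2"
  using compact_imp_bounded[OF compact_continuous_image[OF continuous_on_subset[OF c(2)] K(1)]] by (auto simp: bounded_iff)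
 have "\<bar>\<phi> x\<bar> <= max 0 (max B1 B2)" "\<bar>pdiff b \<phi> x\<bar> <= max 0 (max B1 B2)" for x
  using B1[of x] B2[of x] z[of x] zp[of x] by (cases "x \<in> K"; auto)+
 then show thesis using that K c z zp by blast
qed

text \<open>In the identity for the same convex combinations on both sides, the left side converges
  because combinations of later and later terms of a convergent sequence have the same limit, the
  right side because the combined gradients converge in L^2 and phi is bounded with compact
  support.\<close>

lemma W12_loc_limit:
 fixes u :: "nat => 'a::euclidean_space => real" and g :: "nat => 'a => 'a"
 assumes Om: "open Om" and wg: "!!j. weak_grad Om (u j) (g j)"
  and u01: "!!j. AE x in lebesgue. x \<in> Om --> u j x \<in> {0..1}"
  and M: "!!j. (\<integral>\<^sup>+x\<in>Om. en ((norm (g j x))^2) \<partial>lebesgue) <= en M"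
  and conv: "L1loc_conv Om u u0"
 shows "W12_loc Om u0" "AE x in lebesgue. x \<in> Om --> u0 x \<in> {0..1}"
proof -
 have [measurable]: "Om \<in> sets borel" using Om by simp
 have iu: "set_integrable lebesgue K (u j)" "set_integrable lebesgue K (g j)" "set_integrable lebesgue K u0"
  if "compact K" "K \<subseteq> Om" for K j using wg[of j] conv that unfolding weak_grad_def L1loc_conv_def by auto
 have "\<forall>j. \<exists>v. v \<in> BM & (\<forall>x. x \<notin> Om --> v x = 0) & (AE x in lborel. x \<in> Om --> v x = u j x)"
  by (intro allI borel_rep Om iu)
 from choice[OF this] obtain v where v: "!!j. v j \<in> BM"
  "!!j. AE x in lborel. x \<in> Om --> v j x = u j x" by blast
 have "\<exists>v. v \<in> BM & (\<forall>x. x \<notin> Om --> v x = 0) & (AE x in lborel. x \<in> Om --> v x = u0 x)"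
  by (intro borel_rep Om iu)
 then obtain v0 where v0: "v0 \<in> BM" "AE x in lborel. x \<in> Om --> v0 x = u0 x" by blast
 have "\<forall>j. \<exists>G. G \<in> BM & (\<forall>x. x \<notin> Om --> G x = 0) & (AE x in lborel. x \<in> Om --> G x = g j x)"
  by (intro allI borel_rep Om iu)
 from choice[OF this] obtain G where G: "!!j. G j \<in> BM" "!!j x. x \<notin> Om ==> G j x = 0"
  "!!j. AE x in lborel. x \<in> Om --> G j x = g j x" by blast
 note v(1)[measurable] v0(1)[measurable] G(1)[measurable]
 have EG: "energy2 (G j) <= en M" for j
 proof -
  have "energy2 (G j) = (\<integral>\<^sup>+x. en ((norm (G j x))^2) \<partial>lebesgue)"
   unfolding energy2_def by (rule nn_integral_completion[symmetric])
  also have "... = (\<integral>\<^sup>+x\<in>Om. en ((norm (g j x))^2) \<partial>lebesgue)"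
  proof (rule nn_integral_cong_AE)
   have "AE x in lebesgue. x \<in> Om --> G j x = g j x" using G(3) by (auto intro: AE_completion)
   then show "AE x in lebesgue. en ((norm (G j x))^2) = en ((norm (g j x))^2)*chi Om x"
    by eventually_elim (use G(2) in \<open>auto simp: indicator_def\<close>)
  qed
  finally show ?thesis using M[of j] by simp
 qed
 from mazur_L2[of G, OF G(1) EG] obtain c g0 where c: "!!k. c k \<in> conv_tail G k" and g0: "g0 \<in> BM" "energy2 g0 < \<infinity>"
  and cg: "(%k. energy2 (%x. comb (c k) G x - g0 x)) ----> 0" by blast
 note g0(1)[measurable]
 have vlim: "(%j. LI x:K. en \<bar>v j x - v0 x\<bar>) ----> 0" if K: "compact K" "K \<subseteq> Om" for K
 proof -
  have [measurable]: "K \<in> sets borel" using K by (intro borel_compact)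
  have "(%j. en (LINT x:K|lebesgue. \<bar>u j x - u0 x\<bar>)) ----> en 0"
   using conv K unfolding L1loc_conv_def by (intro tendsto_ennrealI) auto
  then show ?thesis using L1_rep[OF _ K(2) iu(1)[OF K] iu(3)[OF K] v v0] by simp
 qed
 have "AE x in lborel. x \<in> K --> v0 x \<in> {0..1}" if K: "compact K" "K \<subseteq> Om" for K
 proof -
  have [measurable]: "K \<in> sets borel" using K by (intro borel_compact)
  \<comment> \<open>The distance of \<open>v0 x\<close> to [0,1], dominated by the distance to
    \<open>v j x\<close>, which lies in [0,1] almost everywhere on K.\<close>
  define d where "d x = max 0 (max (- v0 x) (v0 x - 1))" for x
  have [measurable]: "d \<in> BM" unfolding d_def[abs_def] by measurable
  have "(LI x:K. en (d x)) <= (dist1 K (v j) v0)" for j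
  proof (rule nn_integral_mono_AE)
   have "AE x in lborel. x \<in> Om --> u j x \<in> {0..1}" using u01[of j] by (simp add: AE_completion_iff)
   then show "AE x in lborel. en (d x)*chi K x <= en \<bar>v j x - v0 x\<bar>*chi K x"
    using v(2)[of j] by eventually_elim (use K in \<open>auto simp: indicator_def d_def intro!: ennreal_leI\<close>)
  qed
  then have "(LI x:K. en (d x)) <= 0"
   by (intro tendsto_lowerbound[OF vlim[OF K]]) auto
  then have "AE x in lborel. en (d x)*chi K x = 0"
   by (subst (asm) le_zero_eq, subst (asm) nn_integral_0_iff_AE) auto
  then show ?thesis by eventually_elim (auto simp: indicator_def d_def max_def split: if_splits)
 qed
 from AE_open_if_compact[OF Om this] have v01: "AE x in lborel. x \<in> Om --> v0 x \<in> {0..1}" .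
 have "AE x in lborel. x \<in> Om --> u0 x \<in> {0..1}" using v01 v0(2) by eventually_elim auto
 then show u0_01: "AE x in lebesgue. x \<in> Om --> u0 x \<in> {0..1}" by (auto intro: AE_completion)
 have sq: "set_integrable lebesgue K (%x. (norm (g0 x))^2)" if [measurable]: "K \<in> sets borel" for K
 proof -
  have "integrable lborel (%x. (norm (g0 x))^2)"
   using g0(2) unfolding energy2_def by (intro integrableI_bounded) auto
  then have "integrable lborel (%x. chi K x *R (norm (g0 x))\<^sup>2)" by (intro integrable_mult_indicator) auto
  then show ?thesis unfolding set_integrable_def by (subst integrable_completion) auto
 qed
 have ig0: "set_integrable lebesgue K g0" if K: "compact K" for K
 proof -
  have [measurable]: "K \<in> sets borel" using K by (intro borel_compact)
  have "integrable lborel (%x. ind K x *R g0 x)"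
  proof (rule integrableI_bounded)
   have "(LI x. en (norm (ind K x *R g0 x))) <= (LI x. chi K x + en ((norm (g0 x))^2))"
   proof (rule nn_integral_mono)
    fix x
    have "norm (g0 x) <= 1 + (norm (g0 x))^2" 
     using sum_squares_bound[of "norm (g0 x)" 1] zero_le_power2[of "norm (g0 x)"] norm_ge_zero[of "g0 x"] by (simp only: power_one mult_1_right)
    then have "en (norm (g0 x)) <= 1 + en ((norm (g0 x))^2)" by (simp flip: ennreal_plus ennreal_1 add: ennreal_leI)
    then show "en (norm (ind K x *R g0 x)) <= chi K x + en ((norm (g0 x))^2)"
     by (cases "x \<in> K") auto
   qed
   also have "... = vol K + energy2 g0" unfolding energy2_def by (simp add: nn_integral_add)
   also have "... < \<infinity>" using g0(2) emeasure_compact_finite[OF K] by simp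
   finally show "(LI x. en (norm (ind K x *R g0 x))) < \<infinity>" .
  qed simp
  then show ?thesis unfolding set_integrable_def by (subst integrable_completion) auto
 qed
 have "weak_grad Om u0 g0"
  unfolding weak_grad_def
 proof (intro conjI allI impI ballI)
  show "set_integrable lebesgue K u0" "set_integrable lebesgue K g0" if "compact K & K \<subseteq> Om" for K
   using that iu ig0 by auto
  fix \<phi> b assume \<phi>: "test_fn Om \<phi>" and b: "b \<in> (Basis :: 'a set)"
  obtain K B where K: "compact K" "K \<subseteq> Om" and cont: "continuous_on UNIV \<phi>" "continuous_on UNIV (pdiff b \<phi>)"
   and z: "!!x. x \<notin> K ==> \<phi> x = 0" "!!x. x \<notin> K ==> pdiff b \<phi> x = 0" and B: "!!x. \<bar>\<phi> x\<bar> <= B" "!!x. \<bar>pdiff b \<phi> x\<bar> <= B"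
   using test_fnD[OF \<phi> b] by blast
  have Kb[measurable]: "K \<in> sets borel" using K by (intro borel_compact)
  have [measurable]: "\<phi> \<in> BM" "pdiff b \<phi> \<in> BM"
   using cont by (auto intro: borel_measurable_continuous_onI)
  have inner_rep: "set_integrable lebesgue K (%x. h x \<bullet> b)" if "set_integrable lebesgue K h" for h :: "'a => 'a"
   using integrable_inner_left[OF that[unfolded set_integrable_def], of b] unfolding set_integrable_def by simp
  define L where "L j = (LINT x|lborel. v j x*pdiff b \<phi> x)" for j
  have LG: "L j = - (LINT x|lborel. (G j x \<bullet> b)*\<phi> x)" for j
  proof -
   have "L j = (LINT x:Om|lebesgue. u j x*pdiff b \<phi> x)"
    unfolding L_def by (rule LINT_rep[symmetric, OF Kb K(2) iu(1)[OF K] v]) (use z in auto)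
   also have "... = - (LINT x:Om|lebesgue. (g j x \<bullet> b)*\<phi> x)" using wg[of j] \<phi> b unfolding weak_grad_def by blast
   also have "(LINT x:Om|lebesgue. (g j x \<bullet> b)*\<phi> x) = (LINT x|lborel. (G j x \<bullet> b)*\<phi> x)"
    by (rule LINT_rep[OF Kb K(2) inner_rep[OF iu(2)[OF K]]]) (use z G(3)[of j] in \<open>auto elim!: eventually_mono\<close>)
   finally show ?thesis .
  qed
  have iG: "integrable lborel (%x. ind K x*(G j x \<bullet> b))" for j
  proof -
   have "AE x in lborel. x \<in> Om --> G j x \<bullet> b = g j x \<bullet> b" using G(3)[of j] by eventually_elim auto
   from rep_integrable[OF Kb K(2) inner_rep[OF iu(2)[OF K]] _ this] show ?thesis by simp
  qed
  have Lv: "L ----> (LINT x|lborel. v0 x*pdiff b \<phi> x)"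
   unfolding L_def
  proof (rule LINT_tendsto_bounded[OF Kb v(1) v0(1) _ _ _ z(2) B(2) vlim[OF K]])
   show "integrable lborel (%x. ind K x * v j x)" for j
    using rep_integrable[OF Kb K(2) iu(1)[OF K] v(1) v(2)] by simp
   show "integrable lborel (%x. ind K x * v0 x)"
    using rep_integrable[OF Kb K(2) iu(3)[OF K] v0] by simp
  qed simp
  have "(%k. \<Sum>i\<in>{i. c k i \<noteq> 0}. c k i*L i) ----> (LINT x|lborel. v0 x*pdiff b \<phi> x)"
   by (rule conv_tail_tendsto[OF c Lv])
  moreover have cs: "comb (c k) G x \<bullet> b = (\<Sum>i\<in>{i. c k i \<noteq> 0}. c k i*(G i x \<bullet> b))" for k x
   unfolding comb_def by (simp add: inner_sum_left)
  have icomb: "integrable lborel (%x. ind K x*(comb (c k) G x \<bullet> b))" for k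
  proof -
   have "integrable lborel (%x. \<Sum>i\<in>{i. c k i \<noteq> 0}. c k i*(ind K x*(G i x \<bullet> b)))"
    by (intro Bochner_Integration.integrable_sum integrable_mult_right iG)
   then show ?thesis by (simp add: cs sum_distrib_left mult_ac)
  qed
  have iG\<phi>: "integrable lborel (%x. (G i x \<bullet> b)*\<phi> x)" for i
  proof (rule Bochner_Integration.integrable_bound[OF integrable_mult_right[OF iG[of i], of B]])
   show "AE x in lborel. norm ((G i x \<bullet> b)*\<phi> x) <= norm (B*(ind K x*(G i x \<bullet> b)))"
   proof (rule AE_I2)
    fix x
    show "norm ((G i x \<bullet> b)*\<phi> x) <= norm (B*(ind K x*(G i x \<bullet> b)))"
     using z(1)[of x] order_trans[OF B(1)[of x] abs_ge_self] by (cases "x \<in> K") (auto simp: abs_mult mult.commute[of "\<bar>B\<bar>"] intro: mult_left_mono)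
   qed
  qed measurable
  have "(\<Sum>i\<in>{i. c k i \<noteq> 0}. c k i*L i) = - (LINT x|lborel. (comb (c k) G x \<bullet> b)*\<phi> x)" for k
  proof -
   have "(LINT x|lborel. (comb (c k) G x \<bullet> b)*\<phi> x) = (LINT x|lborel. (\<Sum>i\<in>{i. c k i \<noteq> 0}. c k i*((G i x \<bullet> b)*\<phi> x)))"
    by (simp add: cs sum_distrib_right mult.assoc)
   also have "... = (\<Sum>i\<in>{i. c k i \<noteq> 0}. c k i*(LINT x|lborel. (G i x \<bullet> b)*\<phi> x))"
    using iG\<phi> by (subst Bochner_Integration.integral_sum) auto
   finally show ?thesis by (simp add: LG sum_negf)
  qed
  moreover have "(%k. LINT x|lborel. (comb (c k) G x \<bullet> b)*\<phi> x) ----> (LINT x|lborel. (g0 x \<bullet> b)*\<phi> x)"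
  proof (rule LINT_tendsto_bounded[OF Kb _ _ icomb _ _ z(1) B(1)])
   have "set_integrable lborel K (%x. g0 x \<bullet> b)"
    using inner_rep[OF ig0[OF K(1)]] unfolding set_integrable_def by (subst (asm) integrable_completion) auto
   then show "integrable lborel (%x. ind K x*(g0 x \<bullet> b))" by (simp add: set_integrable_def)
   show "(%k. LI x:K. en \<bar>comb (c k) G x \<bullet> b - g0 x \<bullet> b\<bar>) ----> 0"
   proof (rule tendsto_0_if_all_le)
    fix e :: real assume e: "e > 0"
    define m where "m = enn2real (vol K)"
    have m: "vol K = en m" "m >= 0" using emeasure_compact_finite[OF K(1)] by (auto simp: m_def)
    \<comment> \<open>For y <= d + y^2/d integrated over K: the first term contributes at most e/2,
      the second is made at most e/2 by the bound d*e/2 on the energy.\<close>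
    define d where "d = e/(2*(m + 1))"
    have d: "d > 0" "d*m <= e/2" using e m by (auto simp: d_def field_simps)
    have "eventually (%k. energy2 (%x. comb (c k) G x - g0 x) < en (d*(e/2))) sq"
     using d e by (intro order_tendstoD(2)[OF cg]) auto
    then show "eventually (%k. (LI x:K. en \<bar>comb (c k) G x \<bullet> b - g0 x \<bullet> b\<bar>) <= en e) sq"
    proof eventually_elim
     case (elim k)
     have "(LI x:K. en \<bar>comb (c k) G x \<bullet> b - g0 x \<bullet> b\<bar>) <= (LI x. en d*chi K x + en (1/d)*en ((norm (comb (c k) G x - g0 x))^2))"
     proof (rule nn_integral_mono)
      fix x
      define y where "y = norm (comb (c k) G x - g0 x)"
      have "\<bar>comb (c k) G x \<bullet> b - g0 x \<bullet> b\<bar> <= y"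
       using Basis_le_norm[OF b, of "comb (c k) G x - g0 x"] by (simp add: y_def inner_diff_left)
      also have "y <= d + (1/d)*y\<^sup>2"
      proof -
       have "d*y <= d\<^sup>2 + y\<^sup>2" 
       proof -
        have "0 <= d*y" using d(1) by (simp add: y_def)
        then show ?thesis using sum_squares_bound[of d y] by linarith
       qed
       then show ?thesis using d(1) by (simp add: field_simps power2_eq_square)
      qed
      finally have "en \<bar>comb (c k) G x \<bullet> b - g0 x \<bullet> b\<bar> <= en d + en (1/d)*en (y\<^sup>2)"
       using d(1) by (simp flip: ennreal_mult ennreal_plus add: ennreal_leI)
      then show "en \<bar>comb (c k) G x \<bullet> b - g0 x \<bullet> b\<bar>*chi K x <= en d*chi K x + en (1/d)*en ((norm (comb (c k) G x - g0 x))^2)"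
       by (auto simp: indicator_def y_def)
     qed
     also have "... = en d * vol K + en (1/d)*energy2 (%x. comb (c k) G x - g0 x)"
      unfolding energy2_def by (simp add: nn_integral_add nn_integral_cmult)
     also have "... <= en d*en m + en (1/d)*en (d*(e/2))"
      unfolding m(1) by (intro add_mono mult_left_mono less_imp_le[OF elim] order_refl) auto
     also have "... = en (d*m + e/2)" using d e m by (simp flip: ennreal_mult ennreal_plus)
     also have "... <= en e" using d by (intro ennreal_leI) auto
     finally show ?case .
    qed
   qed
  qed simp_all
  ultimately have "(LINT x|lborel. v0 x*pdiff b \<phi> x) = - (LINT x|lborel. (g0 x \<bullet> b)*\<phi> x)"
   by (auto intro!: LIMSEQ_unique tendsto_minus)
  moreover have "(LINT x:Om|lebesgue. u0 x*pdiff b \<phi> x) = (LINT x|lborel. v0 x*pdiff b \<phi> x)"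
   by (rule LINT_rep[OF Kb K(2) iu(3)[OF K] v0]) (use z in auto)
  moreover have "(LINT x:Om|lebesgue. (g0 x \<bullet> b)*\<phi> x) = (LINT x|lborel. (g0 x \<bullet> b)*\<phi> x)"
   by (rule LINT_rep[OF Kb K(2) inner_rep[OF ig0[OF K(1)]]]) (use z in auto)
  ultimately show "(LINT x:Om|lebesgue. u0 x*pdiff b \<phi> x) = - (LINT x:Om|lebesgue. (g0 x \<bullet> b)*\<phi> x)" by simp
 qed
 moreover have "set_integrable lebesgue K (%x. (u0 x)^2)" if K: "compact K" "K \<subseteq> Om" for K
  unfolding set_integrable_def
 proof (rule Bochner_Integration.integrable_bound[OF iu(3)[OF K, unfolded set_integrable_def]])
  have "(%x. ind K x *R u0 x) \<in> borel_measurable lebesgue"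
   using iu(3)[OF K] unfolding set_integrable_def by (rule borel_measurable_integrable)
  then have "(%x. (ind K x *R u0 x)^2) \<in> borel_measurable lebesgue" by (rule borel_measurable_power)
  moreover have "(%x. (ind K x *R u0 x)^2) = (%x. ind K x *R (u0 x)\<^sup>2)" by (auto simp: indicator_def)
  ultimately show "(%x. ind K x *R (u0 x)\<^sup>2) \<in> borel_measurable lebesgue" by simp
  show "AE x in lebesgue. norm (ind K x *R (u0 x)\<^sup>2) <= norm (ind K x *R u0 x)"
   using u0_01 by eventually_elim (use K in \<open>auto simp: indicator_def power2_eq_square intro: mult_left_le\<close>)
 qed
 ultimately show "W12_loc Om u0" unfolding W12_loc_def using sq borel_compact by (intro exI[of _ g0]) blast
qed

section \<open>Compactness in mean\<close>

lemma diagonal_convergent: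
 fixes a :: "nat => nat => real"
 assumes "!!n j. \<bar>a n j\<bar> <= B n"
 shows "\<exists>s. strict_mono s & (\<forall>n. convergent (%j. a n (s j)))"
proof -
 interpret subseqs "%n s. convergent (%j. a n (s j))"
 proof
  fix n and s :: "nat => nat"
  have "bounded (range (%j. a n (s j)))" using assms[of n] by (intro boundedI[of _ "B n"]) auto
  then obtain l r where "strict_mono r" "((%j. a n (s j)) \<circ> r) ----> l" using bounded_imp_convergent_subsequence by blast
  then show "\<exists>r. strict_mono r & convergent (%j. a n ((s \<circ> r) j))" by (auto simp: convergent_def o_def)
 qed
 have "convergent (%j. a n (diagseq j))" for n
 proof -
  have "convergent (%j. a n ((diagseq \<circ> (+) (Suc n)) j))"
  proof (rule diagseq_holds)
   fix r s :: "nat => nat" and m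
   assume "strict_mono r" "convergent (%j. a m (s j))"
   from convergent_subseq_convergent[OF this(2,1)] show "convergent (%j. a m ((s \<circ> r) j))" by (simp add: o_def)
  qed
  then have "convergent (%j. a n (diagseq (j + Suc n)))" by (simp add: o_def add.commute)
  then show ?thesis using convergent_ignore_initial_segment[of "%j. a n (diagseq j)" "Suc n"] by simp
 qed
 then show ?thesis using subseq_diagseq by blast
qed

lemma integrable_indicator_ball: "integrable lborel (ind (ball (z::'a::euclidean_space) r))"
 using emeasure_bounded_finite[of "ball z r"] by (intro integrable_real_indicator) (auto simp: less_top)

lemma ball_integral_diff:
 fixes w :: "'a::euclidean_space => real"
 assumes w[measurable]: "w \<in> BM" and w1: "!!x. \<bar>w x\<bar> <= 1" and e: "e >= 0"
  and tr: "trdiff (chi (ball 0 r)) (x - d) <= en e"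
 shows "\<bar>(LINT y|lborel. ind (ball x r) y*w y) - (LINT y|lborel. ind (ball d r) y*w y)\<bar> <= e"
proof -
 have i: "integrable lborel (%y. ind (ball z r) y*w y)" for z
 proof (rule Bochner_Integration.integrable_bound[of _ "ind (ball z r)"])
  show "integrable lborel (ind (ball z r))" by (rule integrable_indicator_ball)
  show "AE y in lborel. norm (ind (ball z r) y*w y) <= norm (ind (ball z r) y)"
   using w1 by (intro AE_I2) (auto simp: indicator_def)
 qed measurable
 have "en \<bar>(LINT y|lborel. ind (ball x r) y*w y) - (LINT y|lborel. ind (ball d r) y*w y)\<bar>
  <= (LI y. en \<bar>ind (ball x r) y*w y - ind (ball d r) y*w y\<bar>)"
  using integral_norm_bound_ennreal[of lborel "%y. ind (ball x r) y*w y - ind (ball d r) y*w y"] i by simp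
 also have "... <= (LI y. en \<bar>ind (ball d r) y - ind (ball x r) y\<bar>)"
  using w1 by (intro nn_integral_mono ennreal_leI) (auto simp: indicator_def)
 also have "... = (LI y. en \<bar>ind (ball 0 r) ((y + (- x)) + (x - d)) - ind (ball 0 r) (y + (- x))\<bar>)"
  by (intro nn_integral_cong) (auto simp: indicator_def dist_norm norm_minus_commute)
 also have "... = trdiff (chi (ball 0 r)) (x - d)"
  unfolding trdiff_def by (rule nn_integral_translate[of "%y. en \<bar>ind (ball 0 r) (y + (x - d)) - ind (ball 0 r) y\<bar>"]) measurable
 also note tr
 finally show ?thesis using e by simp
qed

text \<open>A diagonal sequence makes the integrals over dyadic balls with centres in a countable
  dense set converge. Uniform boundedness and the continuity of translations of a ball extend this
  to all centres.\<close>

lemma weakly_convergent_subseq: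
 fixes w :: "nat => 'a::euclidean_space => real"
 assumes w[measurable]: "!!j. w j \<in> BM" and w1: "!!j x. \<bar>w j x\<bar> <= 1"
 shows "\<exists>s. strict_mono s & (\<forall>x k. Cauchy (%j. LINT y|lborel. ind (ball x (hp k)) y*w (s j) y))"
proof -
 obtain D :: "'a set" where D: "countable D" "!!X. open X ==> X \<noteq> {} ==> \<exists>d\<in>D. d \<in> X"
  by (rule countable_dense_setE) blast
 define P where "P j k x = (LINT y|lborel. ind (ball x (hp k)) y*w j y)" for j k x
 have Pb: "\<bar>P j k x\<bar> <= measure lborel (ball x (hp k))" for j k x
 proof -
  have "\<bar>P j k x\<bar> <= (LINT y|lborel. \<bar>ind (ball x (hp k)) y*w j y\<bar>)" unfolding P_def by (rule integral_abs_bound)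
  also have "... <= (LINT y|lborel. ind (ball x (hp k)) y)"
   using w1 by (intro integral_mono' integrable_indicator_ball) (auto simp: indicator_def)
  finally show ?thesis by simp
 qed
 have "\<exists>s. strict_mono s & (\<forall>n. convergent (%j. P (s j) (snd (prod_decode n)) (from_nat_into D (fst (prod_decode n)))))"
  by (rule diagonal_convergent) (rule Pb)
 then obtain s where s: "strict_mono s" "!!n. convergent (%j. P (s j) (snd (prod_decode n)) (from_nat_into D (fst (prod_decode n))))" by blast
 have conv: "convergent (%j. P (s j) k d)" if d: "d \<in> D" for k d
  using s(2)[of "prod_encode (to_nat_on D d, k)"] d D(1) by simp
 have "Cauchy (%j. P (s j) k x)" for k x
 proof (rule CauchyI)
  fix e :: real assume e: "e > 0"
  from trdiff_small[OF integrable_indicator_ball[of "0::'a" "hp k"], of "e/3"] e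
  obtain de where de: "de > 0" "!!v. norm v < de ==> trdiff (ind (ball (0::'a) (hp k))) v <= en (e/3)" by auto
  obtain d where d: "d \<in> D" "d \<in> ball x de" using D(2)[of "ball x de"] de(1) by auto
  have close: "\<bar>P j k x - P j k d\<bar> <= e/3" for j
   unfolding P_def using d de e by (intro ball_integral_diff w w1) (auto simp: dist_norm)
  obtain J where J: "!!m n. m >= J ==> n >= J ==> norm (P (s m) k d - P (s n) k d) < e/3"
   using CauchyD[OF convergent_Cauchy[OF conv[OF d(1)]], of "e/3" k] e by auto
  have "norm (P (s m) k x - P (s n) k x) < e" if "m >= J" "n >= J" for m n
   using J[OF that] close[of "s m"] close[of "s n"] unfolding real_norm_def by linarith
  then show "\<exists>M. \<forall>m\<ge>M. \<forall>n\<ge>M. norm (P (s m) k x - P (s n) k x) < e" by blast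
 qed
 then show ?thesis using s(1) unfolding P_def by blast
qed

text \<open>For each shift v shorter than 2^-k the L^1 difference on S is at most 2^-k times the
  integral of G; the condition on S keeps the segments in Q.\<close>

lemma mean_osc_upgrad:
 fixes w G :: "'a::euclidean_space => real"
 assumes up: "upgrad Q w G" and S[measurable]: "S \<in> sets borel" and SQ: "!!x. x \<in> S ==> ball x (hp k) \<subseteq> Q"
 shows "(LI x:S. mean_osc k w x) <= en (unit_ball_vol (real DIM('a))*hp k)*(LI x. en (G x))"
proof -
 have [measurable]: "w \<in> BM" "G \<in> BM" using up by (auto simp: upgrad_def)
 define I where "I = (LI x. en (G x))"
 have 1: "(LI x:S. en \<bar>w (x + v) - w x\<bar>) <= en (hp k)*I" if v: "v \<in> ball 0 (hp k)" for v
 proof -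
  have "AE x in lborel. closed_segment x (x + v) \<subseteq> Q --> en \<bar>w (x + v) - w x\<bar> <= en (norm v)*(LI ta:{0..1}. en (G (x + ta *R v)))"
   using up by (simp add: upgrad_def)
  then have "(LI x:S. en \<bar>w (x + v) - w x\<bar>) <= (LI x. en (norm v)*(LI ta:{0..1}. en (G (x + ta *R v))))"
  proof (intro nn_integral_mono_AE, eventually_elim)
   case (elim x)
   have "closed_segment x (x + v) \<subseteq> ball x (hp k)"
    using v by (intro closed_segment_subset) (auto simp: dist_norm)
   then show ?case using elim SQ[of x] by (auto simp: indicator_def)
  qed
  also have "... = en (norm v)*(LI x. LI ta. en (G (x + ta *R v))*chi {0..1} ta)"
   by (rule nn_integral_cmult) measurable
  also have "(LI x. LI ta. en (G (x + ta *R v))*chi {0..1} ta) = (LI ta. LI x. en (G (x + ta *R v))*chi {0..1} ta)"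
   by (rule lborel_pair.Fubini') measurable
  also have "... = I" by (simp add: nn_integral_multc nn_integral_translate[of "%x. en (G x)"] nn_integral_cmult I_def)
  also have "en (norm v)*I <= en (hp k)*I" using v by (intro mult_right_mono ennreal_leI) auto
  finally show ?thesis .
 qed
 have "(LI x:S. mean_osc k w x)
  = (LI x. en (2^(k*DIM('a)))*(LI v. en \<bar>w (x + v) - w x\<bar>*chi S x*chi (ball 0 (hp k)) v))"
  by (intro nn_integral_cong) (auto simp: mean_osc_shift indicator_def)
 also have "... = en (2^(k*DIM('a)))*(LI x. LI v. en \<bar>w (x + v) - w x\<bar>*chi S x*chi (ball 0 (hp k)) v)"
  by (rule nn_integral_cmult) measurable
 also have "(LI x. LI v. en \<bar>w (x + v) - w x\<bar>*chi S x*chi (ball 0 (hp k)) v)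
  = (LI v. LI x. en \<bar>w (x + v) - w x\<bar>*chi S x*chi (ball 0 (hp k)) v)"
  by (rule lborel_pair.Fubini') measurable
 also have "... <= (LI v. (en (hp k)*I)*chi (ball (0::'a) (hp k)) v)"
  using 1 by (intro nn_integral_mono) (auto simp: nn_integral_multc indicator_def)
 also have "... = en (hp k)*I*en (unit_ball_vol (real DIM('a))*hp (k*DIM('a)))"
  by (simp add: nn_integral_cmult emeasure_ball_dyadic)
 also have "en (2^(k*DIM('a)))*(en (hp k)*I*en (unit_ball_vol (real DIM('a))*hp (k*DIM('a))))
   = en (unit_ball_vol (real DIM('a))*hp k)*I"
 proof -
  have "en (2^(k*DIM('a)))*(en (hp k)*en (unit_ball_vol (real DIM('a))*hp (k*DIM('a)))) = en (unit_ball_vol (real DIM('a))*hp k)"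
   by (simp flip: ennreal_mult add: power_one_over)
  then show ?thesis by (simp add: mult_ac)
 qed
 finally show ?thesis by (simp add: I_def mult_left_mono)
qed

text \<open>No regularity of the boundary of Q enters: the functions are bounded by 1, so a thin
  boundary layer contributes little. Inside, w is close to its averages over balls of radius 2^-k,
  uniformly in j, and the averages converge boundedly.\<close>

lemma rellich:
 fixes w G :: "nat => 'a::euclidean_space => real"
 assumes Q: "open Q" "bounded Q" and up: "!!j. upgrad Q (w j) (G j)"
  and w1: "!!j x. w j x \<in> {0..1}" and w0: "!!j x. x \<notin> Q ==> w j x = 0"
  and M: "!!j. (LI x. en (G j x)) <= en M"
 shows "\<exists>s v. strict_mono s & v \<in> BM & (\<forall>x. v x \<in> {0..1}) & (AE x in lborel. (%j. w (s j) x) ----> v x)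
  & (%j. LI x:Q. en \<bar>w (s j) x - v x\<bar>) ----> 0"
proof -
 have [measurable]: "w j \<in> BM" for j using up by (auto simp: upgrad_def)
 have [measurable]: "Q \<in> sets borel" using Q by simp
 have Qfin: "vol Q < \<infinity>" using emeasure_bounded_finite[OF Q(2)] by simp
 obtain s where s: "strict_mono s" and sC: "!!x k. Cauchy (%j. LINT y|lborel. ind (ball x (hp k)) y*w (s j) y)"
  using weakly_convergent_subseq[of w] w1 by auto
 define W where "W j = w (s j)" for j
 have [measurable]: "W j \<in> BM" for j by (simp add: W_def)
 have W1: "W j x \<in> {0..1}" "x \<notin> Q ==> W j x = 0" for j x using w1 w0 by (auto simp: W_def)
 define P where "P k j x = (LINT y|lborel. ind (ball x (hp k)) y*W j y)" for k j x
 have PC: "Cauchy (%j. P k j x)" for k x using sC by (simp add: P_def W_def)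
 have [measurable]: "P k j \<in> BM" for k j
 proof -
  have "(%x. LINT y|lborel. (if dist x y < (1/2)^k then W j y else 0)) \<in> borel_measurable lborel"
   by (intro lborel.borel_measurable_lebesgue_integral) measurable
  moreover have "P k j = (%x. LINT y|lborel. (if dist x y < (1/2)^k then W j y else 0))"
   unfolding P_def by (intro ext Bochner_Integration.integral_cong) (auto simp: indicator_def)
  ultimately show ?thesis by simp
 qed
 have iW: "integrable lborel (W j)" for j
 proof (rule Bochner_Integration.integrable_bound[of _ "ind Q"])
  show "integrable lborel (ind Q)" using Qfin by (intro integrable_real_indicator) auto
  show "AE x in lborel. norm (W j x) <= norm (ind Q x)"
   using W1 by (intro AE_I2) (auto simp: indicator_def)
 qed measurable
 define om where "om = unit_ball_vol (real DIM('a))"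
 have om: "om > 0" by (simp add: om_def)
 define S where "S k = {x. ball x (hp k) \<subseteq> Q}" for k :: nat
 have SQ: "S k \<subseteq> Q" for k by (auto simp: S_def)
 have [measurable]: "S k \<in> sets borel" for k
 proof -
  have "- S k = (\<Union>y\<in>- Q. ball y (hp k))" by (auto simp: S_def dist_commute subset_eq)
  then have "closed (S k)" unfolding closed_def by auto
  then show ?thesis by simp
 qed
 \<comment> \<open>Comparison through the averages: each function is compared with its own ball
   average, and the two averages with each other.\<close>
 have pt: "en om*en \<bar>W i x - W j x\<bar> <= mean_osc k (W i) x + mean_osc k (W j) x + en (2^(k*DIM('a)))*en \<bar>P k i x - P k j x\<bar>" for i j k x
 proof -
  let ?B = "ball x (hp k)"
  have iB: "integrable lborel (%y. ind ?B y * H y)" if "integrable lborel H" for H :: "'a => real"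
   using integrable_real_mult_indicator[OF _ that, of ?B] by (simp add: mult.commute)
  have iB': "integrable lborel (%y. ind ?B y*c)" for c :: real by (intro integrable_mult_left integrable_indicator_ball)
  have m: "measure lborel ?B*c = (LINT y|lborel. ind ?B y*c)" for c by simp
  have d: "en \<bar>P k j x - measure lborel ?B*W j x\<bar> <= (dev ?B (W j) (W j x))" for j
  proof -
   have "P k j x - measure lborel ?B*W j x = (LINT y|lborel. ind ?B y*W j y - ind ?B y*W j x)"
    unfolding P_def m by (rule Bochner_Integration.integral_diff[symmetric]) (intro iB iW iB')+
   then have "en \<bar>P k j x - measure lborel ?B*W j x\<bar> <= (LI y. en \<bar>ind ?B y*W j y - ind ?B y*W j x\<bar>)"
    using integral_norm_bound_ennreal[OF Bochner_Integration.integrable_diff[OF iB[OF iW[of j]] iB'[of "W j x"]]] by simp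
   also have "... = (dev ?B (W j) (W j x))" by (intro nn_integral_cong) (auto simp: indicator_def)
   finally show ?thesis .
  qed
  define c where "c = (2::real)^(k*DIM('a))"
  have "vol ?B = en (om*hp (k*DIM('a)))" unfolding om_def by (rule emeasure_ball_dyadic)
  then have c: "c > 0" "c*measure lborel ?B = om" using om by (auto simp: c_def measure_def power_one_over)
  have "om*\<bar>W i x - W j x\<bar> = c*\<bar>measure lborel ?B*W i x - measure lborel ?B*W j x\<bar>"
   unfolding c(2)[symmetric] by (simp add: abs_mult flip: right_diff_distrib)
  also have "... <= c*(\<bar>P k i x - measure lborel ?B*W i x\<bar> + \<bar>P k j x - measure lborel ?B*W j x\<bar> + \<bar>P k i x - P k j x\<bar>)"
   using c(1) by (intro mult_left_mono) auto
  finally have "en (om*\<bar>W i x - W j x\<bar>) <= en (c*(\<bar>P k i x - measure lborel ?B*W i x\<bar> + \<bar>P k j x - measure lborel ?B*W j x\<bar> + \<bar>P k i x - P k j x\<bar>))"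
   by (rule ennreal_leI)
  also have "... = en c*en \<bar>P k i x - measure lborel ?B*W i x\<bar> + en c*en \<bar>P k j x - measure lborel ?B*W j x\<bar> + en c*en \<bar>P k i x - P k j x\<bar>"
   using c(1) by (simp flip: ennreal_mult ennreal_plus add: distrib_left)
  also have "... <= mean_osc k (W i) x + mean_osc k (W j) x + en c*en \<bar>P k i x - P k j x\<bar>"
   unfolding mean_osc_def c_def by (intro add_mono mult_left_mono d order_refl) auto
  finally show ?thesis using om by (simp add: ennreal_mult c_def)
 qed
 have cauchy: "\<exists>N. \<forall>i\<ge>N. \<forall>j\<ge>N. LINT x|lborel. norm (W i x - W j x) < e" if e: "e > 0" for e
 proof -
  have "(%k. vol (Q - S k)) ----> vol (\<Inter>k. Q - S k)"
  proof (rule Lim_emeasure_decseq)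
   show "decseq (%k. Q - S k)"
   proof (rule decseq_SucI)
    fix k
    have "ball x ((1/2)^Suc k) \<subseteq> ball x (hp k)" for x :: 'a by (rule subset_ball) simp
    then have "S k \<subseteq> S (Suc k)" unfolding S_def by blast
    then show "Q - S (Suc k) \<subseteq> Q - S k" by blast
   qed
   show "vol (Q - S k) \<noteq> \<infinity>" for k
    using emeasure_mono[of "Q - S k" Q lborel] Qfin by (auto simp: top_unique)
  qed auto
  moreover have "(\<Inter>k. Q - S k) = {}"
  proof -
   have "\<exists>k. x \<in> S k" if "x \<in> Q" for x
   proof -
    obtain r where r: "r > 0" "ball x r \<subseteq> Q" using openE[OF Q(1) \<open>x \<in> Q\<close>] by blast
    obtain k where "hp k < r" using real_arch_pow_inv[OF r(1), of "1/2"] by auto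
    then have "ball x (hp k) \<subseteq> ball x r" by (intro subset_ball) simp
    then show ?thesis using r by (auto simp: S_def)
   qed
   then show ?thesis by blast
  qed
  ultimately have "(%k. vol (Q - S k)) ----> 0" by (simp only: emeasure_empty)
  then have "eventually (%k. vol (Q - S k) < en (e/4)) sq" using e by (intro order_tendstoD(2)) auto
  moreover have "(%k. hp k*\<bar>M\<bar>) ----> 0*\<bar>M\<bar>" by (intro tendsto_intros) auto
  then have "eventually (%k. hp k*\<bar>M\<bar> < e/8) sq" using e by (intro order_tendstoD(2)) auto
  ultimately have "eventually (%k. vol (Q - S k) < en (e/4) & hp k*\<bar>M\<bar> < e/8) sq" by (rule eventually_conj)
  then obtain k where k: "vol (Q - S k) < en (e/4)" "hp k*\<bar>M\<bar> < e/8"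
   using eventually_happens'[OF sequentially_bot] by blast
  define p where "p x = lim (%j. P k j x)" for x
  have [measurable]: "p \<in> BM" unfolding p_def[abs_def] by (rule borel_measurable_lim_metric) simp
  have Pp: "(%j. P k j x) ----> p x" for x using PC[of k x] unfolding p_def by (simp add: Cauchy_convergent_iff convergent_LIMSEQ_iff)
  define c where "c = (2::real)^(k*DIM('a))"
  have c: "c > 0" by (simp add: c_def)
  define b where "b = om*hp (k*DIM('a))"
  have b: "b >= 0" using om by (simp add: b_def)
  have Pb: "\<bar>P k j x\<bar> <= b" for j x
  proof -
   have "\<bar>P k j x\<bar> <= (LINT y|lborel. \<bar>ind (ball x (hp k)) y*W j y\<bar>)" unfolding P_def by (rule integral_abs_bound)
   also have "... <= (LINT y|lborel. ind (ball x (hp k)) y)"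
    using W1 by (intro integral_mono' integrable_indicator_ball) (auto simp: indicator_def abs_mult)
   also have "... = b" using om by (simp add: measure_def emeasure_ball_dyadic b_def om_def)
   finally show ?thesis .
  qed
  have "(%j. LI x. en \<bar>P k j x - p x\<bar>*chi Q x) ----> (\<integral>\<^sup>+x. 0 \<partial>(lborel::'a measure))"
  proof (rule nn_integral_dominated_convergence[where w="%x. en (2 * b)*chi Q x"])
   show "AE x in lborel. en \<bar>P k j x - p x\<bar>*chi Q x <= en (2 * b)*chi Q x" for j
   proof (intro AE_I2 mult_right_mono ennreal_leI)
    fix x
    have "\<bar>p x\<bar> <= b" by (rule LIMSEQ_le_const2[OF tendsto_rabs[OF Pp[of x]]]) (use Pb in auto)
    then show "\<bar>P k j x - p x\<bar> <= 2 * b" using Pb[of j x] by linarith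
   qed simp
   show "(LI x. en (2 * b)*chi Q x) < \<infinity>" using Qfin by (simp add: nn_integral_cmult ennreal_mult_less_top)
   show "AE x in lborel. (%j. en \<bar>P k j x - p x\<bar>*chi Q x) ----> 0"
   proof (rule AE_I2)
    fix x
    have "(%j. \<bar>P k j x - p x\<bar>) ----> 0" using Pp[of x] by (intro tendsto_rabs_zero LIM_zero)
    then have "(%j. en \<bar>P k j x - p x\<bar>) ----> en 0" by (rule tendsto_ennrealI)
    then show "(%j. en \<bar>P k j x - p x\<bar>*chi Q x) ----> 0" by (auto simp: indicator_def)
   qed
  qed measurable
  then have "(%j. LI x. en \<bar>P k j x - p x\<bar>*chi Q x) ----> 0" by simp
  then have "eventually (%j. (LI x. en \<bar>P k j x - p x\<bar>*chi Q x) < en (om*e/(8*c))) sq"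
   using om e c by (intro order_tendstoD(2)) auto
  then obtain N where N: "!!j. j >= N ==> (LI x. en \<bar>P k j x - p x\<bar>*chi Q x) < en (om*e/(8*c))"
   by (auto simp: eventually_sequentially)
  have "(LINT x|lborel. norm (W i x - W j x)) < e" if ij: "i >= N" "j >= N" for i j
  proof -
   have mo: "(LI x:S k. mean_osc k (W j) x) <= en (om*(e/8))" for j
   proof -
    have "(LI x:S k. mean_osc k (W j) x) <= en (om*hp k)*(LI x. en (G (s j) x))"
     unfolding om_def W_def by (rule mean_osc_upgrad[OF up]) (simp, simp add: S_def)
    also have "... <= en (om*hp k)*en \<bar>M\<bar>"
     by (intro mult_left_mono order_trans[OF M] ennreal_leI) auto
    also have "... = en (om*(hp k*\<bar>M\<bar>))" using om by (simp add: mult.assoc flip: ennreal_mult)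
    also have "... <= en (om*(e/8))" using k(2) om by (intro ennreal_leI mult_left_mono) auto
    finally show ?thesis .
   qed
   have PP: "(dist1 Q (P k i) (P k j)) <= en (om*e/(4*c))"
   proof -
    have "(dist1 Q (P k i) (P k j)) <= (LI x. en \<bar>P k i x - p x\<bar>*chi Q x + en \<bar>P k j x - p x\<bar>*chi Q x)"
     by (intro nn_integral_mono) (auto simp: indicator_def simp flip: ennreal_plus intro!: ennreal_leI)
    also have "... = (LI x. en \<bar>P k i x - p x\<bar>*chi Q x) + (LI x. en \<bar>P k j x - p x\<bar>*chi Q x)"
     by (rule nn_integral_add) measurable
    also have "... <= en (om*e/(8*c)) + en (om*e/(8*c))"
     using N ij by (intro add_mono less_imp_le) auto
    also have "... = en (om*e/(4*c))" using om e c by (simp flip: ennreal_plus)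
    finally show ?thesis .
   qed
   have "en om*(dist1 (S k) (W i) (W j))
    <= (LI x. (mean_osc k (W i) x*chi (S k) x + mean_osc k (W j) x*chi (S k) x) + en c*(en \<bar>P k i x - P k j x\<bar>*chi Q x))"
   proof (subst nn_integral_cmult[symmetric])
    show "(LI x. en om*(en \<bar>W i x - W j x\<bar>*chi (S k) x))
     <= (LI x. (mean_osc k (W i) x*chi (S k) x + mean_osc k (W j) x*chi (S k) x) + en c*(en \<bar>P k i x - P k j x\<bar>*chi Q x))"
     using SQ[of k] pt[of i _ j k] by (intro nn_integral_mono) (auto simp: indicator_def c_def)
   qed measurable
   also have "... = ((LI x:S k. mean_osc k (W i) x) + (LI x:S k. mean_osc k (W j) x)) + en c*(dist1 Q (P k i) (P k j))"
    by (simp add: nn_integral_add nn_integral_cmult)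
   also have "... <= (en (om*(e/8)) + en (om*(e/8))) + en c*en (om*e/(4*c))"
    by (intro add_mono mo mult_left_mono PP) simp
   also have "... = en om*en (e/2)" using om e c by (simp flip: ennreal_plus ennreal_mult)
   finally have A: "(dist1 (S k) (W i) (W j)) <= en (e/2)"
    using om by (subst (asm) ennreal_mult_le_mult_iff) auto
   have "(LI x. en \<bar>W i x - W j x\<bar>) <= (LI x. en \<bar>W i x - W j x\<bar>*chi (S k) x + chi (Q - S k) x)"
   proof (rule nn_integral_mono)
    fix x
    show "en \<bar>W i x - W j x\<bar> <= en \<bar>W i x - W j x\<bar>*chi (S k) x + chi (Q - S k) x"
    proof (cases "x \<in> Q - S k")
     case True
     have "\<bar>W i x - W j x\<bar> <= 1" using W1(1)[of i x] W1(1)[of j x] by auto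
     from ennreal_leI[OF this] show ?thesis using True by simp
    next
     case False
     then show ?thesis using W1(2)[of x i] W1(2)[of x j] by (cases "x \<in> S k") auto
    qed
   qed
   also have "... = (dist1 (S k) (W i) (W j)) + vol (Q - S k)"
    by (simp add: nn_integral_add)
   also have "... <= en (e/2) + en (e/4)" using k(1) A by (intro add_mono) auto
   also have "... = en (3*e/4)" using e by (simp flip: ennreal_plus)
   finally have "en (LINT x|lborel. norm (W i x - W j x)) <= en (3*e/4)"
    using iW by (subst nn_integral_eq_integral[symmetric]) auto
   then show ?thesis using e by (subst (asm) ennreal_le_iff) auto
  qed
  then show ?thesis by blast
 qed
 obtain r where r: "strict_mono r" "AE x in lborel. Cauchy (%i. W (r i) x)"
  by (rule cauchy_L1_AE_cauchy_subseq[OF iW cauchy])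
 \<comment> \<open>Clamped to have values in [0,1] at every point, also where the sequence fails to
   converge.\<close>
 define v where "v x = max 0 (min 1 (lim (%i. W (r i) x)))" for x
 have "(%x. lim (%i. W (r i) x)) \<in> BM" by (rule borel_measurable_lim_metric) simp
 then have [measurable]: "v \<in> BM" unfolding v_def[abs_def] by measurable
 have v1: "v x \<in> {0..1}" for x by (simp add: v_def)
 have conv: "AE x in lborel. (%j. W (r j) x) ----> v x"
  using r(2)
 proof eventually_elim
  case (elim x)
  then have l: "(%j. W (r j) x) ----> lim (%i. W (r i) x)" by (simp add: Cauchy_convergent_iff convergent_LIMSEQ_iff)
  have "0 <= lim (%i. W (r i) x)" by (rule LIMSEQ_le_const[OF l]) (use W1 in auto)
  moreover have "lim (%i. W (r i) x) <= 1" by (rule LIMSEQ_le_const2[OF l]) (use W1 in auto)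
  ultimately show ?case using l by (simp add: v_def)
 qed
 have "(%j. LI x. en \<bar>W (r j) x - v x\<bar>*chi Q x) ----> (\<integral>\<^sup>+x. 0 \<partial>(lborel::'a measure))"
 proof (rule nn_integral_dominated_convergence[where w="chi Q"])
  show "AE x in lborel. en \<bar>W (r j) x - v x\<bar>*chi Q x <= chi Q x" for j
  proof (rule AE_I2)
   fix x
   have "\<bar>W (r j) x - v x\<bar> <= 1" using W1(1)[of "r j" x] v1[of x] by auto
   from ennreal_leI[OF this] show "en \<bar>W (r j) x - v x\<bar>*chi Q x <= chi Q x" by (auto simp: indicator_def)
  qed
  show "(LI x. chi Q x) < \<infinity>" using Qfin by simp
  show "AE x in lborel. (%j. en \<bar>W (r j) x - v x\<bar>*chi Q x) ----> 0"
   using conv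
  proof eventually_elim
   case (elim x)
   then have "(%j. \<bar>W (r j) x - v x\<bar>) ----> 0" by (intro tendsto_rabs_zero LIM_zero)
   then have "(%j. en \<bar>W (r j) x - v x\<bar>) ----> en 0" by (rule tendsto_ennrealI)
   then show ?case by (auto simp: indicator_def)
  qed
 qed measurable
 then have "(%j. LI x:Q. en \<bar>w ((s \<circ> r) j) x - v x\<bar>) ----> 0" by (simp add: W_def)
 moreover have "AE x in lborel. (%j. w ((s \<circ> r) j) x) ----> v x" using conv by (simp add: W_def)
 moreover have "strict_mono (s \<circ> r)" using s r(1) by (rule strict_mono_o)
 ultimately show ?thesis using v1 by (intro exI[of _ "s \<circ> r"] exI[of _ v]) simp
qed

section \<open>Cones and tubes\<close>

text \<open>A truncated open convex cone, nonempty for si < |nu|. As si decreases to 0, the cones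
  about nu and -nu exhaust the ball up to a hyperplane.\<close>

definition cone :: "'a::euclidean_space => real => 'a set" where
 "cone nu si = {v\<in>ball 0 1. si*norm v < v \<bullet> nu}"

lemma cone_props:
 fixes nu :: "'a::euclidean_space"
 assumes si: "si > 0"
 shows "open (cone nu si)" "convex (cone nu si)" "cone nu si \<subseteq> ball 0 1" "cone nu si \<in> sets borel"
  "v \<in> cone nu si ==> (1/2) *R v \<in> cone nu si" "vol (cone nu si) < \<infinity>"
  "si < norm nu ==> vol (cone nu si) > 0"
proof -
 have e: "cone nu si = ball 0 1 \<inter> {v. si*norm v < v \<bullet> nu}" by (auto simp: cone_def)
 have "open {v. si*norm v < v \<bullet> nu}" by (intro open_Collect_less continuous_intros)
 then show op: "open (cone nu si)" unfolding e by auto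
 then show "cone nu si \<in> sets borel" by simp
 show "convex (cone nu si)"
  unfolding e
 proof (intro convex_Int convex_ball convexI)
  fix v w :: 'a and a b :: real
  assume v: "v \<in> {v. si*norm v < v \<bullet> nu}" "w \<in> {v. si*norm v < v \<bullet> nu}" and ab: "0 <= a" "0 <= b" "a + b = 1"
  have "si*norm (a *R v + b *R w) <= si*(a*norm v + b*norm w)"
   using si ab norm_triangle_ineq[of "a *R v" "b *R w"] by (intro mult_left_mono) auto
  also have "... = a*(si*norm v) + b*(si*norm w)" by (simp add: algebra_simps)
  also have "... < a*(v \<bullet> nu) + b*(w \<bullet> nu)"
  proof (cases "a = 0")
   case False
   then show ?thesis using v ab by (intro add_less_le_mono mult_strict_left_mono mult_left_mono) auto
  qed (use v ab in auto)
  finally show "a *R v + b *R w \<in> {v. si*norm v < v \<bullet> nu}" by (simp add: inner_add_left)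
 qed
 show sub: "cone nu si \<subseteq> ball 0 1" by (auto simp: cone_def)
 show "v \<in> cone nu si ==> (1/2) *R v \<in> cone nu si" by (auto simp: cone_def)
 show "vol (cone nu si) < \<infinity>"
  using emeasure_bounded_finite[OF bounded_subset[OF bounded_ball sub]] by simp
 assume "si < norm nu"
 then have "((1/2)/norm nu) *R nu \<in> cone nu si"
  using si by (cases "nu = 0") (auto simp: cone_def power2_norm_eq_inner[symmetric] power2_eq_square)
 then have "cone nu si \<noteq> {}" by auto
 then show "vol (cone nu si) > 0"
  using op open_not_negligible[OF op] by (auto simp: negligible_iff_emeasure0 zero_less_iff_neq_zero)
qed

text \<open>On the cone the linear part is at least si*|v|, while differentiability makes the error
  at most half of that at small scales.\<close>

lemma cone_pos:
 fixes x :: "'a::euclidean_space"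
 assumes m: "(m has_derivative (%v. v \<bullet> nu)) (at x)" and mx: "m x = 0" and si: "si > 0"
 shows "\<exists>k0. \<forall>k\<ge>k0. \<forall>q\<in>sc x k (cone nu si). 0 < m q"
proof -
 obtain d where d: "d > 0" "!!y. norm (y - x) < d ==> norm (m y - m x - (y - x) \<bullet> nu) <= (si/2)*norm (y - x)"
  using m si unfolding has_derivative_at_alt by (meson half_gt_zero)
 obtain k0 where k0: "hp k0 < d" using real_arch_pow_inv[OF d(1), of "1/2"] by auto
 have "0 < m q" if k: "k >= k0" and q: "q \<in> sc x k (cone nu si)" for k q
 proof -
  have qb: "q \<in> ball x (hp k)" using q sc_mono[of "cone nu si" "ball 0 1"] cone_props(3)[OF si] unfolding sc_ball[symmetric] by blast
  have "hp k <= hp k0" using k by (intro power_decreasing) simp_all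
  then have "norm (q - x) < d" using k0 qb unfolding mem_ball dist_norm norm_minus_commute[of x q] by linarith
  from d(2)[OF this] have "(q - x) \<bullet> nu - (si/2)*norm (q - x) <= m q" unfolding mx real_norm_def by linarith
  moreover have "si*norm (q - x) < (q - x) \<bullet> nu" using q by (simp add: sc_def cone_def)
  moreover have "0 <= si*norm (q - x)" using si by simp
  ultimately show ?thesis by linarith
 qed
 then show ?thesis by blast
qed

lemma has_derivative_inner_rep:
 fixes m :: "'a::euclidean_space => real"
 assumes "(m has_derivative D) (at x)"
 shows "D = (%v. v \<bullet> (\<Sum>b\<in>Basis. D b *R b))"
proof
 fix v
 interpret linear D using assms by (rule has_derivative_linear)
 have "D v = D (\<Sum>b\<in>Basis. (v \<bullet> b) *R b)" by (simp add: euclidean_representation)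
 also have "... = v \<bullet> (\<Sum>b\<in>Basis. D b *R b)" by (simp add: sum scale inner_sum_right mult.commute)
 finally show "D v = v \<bullet> (\<Sum>b\<in>Basis. D b *R b)" .
qed

text \<open>The composition of m with the curve c has derivative 1 at time 0. Only times in [-1, 0]
  are compared, since at the boundary of a tube the curve stays in the closure only on that
  side.\<close>

lemma gradient_nonzero:
 fixes m :: "'a::euclidean_space => real" and c :: "real => 'a"
 assumes m: "(m has_derivative D) (at x)" and c: "(c has_vector_derivative c') (at 0)" "c 0 = x"
  and eq: "!!th. th \<in> {-1..0} ==> m (c th) = \<phi> th" and \<phi>: "(\<phi> has_vector_derivative 1) (at 0)"
 shows "\<exists>nu. nu \<noteq> 0 & (m has_derivative (%v. v \<bullet> nu)) (at x)"
proof -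
 define nu where "nu = (\<Sum>b\<in>Basis. D b *R b)"
 have D: "D = (%v. v \<bullet> nu)" unfolding nu_def by (rule has_derivative_inner_rep[OF m])
 have "((m \<circ> c) has_vector_derivative D c') (at 0)"
  using diff_chain_at[OF c(1)[unfolded has_vector_derivative_def], of m D] m c(2)
  by (simp add: has_vector_derivative_def D o_def)
 then have 1: "((m \<circ> c) has_vector_derivative D c') (at 0 within cbox (-1) 0)" by (rule has_vector_derivative_at_within)
 have "(\<phi> has_vector_derivative 1) (at 0 within cbox (-1) 0)" by (rule has_vector_derivative_at_within[OF \<phi>])
 then have "((m \<circ> c) has_vector_derivative 1) (at 0 within cbox (-1) 0)"
  by (rule has_vector_derivative_transform[rotated 2]) (use eq in auto)
 from vector_derivative_unique_within_closed_interval[OF _ _ 1 this] have "D c' = 1" by simp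
 then have "nu \<noteq> 0" by (auto simp: D)
 then show ?thesis using m unfolding D by blast
qed

text \<open>The complements of the two cones in the ball decrease to a piece of the hyperplane
  orthogonal to nu, which is null.\<close>

lemma slab_small:
 fixes nu :: "'a::euclidean_space"
 assumes "nu \<noteq> 0" and e: "e > (0::en)"
 shows "\<exists>si>0. si < norm nu & vol (ball 0 1 - (cone nu si \<union> cone (- nu) si)) < e"
proof -
 define si where "si n = norm nu * inverse (real (Suc (Suc n)))" for n
 have si: "si n > 0" "si n < norm nu" for n
  using assms(1) mult_strict_left_mono[of "inverse (real (Suc (Suc n)))" 1 "norm nu"] by (auto simp: si_def inverse_eq_divide)
 define S where "S n = ball 0 1 - (cone nu (si n) \<union> cone (- nu) (si n))" for n
 have [measurable]: "cone nu (si n) \<in> sets borel" "cone (- nu) (si n) \<in> sets borel" for n using cone_props(4)[OF si(1)] by auto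
 have "(%n. vol (S n)) ----> vol (\<Inter>n. S n)"
 proof (rule Lim_emeasure_decseq)
  show "decseq S"
  proof (rule decseq_SucI)
   fix n
   have "si (Suc n) <= si n" unfolding si_def by (intro mult_left_mono le_imp_inverse_le) auto
   then have "si (Suc n)*norm v <= si n*norm v" for v :: 'a by (rule mult_right_mono) simp
   then have "cone nu (si n) \<subseteq> cone nu (si (Suc n))" for nu :: 'a by (auto simp: cone_def intro: le_less_trans)
   then show "S (Suc n) \<subseteq> S n" unfolding S_def by blast
  qed
  show "range S \<subseteq> sets lborel" by (auto simp: S_def)
  show "vol (S n) \<noteq> \<infinity>" for n
  proof -
   have "vol (S n) <= vol (ball (0::'a) 1)" by (rule emeasure_mono) (auto simp: S_def)
   also have "... < \<infinity>" by (rule emeasure_lborel_ball_finite)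
   finally show ?thesis by simp
  qed
 qed
 moreover have "vol (\<Inter>n. S n) = 0"
 proof -
  have "v \<bullet> nu = 0" if v: "v \<in> (\<Inter>n. S n)" for v
  proof -
   have le: "\<bar>v \<bullet> nu\<bar> <= si n*norm v" for n using v by (auto simp: S_def cone_def not_less abs_le_iff dest!: INT_D[of _ _ _ n])
   have "(%n. norm nu * inverse (real (Suc (Suc n)))*norm v) ----> norm nu*0*norm v"
    by (intro tendsto_intros LIMSEQ_Suc[OF LIMSEQ_inverse_real_of_nat])
   then have "(%n. si n*norm v) ----> 0" by (simp add: si_def)
   from LIMSEQ_le_const[OF this] le show ?thesis by fastforce
  qed
  then have "(\<Inter>n. S n) \<subseteq> {v. nu \<bullet> v = 0}" by (auto simp: inner_commute)
  then have "negligible (\<Inter>n. S n)" using negligible_hyperplane[of nu 0] assms(1) negligible_subset by blast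
  then show ?thesis by (simp add: negligible_iff_emeasure0 S_def)
 qed
 ultimately have "(%n. vol (S n)) ----> 0" by simp
 from order_tendstoD(2)[OF this e] obtain n where "vol (S n) < e"
  using eventually_happens'[OF sequentially_bot] by blast
 then show ?thesis using si unfolding S_def by blast
qed

section \<open>Tubes and their slices in coordinates\<close>

lemma cis_inj:
 assumes "cis a = cis b" "\<bar>a - b\<bar> < 2*pi" shows "a = b"
proof -
 have "cis (a - b) = 1" using assms(1) by (simp add: cis_divide[symmetric])
 then have "cos (a - b) = 1" by (simp add: complex_eq_iff)
 then obtain n :: int where n: "a - b = real_of_int n*2*pi" using cos_one_2pi_int by blast
 then have "real_of_int \<bar>n\<bar>*(2*pi) < 1*(2*pi)" using assms(2) by (simp add: abs_mult)
 then have "\<bar>n\<bar> < 1" by (subst (asm) mult_less_cancel_right) (auto simp del: of_int_abs)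
 then show ?thesis using n by simp
qed

lemma tube_image:
 assumes "tube C Wb \<gamma> \<Phi> T"
 shows "closure T = \<Phi> ` (S1 \<times> cball 0 1)" "T = \<Phi> ` (S1 \<times> ball 0 1)" "compact (closure T)" "closure T \<subseteq> - Wb"
 using assms by (auto simp: tube_def bij_betw_def)

text \<open>\<open>smooth_on\<close> speaks of smooth extensions to open sets. Here \<Psi> extends
  \<Phi> and g extends its inverse, so that derivatives exist also at boundary points; compactness
  bounds those of \<Psi>.\<close>

lemma tube_charts:
 fixes \<Phi> :: "complex \<times> 'b::euclidean_space => 'a::euclidean_space"
 assumes tube: "tube C Wb \<gamma> \<Phi> T"
 shows "\<exists>g \<Psi> B. (\<forall>q\<in>closure T. \<exists>D. (g has_derivative D) (at q)) &
  (\<forall>p\<in>S1 \<times> cball 0 1. \<Phi> p \<in> closure T & g (\<Phi> p) = p & \<Psi> p = \<Phi> p) &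
  (\<forall>p\<in>S1 \<times> cball 0 1. \<exists>D. (\<Psi> has_derivative D) (at p) & onorm D <= B)"
proof -
 have T: "T = \<Phi> ` (S1 \<times> ball 0 1)" "bij_betw \<Phi> (S1 \<times> cball 0 1) (closure T)"
  and sm: "smooth_on (S1 \<times> cball 0 1) \<Phi>" "smooth_on (closure T) (inv_into (S1 \<times> cball 0 1) \<Phi>)"
  using tube by (auto simp: tube_def)
 obtain U g where U: "closure T \<subseteq> U" "smooth_open U g" "!!q. q \<in> closure T ==> g q = inv_into (S1 \<times> cball 0 1) \<Phi> q"
  using sm(2) unfolding smooth_on_def by blast
 obtain V \<Psi> where V: "S1 \<times> cball 0 1 \<subseteq> V" "smooth_open V \<Psi>" "!!p. p \<in> S1 \<times> cball 0 1 ==> \<Psi> p = \<Phi> p"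
  using sm(1) unfolding smooth_on_def by blast
 have img: "closure T = \<Phi> ` (S1 \<times> cball 0 1)" and inj: "inj_on \<Phi> (S1 \<times> cball 0 1)" using T(2) by (auto simp: bij_betw_def)
 have cpt: "compact (S1 \<times> cball 0 1 :: (complex \<times> 'b) set)" by (intro compact_Times) auto
 have "\<exists>B. \<forall>p\<in>S1 \<times> cball 0 1. norm (pdiff b \<Psi> p) <= B" if "b \<in> Basis" for b :: "complex \<times> 'b"
 proof -
  have "continuous_on V (pdiff b \<Psi>)" using V(2) that unfolding smooth_open_def by (auto dest!: spec[of _ "[b]"])
  from compact_imp_bounded[OF compact_continuous_image[OF continuous_on_subset[OF this V(1)] cpt]]
  show ?thesis by (auto simp: bounded_iff)
 qed
 then have "\<forall>b. \<exists>B. b \<in> Basis --> (\<forall>p\<in>S1 \<times> cball 0 1. norm (pdiff b \<Psi> p) <= B)" by blast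
 from choice[OF this] obtain B where B: "!!b p. b \<in> Basis ==> p \<in> S1 \<times> cball 0 1 ==> norm (pdiff b \<Psi> p) <= B b" by blast
 show ?thesis
 proof (rule exI[of _ g], rule exI[of _ \<Psi>], rule exI[of _ "\<Sum>b\<in>Basis. B b"], intro conjI ballI)
  fix q assume "q \<in> closure T"
  then show "\<exists>D. (g has_derivative D) (at q)"
   using smooth_open_has_derivative[OF U(2)] U(1) by blast
 next
  fix p :: "complex \<times> 'b" assume p: "p \<in> S1 \<times> cball 0 1"
  show "\<Phi> p \<in> closure T" using img p by blast
  then show "g (\<Phi> p) = p" using U(3)[of "\<Phi> p"] inv_into_f_f[OF inj p] by simp
  show "\<Psi> p = \<Phi> p" by (rule V(3)[OF p])
  show "\<exists>D. (\<Psi> has_derivative D) (at p) & onorm D <= (\<Sum>b\<in>Basis. B b)"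
  proof (intro exI conjI)
   show "(\<Psi> has_derivative (%v. \<Sum>b\<in>Basis. (v \<bullet> b) *R pdiff b \<Psi> p)) (at p)"
    using V(1) p by (intro smooth_open_has_derivative[OF V(2)]) blast
   show "onorm (%v. \<Sum>b\<in>Basis. (v \<bullet> b) *R pdiff b \<Psi> p) <= (\<Sum>b\<in>Basis. B b)"
   proof (rule onorm_le)
    fix v :: "complex \<times> 'b"
    have "norm (\<Sum>b\<in>Basis. (v \<bullet> b) *R pdiff b \<Psi> p) <= (\<Sum>b\<in>Basis. B b*norm v)"
    proof (rule sum_norm_le)
     fix b :: "complex \<times> 'b" assume b: "b \<in> Basis"
     have "norm ((v \<bullet> b) *R pdiff b \<Psi> p) = \<bar>v \<bullet> b\<bar>*norm (pdiff b \<Psi> p)" by simp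
     also have "... <= norm v * B b" by (intro mult_mono Basis_le_norm[OF b] B[OF b p]) auto
     finally show "norm ((v \<bullet> b) *R pdiff b \<Psi> p) <= B b*norm v" by (simp add: mult.commute)
    qed
    then show "norm (\<Sum>b\<in>Basis. (v \<bullet> b) *R pdiff b \<Psi> p) <= (\<Sum>b\<in>Basis. B b)*norm v" by (simp add: sum_distrib_right)
   qed
  qed
 qed
qed

text \<open>Invariance of domain for \<Phi> in the coordinates (angle, y), on angular windows of
  length 2*pi, where \<open>cis\<close> is injective.\<close>

lemma tube_open:
 fixes \<Phi> :: "complex \<times> 'b::euclidean_space => 'a::euclidean_space"
 assumes tube: "tube C Wb \<gamma> \<Phi> T" and dim: "DIM('a) = Suc DIM('b)"
 shows "open T"
proof -
 obtain g \<Psi> B where g: "!!p. p \<in> S1 \<times> cball 0 1 ==> \<Phi> p \<in> closure T & g (\<Phi> p) = p & \<Psi> p = \<Phi> p"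
  and \<Psi>: "!!p. p \<in> S1 \<times> cball 0 1 ==> \<exists>D. (\<Psi> has_derivative D) (at p) & onorm D <= B"
  using tube_charts[OF tube] by blast
 note T = tube_image(2)[OF tube]
 have cont: "continuous_on (S1 \<times> cball 0 1) \<Phi>"
 proof -
  have "continuous_on (S1 \<times> cball 0 1) \<Psi>"
   using \<Psi> by (intro continuous_at_imp_continuous_on) (blast dest: has_derivative_continuous)
  then show ?thesis by (rule continuous_on_eq) (use g in blast)
 qed
 define h where "h p = \<Phi> (cis (fst p), snd p)" for p :: "real \<times> 'b"
 define J where "J a = {a - pi<..<a + pi} \<times> ball (0::'b) 1" for a :: real
 have mem: "(cis th, y) \<in> S1 \<times> cball 0 1" if "y \<in> ball 0 1" for th and y :: 'b using that by auto
 have "open (h ` J a)" for a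
 proof (rule invariance_of_domain_gen)
  show "open (J a)" unfolding J_def by (intro open_Times) auto
  have "continuous_on (J a) (%p. (cis (fst p), snd p))"
   by (intro continuous_intros)
  then show "continuous_on (J a) h" unfolding h_def
   by (rule continuous_on_compose2[OF cont]) (auto simp: J_def)
  show "inj_on h (J a)"
  proof (rule inj_onI)
   fix p q assume pq: "p \<in> J a" "q \<in> J a" "h p = h q"
   then have "g (\<Phi> (cis (fst p), snd p)) = g (\<Phi> (cis (fst q), snd q))" by (simp add: h_def)
   then have "(cis (fst p), snd p) = (cis (fst q), snd q)" using g mem pq by (auto simp: J_def)
   moreover have "\<bar>fst p - fst q\<bar> < 2*pi" using pq by (auto simp: J_def)
   ultimately show "p = q" using cis_inj by (auto simp: prod_eq_iff)
  qed
  show "DIM('a) <= DIM(real \<times> 'b)" using dim by simp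
 qed
 moreover have "T = (\<Union>a. h ` J a)"
 proof
  show "T \<subseteq> (\<Union>a. h ` J a)"
  proof
   fix q assume "q \<in> T"
   then obtain s y where s: "q = \<Phi> (s, y)" "s \<in> S1" "y \<in> ball 0 1" unfolding T by auto
   have "cis (Arg s) = s" using s(2) by (subst cis_Arg) (auto simp: sgn_div_norm)
   then have "q = h (Arg s, y)" "(Arg s, y) \<in> J (Arg s)" using s by (auto simp: h_def J_def)
   then show "q \<in> (\<Union>a. h ` J a)" by blast
  qed
  show "(\<Union>a. h ` J a) \<subseteq> T" by (auto simp: h_def J_def T)
 qed
 ultimately show ?thesis by auto
qed

text \<open>\<open>ess_disconnects\<close> tests points of density 1 of T, and this confines them to
  T. A boundary point z = \<Phi>(s, y) with |y| = 1 sees a full cone outside T, on which T would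
  have density 0.\<close>

lemma tube_dens_pts:
 fixes \<Phi> :: "complex \<times> 'b::euclidean_space => 'a::euclidean_space"
 assumes tube: "tube C Wb \<gamma> \<Phi> T" and dim: "DIM('a) = Suc DIM('b)"
 shows "dens_pts T 1 \<subseteq> T"
proof
 fix z assume "z \<in> dens_pts T 1"
 have T_op: "open T" by (rule tube_open[OF assms])
 obtain g \<Psi> B where g': "!!q. q \<in> closure T ==> \<exists>D. (g has_derivative D) (at q)"
  and g: "!!p. p \<in> S1 \<times> cball 0 1 ==> \<Phi> p \<in> closure T & g (\<Phi> p) = p & \<Psi> p = \<Phi> p"
  and \<Psi>: "!!p. p \<in> S1 \<times> cball 0 1 ==> \<exists>D. (\<Psi> has_derivative D) (at p) & onorm D <= B"
  using tube_charts[OF tube] by blast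
 note T = tube_image[OF tube]
 have "z \<in> dens_pts (- T) 0" using \<open>z \<in> dens_pts T 1\<close> T_op by (subst (asm) dens_pts_1_iff) auto
 then have t0: "aplim (chi (- T)) z 0" using T_op by (subst (asm) dens_pts_0_iff_trc) auto
 have m: "ind (- T) \<in> BM" using T_op by auto
 have no_cone: False if K: "K \<in> sets borel" "K \<subseteq> ball 0 1" "vol K > 0"
  and avoid: "\<forall>k\<ge>k0. sc z k K \<inter> T = {}" for K k0
 proof -
  have "trc K (chi (- T)) z 0" by (rule trc_dominated[OF K(2) order_refl _ m m t0 t0 open_UNIV, where c=1]) auto
  moreover have "trc K (chi (- T)) z 1"
   unfolding trc_def
  proof (rule tendsto_eventually, rule eventually_mono[OF eventually_ge_at_top[of k0]])
   fix k assume "k0 <= k"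
   then have "!!q. q \<in> sc z k K ==> q \<notin> T" using avoid by blast
   then have z: "en \<bar>chi (- T) q - 1\<bar>*chi (sc z k K) q = 0" for q by (cases "q \<in> sc z k K") auto
   show "en (2^(k*DIM('a)))*(dev (sc z k K) (chi (- T)) 1) = 0" unfolding z by simp
  qed
  ultimately have "(0::real) = 1" by (rule trc_unique[OF K(1) m K(3)])
  then show False by simp
 qed
 have "z \<in> closure T"
 proof (rule ccontr)
  assume "z \<notin> closure T"
  then obtain r where r: "r > 0" "ball z r \<subseteq> - closure T" using openE[of "- closure T" z] by (auto simp: open_Compl)
  obtain k0 where k0: "hp k0 < r" using real_arch_pow_inv[OF r(1), of "1/2"] by auto
  have "sc z k (ball 0 1) \<inter> T = {}" if "k >= k0" for k
  proof -
   have "hp k <= hp k0" using that by (intro power_decreasing) auto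
   then have "ball z (hp k) \<subseteq> ball z r" using k0 by (intro subset_ball) linarith
   then show ?thesis using r(2) closure_subset[of T] by (auto simp: sc_ball)
  qed
  then show False using no_cone[of "ball 0 1" k0] emeasure_ball_dyadic[of "0::'a" 0] by auto
 qed
 then obtain s y where z: "z = \<Phi> (s, y)" "s \<in> S1" "y \<in> cball 0 1" unfolding T(1) by blast
 have p: "(s, y) \<in> S1 \<times> cball 0 1" using z by auto
 show "z \<in> T"
 proof (rule ccontr)
  assume "z \<notin> T"
  then have y: "norm y = 1" using z unfolding T(2) by (cases "norm y = 1") auto
  \<comment> \<open>Negative on T by Cauchy-Schwarz and zero at z; along the radial curve it equals
    the parameter, so its gradient at z is nonzero and it is positive on a cone.\<close>
  define m where "m q = snd (g q) \<bullet> y - 1" for q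
  obtain D where D: "(g has_derivative D) (at z)" using g'[OF \<open>z \<in> closure T\<close>] by blast
  have mz: "m z = 0" using g[OF p] y by (simp add: m_def z(1) power2_norm_eq_inner[symmetric])
  have md: "(m has_derivative (%v. snd (D v) \<bullet> y)) (at z)" unfolding m_def
   by (rule derivative_eq_intros D refl | simp)+
  obtain E where E: "(\<Psi> has_derivative E) (at (s, y))" using \<Psi>[OF p] by blast
  have "((%th. (s, y + th *R y)) has_derivative (%th. (0, th *R y))) (at 0)"
   by (rule derivative_eq_intros refl | simp)+
  from diff_chain_at[OF this, of \<Psi> E] E
  have cd: "((%th. \<Psi> (s, y + th *R y)) has_derivative (%th. E (0, th *R y))) (at 0)" by (simp add: o_def)
  have "E (0, th *R y) = th *R E (0, y)" for th
   using linear_scale[OF has_derivative_linear[OF E], of th "(0, y)"] by simp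
  then have cv: "((%th. \<Psi> (s, y + th *R y)) has_vector_derivative E (0, y)) (at 0)" using cd by (simp add: has_vector_derivative_def)
  have "\<exists>nu. nu \<noteq> 0 & (m has_derivative (%v. v \<bullet> nu)) (at z)"
  proof (rule gradient_nonzero[OF md cv])
   show "\<Psi> (s, y + 0 *R y) = z" using g[OF p] z by simp
   show "((%th. th) has_vector_derivative 1) (at (0::real))" by (rule has_vector_derivative_id)
   fix th :: real assume th: "th \<in> {- 1..0}"
   have "y + th *R y = (1 + th) *R y" by (simp add: scaleR_left_distrib)
   then have "(s, y + th *R y) \<in> S1 \<times> cball 0 1" using th y z(2) by simp
   from g[OF this] show "m (\<Psi> (s, y + th *R y)) = th"
    using y by (simp add: m_def inner_add_left power2_norm_eq_inner[symmetric])
  qed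
  then obtain nu where nu: "nu \<noteq> 0" "(m has_derivative (%v. v \<bullet> nu)) (at z)" by blast
  define si where "si = norm nu/2"
  have si: "si > 0" "si < norm nu" using nu(1) by (auto simp: si_def)
  obtain k0 where k0: "!!k q. k >= k0 ==> q \<in> sc z k (cone nu si) ==> 0 < m q" using cone_pos[OF nu(2) mz si(1)] by blast
  have "m q < 0" if "q \<in> T" for q
  proof -
   obtain s' y' where q: "q = \<Phi> (s', y')" "s' \<in> S1" "y' \<in> ball 0 1" using \<open>q \<in> T\<close> unfolding T(2) by blast
   then have "snd (g q) = y'" using g[of "(s', y')"] by auto
   then have "snd (g q) \<bullet> y <= norm y'*norm y" using norm_cauchy_schwarz[of y' y] by simp
   then show ?thesis using q y by (simp add: m_def)
  qed
  then have "\<forall>k\<ge>k0. sc z k (cone nu si) \<inter> T = {}" using k0 by fastforce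
  then show False using no_cone[of "cone nu si" k0] cone_props[OF si(1)] si(2) by blast
 qed
qed

text \<open>The slice is a smooth level set near x. Its normal nu gives cones that at small scales
  lie strictly on the two sides of it.\<close>

lemma tube_slice_cones:
 fixes \<Phi> :: "complex \<times> 'b::euclidean_space => 'a::euclidean_space"
 assumes tube: "tube C Wb \<gamma> \<Phi> T" and dim: "DIM('a) = Suc DIM('b)" and s: "s \<in> S1" and x: "x \<in> slice \<Phi> s"
 shows "\<exists>nu m. nu \<noteq> 0 & continuous_on T m & (\<forall>q\<in>T \<inter> slice \<Phi> s. m q = 0) &
   (\<forall>si>0. \<exists>k0. \<forall>k\<ge>k0. (\<forall>q\<in>sc x k (cone nu si). q \<in> T & 0 < m q) & (\<forall>q\<in>sc x k (cone (- nu) si). q \<in> T & m q < (0::real)))"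
proof -
 have T_op: "open T" by (rule tube_open[OF tube dim])
 obtain g \<Psi> B where g': "!!q. q \<in> closure T ==> \<exists>D. (g has_derivative D) (at q)"
  and g: "!!p. p \<in> S1 \<times> cball 0 1 ==> \<Phi> p \<in> closure T & g (\<Phi> p) = p & \<Psi> p = \<Phi> p"
  and \<Psi>: "!!p. p \<in> S1 \<times> cball 0 1 ==> \<exists>D. (\<Psi> has_derivative D) (at p) & onorm D <= B"
  using tube_charts[OF tube] by blast
 note T = tube_image(2)[OF tube]
 \<comment> \<open>The sine of the angle relative to s. It separates the two sides of the slice
   locally; it vanishes on the slice of -s as well.\<close>
 define m where "m q = Im (cnj s*fst (g q))" for q
 obtain y where y: "x = \<Phi> (s, y)" "y \<in> ball 0 1" using x by (auto simp: slice_def)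
 have xT: "x \<in> T" using y s T by auto
 have sl: "m q = 0" if q: "q \<in> slice \<Phi> s" for q
 proof -
  obtain y' where "q = \<Phi> (s, y')" "y' \<in> ball 0 1" using q by (auto simp: slice_def)
  then have "fst (g q) = s" using g[of "(s, y')"] s by auto
  then show ?thesis by (simp add: m_def)
 qed
 have cont: "continuous_on T m"
 proof -
  have "continuous_on T g" using g' closure_subset[of T]
   by (intro continuous_at_imp_continuous_on) (blast dest: has_derivative_continuous)
  then show ?thesis unfolding m_def by (intro continuous_intros)
 qed
 have p: "(s, y) \<in> S1 \<times> cball 0 1" using y s by auto
 obtain D where D: "(g has_derivative D) (at x)" using g'[of x] xT closure_subset[of T] by blast
 have md: "(m has_derivative (%v. Im (cnj s*fst (D v)))) (at x)" unfolding m_def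
  by (rule derivative_eq_intros D refl | simp)+
 obtain E where E: "(\<Psi> has_derivative E) (at (s, y))" using \<Psi>[OF p] by blast
 have "((%th. (s*cis th, y)) has_derivative (%th. (s*(th *R \<i>), 0))) (at 0)"
  by (rule derivative_eq_intros refl has_derivative_mult_right | simp add: has_vector_derivative_def)+
 from diff_chain_at[OF this, of \<Psi> E] E
 have cd: "((%th. \<Psi> (s*cis th, y)) has_derivative (%th. E (s*(th *R \<i>), 0))) (at 0)" by (simp add: o_def)
 have "E (s*(th *R \<i>), 0) = th *R E (s*\<i>, 0)" for th
  using linear_scale[OF has_derivative_linear[OF E], of th "(s*\<i>, 0)"] by simp
 then have cv: "((%th. \<Psi> (s*cis th, y)) has_vector_derivative E (s*\<i>, 0)) (at 0)" using cd by (simp add: has_vector_derivative_def)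
 have "\<exists>nu. nu \<noteq> 0 & (m has_derivative (%v. v \<bullet> nu)) (at x)"
 proof (rule gradient_nonzero[OF md cv])
  show "\<Psi> (s*cis 0, y) = x" using g[OF p] y by simp
  show "(sin has_vector_derivative 1) (at (0::real))"
   using DERIV_sin[of "0::real"] by (simp add: has_real_derivative_iff_has_vector_derivative)
  fix th :: real
  have "cnj s * s = 1" using s by (simp add: complex_norm_square[symmetric] mult.commute)
  then have "cnj s*(s*cis th) = cis th" by (simp add: mult.assoc[symmetric])
  moreover have "(s*cis th, y) \<in> S1 \<times> cball 0 1" using p by (simp add: norm_mult)
  from g[OF this] have "fst (g (\<Psi> (s*cis th, y))) = s*cis th" by simp
  ultimately have "cnj s*fst (g (\<Psi> (s*cis th, y))) = cis th" by (simp only:)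
  then show "m (\<Psi> (s*cis th, y)) = sin th" by (simp only: m_def cis.sel)
 qed
 then obtain nu where nu: "nu \<noteq> 0" "(m has_derivative (%v. v \<bullet> nu)) (at x)" by blast
 have "((%q. - m q) has_derivative (%v. v \<bullet> (- nu))) (at x)" using has_derivative_minus[OF nu(2)] by simp
 note neg = cone_pos[OF this]
 have ex: "\<exists>k0. \<forall>k\<ge>k0. (\<forall>q\<in>sc x k (cone nu si). q \<in> T & 0 < m q) & (\<forall>q\<in>sc x k (cone (- nu) si). q \<in> T & m q < 0)" if si: "si > 0" for si
 proof -
  obtain r where r: "r > 0" "ball x r \<subseteq> T" using openE[OF T_op xT] by blast
  obtain k0 where k0: "hp k0 < r" using real_arch_pow_inv[OF r(1), of "1/2"] by auto
  obtain k1 where k1: "!!k q. k >= k1 ==> q \<in> sc x k (cone nu si) ==> 0 < m q" using cone_pos[OF nu(2) sl[OF x] si] by blast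
  obtain k2 where k2: "!!k q. k >= k2 ==> q \<in> sc x k (cone (- nu) si) ==> 0 < - m q" using neg[OF _ si] sl[OF x] by auto
  have "sc x k (cone mu si) \<subseteq> T" if "k >= k0" for k mu
  proof -
   have "hp k <= hp k0" using that by (intro power_decreasing) auto
   then have "ball x (hp k) \<subseteq> ball x r" using k0 by (intro subset_ball) linarith
   then show ?thesis using r(2) sc_mono[OF cone_props(3)[OF si, of mu], of x k] by (auto simp: sc_ball)
  qed
  then show ?thesis using k1 k2 by (intro exI[of _ "max k0 (max k1 k2)"]) fastforce
 qed
 show ?thesis using nu(1) cont sl ex by blast
qed

lemma negligible_iff_AE:
 fixes A :: "'a::euclidean_space set"
 shows "negligible A \<longleftrightarrow> (AE x in lborel. x \<notin> A)"
proof
 assume "negligible A"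
 then have "AE x in lebesgue. x \<notin> A" by (intro AE_not_in) (simp add: negligible_iff_null_sets)
 then show "AE x in lborel. x \<notin> A" by (simp add: AE_completion_iff)
next
 assume "AE x in lborel. x \<notin> A"
 then obtain N where N: "N \<in> null_sets lborel" "{x\<in>space lborel. ~ x \<notin> A} \<subseteq> N" unfolding eventually_ae_filter by blast
 have "negligible N" using null_sets_completionI[OF N(1)] by (simp add: negligible_iff_null_sets)
 then show "negligible A" by (rule negligible_subset) (use N(2) in auto)
qed

lemma slice_subset: "tube C Wb \<gamma> \<Phi> T ==> s \<in> S1 ==> slice \<Phi> s \<subseteq> T"
 using tube_image(2)[of C Wb \<gamma> \<Phi> T] by (auto simp: slice_def)

lemma tube_minus_slice_open:
 fixes \<Phi> :: "complex \<times> 'b::euclidean_space => 'a::euclidean_space"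
 assumes tube: "tube C Wb \<gamma> \<Phi> T" and dim: "DIM('a) = Suc DIM('b)" and s: "s \<in> S1"
 shows "open (T - slice \<Phi> s)"
proof -
 have T_op: "open T" by (rule tube_open[OF tube dim])
 obtain g \<Psi> B where g': "!!q. q \<in> closure T ==> \<exists>D. (g has_derivative D) (at q)"
  and g: "!!p. p \<in> S1 \<times> cball 0 1 ==> \<Phi> p \<in> closure T & g (\<Phi> p) = p & \<Psi> p = \<Phi> p"
  using tube_charts[OF tube] by blast
 note T = tube_image(2)[OF tube]
 have "continuous_on T g" using g' closure_subset[of T]
  by (intro continuous_at_imp_continuous_on) (blast dest: has_derivative_continuous)
 then have "continuous_on T (%q. fst (g q))" by (intro continuous_intros)
 then have "open (T \<inter> (%q. fst (g q)) -` (- {s}))"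
  using T_op by (intro continuous_open_preimage) auto
 moreover have "T \<inter> (%q. fst (g q)) -` (- {s}) = T - slice \<Phi> s"
 proof -
  have "fst (g q) = s \<longleftrightarrow> q \<in> slice \<Phi> s" if q: "q \<in> T" for q
  proof -
   obtain s' y where q: "q = \<Phi> (s', y)" "s' \<in> S1" "y \<in> ball 0 1" using q unfolding T by blast
   then have 1: "g q = (s', y)" using g[of "(s', y)"] by auto
   show ?thesis
   proof
    assume "q \<in> slice \<Phi> s"
    then obtain y' where "q = \<Phi> (s, y')" "y' \<in> ball 0 1" by (auto simp: slice_def)
    then show "fst (g q) = s" using g[of "(s, y')"] s by auto
   qed (use 1 q in \<open>auto simp: slice_def\<close>)
  qed
  then show ?thesis by auto
 qed
 ultimately show ?thesis by simp
qed

text \<open>In the coordinates (angle, y) the set N stays null, so by Fubini almost every angle sees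
  a null set of y. The Lipschitz maps \<open>cis\<close> and \<Psi>(s, .) carry null sets of angles
  to H^1-null sets and null sets of y to H^n-null sets.\<close>

lemma slice_null_transfer:
 fixes \<Phi> :: "complex \<times> 'b::euclidean_space => 'a::euclidean_space"
 assumes tube: "tube C Wb \<gamma> \<Phi> T" and dim: "DIM('a) = Suc DIM('b)" and N: "negligible N"
 shows "hnull 1 {s\<in>S1. ~ hnull DIM('b) (slice \<Phi> s \<inter> N)}"
proof -
 obtain g \<Psi> B where g': "!!q. q \<in> closure T ==> \<exists>D. (g has_derivative D) (at q)"
  and g: "!!p. p \<in> S1 \<times> cball 0 1 ==> \<Phi> p \<in> closure T & g (\<Phi> p) = p & \<Psi> p = \<Phi> p"
  and \<Psi>: "!!p. p \<in> S1 \<times> cball 0 1 ==> \<exists>D. (\<Psi> has_derivative D) (at p) & onorm D <= B"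
  using tube_charts[OF tube] by blast
 note T = tube_image(2)[OF tube]
 define S where "S = {q\<in>N \<inter> T. fst (g q) \<notin> \<real>\<^sub>\<le>\<^sub>0}"
 define ka where "ka q = (Im (Ln (fst (g q))), snd (g q))" for q
 have neg: "negligible (ka ` S)"
 proof (rule negligible_differentiable_image_negligible)
  show "DIM('a) <= DIM(real \<times> 'b)" using dim by simp
  show "negligible S" using N by (rule negligible_subset) (auto simp: S_def)
  show "ka differentiable_on S"
  proof (rule differentiable_at_imp_differentiable_on)
   fix q assume q: "q \<in> S"
   then obtain D where D: "(g has_derivative D) (at q)" using g'[of q] closure_subset[of T] by (auto simp: S_def)
   have L: "(Ln has_derivative (*) (inverse (fst (g q)))) (at (fst (g q)))"
    using has_field_derivative_Ln[of "fst (g q)"] q by (auto simp: S_def has_field_derivative_def)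
   have "((%q. fst (g q)) has_derivative (%v. fst (D v))) (at q)" by (rule has_derivative_fst[OF D])
   from diff_chain_at[OF this L] have "((%q. Ln (fst (g q))) has_derivative (%v. inverse (fst (g q))*fst (D v))) (at q)" by (simp add: o_def)
   from has_derivative_Pair[OF has_derivative_Im[OF this] has_derivative_snd[OF D]]
   show "ka differentiable at q" unfolding ka_def[abs_def] differentiable_def by blast
  qed
 qed
 have "AE p in lborel. p \<notin> ka ` S"
  using neg by (simp add: negligible_iff_AE)
 then have "AE p in lborel \<Otimes>\<^sub>M lborel. p \<notin> ka ` S" by (subst lborel_prod)
 from lborel_pair.AE_pair[OF this] have ae: "AE th in lborel. AE y in lborel. (th, y) \<notin> ka ` S" .
 define \<Theta> where "\<Theta> = {th. ~ (AE y in lborel. (th, y) \<notin> ka ` S)}"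
 have "negligible \<Theta>"
  using ae by (simp add: \<Theta>_def negligible_iff_AE)
 have "hnull DIM(real) (cis ` \<Theta>)"
 proof (rule hnull_lipschitz_image[OF \<open>negligible \<Theta>\<close>, of _ 1])
  fix a b :: real
  have "norm (cis a - cis b) <= 1*norm (a - b)"
  proof (rule differentiable_bound[of UNIV])
   fix th :: real
   show "(cis has_derivative (%t. t *R (\<i>*cis th))) (at th within UNIV)"
    by (rule derivative_eq_intros refl | simp)+
   show "onorm (%t. t *R (\<i>*cis th)) <= 1" by (intro onorm_le) (simp add: norm_mult)
  qed auto
  then show "dist (cis a) (cis b) <= 1*dist a b" by (simp add: dist_norm)
 qed
 \<comment> \<open>The angle is read off the principal logarithm, whose cut meets the circle in this
   one point.\<close>
 moreover have "hnull 1 {- 1 :: complex}"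
  using hnull_lipschitz_image[of "{0::real}" "%_. - 1 :: complex" 0] by simp
 ultimately have hU: "hnull 1 (cis ` \<Theta> \<union> {- 1})" by (intro hnull_Un) simp_all
 show ?thesis
 proof (rule hnull_mono[OF hU], intro subsetI, rule ccontr)
  fix s assume s: "s \<in> {s\<in>S1. ~ hnull DIM('b) (slice \<Phi> s \<inter> N)}" and "s \<notin> cis ` \<Theta> \<union> {- 1}"
  define th where "th = Im (Ln s)"
  have s1: "norm s = 1" using s by simp
  have snp: "s \<notin> \<real>\<^sub>\<le>\<^sub>0"
  proof
   assume "s \<in> \<real>\<^sub>\<le>\<^sub>0"
   then obtain r :: real where "s = of_real r" "r <= 0" by (auto elim: nonpos_Reals_cases)
   then have "s = - 1" using s1 by auto
   then show False using \<open>s \<notin> cis ` \<Theta> \<union> {- 1}\<close> by simp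
  qed
  have "s \<noteq> 0" using s1 by auto
  then have "cis th = s"
   using s1 exp_Ln[of s] exp_eq_polar[of "Ln s"] Re_Ln[of s] by (auto simp: th_def)
  then have "th \<notin> \<Theta>" using \<open>s \<notin> cis ` \<Theta> \<union> {- 1}\<close> by blast
  then have "negligible {y. (th, y) \<in> ka ` S}" by (simp add: \<Theta>_def negligible_iff_AE)
  then have "negligible ({y. (th, y) \<in> ka ` S} \<inter> ball 0 1)" by (rule negligible_subset) auto
  then have "hnull DIM('b) ((%y. \<Psi> (s, y)) ` ({y. (th, y) \<in> ka ` S} \<inter> ball 0 1))"
  proof (rule hnull_lipschitz_image[of _ _ B])
   have B0: "B >= 0" using \<Psi>[of "(s, 0)"] s1 onorm_pos_le has_derivative_bounded_linear by fastforce
   fix a b :: 'b assume ab: "a \<in> {y. (th, y) \<in> ka ` S} \<inter> ball 0 1" "b \<in> {y. (th, y) \<in> ka ` S} \<inter> ball 0 1"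
   have "\<forall>y. \<exists>D. y \<in> cball 0 1 --> (\<Psi> has_derivative D) (at (s, y)) & onorm D <= B" using \<Psi> s1 by simp
   from choice[OF this] obtain D where D: "!!y. y \<in> cball 0 1 ==> (\<Psi> has_derivative D y) (at (s, y))" "!!y. y \<in> cball 0 1 ==> onorm (D y) <= B" by blast
   have "norm (\<Psi> (s, a) - \<Psi> (s, b)) <= B*norm (a - b)"
   proof (rule differentiable_bound[OF convex_cball[of 0 1], of "%y. \<Psi> (s, y)" "%y v. D y (0, v)"])
    fix y :: 'b assume y: "y \<in> cball 0 1"
    have "((%y. (s, y)) has_derivative (%v. (0, v))) (at y)" by (rule derivative_eq_intros refl | simp)+
    from diff_chain_at[OF this D(1)[OF y]] show "((%y. \<Psi> (s, y)) has_derivative (%v. D y (0, v))) (at y within cball 0 1)"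
     by (simp add: o_def has_derivative_at_withinI)
    show "onorm (%v. D y (0, v)) <= B"
    proof (rule onorm_le)
     fix v :: 'b
     have "norm (D y (0, v)) <= onorm (D y)*norm (0::complex, v)" by (rule onorm[OF has_derivative_bounded_linear[OF D(1)[OF y]]])
     also have "... <= B*norm v" using D(2)[OF y] by (intro mult_mono B0) (auto simp: norm_Pair)
     finally show "norm (D y (0, v)) <= B*norm v" .
    qed
   qed (use ab in auto)
   then show "dist (\<Psi> (s, a)) (\<Psi> (s, b)) <= B*dist a b" by (simp add: dist_norm)
  qed
  moreover have "slice \<Phi> s \<inter> N \<subseteq> (%y. \<Psi> (s, y)) ` ({y. (th, y) \<in> ka ` S} \<inter> ball 0 1)"
  proof
   fix q assume q: "q \<in> slice \<Phi> s \<inter> N"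
   then obtain y where y: "q = \<Phi> (s, y)" "y \<in> ball 0 1" by (auto simp: slice_def)
   then have gq: "g q = (s, y)" "\<Psi> (s, y) = q" using g[of "(s, y)"] s1 by auto
   have "q \<in> T" unfolding T using y s1 by auto
   then have "q \<in> S" using q gq snp by (simp add: S_def)
   moreover have "ka q = (th, y)" by (simp add: ka_def gq th_def)
   ultimately have "(th, y) \<in> ka ` S" by (metis imageI)
   then show "q \<in> (%y. \<Psi> (s, y)) ` ({y. (th, y) \<in> ka ` S} \<inter> ball 0 1)" using y(2) gq(2) by force
  qed
  ultimately have "hnull DIM('b) (slice \<Phi> s \<inter> N)" by (rule hnull_mono)
  then show False using s by simp
 qed
qed

section \<open>Traces, precise representatives and essential boundaries\<close>

lemma emeasure_unit_ball: "vol (ball (0::'a::euclidean_space) 1) > 0" "vol (ball (0::'a::euclidean_space) 1) < \<infinity>"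
 using emeasure_ball_dyadic[of "0::'a" 0] by auto

lemma trc_le:
 fixes K :: "'a::euclidean_space set"
 assumes "trc K' w1 p a1" "K \<subseteq> K'" "K' \<subseteq> ball 0 1" "K' \<in> sets borel" "w1 \<in> BM" "open U" "p \<in> U"
  and le: "!!q. q \<in> U ==> \<bar>w q - a\<bar> <= c*\<bar>w1 q - a1\<bar>"
 shows "trc K w p a"
 by (rule trc_dominated[OF assms(2-5) assms(5) assms(1) assms(1) assms(6,7), where c="c/2"]) (use le in \<open>auto simp: field_simps\<close>)

lemma trc_subset:
 fixes K :: "'a::euclidean_space set"
 assumes "trc K' w p a" "K \<subseteq> K'" "K' \<subseteq> ball 0 1" "K' \<in> sets borel" "w \<in> BM"
 shows "trc K w p a"
 by (rule trc_le[OF assms open_UNIV, where c=1]) auto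

text \<open>From \<open>al * (ind A - a/al) = (f * ind A - a) - (f - al) * ind A\<close> the
  deviation of the indicator is bounded by those of f 1_A and f; positivity of \<open>al\<close>
  allows the division.\<close>

lemma trc_ratio:
 fixes K :: "'a::euclidean_space set"
 assumes K: "K \<subseteq> ball 0 1" "K \<in> sets borel" and A[measurable]: "A \<in> sets borel" and f[measurable]: "f \<in> BM"
  and t: "trc K (%q. f q * ind A q) p a" "trc K f p al" and al: "al > 0"
 shows "trc K (ind A) p (a/al)"
proof (rule trc_dominated[OF order_refl K _ f t open_UNIV, where c="1/al"])
 fix q
 have "al*(ind A q - a/al) = (f q * ind A q - a) - (f q - al) * ind A q"
  using al by (simp add: algebra_simps)
 also have "\<bar>...\<bar> <= \<bar>f q * ind A q - a\<bar> + \<bar>f q - al\<bar>"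
  by (rule order_trans[OF abs_triangle_ineq4]) (auto simp: indicator_def)
 finally have "al*\<bar>ind A q - a/al\<bar> <= \<bar>f q * ind A q - a\<bar> + \<bar>f q - al\<bar>"
  unfolding abs_mult using al by simp
 then show "\<bar>ind A q - a/al\<bar> <= 1/al*(\<bar>f q * ind A q - a\<bar> + \<bar>f q - al\<bar>)"
  using al by (simp add: pos_le_divide_eq mult.commute)
qed auto

text \<open>An indicator equals its square, so its trace satisfies a = a^2.\<close>

lemma trc_indicator_01:
 fixes K :: "'a::euclidean_space set"
 assumes K: "K \<subseteq> ball 0 1" "K \<in> sets borel" "vol K > 0" and A[measurable]: "A \<in> sets borel"
  and t: "trc K (ind A) p a"
 shows "a = 0 \<or> a = 1"
proof -
 have "trc K (ind A) p (a\<^sup>2)"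
 proof (rule trc_le[OF t order_refl K(1,2) _ open_UNIV, where c="1 + \<bar>a\<bar>"])
  fix q
  have "ind A q - a\<^sup>2 = (ind A q + a)*(ind A q - a)"
   by (auto simp: indicator_def power2_eq_square algebra_simps)
  also have "\<bar>...\<bar> <= (1 + \<bar>a\<bar>)*\<bar>ind A q - a\<bar>"
   unfolding abs_mult by (intro mult_right_mono) (auto simp: indicator_def)
  finally show "\<bar>ind A q - a\<^sup>2\<bar> <= (1 + \<bar>a\<bar>)*\<bar>ind A q - a\<bar>" .
 qed auto
 with t have "a = a\<^sup>2" by (intro trc_unique[OF K(2) _ K(3)]) auto
 then show ?thesis by (simp add: power2_eq_square)
qed

lemma trc_complement:
 fixes A :: "'a::euclidean_space set"
 shows "trc K (ind (- A)) p a \<longleftrightarrow> trc K (ind A) p (1 - a)"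
proof -
 have "\<bar>ind (- A) q - a\<bar> = \<bar>ind A q - (1 - a)\<bar>" for q by (auto simp: indicator_def)
 then show ?thesis by (simp add: trc_def)
qed

lemma dens_pts_cong:
 fixes E F :: "'a::euclidean_space set"
 assumes F: "F \<in> sets lebesgue" and U: "open U" "y \<in> U" and eq: "AE x in lborel. x \<in> U --> (x \<in> E \<longleftrightarrow> x \<in> F)"
 shows "y \<in> dens_pts E t \<longleftrightarrow> y \<in> dens_pts F t"
proof -
 obtain r where r: "r > 0" "ball y r \<subseteq> U" using openE[OF U] by blast
 have "measure lebesgue (E \<inter> ball y rh) = measure lebesgue (F \<inter> ball y rh)" if rh: "rh < r" for rh
 proof (rule measure_negligible_symdiff)
  show "F \<inter> ball y rh \<in> lmeasurable" using F lmeasurable_ball[of y rh] by (metis Int_commute fmeasurable_Int_fmeasurable)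
  have sub: "ball y rh \<subseteq> U" using r(2) subset_ball[of rh r y] rh by auto
  show "negligible (F \<inter> ball y rh - E \<inter> ball y rh \<union> (E \<inter> ball y rh - F \<inter> ball y rh))"
   unfolding negligible_iff_AE using eq by eventually_elim (use sub in auto)
 qed
 then have "eventually (%rh. measure lebesgue (E \<inter> ball y rh)/measure lebesgue (ball y rh) = measure lebesgue (F \<inter> ball y rh)/measure lebesgue (ball y rh)) (at_right 0)"
  using r(1) by (auto simp: eventually_at_right_field)
 then show ?thesis unfolding dens_pts_def by (simp add: tendsto_cong)
qed

lemma ess_bd_iff_trc:
 fixes E F :: "'a::euclidean_space set"
 assumes F: "F \<in> sets borel" and U: "open U" "y \<in> U" and eq: "AE x in lborel. x \<in> U --> (x \<in> E \<longleftrightarrow> x \<in> F)"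
 shows "y \<in> ess_bd E \<longleftrightarrow> ~ aplim (ind F) y 0 & ~ aplim (ind F) y 1"
proof -
 have FL: "F \<in> sets lebesgue" using F by simp
 have "y \<in> dens_pts E 0 \<longleftrightarrow> aplim (ind F) y 0"
  using dens_pts_cong[OF FL U eq] dens_pts_0_iff_trc[OF F] by simp
 moreover have "y \<in> dens_pts E 1 \<longleftrightarrow> aplim (ind F) y 1"
  using dens_pts_cong[OF FL U eq] dens_pts_1_iff[OF FL, of y] dens_pts_0_iff_trc[of "- F" y] F trc_complement[of "ball 0 1" F y 0] by simp
 ultimately show ?thesis by (simp add: ess_bd_def)
qed

lemma ess_bd_imp_pos:
 fixes E :: "'a::euclidean_space set"
 assumes "x \<in> ess_bd E" shows "emeasure lebesgue E > 0 \<or> E \<notin> sets lebesgue"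
proof (rule ccontr)
 assume "~ ?thesis"
 then have "negligible E" by (auto simp: negligible_iff_null_sets null_sets_def)
 then have "AE q in lborel. q \<in> UNIV --> (q \<in> E \<longleftrightarrow> q \<in> {})" by (simp add: negligible_iff_AE)
 from ess_bd_iff_trc[OF _ open_UNIV _ this, of x] assms have "~ aplim (ind {}) x 0" by simp
 then show False by (simp add: trc_def)
qed

lemma u_minus_eq: "u_minus Om u x = - u_plus Om (%x. - u x) x"
proof -
 define S where "S = {t. x \<in> dens_pts {y\<in>Om. u y < t} 0}"
 have "{t. x \<in> dens_pts {y\<in>Om. - u y > t} 0} = uminus ` S"
 proof
  show "{t. x \<in> dens_pts {y\<in>Om. - u y > t} 0} \<subseteq> uminus ` S"
  proof
   fix t assume "t \<in> {t. x \<in> dens_pts {y\<in>Om. - u y > t} 0}"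
   then have "- t \<in> S" by (simp add: S_def less_minus_iff)
   then show "t \<in> uminus ` S" by (metis image_eqI minus_minus)
  qed
 qed (auto simp: S_def)
 then show ?thesis by (simp add: u_minus_def u_plus_def Inf_real_def S_def[symmetric] image_image)
qed

text \<open>By Chebyshev, the superlevel set {v > t} has density 0 at y for t > a and density 1 for
  t < a.\<close>

lemma u_plus_if_trc:
 fixes u v :: "'a::euclidean_space => real"
 assumes Om: "open Om" "y \<in> Om" and v[measurable]: "v \<in> BM" and eq: "AE x in lborel. x \<in> Om --> v x = u x"
  and t: "aplim v y a"
 shows "u_plus Om u y = a"
proof -
 have d: "y \<in> dens_pts {z\<in>Om. u z > t} 0 \<longleftrightarrow> aplim (ind {z. v z > t}) y 0" for t
 proof -
  have e: "AE x in lborel. x \<in> Om --> (x \<in> {z\<in>Om. u z > t} \<longleftrightarrow> x \<in> {z. v z > t})" using eq by eventually_elim auto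
  have b: "{z. v z > t} \<in> sets borel" by measurable
  show ?thesis using dens_pts_cong[OF _ Om e] dens_pts_0_iff_trc[OF b] b by simp
 qed
 have 1: "t \<in> {t. y \<in> dens_pts {z\<in>Om. u z > t} 0}" if t': "a < t" for t
 proof -
  have "aplim (ind {z. v z > t}) y 0"
  proof (rule trc_le[OF t order_refl order_refl _ v open_UNIV, where c="1/(t - a)"])
   fix q show "\<bar>ind {z. v z > t} q - 0\<bar> <= 1/(t - a)*\<bar>v q - a\<bar>"
    using t' by (auto simp: indicator_def field_simps)
  qed auto
  then show ?thesis by (simp add: d)
 qed
 have 2: "a <= t" if "t \<in> {t. y \<in> dens_pts {z\<in>Om. u z > t} 0}" for t
 proof (rule ccontr)
  assume t': "~ a <= t"
  have b: "{z. v z > t} \<in> sets borel" by measurable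
  have "aplim (ind {z. v z > t}) y 1"
  proof (rule trc_le[OF t order_refl order_refl _ v open_UNIV, where c="1/(a - t)"])
   fix q show "\<bar>ind {z. v z > t} q - 1\<bar> <= 1/(a - t)*\<bar>v q - a\<bar>"
    using t' by (auto simp: indicator_def field_simps)
  qed auto
  moreover have "aplim (ind {z. v z > t}) y 0" using that d by simp
  ultimately have "(1::real) = 0" using b emeasure_unit_ball(1) by (intro trc_unique[of "ball 0 1"]) auto
  then show False by simp
 qed
 show ?thesis unfolding u_plus_def
 proof (rule cInf_eq)
  show "a <= t" if "t \<in> {t. y \<in> dens_pts {z\<in>Om. u z > t} 0}" for t using 2 that .
  fix b assume b: "!!t. t \<in> {t. y \<in> dens_pts {z\<in>Om. u z > t} 0} ==> b <= t"
  show "b <= a" by (rule dense_ge) (use b 1 in blast)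
 qed
qed

text \<open>At points with an approximate limit the upper and lower values coincide with it. Since
  all but an H^n-null set of points have one, superlevel sets of the precise representative can be
  handled through traces.\<close>

lemma prec_ge_if_trc:
 fixes u v :: "'a::euclidean_space => real"
 assumes Om: "open Om" "y \<in> Om" and v[measurable]: "v \<in> BM" and eq: "AE x in lborel. x \<in> Om --> v x = u x"
  and t: "aplim v y a"
 shows "y \<in> prec_ge Om u t \<longleftrightarrow> t <= a"
proof -
 have "aplim (%x. - v x) y (- a)"
  by (rule trc_le[OF t order_refl order_refl _ v open_UNIV, where c=1]) auto
 moreover have "AE x in lborel. x \<in> Om --> - v x = - u x" using eq by eventually_elim auto
 ultimately have "u_plus Om (%x. - u x) y = - a" by (intro u_plus_if_trc[OF Om, of "%x. - v x"]) auto
 moreover have "u_plus Om u y = a" by (rule u_plus_if_trc[OF Om v eq t])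
 ultimately show ?thesis using Om by (simp add: prec_ge_def u_minus_eq)
qed

lemma trc_set_measurable:
 fixes w :: "'a::euclidean_space => real"
 assumes [measurable]: "w \<in> BM"
 shows "{p. aplim w p a} \<in> sets borel"
proof -
 define I where "I k p = en (2^(k*DIM('a)))*(LI v:ball 0 (hp k). en \<bar>w (p + v) - a\<bar>)" for k and p :: 'a
 have [measurable]: "I k \<in> BM" for k
 proof -
  have "(%p. en (2^(k*DIM('a)))*(LI v:ball 0 (hp k). en \<bar>w (p + v) - a\<bar>)) \<in> borel_measurable lborel" by measurable
  then show ?thesis by (simp add: I_def[abs_def])
 qed
 have "aplim w p a \<longleftrightarrow> limsup (%k. I k p) <= 0" for p
 proof -
  have e: "(%k. en (2^(k*DIM('a)))*(dev (sc p k (ball 0 1)) w a)) = (%k. I k p)"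
   unfolding sc_ball I_def by (intro ext arg_cong2[where f="(*)"] refl nn_integral_ball_shift) measurable
  have "(%k. I k p) ----> 0 \<longleftrightarrow> limsup (%k. I k p) <= 0"
  proof
   assume "limsup (%k. I k p) <= 0"
   moreover have "liminf (%k. I k p) <= limsup (%k. I k p)" by (rule Liminf_le_Limsup) simp
   ultimately show "(%k. I k p) ----> 0" by (intro Liminf_eq_Limsup) auto
  qed (simp add: lim_imp_Limsup)
  then show ?thesis unfolding trc_def e .
 qed
 then have "{p. aplim w p a} = {p. limsup (%k. I k p) <= 0}" by auto
 also have "... \<in> sets borel" by measurable
 finally show ?thesis .
qed

lemma u_plus_measurable:
 fixes u v :: "'a::euclidean_space => real"
 assumes Om: "open Om" and v[measurable]: "v \<in> BM" and eq: "AE x in lborel. x \<in> Om --> v x = u x"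
  and bd: "!!x. \<bar>v x\<bar> <= 1"
 shows "(%x. if x \<in> Om then u_plus Om u x else 0) \<in> BM"
proof (rule borel_measurableI_less)
 fix c :: real
 have [measurable]: "Om \<in> sets borel" using Om by simp
 define P where "P t = {y. aplim (ind {z. v z > t}) y 0}" for t
 have Pm[measurable]: "P t \<in> sets borel" for t unfolding P_def by (rule trc_set_measurable) measurable
 have d: "y \<in> dens_pts {z\<in>Om. u z > t} 0 \<longleftrightarrow> y \<in> P t" if y: "y \<in> Om" for t y
 proof -
  have e: "AE x in lborel. x \<in> Om --> (x \<in> {z\<in>Om. u z > t} \<longleftrightarrow> x \<in> {z. v z > t})" using eq by eventually_elim auto
  have b: "{z. v z > t} \<in> sets borel" by measurable
  show ?thesis using dens_pts_cong[OF _ Om y e] dens_pts_0_iff_trc[OF b] b by (simp add: P_def)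
 qed
 have mono: "y \<in> P t'" if "y \<in> P t" "t <= t'" for y t t'
 proof -
  have "aplim (ind {z. v z > t}) y 0" using that by (simp add: P_def)
  then have "aplim (ind {z. v z > t'}) y 0"
   by (rule trc_le[OF _ order_refl order_refl _ _ open_UNIV, where c=1]) (use that(2) in \<open>auto simp: indicator_def\<close>)
  then show ?thesis by (simp add: P_def)
 qed
 \<comment> \<open>Together with the lower bound -1 this makes the real infimum in
   \<open>u_plus\<close> a genuine one, over a nonempty set bounded below.\<close>
 have ne: "1 \<in> {t. y \<in> P t}" for y
 proof -
  have "{z. v z > 1} = {}" using bd by (auto simp: not_less abs_le_iff)
  then show ?thesis by (simp add: P_def trc_def)
 qed
 have bb: "- 1 <= t" if "y \<in> P t" for y t
 proof (rule ccontr)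
  assume "~ - 1 <= t"
  then have "{z. v z > t} = UNIV" using bd by (auto simp: abs_le_iff) (smt (verit))
  then have "aplim (ind UNIV) y 0" using that by (simp add: P_def)
  moreover have "aplim (ind UNIV) y 1" by (simp add: trc_def)
  ultimately have "(0::real) = 1" using emeasure_unit_ball(1) by (intro trc_unique[of "ball 0 1"]) auto
  then show False by simp
 qed
 have "u_plus Om u y < c \<longleftrightarrow> (\<exists>q\<in>\<rat>. q < c & y \<in> P q)" if y: "y \<in> Om" for y
 proof -
  have up: "u_plus Om u y = Inf {t. y \<in> P t}" unfolding u_plus_def d[OF y] ..
  have bdd: "bdd_below {t. y \<in> P t}" by (rule bdd_belowI[of _ "- 1"]) (use bb in auto)
  show ?thesis unfolding up
  proof
   assume "Inf {t. y \<in> P t} < c"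
   then obtain t where t: "y \<in> P t" "t < c" using cInf_less_iff[OF _ bdd] ne by blast
   obtain q where "q \<in> \<rat>" "t < q" "q < c" using Rats_dense_in_real[OF t(2)] by blast
   then show "\<exists>q\<in>\<rat>. q < c & y \<in> P q" using mono[OF t(1), of q] by auto
  next
   assume "\<exists>q\<in>\<rat>. q < c & y \<in> P q"
   then show "Inf {t. y \<in> P t} < c" using cInf_lower[OF _ bdd] by fastforce
  qed
 qed
 then have "{x\<in>space borel. (if x \<in> Om then u_plus Om u x else 0) < c} = (Om \<inter> (\<Union>q\<in>{q\<in>\<rat>. q < c}. P q)) \<union> (if 0 < c then - Om else {})"
  by auto
 also have "... \<in> sets borel"
 proof -
  have "(\<Union>q\<in>{q\<in>\<rat>. q < c}. P q) \<in> sets borel"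
   by (intro sets.countable_UN') (auto intro: countable_subset[OF _ countable_rat])
  then show ?thesis by auto
 qed
 finally show "{x\<in>space borel. (if x \<in> Om then u_plus Om u x else 0) < c} \<in> sets borel" .
qed

lemma prec_ge_borel:
 fixes u v :: "'a::euclidean_space => real"
 assumes Om: "open Om" and v[measurable]: "v \<in> BM" and eq: "AE x in lborel. x \<in> Om --> v x = u x"
  and bd: "!!x. \<bar>v x\<bar> <= 1"
 shows "prec_ge Om u t \<in> sets borel"
proof -
 have [measurable]: "Om \<in> sets borel" using Om by simp
 define p where "p x = (if x \<in> Om then u_plus Om u x else 0)" for x
 define m where "m x = (if x \<in> Om then u_plus Om (%x. - u x) x else 0)" for x
 have [measurable]: "p \<in> BM" unfolding p_def[abs_def] by (rule u_plus_measurable[OF assms])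
 have "AE x in lborel. x \<in> Om --> - v x = - u x" using eq by eventually_elim auto
 then have [measurable]: "m \<in> BM" unfolding m_def[abs_def]
  by (intro u_plus_measurable[OF Om, of "%x. - v x"]) (use bd in auto)
 have "prec_ge Om u t = {x\<in>Om. p x = - m x & t <= p x}"
  unfolding prec_ge_def u_minus_eq p_def m_def by auto
 also have "... \<in> sets borel" by measurable
 finally show ?thesis .
qed

section \<open>One-sided traces of the limit\<close>

text \<open>The slab left out by two wide cones has small volume, and |w - c| <= 1 bounds its
  contribution at every scale by that volume.\<close>

lemma trc_from_cones:
 fixes nu x :: "'a::euclidean_space"
 assumes nu: "nu \<noteq> 0" and w[measurable]: "w \<in> BM" and bd: "!!q. \<bar>w q - c\<bar> <= 1"
  and t: "!!si. 0 < si ==> si < norm nu ==> trc (cone nu si) w x c" "!!si. 0 < si ==> si < norm nu ==> trc (cone (- nu) si) w x c"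
 shows "aplim w x c"
 unfolding trc_def
proof (rule tendsto_0_if_all_le)
 fix e :: real assume e: "e > 0"
 define I where "I K k = en (2^(k*DIM('a)))*(dev (sc x k K) w c)" for K and k :: nat
 obtain si where si: "0 < si" "si < norm nu" and sl: "vol (ball 0 1 - (cone nu si \<union> cone (- nu) si)) < en (e/2)"
  using slab_small[OF nu, of "en (e/2)"] e by auto
 define S where "S = ball 0 1 - (cone nu si \<union> cone (- nu) si)"
 have [measurable]: "cone nu si \<in> sets borel" "cone (- nu) si \<in> sets borel" using cone_props(4)[OF si(1)] by auto
 have [measurable]: "S \<in> sets borel" unfolding S_def by measurable
 have "I (cone nu si) ----> 0" "I (cone (- nu) si) ----> 0" using t[OF si] by (simp_all add: trc_def I_def[abs_def])
 then have "eventually (%k. I (cone nu si) k < en (e/4)) sq" "eventually (%k. I (cone (- nu) si) k < en (e/4)) sq"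
  using e by (auto intro: order_tendstoD(2))
 then have "eventually (%k. I (ball 0 1) k <= en e) sq"
 proof eventually_elim
  case (elim k)
  have IS: "I S k <= en (e/2)"
  proof -
   have "I S k <= en (2^(k*DIM('a)))*(LI q. chi (sc x k S) q)"
    unfolding I_def
   proof (intro mult_left_mono nn_integral_mono)
    fix q show "en \<bar>w q - c\<bar>*chi (sc x k S) q <= chi (sc x k S) q"
     using ennreal_leI[OF bd[of q]] by (auto simp: indicator_def)
   qed simp
   also have "... = vol S" by (simp add: emeasure_sc)
   finally show ?thesis using sl by (simp add: S_def)
  qed
  have "I (ball 0 1) k <= en (2^(k*DIM('a)))*(LI q. (en \<bar>w q - c\<bar>*chi (sc x k (cone nu si)) q + en \<bar>w q - c\<bar>*chi (sc x k (cone (- nu) si)) q)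
    + en \<bar>w q - c\<bar>*chi (sc x k S) q)"
   unfolding I_def
  proof (intro mult_left_mono nn_integral_mono)
   fix q
   have "q \<in> sc x k (ball 0 1) ==> q \<in> sc x k (cone nu si) \<or> q \<in> sc x k (cone (- nu) si) \<or> q \<in> sc x k S" by (auto simp: sc_def S_def)
   then show "en \<bar>w q - c\<bar>*chi (sc x k (ball 0 1)) q <= (en \<bar>w q - c\<bar>*chi (sc x k (cone nu si)) q + en \<bar>w q - c\<bar>*chi (sc x k (cone (- nu) si)) q)
    + en \<bar>w q - c\<bar>*chi (sc x k S) q"
    unfolding indicator_def by (auto intro: add_increasing add_increasing2)
  qed simp
  also have "... = (I (cone nu si) k + I (cone (- nu) si) k) + I S k"
   unfolding I_def by (simp add: nn_integral_add distrib_left)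
  also have "... <= (en (e/4) + en (e/4)) + en (e/2)" by (intro add_mono IS less_imp_le[OF elim(1)] less_imp_le[OF elim(2)])
  also have "... = en e" using e by (simp flip: ennreal_plus)
  finally show ?case .
 qed
 then show "eventually (%k. en (2^(k*DIM('a)))*(dev (sc x k (ball 0 1)) w c) <= en e) sq"
  by (simp add: I_def)
qed

lemma cone_antimono: "si <= ta ==> cone nu ta \<subseteq> cone nu si"
 unfolding cone_def by (auto intro: le_less_trans[OF mult_right_mono[OF _ norm_ge_zero]])

text \<open>Each one-sided trace of f 1_A is 0 or \<open>al\<close>, because the indicator has
  traces 0 or 1. Were the two sides equal, they would agree at all apertures and A would have
  density 0 or 1 at x by \<open>trc_from_cones\<close>.\<close>

lemma cone_traces_differ:
 fixes nu x :: "'a::euclidean_space"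
 assumes nu: "nu \<noteq> 0" and A[measurable]: "A \<in> sets borel" and f[measurable]: "f \<in> BM"
  and tf: "aplim f x al" and al: "al > 0"
  and ex: "!!mu si. mu = nu \<or> mu = - nu ==> 0 < si ==> si < norm nu ==> \<exists>a. trc (cone mu si) (%q. f q * ind A q) x a"
  and nA: "~ aplim (ind A) x 0" "~ aplim (ind A) x 1"
  and si0: "0 < si0" "si0 < norm nu"
  and t: "trc (cone nu si0) (%q. f q * ind A q) x a" "trc (cone (- nu) si0) (%q. f q * ind A q) x b"
 shows "a = al & b = 0 \<or> a = 0 & b = al"
proof -
 let ?W = "%q. f q * ind A q"
 have K: "cone mu si \<subseteq> ball 0 1" "cone mu si \<in> sets borel" "vol (cone mu si) > 0"
  if "mu = nu \<or> mu = - nu" "0 < si" "si < norm nu" for mu si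
  using cone_props(3,4)[OF that(2)] cone_props(7)[OF that(2), of mu] that by auto
 have ind: "trc (cone mu si) (ind A) x (c/al)" if "mu = nu \<or> mu = - nu" "0 < si" "si < norm nu" "trc (cone mu si) ?W x c" for mu si c
  using K[OF that(1-3)] trc_ratio[OF _ _ A f that(4) trc_subset[OF tf _ order_refl] al] by auto
 have two: "c = 0 \<or> c = al" if "mu = nu \<or> mu = - nu" "0 < si" "si < norm nu" "trc (cone mu si) ?W x c" for mu si c
  using trc_indicator_01[OF K[OF that(1-3)] A ind[OF that]] al by (auto simp: field_simps)
 \<comment> \<open>Cones with the same axis are nested, and the trace on the larger one restricts to
   the smaller one; so the value does not depend on the aperture.\<close>
 have all: "trc (cone mu si) (ind A) x (c/al)" if mu: "mu = nu \<or> mu = - nu" and si: "0 < si" "si < norm nu" and c: "trc (cone mu si0) ?W x c" for mu si c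
 proof -
  obtain d where d: "trc (cone mu si) ?W x d" using ex[OF mu si] by blast
  have "d = c"
  proof (cases "si <= si0")
   case True
   then have "trc (cone mu si0) ?W x d" using K[OF mu si] cone_antimono[OF True] by (intro trc_subset[OF d]) auto
   then show ?thesis using c K[OF mu si0] by (intro trc_unique) auto
  next
   case False
   then have "trc (cone mu si) ?W x c" using K[OF mu si0] cone_antimono[of si0 si] by (intro trc_subset[OF c]) auto
   then show ?thesis using d K[OF mu si] by (intro trc_unique) auto
  qed
  then show ?thesis using ind[OF mu si d] by simp
 qed
 have "a \<noteq> b"
 proof
  assume "a = b"
  have "aplim (ind A) x (a/al)"
  proof (rule trc_from_cones[OF nu])
   show "trc (cone nu si) (ind A) x (a/al)" if "0 < si" "si < norm nu" for si using all[OF _ that t(1)] by simp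
   show "trc (cone (- nu) si) (ind A) x (a/al)" if "0 < si" "si < norm nu" for si using all[OF _ that t(2)] \<open>a = b\<close> by simp
   show "\<bar>ind A q - a/al\<bar> <= 1" for q using two[OF _ si0 t(1)] al by (auto simp: indicator_def)
  qed simp
  then show False using two[OF _ si0 t(1)] nA al by auto
 qed
 then show ?thesis using two[OF _ si0 t(1)] two[OF _ si0 t(2)] by auto
qed

text \<open>\<open>trc_exists_limit\<close> for a constant sequence. The rate depends on L and K
  only, hence is the same for all members of a sequence with a common energy bound.\<close>

lemma energy_trace:
 fixes K :: "'a::euclidean_space set"
 assumes up: "upgrad Q w G" and K[measurable]: "K \<in> sets borel" and cK: "convex K" "K \<subseteq> ball 0 1"
  and star: "!!v. v \<in> K ==> (1/2) *R v \<in> K" and mK: "vol K > 0"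
  and sub: "!!k. k >= k0 ==> sc x k K \<subseteq> Q" and L: "L > 0"
  and en: "!!k. (LI q:ball x (hp k). en (G q)) <= en (L*(3/2)^k*hp (k*DIM('a)))"
 shows "\<exists>a. \<forall>k\<ge>k0. (dev (sc x k K) w a)
   <= en ((2^Suc DIM('a)*(L/measure lborel K))*(10 + 8*2^DIM('a))*(3/4)^k) * vol (sc x k K)"
proof -
 have [measurable]: "w \<in> BM" "G \<in> BM" using up by (auto simp: upgrad_def)
 have fin: "vol K < \<infinity>" using emeasure_mono[OF cK(2), of lborel] emeasure_unit_ball(2) by (auto intro: le_less_trans)
 define m where "m = measure lborel K"
 have m: "vol K = en m" "m > 0"
  using fin mK by (auto simp: m_def emeasure_eq_ennreal_measure less_top)
 have "\<exists>a. \<forall>k\<ge>k0. (dev (sc x k K) w a)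
   <= en ((2^Suc DIM('a)*(L/m))*(10 + 8*2^DIM('a))*(3/4)^k) * vol (sc x k K)"
 proof (rule trc_exists_limit[OF up K cK star fin mK sub, where ?w0.0=w])
  show "L/m > 0" using L m by simp
  show "frequently (%j. (LI q:sc x k K. en (G q)) <= en (L/m*(3/2)^k) * vol (sc x k K)) sq" for k
  proof -
   have "(LI q:sc x k K. en (G q)) <= (LI q:ball x (hp k). en (G q))"
    using sc_mono[OF cK(2), of x k] by (intro nn_integral_mono mult_left_mono) (auto simp: sc_ball indicator_def)
   also note en
   also have "en (L*(3/2)^k*hp (k*DIM('a))) = en (L/m*(3/2)^k) * vol (sc x k K)"
    using L m by (simp add: emeasure_sc' flip: ennreal_mult)
   finally show ?thesis by (simp add: frequently_const)
  qed
 qed simp_all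
 then show ?thesis by (simp add: m_def)
qed

text \<open>On a set of finite measure the deviation from \<open>a j\<close> depends continuously on
  the function in L^1 and on the constant, so a bound holding infinitely often passes to the
  limit.\<close>

lemma trace_bound_limit:
 fixes w :: "nat => 'a::euclidean_space => real"
 assumes w[measurable]: "!!j. w j \<in> BM" "w0 \<in> BM" and S[measurable]: "S \<in> sets borel" "S \<subseteq> Q"
  and fin: "vol S < \<infinity>" and a: "a ----> al"
  and lim: "(%j. LI x:Q. en \<bar>w j x - w0 x\<bar>) ----> 0" and c: "c < \<infinity>"
  and fr: "frequently (%j. (dev S (w j) (a j)) <= c) sq"
 shows "(dev S w0 al) <= c"
proof (rule ccontr)
 define D where "D j = ((dist1 Q (w j) w0) + c) + vol S*en \<bar>a j - al\<bar>" for j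
 have "(%j. en \<bar>a j - al\<bar>) ----> en 0" by (intro tendsto_ennrealI tendsto_rabs_zero LIM_zero a)
 then have "D ----> (0 + c) + vol S*en 0" unfolding D_def[abs_def]
  using fin by (intro tendsto_add tendsto_const lim ennreal_tendsto_cmult) (auto simp: less_top)
 moreover assume "~ (dev S w0 al) <= c"
 ultimately have "eventually (%j. D j < (dev S w0 al)) sq" by (intro order_tendstoD(2)) auto
 then have "frequently (%j. (dev S (w j) (a j)) <= c & D j < (dev S w0 al)) sq"
  using fr by (rule frequently_eventually_frequently[rotated])
 then obtain j where j: "(dev S (w j) (a j)) <= c" "D j < (dev S w0 al)"
  by (auto dest: frequently_ex)
 have "(dev S w0 al)
  <= (LI x. (en \<bar>w j x - w0 x\<bar>*chi S x + en \<bar>w j x - a j\<bar>*chi S x) + en \<bar>a j - al\<bar>*chi S x)"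
  by (intro nn_integral_mono) (auto simp: indicator_def simp flip: ennreal_plus intro!: ennreal_leI)
 also have "... = ((dist1 S (w j) w0) + (dev S (w j) (a j))) + vol S*en \<bar>a j - al\<bar>"
  by (simp add: nn_integral_add nn_integral_cmult mult.commute[of "vol S"])
 also have "... <= D j" unfolding D_def
  using S(2) by (intro add_mono order_refl j(1) nn_integral_mono mult_left_mono) (auto simp: indicator_def)
 finally show False using j(2) by simp
qed

lemma upgrad_le:
 fixes w w' :: "'a::euclidean_space => real"
 assumes up: "upgrad Q w G" and R: "R \<subseteq> Q" and m: "w' \<in> BM" "G' \<in> BM"
  and le: "!!p q. p \<in> R ==> q \<in> R ==> \<bar>w' p - w' q\<bar> <= \<bar>w p - w q\<bar>" and G: "!!q. q \<in> R ==> G' q = G q"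
 shows "upgrad R w' G'"
 unfolding upgrad_def
proof (intro conjI allI m)
 fix h
 have "AE p in lborel. closed_segment p (p + h) \<subseteq> Q --> en \<bar>w (p + h) - w p\<bar> <= en (norm h)*(LI ta:{0..1}. en (G (p + ta *R h)))"
  using up by (simp add: upgrad_def)
 then show "AE p in lborel. closed_segment p (p + h) \<subseteq> R --> en \<bar>w' (p + h) - w' p\<bar> <= en (norm h)*(LI ta:{0..1}. en (G' (p + ta *R h)))"
 proof eventually_elim
  case (elim p)
  show ?case
  proof
   assume seg: "closed_segment p (p + h) \<subseteq> R"
   have "p + ta *R h \<in> R" if "ta \<in> {0..1}" for ta
   proof -
    have "p + ta *R h = (1 - ta) *R p + ta *R (p + h)" by (simp add: algebra_simps)
    then have "p + ta *R h \<in> closed_segment p (p + h)" using that by (auto simp: closed_segment_def)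
    then show ?thesis using seg by blast
   qed
   then have "(LI ta:{0..1}. en (G' (p + ta *R h))) = (LI ta:{0..1}. en (G (p + ta *R h)))"
    using G by (intro nn_integral_cong) (auto simp: indicator_def)
   moreover have "en \<bar>w' (p + h) - w' p\<bar> <= en \<bar>w (p + h) - w p\<bar>"
    using seg by (intro ennreal_leI le) auto
   moreover have "closed_segment p (p + h) \<subseteq> Q" using seg R by blast
   ultimately show "en \<bar>w' (p + h) - w' p\<bar> <= en (norm h)*(LI ta:{0..1}. en (G' (p + ta *R h)))"
    using elim by (metis (no_types, lifting) order_trans)
  qed
 qed
qed

text \<open>For each j the traces at x on the two opposite cones are f_j(x) and 0 in one of the two
  orders, with rates uniform in j. One order occurs infinitely often; the limit inherits it, and f0
  x > 0 turns it into traces 1 and 0 of B.\<close>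

lemma interface_limit:
 fixes f G :: "nat => 'a::euclidean_space => real" and nu x :: 'a
 assumes Q: "open Q" "bounded Q" "x \<in> Q" and P: "open P" "P \<subseteq> Q" and nu: "nu \<noteq> 0"
  and cones: "!!si. si > 0 ==> \<exists>k0. \<forall>k\<ge>k0. sc x k (cone nu si) \<subseteq> P & sc x k (cone (- nu) si) \<subseteq> P"
  and up: "!!j. upgrad Q (f j) (G j)" and f01: "!!j q. f j q \<in> {0..1}" and f0[measurable]: "f0 \<in> BM"
  and lim: "(%j. LI q:Q. en \<bar>f j q - f0 q\<bar>) ----> 0" and fae: "AE q in lborel. q \<in> Q --> (%j. f j q) ----> f0 q"
  and fx: "(%j. f j x) ----> f0 x" "!!j. f j x > 0" "f0 x > 0" and tr: "!!j a. aplim (f j) x a ==> f j x = a"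
  and L: "L > 0" and en: "!!j k. (LI q:ball x (hp k). en (G j q)) <= en (L*(3/2)^k*hp (k*DIM('a)))"
  and E1: "!!j. (LI q. en (G j q)) <= en M1" and E2: "!!j. (LI q. en ((G j q)^2)) <= en M" and M: "M >= 0"
  and A[measurable]: "!!j. A j \<in> sets borel" and upA: "!!j. upgrad P (%q. f j q * ind (A j) q) (G j)"
  and nA: "!!j. ~ aplim (ind (A j)) x 0" "!!j. ~ aplim (ind (A j)) x 1"
 shows "\<exists>B. B \<in> sets borel & B \<subseteq> P & ~ aplim (ind B) x 0 & ~ aplim (ind B) x 1 &
  hnull (DIM('a) - 1) {y\<in>P. ~ (\<exists>a. aplim (%q. f0 q * ind B q) y a)}"
proof -
 have fm[measurable]: "f j \<in> BM" and [measurable]: "G j \<in> BM" for j using up[of j] by (auto simp: upgrad_def)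
 have [measurable]: "P \<in> sets borel" using P by simp
 define W where "W j q = f j q * ind (A j) q" for j q
 have Wm[measurable]: "W j \<in> BM" for j unfolding W_def[abs_def] by measurable
 have upW: "upgrad P (W j) (G j)" for j using upA[of j] by (simp add: W_def[abs_def])
 define w where "w j q = W j q * ind P q" for j q
 have "\<exists>s v. strict_mono s & v \<in> BM & (\<forall>x. v x \<in> {0..1}) & (AE x in lborel. (%j. w (s j) x) ----> v x)
  & (%j. LI x:P. en \<bar>w (s j) x - v x\<bar>) ----> 0"
 proof (rule rellich[OF P(1) bounded_subset[OF Q(2) P(2)] _ _ _ E1])
  show "upgrad P (w j) (G j)" for j
   by (rule upgrad_le[OF upW[of j]]) (auto simp: w_def[abs_def])
  show "w j x \<in> {0..1}" for j x using f01[of j x] by (auto simp: w_def W_def indicator_def)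
 qed (auto simp: w_def)
 then obtain s v where s: "strict_mono s" and [measurable]: "v \<in> BM" and v01: "!!x. v x \<in> {0..1}"
  and vae: "AE x in lborel. (%j. w (s j) x) ----> v x" and vlim: "(%j. LI x:P. en \<bar>w (s j) x - v x\<bar>) ----> 0" by blast
 \<comment> \<open>Where the limit v is positive, the approximating functions eventually coincide
   with f_j there, so v = f0; elsewhere v = 0. Hence v = f0 1_B almost everywhere in P, although the
   indicators of A_j need not converge.\<close>
 define B where "B = {q\<in>P. v q > 0}"
 have Bm[measurable]: "B \<in> sets borel" unfolding B_def by measurable
 define z where "z q = f0 q * ind B q" for q
 have zm[measurable]: "z \<in> BM" unfolding z_def[abs_def] by measurable
 have vz: "AE q in lborel. q \<in> P --> v q = z q"
  using vae fae
 proof eventually_elim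
  case (elim q)
  show ?case
  proof
   assume q: "q \<in> P"
   show "v q = z q"
   proof (cases "v q > 0")
    case True
    then have "eventually (%j. 0 < w (s j) q) sq" using elim(1) by (intro order_tendstoD(1)) auto
    then have "eventually (%j. w (s j) q = f (s j) q) sq" by eventually_elim (auto simp: w_def W_def indicator_def split: if_splits)
    then have "(%j. f (s j) q) ----> v q" using elim(1) by (simp add: tendsto_cong)
    moreover have "(%j. f (s j) q) ----> f0 q" using elim(2) q P(2) LIMSEQ_subseq_LIMSEQ[OF _ s, of "%j. f j q"] by (auto simp: o_def)
    ultimately have "v q = f0 q" by (rule LIMSEQ_unique)
    then show ?thesis using True q by (simp add: z_def B_def)
   next
    case False
    then show ?thesis using v01[of q] by (simp add: z_def B_def)
   qed
  qed
 qed
 have zlim: "(%j. LI q:P. en \<bar>W (s j) q - z q\<bar>) ----> 0"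
 proof -
  have "(dist1 P (W (s j)) z) = (dist1 P (w (s j)) v)" for j
   using vz by (intro nn_integral_cong_AE, eventually_elim) (auto simp: indicator_def w_def)
  then show ?thesis using vlim by simp
 qed
 obtain k0 where k0: "!!k. k >= k0 ==> sc x k (ball 0 1) \<subseteq> Q"
 proof -
  obtain r where r: "r > 0" "ball x r \<subseteq> Q" using openE[OF Q(1,3)] by blast
  obtain k0 where k0: "hp k0 < r" using real_arch_pow_inv[OF r(1), of "1/2"] by auto
  show thesis
  proof (rule that[of k0])
   fix k assume "k0 <= k"
   then have "hp k <= hp k0" by (intro power_decreasing) auto
   then have "ball x (hp k) \<subseteq> ball x r" using k0 by (intro subset_ball) linarith
   then show "sc x k (ball 0 1) \<subseteq> Q" using r(2) by (simp add: sc_ball)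
  qed
 qed
 define C where "C K = (2^Suc DIM('a)*(L/measure lborel K))*(10 + 8*2^DIM('a))" for K :: "'a set"
 have limit_trc: "trc K y0 x al"
  if [measurable]: "K \<in> sets borel" "!!j. y j \<in> BM" "y0 \<in> BM"
   and "K \<subseteq> ball 0 1" "!!k. k >= k1 ==> sc x k K \<subseteq> R" "a ----> al" "(%j. LI q:R. en \<bar>y j q - y0 q\<bar>) ----> 0"
   and fr: "frequently (%j. \<forall>k\<ge>k1. (dev (sc x k K) (y j) (a j)) <= en (C K*(3/4)^k) * vol (sc x k K)) sq"
  for K R a al k1 and y :: "nat => 'a => real" and y0
 proof (rule trc_if_bound[where ?k0.0=k1 and L="C K"])
  show fin: "vol K < \<infinity>" using emeasure_mono[OF \<open>K \<subseteq> ball 0 1\<close>, of lborel] emeasure_unit_ball(2) by (auto intro: le_less_trans)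
  then have finS: "vol (sc x k K) < \<infinity>" for k by (simp add: emeasure_sc' ennreal_mult_less_top)
  fix k assume k: "k1 <= k"
  show "(dev (sc x k K) y0 al) <= en (C K*(3/4)^k) * vol (sc x k K)"
  proof (rule trace_bound_limit[OF that(2,3) _ that(5)[OF k] finS that(6,7)])
   show "en (C K*(3/4)^k) * vol (sc x k K) < \<infinity>" using finS[of k] by (simp add: ennreal_mult_less_top)
   show "frequently (%j. (dev (sc x k K) (y j) (a j)) <= en (C K*(3/4)^k) * vol (sc x k K)) sq"
    by (rule frequently_elim1[OF fr]) (use k in blast)
  qed measurable
 qed simp
 \<comment> \<open>The trace of f_j at x exists by the energy bound and equals the value f_j(x) by
   \<open>tr\<close>.\<close>
 have ball_b: "\<forall>k\<ge>k0. (dev (sc x k (ball 0 1)) (f j) (f j x)) <= en (C (ball 0 1)*(3/4)^k) * vol (sc x k (ball 0 1))"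
  and ball_t: "aplim (f j) x (f j x)" for j
 proof -
  have "\<exists>a. \<forall>k\<ge>k0. (dev (sc x k (ball 0 1)) (f j) a) <= en (C (ball 0 1)*(3/4)^k) * vol (sc x k (ball 0 1))"
   unfolding C_def by (rule energy_trace[OF up _ _ _ _ emeasure_unit_ball(1) k0 L en]) auto
  then obtain a where a: "\<forall>k\<ge>k0. (dev (sc x k (ball 0 1)) (f j) a) <= en (C (ball 0 1)*(3/4)^k) * vol (sc x k (ball 0 1))" by blast
  have t: "aplim (f j) x a" by (rule trc_if_bound[where ?k0.0=k0 and L="C (ball 0 1)"]) (use a emeasure_unit_ball in auto)
  then have "f j x = a" by (rule tr)
  with a t show "\<forall>k\<ge>k0. (dev (sc x k (ball 0 1)) (f j) (f j x)) <= en (C (ball 0 1)*(3/4)^k) * vol (sc x k (ball 0 1))"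
   and "aplim (f j) x (f j x)" by auto
 qed
 have f0t: "aplim f0 x (f0 x)"
  by (rule limit_trc[OF _ _ _ order_refl k0 fx(1) lim]) (use ball_b in \<open>auto intro!: always_eventually eventually_frequently\<close>)
 \<comment> \<open>The threshold \<open>k1\<close> precedes j: it depends on the geometry of the
   cones only.\<close>
 have cone_b: "\<exists>k1. \<forall>j. \<exists>a. \<forall>k\<ge>k1. sc x k (cone mu si) \<subseteq> P & (dev (sc x k (cone mu si)) (W j) a) <= en (C (cone mu si)*(3/4)^k) * vol (sc x k (cone mu si))"
  if mu: "mu = nu \<or> mu = - nu" and si: "0 < si" "si < norm nu" for mu si
 proof -
  obtain k1 where k1: "!!k. k >= k1 ==> sc x k (cone mu si) \<subseteq> P" using cones[OF si(1)] mu by blast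
  have "\<exists>a. \<forall>k\<ge>k1. (dev (sc x k (cone mu si)) (W j) a) <= en (C (cone mu si)*(3/4)^k) * vol (sc x k (cone mu si))" for j
   unfolding C_def
  proof (rule energy_trace[OF upW cone_props(4,2,3)[OF si(1)] cone_props(5)[OF si(1)] _ k1 L en])
   show "0 < vol (cone mu si)" using cone_props(7)[OF si(1), of mu] si(2) mu by auto
  qed
  then show ?thesis using k1 by (intro exI[of _ k1] allI) meson
 qed
 have trc_b: "trc (cone mu si) (W j) x a" if si: "0 < si"
  and "\<forall>k\<ge>k1. sc x k (cone mu si) \<subseteq> P & (dev (sc x k (cone mu si)) (W j) a) <= en (C (cone mu si)*(3/4)^k) * vol (sc x k (cone mu si))"
  for mu si j a k1
  by (rule trc_if_bound[where ?k0.0=k1 and L="C (cone mu si)"]) (use that cone_props(4,6)[OF si] in auto)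
 define si0 where "si0 = norm nu/2"
 have si0: "0 < si0" "si0 < norm nu" using nu by (auto simp: si0_def)
 obtain k1 where "\<forall>j. \<exists>a. \<forall>k\<ge>k1. sc x k (cone nu si0) \<subseteq> P & (dev (sc x k (cone nu si0)) (W j) a) <= en (C (cone nu si0)*(3/4)^k) * vol (sc x k (cone nu si0))"
  using cone_b[OF _ si0, of nu] by blast
 from choice[OF this] obtain a where a: "!!j. \<forall>k\<ge>k1. sc x k (cone nu si0) \<subseteq> P & (dev (sc x k (cone nu si0)) (W j) (a j)) <= en (C (cone nu si0)*(3/4)^k) * vol (sc x k (cone nu si0))" by blast
 obtain k2 where "\<forall>j. \<exists>a. \<forall>k\<ge>k2. sc x k (cone (- nu) si0) \<subseteq> P & (dev (sc x k (cone (- nu) si0)) (W j) a) <= en (C (cone (- nu) si0)*(3/4)^k) * vol (sc x k (cone (- nu) si0))"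
  using cone_b[OF _ si0, of "- nu"] by blast
 from choice[OF this] obtain b where b: "!!j. \<forall>k\<ge>k2. sc x k (cone (- nu) si0) \<subseteq> P & (dev (sc x k (cone (- nu) si0)) (W j) (b j)) <= en (C (cone (- nu) si0)*(3/4)^k) * vol (sc x k (cone (- nu) si0))" by blast
 have ab: "a j = f j x & b j = 0 \<or> a j = 0 & b j = f j x" for j
 proof (rule cone_traces_differ[OF nu A fm ball_t fx(2) _ nA si0 trc_b[OF si0(1) a, unfolded W_def] trc_b[OF si0(1) b, unfolded W_def]])
  fix mu si assume mu: "mu = nu \<or> mu = - nu" and si: "0 < si" "si < norm nu"
  show "\<exists>a. trc (cone mu si) (%q. f j q * ind (A j) q) x a"
   using cone_b[OF mu si] trc_b[OF si(1)] unfolding W_def by blast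
 qed
 have fxs: "(%j. f (s j) x) ----> f0 x" using LIMSEQ_subseq_LIMSEQ[OF fx(1) s] by (simp add: o_def)
 have lta: "trc (cone nu si0) z x al" if c: "c ----> al" and fr: "frequently (%j. c j = a (s j)) sq" for c al
 proof (rule limit_trc[OF cone_props(4)[OF si0(1)] _ zm cone_props(3)[OF si0(1)] _ c zlim])
  show "sc x k (cone nu si0) \<subseteq> P" if "k1 <= k" for k using a that by blast
  show "frequently (%j. \<forall>k\<ge>k1. (dev (sc x k (cone nu si0)) (W (s j)) (c j)) <= en (C (cone nu si0)*(3/4)^k) * vol (sc x k (cone nu si0))) sq"
   using fr by (rule frequently_elim1) (simp add: a)
 qed measurable
 have ltb: "trc (cone (- nu) si0) z x al" if c: "c ----> al" and fr: "frequently (%j. c j = b (s j)) sq" for c al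
 proof (rule limit_trc[OF cone_props(4)[OF si0(1)] _ zm cone_props(3)[OF si0(1)] _ c zlim])
  show "sc x k (cone (- nu) si0) \<subseteq> P" if "k2 <= k" for k using b that by blast
  show "frequently (%j. \<forall>k\<ge>k2. (dev (sc x k (cone (- nu) si0)) (W (s j)) (c j)) <= en (C (cone (- nu) si0)*(3/4)^k) * vol (sc x k (cone (- nu) si0))) sq"
   using fr by (rule frequently_elim1) (simp add: b)
 qed measurable
 \<comment> \<open>Pigeonhole over the two orders in which the traces can occur.\<close>
 have "\<exists>mu mu'. (mu = nu \<or> mu = - nu) & (mu' = nu \<or> mu' = - nu) & trc (cone mu si0) z x (f0 x) & trc (cone mu' si0) z x 0"
 proof -
  have "frequently (%j. (a (s j) = f (s j) x & b (s j) = 0) \<or> (a (s j) = 0 & b (s j) = f (s j) x)) sq"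
   using ab by (intro eventually_frequently always_eventually) auto
  then consider "frequently (%j. a (s j) = f (s j) x & b (s j) = 0) sq" | "frequently (%j. a (s j) = 0 & b (s j) = f (s j) x) sq"
   unfolding frequently_disj_iff by blast
  then show ?thesis
  proof cases
   case 1
   have "trc (cone nu si0) z x (f0 x)" by (rule lta[OF fxs]) (rule frequently_elim1[OF 1], simp)
   moreover have "trc (cone (- nu) si0) z x 0" by (rule ltb[OF tendsto_const]) (rule frequently_elim1[OF 1], simp)
   ultimately show ?thesis by blast
  next
   case 2
   have "trc (cone nu si0) z x 0" by (rule lta[OF tendsto_const]) (rule frequently_elim1[OF 2], simp)
   moreover have "trc (cone (- nu) si0) z x (f0 x)" by (rule ltb[OF fxs]) (rule frequently_elim1[OF 2], simp)
   ultimately show ?thesis by blast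
  qed
 qed
 then obtain mu mu' where mu: "mu = nu \<or> mu = - nu" "trc (cone mu si0) z x (f0 x)" and mu': "mu' = nu \<or> mu' = - nu" "trc (cone mu' si0) z x 0" by blast
 have ind: "trc (cone mu si0) (ind B) x (c/f0 x)" if "trc (cone mu si0) z x c" for c mu
  using cone_props(3,4)[OF si0(1), of mu] trc_subset[OF f0t _ order_refl, of "cone mu si0"]
  by (intro trc_ratio[OF _ _ Bm f0 that[unfolded z_def]] fx(3)) auto
 have val: "d = c/f0 x" if "mu = nu \<or> mu = - nu" "trc (cone mu si0) z x c" "aplim (ind B) x d" for c d mu
 proof (rule trc_unique[OF cone_props(4)[OF si0(1)] _ _ _ ind[OF that(2)]])
  show "trc (cone mu si0) (ind B) x d" using cone_props(3)[OF si0(1)] by (intro trc_subset[OF that(3)]) auto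
  show "0 < vol (cone mu si0)" using cone_props(7)[OF si0(1), of mu] si0(2) that(1) by auto
 qed simp
 \<comment> \<open>A density of B at x would have to equal 1 on one cone and 0 on the other.\<close>
 have no: "~ aplim (ind B) x d" for d using val[OF mu, of d] val[OF mu', of d] fx(3) by auto
 have "hnull (DIM('a) - 1) {y\<in>P. ~ (\<exists>a. aplim z y a)}"
  by (rule hnull_no_trace_limit[OF P(1) upW E2 M zm zlim])
 then show ?thesis using no Bm by (intro exI[of _ B]) (auto simp: B_def z_def[abs_def])
qed

section \<open>Stability of the spanning condition\<close>

text \<open>The weighted sums over all scales have integrals bounded uniformly in j, so by Fatou
  their liminf is finite almost everywhere. Thus one and the same j serves all scales, which the
  uniform rates in \<open>interface_limit\<close> require.\<close>

lemma energy_frequently_bounded: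
 fixes G :: "nat => 'a::euclidean_space => real"
 assumes [measurable]: "!!j. G j \<in> BM" and E: "!!j. (LI q. en (G j q)) <= en M" and M: "M >= 0"
 shows "AE x in lborel. \<exists>L>0. frequently (%j. \<forall>k. (LI q:ball x (hp k). en (G j q)) <= en (L*(3/2)^k*hp (k*DIM('a)))) sq"
proof -
 define I where "I j k x = (LI v:ball 0 (hp k). en (G j (x + v)))" for j k and x :: 'a
 have I: "(LI q:ball x (hp k). en (G j q)) = I j k x" for j k x
  unfolding I_def by (rule nn_integral_ball_shift) measurable
 have [measurable]: "I j k \<in> BM" for j k
 proof -
  have "(%x. LI v:ball 0 (hp k). en (G j (x + v))) \<in> borel_measurable lborel" by measurable
  then show ?thesis by (simp add: I_def[abs_def])
 qed
 \<comment> \<open>The power of 2 normalises by the volume of the ball, and (2/3)^k makes the series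
   converge; its inverse is the growth (3/2)^k in the statement.\<close>
 define c where "c k = (2/3::real)^k*2^(k*DIM('a))" for k
 have c: "c k > 0" for k by (simp add: c_def)
 define om where "om = unit_ball_vol (real DIM('a))"
 define La where "La j x = (\<Sum>k. en (c k)*I j k x)" for j x
 have [measurable]: "La j \<in> BM" for j unfolding La_def[abs_def] by measurable
 have "(LI x. I j k x) <= en (om*hp (k*DIM('a)))*en M" for j k
 proof -
  have "(LI x. I j k x) = (LI v. LI x. en (G j (x + v))*chi (ball 0 (hp k)) v)"
   unfolding I_def by (rule lborel_pair.Fubini') measurable
  also have "... = (LI v. (LI q. en (G j q))*chi (ball (0::'a) (hp k)) v)"
   by (simp add: nn_integral_multc nn_integral_translate[of "%q. en (G j q)"])
  also have "... = (LI q. en (G j q))*en (om*hp (k*DIM('a)))"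
   by (simp add: nn_integral_cmult emeasure_ball_dyadic om_def)
  also have "... <= en (om*hp (k*DIM('a)))*en M" unfolding mult.commute[of _ "en (om * _)"] by (intro mult_left_mono E) simp
  finally show ?thesis .
 qed
 then have "en (c k)*(LI x. I j k x) <= en (c k)*(en (om*hp (k*DIM('a)))*en M)" for j k
  by (intro mult_left_mono) auto
 moreover have "en (c k)*(en (om*hp (k*DIM('a)))*en M) = en (om*M*(2/3)^k)" for k
 proof -
  have "c k*(om*hp (k*DIM('a))*M) = om*M*(2/3)^k" by (simp add: c_def power_one_over)
  then show ?thesis using M c[of k] by (simp add: om_def flip: ennreal_mult)
 qed
 ultimately have term_le: "en (c k)*(LI x. I j k x) <= en (om*M*(2/3)^k)" for j k by simp
 have "(LI x. La j x) <= (\<Sum>k. en (om*M*(2/3)^k))" for j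
  unfolding La_def by (subst nn_integral_suminf) (auto simp: nn_integral_cmult intro!: suminf_le term_le)
 moreover have fin: "(\<Sum>k. en (om*M*(2/3)^k)) < \<infinity>"
  using M by (subst suminf_ennreal2) (auto simp: om_def intro!: summable_mult summable_geometric)
 ultimately have "liminf (%j. LI x. La j x) < \<infinity>"
  by (intro le_less_trans[OF Liminf_le_Limsup le_less_trans[OF Limsup_bounded fin]]) (auto intro: always_eventually)
 moreover have "(LI x. liminf (%j. La j x)) <= liminf (%j. LI x. La j x)" by (rule nn_integral_liminf) measurable
 ultimately have "AE x in lborel. liminf (%j. La j x) \<noteq> \<infinity>" by (intro nn_integral_PInf_AE) auto
 then show ?thesis
 proof eventually_elim
  case (elim x)
  then obtain L0 where L0: "L0 >= 0" "liminf (%j. La j x) = en L0" by (cases "liminf (%j. La j x)") auto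
  have fr: "frequently (%j. La j x <= en (L0 + 1)) sq"
  proof (rule ccontr)
   assume "~ ?thesis"
   then have "eventually (%j. en (L0 + 1) <= La j x) sq" unfolding not_frequently by eventually_elim simp
   then have "en (L0 + 1) <= en L0" unfolding L0(2)[symmetric] by (rule Liminf_bounded)
   then show False using L0(1) by simp
  qed
  have "frequently (%j. \<forall>k. (LI q:ball x (hp k). en (G j q)) <= en ((L0 + 1)*(3/2)^k*hp (k*DIM('a)))) sq"
   using fr
  proof (rule frequently_elim1, intro allI)
   fix j k assume le: "La j x <= en (L0 + 1)"
   have "en (c k)*I j k x <= La j x" unfolding La_def using sum_le_suminf[of "%k. en (c k)*I j k x" "{k}"] by simp
   also note le
   also have "en (L0 + 1) = en (c k)*en ((L0 + 1)*(3/2)^k*hp (k*DIM('a)))"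
   proof -
    have 1: "c k*((3/2)^k*hp (k*DIM('a))) = 1" by (simp add: c_def power_divide)
    have "c k*((L0 + 1)*(3/2)^k*hp (k*DIM('a))) = (L0 + 1)*(c k*((3/2)^k*hp (k*DIM('a))))" by (simp only: mult_ac)
    then have 2: "c k*((L0 + 1)*(3/2)^k*hp (k*DIM('a))) = L0 + 1" unfolding 1 by simp
    have "en (c k)*en ((L0 + 1)*(3/2)^k*hp (k*DIM('a))) = en (c k*((L0 + 1)*(3/2)^k*hp (k*DIM('a))))"
     by (rule ennreal_mult[symmetric]) (use c[of k] L0(1) in auto)
    then show ?thesis unfolding 2 by simp
   qed
   finally show "(LI q:ball x (hp k). en (G j q)) <= en ((L0 + 1)*(3/2)^k*hp (k*DIM('a)))"
    unfolding I using c[of k] by (subst (asm) ennreal_mult_le_mult_iff) auto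
  qed
  then show ?case using L0(1) by (intro exI[of _ "L0 + 1"]) auto
 qed
qed

lemma frequently_subseq:
 assumes "frequently P sq" shows "\<exists>r::nat => nat. strict_mono r & (\<forall>n. P (r n))"
proof -
 have "infinite {n. P n}" using assms by (simp add: frequently_cofinite[symmetric] cofinite_eq_sequentially)
 from infinite_enumerate[OF this] show ?thesis by auto
qed

lemma borel_set_rep:
 fixes E :: "'a::euclidean_space set"
 assumes "E \<in> sets lebesgue" shows "\<exists>A\<in>sets borel. AE x in lborel. x \<in> E \<longleftrightarrow> x \<in> A"
proof -
 have "ind E \<in> borel_measurable (completion lborel)" using assms by simp
 from completion_ex_borel_measurable_real[OF this] obtain g where g: "g \<in> BM" "AE x in lborel. ind E x = g x" by auto
 have "{x. g x = 1} \<in> sets borel" using g(1) by measurable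
 moreover have "AE x in lborel. x \<in> E \<longleftrightarrow> x \<in> {x. g x = 1}"
  using g(2) by eventually_elim (auto simp: indicator_def split: if_splits)
 ultimately show ?thesis by blast
qed

text \<open>Off S and an H^n-null set, a point where A has neither density 0 nor 1 lies in
  \<open>prec_ge\<close>, so v has trace at least t there and f has trace 0. This is the hypothesis
  of \<open>upgrad_mult_indicator\<close>.\<close>

lemma upgrad_from_disconnect:
 fixes u v G :: "'a::euclidean_space => real"
 assumes Om: "open Om" and T: "open T" "T \<subseteq> Om" "vol T < \<infinity>" and P: "open (T - S)" and dim: "DIM('a) >= 2"
  and v[measurable]: "v \<in> BM" and eq: "AE x in lborel. x \<in> Om --> v x = u x"
  and up: "upgrad T v G" and G: "integrable lborel G" "(LI x. en ((G x)^2)) <= en M" "M >= 0"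
  and f: "upgrad T f G" "!!x. 0 <= f x" "integrable lborel f" "!!x. x \<in> T ==> f x = max 0 (t - v x)"
  and disc: "ess_disconnects (prec_ge Om u t \<union> S) T A1 A2" and x: "x \<in> T" "x \<in> ess_bd A1"
 shows "\<exists>A. A \<in> sets borel & upgrad (T - S) (%q. f q * ind A q) G &
  ~ aplim (ind A) x 0 & ~ aplim (ind A) x 1"
proof -
 have part: "leb_partition T A1 A2" and hz: "hausdorff (DIM('a) - 1) ((dens_pts T 1 \<inter> ess_bd A1 \<inter> ess_bd A2) - (prec_ge Om u t \<union> S)) = 0"
  using disc by (auto simp: ess_disconnects_def)
 \<comment> \<open>The members of a partition are only Lebesgue measurable; densities do not notice
   the change on a null set.\<close>
 obtain A' where A': "A' \<in> sets borel" "AE x in lborel. x \<in> A1 \<longleftrightarrow> x \<in> A'" using borel_set_rep[of A1] part by (auto simp: leb_partition_def)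
 define A where "A = A' \<inter> T"
 have A[measurable]: "A \<in> sets borel" using A'(1) T(1) by (auto simp: A_def)
 have e1: "AE x in lborel. x \<in> T --> (x \<in> A1 \<longleftrightarrow> x \<in> A)" using A'(2) by eventually_elim (auto simp: A_def)
 have e2: "AE x in lborel. x \<in> T --> (x \<in> A2 \<longleftrightarrow> x \<in> - A)"
 proof -
  have s: "T - (A1 \<union> A2) \<in> sets lebesgue" "A1 \<inter> A2 \<in> sets lebesgue" using part T(1) by (auto simp: leb_partition_def)
  then have "negligible (T - (A1 \<union> A2))" "negligible (A1 \<inter> A2)" using part by (auto simp: leb_partition_def negligible_iff_null_sets null_sets_def)
  then have "AE x in lborel. x \<notin> T - (A1 \<union> A2)" "AE x in lborel. x \<notin> A1 \<inter> A2" by (simp_all add: negligible_iff_AE)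
  then show ?thesis using e1 by eventually_elim auto
 qed
 note b1 = ess_bd_iff_trc[OF A T(1) _ e1]
 have b2: "y \<in> ess_bd A2 \<longleftrightarrow> ~ aplim (ind A) y 1 & ~ aplim (ind A) y 0" if "y \<in> T" for y
  using ess_bd_iff_trc[OF _ T(1) that e2] A by (simp add: trc_complement)
 have dens: "y \<in> dens_pts T 1" if y: "y \<in> T" for y
 proof -
  have "y \<in> dens_pts (- T) 0 \<longleftrightarrow> y \<in> dens_pts {} 0" by (rule dens_pts_cong[OF _ T(1) y]) auto
  then show ?thesis using T(1) by (simp add: dens_pts_1_iff) (simp add: dens_pts_def)
 qed
 have fm[measurable]: "f \<in> BM" using f(1) by (simp add: upgrad_def)
 have "hnull (DIM('a) - 1) ((dens_pts T 1 \<inter> ess_bd A1 \<inter> ess_bd A2) - (prec_ge Om u t \<union> S))"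
  using hz dim by (intro hnull_if_hausdorff_zero) auto
 moreover have "hnull (DIM('a) - 1) {y\<in>T. ~ (\<exists>a. aplim v y a)}"
  by (rule hnull_no_trace_limit[OF T(1) up G(2,3) v]) simp
 ultimately have hn: "hnull (DIM('a) - 1) (((dens_pts T 1 \<inter> ess_bd A1 \<inter> ess_bd A2) - (prec_ge Om u t \<union> S)) \<union> {y\<in>T. ~ (\<exists>a. aplim v y a)})"
  by (rule hnull_Un)
 have "upgrad (T - S) (%q. f q * ind A q) G"
 proof (rule upgrad_mult_indicator[OF P _ G(1) f(3,2) dim A])
  show "upgrad (T - S) f G" using f(1) G(1) by (intro upgrad_le[OF f(1)]) auto
  show "vol A < \<infinity>" using emeasure_mono[of A T lborel] T by (auto simp: A_def intro: le_less_trans)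
  show "hnull (DIM('a) - 1) {y\<in>T - S. ~ (\<exists>a. aplim f y a & (a = 0 \<or> aplim (ind A) y 0 \<or> aplim (ind A) y 1))}"
  proof (rule hnull_mono[OF hn], intro subsetI, rule ccontr)
   fix y assume y: "y \<in> {y\<in>T - S. ~ (\<exists>a. aplim f y a & (a = 0 \<or> aplim (ind A) y 0 \<or> aplim (ind A) y 1))}"
    and n: "y \<notin> ((dens_pts T 1 \<inter> ess_bd A1 \<inter> ess_bd A2) - (prec_ge Om u t \<union> S)) \<union> {y\<in>T. ~ (\<exists>a. aplim v y a)}"
   then obtain a where a: "aplim v y a" by blast
   have yT: "y \<in> T" "y \<in> Om" using y T(2) by auto
   have tf: "aplim f y (max 0 (t - a))"
    by (rule trc_le[OF a order_refl order_refl _ v T(1) yT(1), where c=1]) (auto simp: f(4))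
   then have "~ aplim (ind A) y 0" "~ aplim (ind A) y 1" "t - a > 0"
    using y by (auto simp: max_def split: if_splits)
   then have "y \<in> ess_bd A1 \<inter> ess_bd A2" using b1[OF yT(1)] b2[OF yT(1)] by simp
   then have "y \<in> prec_ge Om u t" using n y dens[OF yT(1)] by auto
   then have "t <= a" using prec_ge_if_trc[OF Om yT(2) v eq a] by simp
   then show False using \<open>t - a > 0\<close> by simp
  qed
 qed
 then show ?thesis using A b1[OF x(1)] x(2) by blast
qed

text \<open>The partition is B and T - B, whose essential boundaries agree inside T. A point in both
  of them already forces the two measures to be positive.\<close>

lemma disconnect_if_no_trace:
 fixes T :: "'a::euclidean_space set"
 assumes T: "open T" "dens_pts T 1 \<subseteq> T" and B: "B \<in> sets borel" "B \<subseteq> T" and x: "x \<in> T" and dim: "DIM('a) >= 2"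
  and nB: "~ aplim (ind B) x 0" "~ aplim (ind B) x 1"
  and hn: "hnull (DIM('a) - 1) N"
  and N: "!!y. y \<in> T - S ==> y \<notin> N ==> y \<notin> R ==> aplim (ind B) y 0 \<or> aplim (ind B) y 1"
 shows "\<exists>T1 T2. x \<in> ess_bd T1 \<inter> ess_bd T2 & ess_disconnects (R \<union> S) T T1 T2"
proof (intro exI conjI)
 have b1: "y \<in> ess_bd B \<longleftrightarrow> ~ aplim (ind B) y 0 & ~ aplim (ind B) y 1" for y
  by (rule ess_bd_iff_trc[OF B(1) open_UNIV]) auto
 have b2: "y \<in> ess_bd (T - B) \<longleftrightarrow> ~ aplim (ind B) y 1 & ~ aplim (ind B) y 0" if "y \<in> T" for y
  using ess_bd_iff_trc[of "- B" T y "T - B"] B T(1) that by (simp add: trc_complement)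
 show xb: "x \<in> ess_bd B \<inter> ess_bd (T - B)" using b1 b2[OF x] nB by simp
 have L: "B \<in> sets lebesgue" "T - B \<in> sets lebesgue" using B T(1) by auto
 show "ess_disconnects (R \<union> S) T B (T - B)"
  unfolding ess_disconnects_def
 proof (intro conjI)
  have e: "T - (B \<union> (T - B)) = {}" "B \<inter> (T - B) = {}" by auto
  show "leb_partition T B (T - B)" unfolding leb_partition_def e using L B(2) by auto
  show "0 < emeasure lebesgue B*emeasure lebesgue (T - B)"
   using ess_bd_imp_pos[of x B] ess_bd_imp_pos[of x "T - B"] xb L by (simp add: ennreal_zero_less_mult_iff)
  have "dens_pts T 1 \<inter> ess_bd B \<inter> ess_bd (T - B) - (R \<union> S) \<subseteq> N" using T(2) b1 N by blast
  then show "hausdorff (DIM('a) - 1) (dens_pts T 1 \<inter> ess_bd B \<inter> ess_bd (T - B) - (R \<union> S)) = 0"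
   using dim by (intro hausdorff_zero_if_hnull hnull_mono[OF hn]) auto
 qed
qed

text \<open>The cone about -nu misses H, so a trace could only be 0. On the cone about nu the set F
  has full density along the scales s, which contradicts 0. Full density of F at all scales is not
  claimed, hence the subsequence.\<close>

lemma superlevel_side_no_trace:
 fixes nu x :: "'a::euclidean_space"
 assumes F[measurable]: "F \<in> sets borel" and H[measurable]: "H \<in> sets borel" and xF: "x \<in> F"
  and s: "strict_mono s" "(%k. mean_osc (s k) (ind F) x) ----> 0" and si: "0 < si" "si < norm nu"
  and k0: "!!k. k >= k0 ==> sc x k (cone nu si) \<subseteq> H" "!!k. k >= k0 ==> sc x k (cone (- nu) si) \<inter> H = {}"
 shows "~ aplim (ind (F \<inter> H)) x c"
proof
 let ?B = "ind (F \<inter> H)"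
 assume t: "aplim ?B x c"
 note K = cone_props(3,4)[OF si(1)]
 have pos: "vol (cone nu si) > 0" "vol (cone (- nu) si) > 0"
  using cone_props(7)[OF si(1), of nu] cone_props(7)[OF si(1), of "- nu"] si(2) by auto
 have tK: "trc (cone mu si) ?B x c" for mu using K by (intro trc_subset[OF t]) auto
 have "trc (cone (- nu) si) ?B x 0"
  unfolding trc_def
 proof (rule tendsto_eventually, rule eventually_mono[OF eventually_ge_at_top[of k0]])
  fix k assume "k0 <= k"
  then have z: "en \<bar>?B q - 0\<bar>*chi (sc x k (cone (- nu) si)) q = 0" for q
   using k0(2)[of k] by (cases "q \<in> sc x k (cone (- nu) si)") (auto simp: indicator_def)
  show "en (2^(k*DIM('a)))*(dev (sc x k (cone (- nu) si)) ?B 0) = 0" unfolding z by simp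
 qed
 then have c0: "c = 0" using tK pos K by (intro trc_unique[of "cone (- nu) si" ?B]) auto
 define J where "J k = en (2^(k*DIM('a)))*(dev (sc x k (cone nu si)) ?B c)" for k
 have "J ----> 0" using tK[of nu] by (simp add: trc_def J_def[abs_def])
 from tendsto_add[OF LIMSEQ_subseq_LIMSEQ[OF this s(1)] s(2)]
 have lim: "(%k. J (s k) + mean_osc (s k) (ind F) x) ----> 0" by (simp add: o_def)
 have [measurable]: "cone nu si \<in> sets borel" using K by auto
 have le: "vol (cone nu si) <= J k + mean_osc k (ind F) x" if k: "k >= k0" for k
 proof -
  have "vol (cone nu si) = en (2^(k*DIM('a)))*(LI q. chi (sc x k (cone nu si)) q)"
   by (simp add: emeasure_sc)
  also have "... <= en (2^(k*DIM('a)))*(LI q. en \<bar>?B q - c\<bar>*chi (sc x k (cone nu si)) q + en \<bar>ind F q - ind F x\<bar>*chi (ball x (hp k)) q)"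
  proof (intro mult_left_mono nn_integral_mono)
   fix q
   show "chi (sc x k (cone nu si)) q <= en \<bar>?B q - c\<bar>*chi (sc x k (cone nu si)) q + en \<bar>ind F q - ind F x\<bar>*chi (ball x (hp k)) q"
   proof (cases "q \<in> sc x k (cone nu si)")
    case True
    then have "q \<in> H" "q \<in> ball x (hp k)" using k0(1)[OF k] sc_mono[OF K(1), of x k] unfolding sc_ball by blast+
    then show ?thesis using True xF c0 by (cases "q \<in> F") auto
   qed simp
  qed simp
  also have "... = J k + mean_osc k (ind F) x"
   unfolding J_def mean_osc_def by (simp add: nn_integral_add distrib_left)
  finally show ?thesis .
 qed
 have "eventually (%k. vol (cone nu si) <= J (s k) + mean_osc (s k) (ind F) x) sq"
  using eventually_compose_filterlim[OF eventually_ge_at_top[of k0] filterlim_subseq[OF s(1)]] by eventually_elim (rule le)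
 then have "vol (cone nu si) <= 0" by (intro tendsto_lowerbound[OF lim]) auto
 then show False using pos by simp
qed

lemma clamped_rep:
 fixes u :: "'a::euclidean_space => real"
 assumes Om: "open Om" and u: "!!K. compact K ==> K \<subseteq> Om ==> set_integrable lebesgue K u"
  and u01: "AE x in lebesgue. x \<in> Om --> u x \<in> {0..1}"
 shows "\<exists>v. v \<in> BM & (\<forall>x. v x \<in> {0..1}) & (AE x in lborel. x \<in> Om --> v x = u x)"
proof -
 obtain w where w[measurable]: "w \<in> BM" and eq: "AE x in lborel. x \<in> Om --> w x = u x"
  using borel_rep_real[OF Om u] by blast
 have "AE x in lborel. x \<in> Om --> u x \<in> {0..1}" using u01 by (simp add: AE_completion_iff)
 then have "AE x in lborel. x \<in> Om --> max 0 (min 1 (w x)) = u x" using eq by eventually_elim auto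
 then show ?thesis by (intro exI[of _ "%x. max 0 (min 1 (w x))"]) auto
qed

text \<open>All exceptional sets are gathered first: the bad slices of each j, and the points where
  traces, pointwise convergence or energy bounds fail. At a remaining x of a remaining slice the
  partition is constructed pointwise.\<close>

lemma tube_limit:
 fixes u :: "nat => 'a::euclidean_space => real" and g :: "nat => 'a => 'a" and \<Phi> :: "complex \<times> 'b::euclidean_space => 'a"
 assumes dim: "DIM('a) = Suc DIM('b)" and Om: "open (- Wb)" and wg: "!!j. weak_grad (- Wb) (u j) (g j)"
  and u01: "!!j. AE x in lebesgue. x \<in> - Wb --> u j x \<in> {0..1}" and u001: "AE x in lebesgue. x \<in> - Wb --> u0 x \<in> {0..1}"
  and M: "!!j. (\<integral>\<^sup>+x\<in>- Wb. en ((norm (g j x))^2) \<partial>lebesgue) <= en M" "M >= 0"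
  and conv: "L1loc_conv (- Wb) u u0" and t: "t <= 1"
  and span: "!!j. spanning TYPE('b) C Wb (prec_ge (- Wb) (u j) t)" and tube: "tube C Wb \<gamma> \<Phi> T"
 shows "hausdorff 1 {s\<in>S1. ~ (hausdorff DIM('b) {x\<in>slice \<Phi> s. ~ (\<exists>T1 T2. x \<in> ess_bd T1 \<inter> ess_bd T2 &
   ess_disconnects (prec_ge (- Wb) u0 t \<union> slice \<Phi> s) T T1 T2)} = 0)} = 0"
proof -
 let ?Om = "- Wb"
 have dim2: "DIM('a) >= 2" "DIM('a) - 1 = DIM('b)" "DIM('b) >= 1" using dim DIM_positive[where 'a='b] by linarith+
 have T_op: "open T" by (rule tube_open[OF tube dim])
 have TOm: "closure T \<subseteq> ?Om" "T \<subseteq> ?Om" "compact (closure T)" "T \<subseteq> closure T" using tube_image[OF tube] closure_subset[of T] by auto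
 have [measurable]: "T \<in> sets borel" "closure T \<in> sets borel" using T_op by auto
 have Tbd: "bounded T" using TOm(3,4) compact_imp_bounded bounded_subset by blast
 have Tfin: "vol T < \<infinity>" using emeasure_bounded_finite[OF Tbd] by simp
 have iu: "set_integrable lebesgue K (u j)" "set_integrable lebesgue K (g j)" "set_integrable lebesgue K u0" if "compact K" "K \<subseteq> ?Om" for K j
  using wg[of j] conv that unfolding weak_grad_def L1loc_conv_def by auto
 have "\<forall>j. \<exists>v. v \<in> BM & (\<forall>x. v x \<in> {0..1}) & (AE x in lborel. x \<in> ?Om --> v x = u j x)"
  by (intro allI clamped_rep Om iu u01)
 from choice[OF this] obtain v where v: "!!j. v j \<in> BM" "!!j x. v j x \<in> {0..1}" "!!j. AE x in lborel. x \<in> ?Om --> v j x = u j x" by blast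
 have "\<exists>v. v \<in> BM & (\<forall>x. v x \<in> {0..1}) & (AE x in lborel. x \<in> ?Om --> v x = u0 x)"
  by (intro clamped_rep Om iu u001)
 then obtain v0 where v0: "v0 \<in> BM" "!!x. v0 x \<in> {0..1}" "AE x in lborel. x \<in> ?Om --> v0 x = u0 x" by blast
 have "\<forall>j. \<exists>G. G \<in> BM & (\<forall>x. x \<notin> ?Om --> G x = 0) & (AE x in lborel. x \<in> ?Om --> G x = g j x)"
  by (intro allI borel_rep Om iu)
 from choice[OF this] obtain g' where g': "!!j. g' j \<in> BM" "!!j. AE x in lborel. x \<in> ?Om --> g' j x = g j x" by blast
 note v(1)[measurable] v0(1)[measurable] g'(1)[measurable]
 \<comment> \<open>Cutting off to T leaves the inequality on segments in T intact and makes the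
   energies finite on the whole space.\<close>
 define G where "G j x = norm (g' j x)*chi T x" for j x
 have Gm[measurable]: "G j \<in> BM" for j unfolding G_def[abs_def] by measurable
 have E2: "(LI x. en ((G j x)^2)) <= en M" for j
 proof -
  have "(LI x. en ((G j x)^2)) = (\<integral>\<^sup>+x. en ((G j x)^2) \<partial>lebesgue)" by (rule nn_integral_completion[symmetric])
  also have "... <= (\<integral>\<^sup>+x\<in>?Om. en ((norm (g j x))^2) \<partial>lebesgue)"
  proof (rule nn_integral_mono_AE)
   have "AE x in lebesgue. x \<in> ?Om --> g' j x = g j x" using g'(2) by (auto intro: AE_completion)
   then show "AE x in lebesgue. en ((G j x)^2) <= en ((norm (g j x))^2)*chi ?Om x"
    by eventually_elim (use TOm(2) in \<open>auto simp: G_def indicator_def\<close>)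
  qed
  finally show ?thesis using M(1)[of j] by (rule order_trans)
 qed
 \<comment> \<open>From G <= 1 + G^2 on T.\<close>
 define M1 where "M1 = measure lborel T + M"
 have E1: "(LI x. en (G j x)) <= en M1" for j
 proof -
  have "(LI x. en (G j x)) <= (LI x. chi T x + en ((G j x)^2))"
  proof (rule nn_integral_mono)
   fix x
   have "G j x >= 0" by (simp add: G_def)
   then have "G j x <= 1 + (G j x)^2" using sum_squares_bound[of "G j x" 1] by simp
   then have "en (G j x) <= 1 + en ((G j x)^2)" by (simp flip: ennreal_plus ennreal_1 add: ennreal_leI)
   then show "en (G j x) <= chi T x + en ((G j x)^2)" by (cases "x \<in> T") (auto simp: G_def)
  qed
  also have "... = vol T + (LI x. en ((G j x)^2))" by (simp add: nn_integral_add)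
  also have "... <= en (measure lborel T) + en M"
   using Tfin by (intro add_mono E2) (simp add: emeasure_eq_ennreal_measure)
  finally show ?thesis using M(2) by (simp add: M1_def)
 qed
 have M1: "M1 >= 0" using M(2) by (simp add: M1_def)
 have upv: "upgrad T (v j) (G j)" for j
  by (rule upgrad_le[OF upgrad_if_weak_grad[OF wg Om TOm(3,1) v(1,3) g'] TOm(4)]) (auto simp: G_def)
 define f where "f j x = max 0 (t - v j x)*chi T x" for j x
 define f0 where "f0 x = max 0 (t - v0 x)*chi T x" for x
 have fm[measurable]: "f j \<in> BM" "f0 \<in> BM" for j unfolding f_def[abs_def] f0_def[abs_def] by measurable
 have f01: "f j x \<in> {0..1}" for j x using v(2)[of j x] t by (auto simp: f_def indicator_def)
 have fT: "f j x = max 0 (t - v j x)" "f0 x = max 0 (t - v0 x)" if "x \<in> T" for j x using that by (auto simp: f_def f0_def)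
 have upf: "upgrad T (f j) (G j)" for j
  by (rule upgrad_le[OF upv]) (auto simp: fT)
 have fint: "integrable lborel (f j)" for j
 proof (rule Bochner_Integration.integrable_bound[of _ "ind T"])
  show "integrable lborel (ind T)" using Tfin by (intro integrable_real_indicator) auto
  show "AE x in lborel. norm (f j x) <= norm (ind T x)"
  proof (rule AE_I2)
   fix x show "norm (f j x) <= norm (ind T x)" using f01[of j x] by (cases "x \<in> T") (auto simp: f_def)
  qed
 qed measurable
 have iG: "integrable lborel (G j)" for j
  by (rule integrableI_bounded) (use le_less_trans[OF E1[of j] ennreal_less_top] in \<open>auto simp: G_def\<close>)
 have vlim: "(%j. LI x:T. en \<bar>v j x - v0 x\<bar>) ----> 0"
 proof (rule tendsto_sandwich[OF _ _ tendsto_const])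
  have "(%j. en (LINT x:closure T|lebesgue. \<bar>u j x - u0 x\<bar>)) ----> en 0"
   using conv TOm unfolding L1loc_conv_def by (intro tendsto_ennrealI) auto
  then show "(%j. LI x:closure T. en \<bar>v j x - v0 x\<bar>) ----> 0"
   using L1_rep[OF _ TOm(1) iu(1)[OF TOm(3,1)] iu(3)[OF TOm(3,1)] v(1,3) v0(1,3)] by simp
  show "eventually (%j. (dist1 T (v j) v0) <= (dist1 (closure T) (v j) v0)) sq"
   using TOm(4) by (intro always_eventually allI nn_integral_mono mult_left_mono) (auto simp: indicator_def)
 qed simp
 obtain r where r: "strict_mono r" and rae: "AE x in lborel. (%j. en \<bar>v (r j) x - v0 x\<bar>*chi T x) ----> 0"
 proof -
  have "(%x. en \<bar>v j x - v0 x\<bar>*chi T x) \<in> borel_measurable lborel" for j by measurable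
  from AE_subseq_if_nn_integral_tendsto_0[OF this vlim] show thesis using that by blast
 qed
 have flim: "(%j. LI x:T. en \<bar>f (r j) x - f0 x\<bar>) ----> 0"
 proof (rule tendsto_sandwich[OF _ _ tendsto_const])
  show "(%j. LI x:T. en \<bar>v (r j) x - v0 x\<bar>) ----> 0" using LIMSEQ_subseq_LIMSEQ[OF vlim r] by (simp add: o_def)
  show "eventually (%j. (dist1 T (f (r j)) f0) <= (dist1 T (v (r j)) v0)) sq"
   by (intro always_eventually allI nn_integral_mono) (auto simp: indicator_def fT intro!: ennreal_leI)
 qed simp
 have fae: "AE x in lborel. x \<in> T --> (%j. f (r j) x) ----> f0 x"
  using rae
 proof eventually_elim
  case (elim x)
  show ?case
  proof
   assume x: "x \<in> T"
   then have "(%j. en \<bar>v (r j) x - v0 x\<bar>) ----> en 0" using elim by simp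
   then have "(%j. \<bar>v (r j) x - v0 x\<bar>) ----> 0" by (subst (asm) tendsto_ennreal_iff) auto
   then have "(%j. v (r j) x) ----> v0 x" using LIM_zero_cancel tendsto_rabs_zero_iff by blast
   then show "(%j. f (r j) x) ----> f0 x" using x by (auto simp: fT intro!: tendsto_intros)
  qed
 qed
 define F where "F = {x\<in>T. t <= v0 x}"
 have Fm[measurable]: "F \<in> sets borel" unfolding F_def by measurable
 have "integrable lborel (ind F)"
  using emeasure_mono[of F T lborel] Tfin by (intro integrable_real_indicator) (auto simp: F_def intro: le_less_trans)
 from AE_mean_osc_subseq[OF this] obtain ka where ka: "strict_mono ka" "AE x in lborel. (%k. mean_osc (ka k) (ind F) x) ----> 0" by blast
 \<comment> \<open>Full measure in the ambient space is all that is available;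
   \<open>slice_null_transfer\<close> converts it into H^n-almost every point of H^1-almost every
   slice.\<close>
 define good where "good x \<longleftrightarrow> (\<forall>j a. aplim (f j) x a --> f j x = a) & (x \<in> T --> (%j. f (r j) x) ----> f0 x) &
  (\<exists>L>0. frequently (%j. \<forall>k. (LI q:ball x (hp k). en (G (r j) q)) <= en (L*(3/2)^k*hp (k*DIM('a)))) sq) &
  (%k. mean_osc (ka k) (ind F) x) ----> 0" for x
 have "AE x in lborel. \<forall>j. \<forall>a. aplim (f j) x a --> f j x = a"
  unfolding AE_all_countable by (intro allI AE_trc_eq fint)
 then have "AE x in lborel. good x"
  using fae energy_frequently_bounded[of "%j. G (r j)", OF Gm E1 M1] ka(2) unfolding good_def by eventually_elim blast
 then have negN: "negligible {x. ~ good x}" by (simp add: negligible_iff_AE)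
 define OK where "OK j s x \<longleftrightarrow> (\<exists>T1 T2. x \<in> ess_bd T1 \<inter> ess_bd T2 & ess_disconnects (prec_ge ?Om (u j) t \<union> slice \<Phi> s) T T1 T2)" for j s x
 have limit: "\<exists>T1 T2. x \<in> ess_bd T1 \<inter> ess_bd T2 & ess_disconnects (prec_ge ?Om u0 t \<union> slice \<Phi> s) T T1 T2"
  if s: "s \<in> S1" and x: "x \<in> slice \<Phi> s" "good x" and ok: "!!j. OK j s x" for s x
 proof -
  define P where "P = T - slice \<Phi> s"
  have P: "open P" "P \<subseteq> T" using tube_minus_slice_open[OF tube dim s] by (auto simp: P_def)
  have xT: "x \<in> T" using slice_subset[OF tube s] x(1) by blast
  obtain nu m where nu: "nu \<noteq> 0" and m: "continuous_on T m" "!!q. q \<in> T \<inter> slice \<Phi> s ==> m q = 0"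
   and cones: "!!si. si > 0 ==> \<exists>k0. \<forall>k\<ge>k0. (\<forall>q\<in>sc x k (cone nu si). q \<in> T & 0 < m q) & (\<forall>q\<in>sc x k (cone (- nu) si). q \<in> T & m q < (0::real))"
   using tube_slice_cones[OF tube dim s x(1)] by blast
  have tr0: "hnull (DIM('a) - 1) {y\<in>T. ~ (\<exists>a. aplim v0 y a)}"
   by (rule hnull_no_trace_limit[OF T_op upv E2 M(2) v0(1) vlim])
  show ?thesis
  proof (cases "t <= v0 x")
   case True
   then have xF: "x \<in> F" using xT by (simp add: F_def)
   \<comment> \<open>The side of the slice within the tube. Its boundary also contains the slice of
     -s, which causes no harm: outside \<open>prec_ge\<close> the set F, hence also its part in H,
     has density 0 wherever v0 has a trace.\<close>
   define H where "H = {q\<in>T. 0 < m q}"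
   have "open (T \<inter> m -` {0<..})" by (rule continuous_open_preimage[OF m(1) T_op]) auto
   moreover have "T \<inter> m -` {0<..} = H" by (auto simp: H_def)
   ultimately have H: "H \<in> sets borel" by simp
   define si where "si = norm nu/2"
   have si: "0 < si" "si < norm nu" using nu by (auto simp: si_def)
   obtain k0 where k0: "!!k. k >= k0 ==> (\<forall>q\<in>sc x k (cone nu si). q \<in> T & 0 < m q) & (\<forall>q\<in>sc x k (cone (- nu) si). q \<in> T & m q < 0)"
    using cones[OF si(1)] by blast
   have no: "~ aplim (ind (F \<inter> H)) x c" for c
    by (rule superlevel_side_no_trace[OF Fm H xF ka(1) _ si, of k0]) (use x(2) k0 in \<open>fastforce simp: good_def H_def\<close>)+
   show ?thesis
   proof (rule disconnect_if_no_trace[OF T_op tube_dens_pts[OF tube dim] _ _ xT dim2(1) no no tr0])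
    show "F \<inter> H \<in> sets borel" "F \<inter> H \<subseteq> T" using H by (auto simp: F_def)
    fix y assume y: "y \<in> T - slice \<Phi> s" "y \<notin> {y\<in>T. ~ (\<exists>a. aplim v0 y a)}" "y \<notin> prec_ge ?Om u0 t"
    then obtain a where a: "aplim v0 y a" by blast
    have yT: "y \<in> T" "y \<in> ?Om" using y TOm by auto
    then have at: "a < t" using prec_ge_if_trc[OF Om yT(2) v0(1,3) a] y(3) by simp
    have "aplim (ind (F \<inter> H)) y 0"
    proof (rule trc_le[OF a order_refl order_refl _ v0(1) open_UNIV, where c="1/(t - a)"])
     fix q show "\<bar>ind (F \<inter> H) q - 0\<bar> <= 1/(t - a)*\<bar>v0 q - a\<bar>"
      using at by (auto simp: indicator_def F_def field_simps)
    qed auto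
    then show "aplim (ind (F \<inter> H)) y 0 \<or> aplim (ind (F \<inter> H)) y 1" ..
   qed
  next
   case False
   then have f0x: "f0 x > 0" using xT by (simp add: fT)
   obtain L where L: "L > 0" and fr: "frequently (%j. \<forall>k. (LI q:ball x (hp k). en (G (r j) q)) <= en (L*(3/2)^k*hp (k*DIM('a)))) sq"
    using x(2) unfolding good_def by blast
   have fx: "(%j. f (r j) x) ----> f0 x" using x(2) xT by (simp add: good_def)
   have ev: "eventually (%j. 0 < f (r j) x) sq" by (rule order_tendstoD(1)[OF fx f0x])
   \<comment> \<open>This subsequence depends on x: it selects indices whose energies are controlled
     at x at all scales and for which f_j(x) is already positive.\<close>
   have "\<exists>rh::nat => nat. strict_mono rh & (\<forall>j. (\<forall>k. (LI q:ball x (hp k). en (G (r (rh j)) q)) <= en (L*(3/2)^k*hp (k*DIM('a)))) & 0 < f (r (rh j)) x)"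
    by (rule frequently_subseq[OF frequently_eventually_frequently[OF fr ev]])
   then obtain rh :: "nat => nat" where rh: "strict_mono rh" and rhP: "\<forall>j. (\<forall>k. (LI q:ball x (hp k). en (G (r (rh j)) q)) <= en (L*(3/2)^k*hp (k*DIM('a)))) & 0 < f (r (rh j)) x"
    by blast
   have "\<exists>A. A \<in> sets borel & upgrad (T - slice \<Phi> s) (%q. f j q * ind A q) (G j) &
    ~ aplim (ind A) x 0 & ~ aplim (ind A) x 1" for j
   proof -
    obtain T1 T2 where T12: "x \<in> ess_bd T1" "ess_disconnects (prec_ge ?Om (u j) t \<union> slice \<Phi> s) T T1 T2"
     using ok[of j] unfolding OK_def by blast
    show ?thesis
     by (rule upgrad_from_disconnect[OF Om T_op TOm(2) Tfin P(1)[unfolded P_def] dim2(1) v(1,3) upv iG E2 M(2) upf _ fint fT(1) T12(2) xT T12(1)])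
      (use f01[of j] in auto)
   qed
   then have "\<forall>j. \<exists>A. A \<in> sets borel & upgrad P (%q. f j q * ind A q) (G j) &
    ~ aplim (ind A) x 0 & ~ aplim (ind A) x 1" by (simp add: P_def)
   from choice[OF this] obtain A where A: "!!j. A j \<in> sets borel" "!!j. upgrad P (%q. f j q * ind (A j) q) (G j)"
    "!!j. ~ aplim (ind (A j)) x 0" "!!j. ~ aplim (ind (A j)) x 1" by blast
   define i where "i j = r (rh j)" for j
   have "\<exists>B. B \<in> sets borel & B \<subseteq> P & ~ aplim (ind B) x 0 & ~ aplim (ind B) x 1 &
    hnull (DIM('a) - 1) {y\<in>P. ~ (\<exists>a. aplim (%q. f0 q * ind B q) y a)}"
   proof (rule interface_limit[where f="%j. f (i j)" and G="%j. G (i j)" and A="%j. A (i j)" and ?f0.0=f0])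
    show "\<exists>k0. \<forall>k\<ge>k0. sc x k (cone nu si) \<subseteq> P & sc x k (cone (- nu) si) \<subseteq> P" if si: "si > 0" for si
    proof -
     obtain k0 where k0: "!!k. k >= k0 ==> (\<forall>q\<in>sc x k (cone nu si). q \<in> T & 0 < m q) & (\<forall>q\<in>sc x k (cone (- nu) si). q \<in> T & m q < 0)"
      using cones[OF si] by blast
     then have "sc x k (cone nu si) \<subseteq> P & sc x k (cone (- nu) si) \<subseteq> P" if "k >= k0" for k
      using m(2) that unfolding P_def by fastforce
     then show ?thesis by blast
    qed
    show "(%j. LI q:T. en \<bar>f (i j) q - f0 q\<bar>) ----> 0"
     using LIMSEQ_subseq_LIMSEQ[OF flim rh] by (simp add: o_def i_def)
    show "AE q in lborel. q \<in> T --> (%j. f (i j) q) ----> f0 q"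
     using fae by eventually_elim (auto simp: i_def dest: LIMSEQ_subseq_LIMSEQ[OF _ rh] simp: o_def)
    show "(%j. f (i j) x) ----> f0 x" using LIMSEQ_subseq_LIMSEQ[OF fx rh] by (simp add: o_def i_def)
    show "aplim (f (i j)) x a ==> f (i j) x = a" for j a using x(2) by (auto simp: good_def)
    show "0 < f (i j) x" for j using rhP by (simp add: i_def)
    show "(LI q:ball x (hp k). en (G (i j) q)) <= en (L*(3/2)^k*hp (k*DIM('a)))" for j k
     using rhP by (simp add: i_def)
   qed (rule T_op Tbd xT P nu upf f01 fm f0x L E1 E2 M(2) A)+
   then obtain B where B: "B \<in> sets borel" "B \<subseteq> P" "~ aplim (ind B) x 0" "~ aplim (ind B) x 1"
    and hB: "hnull (DIM('a) - 1) {y\<in>P. ~ (\<exists>a. aplim (%q. f0 q * ind B q) y a)}" by blast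
   show ?thesis
   proof (rule disconnect_if_no_trace[OF T_op tube_dens_pts[OF tube dim] B(1) _ xT dim2(1) B(3,4) hnull_Un[OF tr0 hB]])
    show "B \<subseteq> T" using B(2) P(2) by blast
    fix y assume y: "y \<in> T - slice \<Phi> s" "y \<notin> prec_ge ?Om u0 t"
     "y \<notin> {y\<in>T. ~ (\<exists>a. aplim v0 y a)} \<union> {y\<in>P. ~ (\<exists>a. aplim (%q. f0 q * ind B q) y a)}"
    then obtain a b where a: "aplim v0 y a" and b: "aplim (%q. f0 q * ind B q) y b" unfolding P_def by blast
    have yT: "y \<in> T" "y \<in> ?Om" using y TOm by auto
    then have at: "a < t" using prec_ge_if_trc[OF Om yT(2) v0(1,3) a] y(2) by simp
    \<comment> \<open>At y the positive trace of f0 can be divided out of the trace of f0 1_B, so B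
      has density 0 or 1 there.\<close>
    have "aplim f0 y (t - a)"
     by (rule trc_le[OF a order_refl order_refl _ v0(1) T_op yT(1), where c=1]) (use at in \<open>auto simp: fT\<close>)
    from trc_ratio[OF order_refl _ B(1) fm(2) b this] at
    have "aplim (ind B) y (b/(t - a))" by simp
    moreover from trc_indicator_01[OF order_refl _ emeasure_unit_ball(1) B(1) this]
    have "b/(t - a) = 0 \<or> b/(t - a) = 1" by simp
    ultimately show "aplim (ind B) y 0 \<or> aplim (ind B) y 1" by metis
   qed
  qed
 qed
 \<comment> \<open>One H^1-null set of slices for each j; their union over all j is still
   null.\<close>
 define bad where "bad j = {s\<in>S1. ~ (hausdorff DIM('b) {x\<in>slice \<Phi> s. ~ OK j s x} = 0)}" for j
 have "hausdorff 1 (bad j) = 0" for j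
  using span[of j] tube unfolding spanning_def bad_def OK_def by blast
 then have "hnull 1 (bad j)" for j by (intro hnull_if_hausdorff_zero) auto
 then have "hnull 1 (\<Union>j. bad j)" by (rule hnull_UN)
 then have hn: "hnull 1 ((\<Union>j. bad j) \<union> {s\<in>S1. ~ hnull DIM('b) (slice \<Phi> s \<inter> {x. ~ good x})})"
  by (intro hnull_Un slice_null_transfer[OF tube dim negN])
 show ?thesis
 proof (rule hausdorff_zero_if_hnull[OF hnull_mono[OF hn]], intro subsetI, rule ccontr)
  fix s assume s: "s \<in> {s\<in>S1. ~ (hausdorff DIM('b) {x\<in>slice \<Phi> s. ~ (\<exists>T1 T2. x \<in> ess_bd T1 \<inter> ess_bd T2 &
    ess_disconnects (prec_ge ?Om u0 t \<union> slice \<Phi> s) T T1 T2)} = 0)}"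
   and n: "s \<notin> (\<Union>j. bad j) \<union> {s\<in>S1. ~ hnull DIM('b) (slice \<Phi> s \<inter> {x. ~ good x})}"
  have s1: "s \<in> S1" using s by blast
  have "hnull DIM('b) {x\<in>slice \<Phi> s. ~ OK j s x}" for j
   using n s1 dim2(3) by (intro hnull_if_hausdorff_zero) (auto simp: bad_def)
  then have "hnull DIM('b) (\<Union>j. {x\<in>slice \<Phi> s. ~ OK j s x})" by (rule hnull_UN)
  moreover have "hnull DIM('b) (slice \<Phi> s \<inter> {x. ~ good x})" using n s1 by blast
  ultimately have "hnull DIM('b) ((\<Union>j. {x\<in>slice \<Phi> s. ~ OK j s x}) \<union> (slice \<Phi> s \<inter> {x. ~ good x}))" by (rule hnull_Un)
  then have "hausdorff DIM('b) {x\<in>slice \<Phi> s. ~ (\<exists>T1 T2. x \<in> ess_bd T1 \<inter> ess_bd T2 &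
    ess_disconnects (prec_ge ?Om u0 t \<union> slice \<Phi> s) T T1 T2)} = 0"
   using dim2(3) limit[OF s1] by (intro hausdorff_zero_if_hnull) (erule hnull_mono, blast, simp)
  then show False using s by blast
 qed simp
qed

lemma gradient_energy_le_AC:
 fixes u :: "'a::euclidean_space => real"
 assumes Om: "open Om" and wg: "weak_grad Om u (wgrad Om u)" and u01: "AE x in lebesgue. x \<in> Om --> u x \<in> {0..1}"
  and Wp: "!!y. y \<in> {0..1} ==> 0 <= Wp y" and e: "0 < e" "e <= ep" and A: "AC Wp ep u Om <= en A" "A >= 0"
 shows "(\<integral>\<^sup>+x\<in>Om. en ((norm (wgrad Om u x))^2) \<partial>lebesgue) <= en (A/e)"
proof -
 let ?g = "wgrad Om u"
 have "\<exists>G. G \<in> BM & (\<forall>x. x \<notin> Om --> G x = 0) & (AE x in lborel. x \<in> Om --> G x = ?g x)"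
  using wg by (intro borel_rep Om) (simp add: weak_grad_def)
 then obtain G where G[measurable]: "G \<in> BM" and G0: "!!x. x \<notin> Om ==> G x = 0" and eq: "AE x in lborel. x \<in> Om --> G x = ?g x" by blast
 have leb: "AE x in lebesgue. x \<in> Om --> G x = ?g x" using eq by (auto intro: AE_completion)
 have "en e*(\<integral>\<^sup>+x\<in>Om. en ((norm (?g x))^2) \<partial>lebesgue) = en e*(\<integral>\<^sup>+x. en ((norm (G x))^2) \<partial>lebesgue)"
  by (intro arg_cong2[where f="(*)"] refl nn_integral_cong_AE) (use leb in eventually_elim, use G0 in \<open>auto simp: indicator_def\<close>)
 also have "... = en e*(LI x. en ((norm (G x))^2))" by (simp only: nn_integral_completion)
 also have "... = (LI x. en e*en ((norm (G x))^2))" by (rule nn_integral_cmult[symmetric]) measurable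
 also have "... = (\<integral>\<^sup>+x. en e*en ((norm (G x))^2) \<partial>lebesgue)" by (rule nn_integral_completion[symmetric])
 also have "... <= AC Wp ep u Om"
  unfolding AC_def
 proof (rule nn_integral_mono_AE)
  show "AE x in lebesgue. en e*en ((norm (G x))^2) <= en (ep*(norm (?g x))^2 + Wp (u x)/ep)*chi Om x"
   using leb u01
  proof eventually_elim
   case (elim x)
   show ?case
   proof (cases "x \<in> Om")
    case True
    have "0 <= Wp (u x)/ep" using elim(2) True e Wp by (intro divide_nonneg_pos) auto
    then have "e*(norm (G x))^2 <= ep*(norm (?g x))^2 + Wp (u x)/ep"
     using elim(1) True mult_right_mono[OF e(2) zero_le_power2[of "norm (?g x)"]] by simp
    then show ?thesis using True e by (simp add: ennreal_leI flip: ennreal_mult)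
   qed (simp add: G0)
  qed
 qed
 also note A(1)
 also have "en A = en e*en (A/e)" using e A(2) by (simp flip: ennreal_mult)
 finally show ?thesis using e by (subst (asm) ennreal_mult_le_mult_iff) auto
qed

theorem theorem3p2:
  fixes Wp :: "real \<Rightarrow> real"
    and Wb :: "'a::euclidean_space set"
    and C :: "(complex \<Rightarrow> 'a) set"
    and eps dl :: "nat \<Rightarrow> real"
    and eps0 dl0 :: real
    and u :: "nat \<Rightarrow> 'a \<Rightarrow> real"
    and u0 :: "'a \<Rightarrow> real"
  assumes dim: "DIM('a) = Suc DIM('b::euclidean_space)"
    and Wp: "double_well Wp"
    and closedW: "closed Wb"
    and C: "spanning_class Wb C"
    and eps_pos: "\<forall>j. eps j > 0"
    and dl_range: "\<forall>j. dl j \<in> {1/2<..1}"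
    and eps_lim: "eps \<longlonglongrightarrow> eps0"
    and dl_lim: "dl \<longlonglongrightarrow> dl0"
    and u_sob: "\<forall>j. W12_unit (- Wb) (u j)"
    and energy: "(SUP j. AC Wp (eps j) (u j) (- Wb)) < \<infinity>"
    and conv: "L1loc_conv (- Wb) u u0"
    and span: "\<forall>j. \<forall>t\<in>{1/2<..<dl j}. spanning TYPE('b) C Wb (prec_ge (- Wb) (u j) t)"
    and eps0_pos: "eps0 > 0"
    and dl0: "dl0 > 1/2" "dl0 \<le> 1"
  shows "W12_loc (- Wb) u0 \<and>
         (\<forall>t\<in>{1/2<..<dl0}. spanning TYPE('b) C Wb (prec_ge (- Wb) u0 t))"
proof -
 let ?Om = "- Wb"
 have Om: "open ?Om" using closedW by (rule open_Compl)
 have u01: "AE x in lebesgue. x \<in> ?Om --> u j x \<in> {0..1}" for j using u_sob by (simp add: W12_unit_def)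
 have wg: "weak_grad ?Om (u j) (wgrad ?Om (u j))" for j
 proof -
  have "\<exists>g. weak_grad ?Om (u j) g" using u_sob by (auto simp: W12_unit_def W12_def)
  then show ?thesis unfolding wgrad_def by (rule someI_ex)
 qed
 have Wp0: "0 <= Wp y" if "y \<in> {0..1}" for y
  using Wp that unfolding double_well_def by (cases "y = 0 \<or> y = 1") (auto intro: less_imp_le)
 \<comment> \<open>A positive limit bounds all late terms below by half of it; the finitely many
   earlier ones are positive.\<close>
 obtain e where e: "0 < e" "!!j. e <= eps j"
 proof -
  have "eventually (%j. eps0/2 < eps j) sq" using eps0_pos by (intro order_tendstoD(1)[OF eps_lim]) simp
  then obtain J where J: "!!j. j >= J ==> eps0/2 < eps j" by (auto simp: eventually_sequentially)
  define e where "e = Min (insert (eps0/2) (eps ` {..<J}))"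
  have "0 < e" unfolding e_def using eps0_pos eps_pos by (subst Min_gr_iff) auto
  moreover have "e <= eps j" for j
  proof (cases "j < J")
   case True
   then show ?thesis unfolding e_def by (intro Min_le) auto
  next
   case False
   have "e <= eps0/2" unfolding e_def by (intro Min_le) auto
   then show ?thesis using J[of j] False by simp
  qed
  ultimately show thesis using that by blast
 qed
 define A where "A = enn2real (SUP j. AC Wp (eps j) (u j) ?Om)"
 have A: "AC Wp (eps j) (u j) ?Om <= en A" for j
 proof -
  have "AC Wp (eps j) (u j) ?Om <= (SUP j. AC Wp (eps j) (u j) ?Om)" by (rule SUP_upper) simp
  also have "... = en A" using energy by (simp add: A_def)
  finally show ?thesis .
 qed
 have A0: "A >= 0" by (simp add: A_def)
 have M: "(\<integral>\<^sup>+x\<in>?Om. en ((norm (wgrad ?Om (u j) x))^2) \<partial>lebesgue) <= en (A/e)" for j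
  by (rule gradient_energy_le_AC[OF Om wg u01 Wp0 e A A0])
 note lim = W12_loc_limit[OF Om wg u01 M conv]
 have "spanning TYPE('b) C Wb (prec_ge ?Om u0 t)" if t: "t \<in> {1/2<..<dl0}" for t
  unfolding spanning_def
 proof (intro conjI allI impI)
  have "set_integrable lebesgue K u0" if "compact K" "K \<subseteq> ?Om" for K using conv that by (simp add: L1loc_conv_def)
  from clamped_rep[OF Om this lim(2)]
  obtain v where v: "v \<in> BM" "!!x. v x \<in> {0..1}" "AE x in lborel. x \<in> ?Om --> v x = u0 x" by blast
  show "prec_ge ?Om u0 t \<in> sets borel" by (rule prec_ge_borel[OF Om v(1,3)]) (use v(2) in \<open>auto simp: abs_le_iff intro: order_trans[of _ 0]\<close>)
  show "prec_ge ?Om u0 t \<subseteq> ?Om" by (auto simp: prec_ge_def)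
  fix \<gamma> T and \<Phi> :: "complex \<times> 'b => 'a" assume tube: "tube C Wb \<gamma> \<Phi> T"
  \<comment> \<open>The hypothesis at level t is available for late indices only, so the sequence is
    shifted; the limit is obtained at the same level t.\<close>
  have "eventually (%j. t < dl j) sq" using t by (intro order_tendstoD(1)[OF dl_lim]) simp
  then obtain J where J: "!!j. j >= J ==> t < dl j" by (auto simp: eventually_sequentially)
  have conv': "L1loc_conv ?Om (%j. u (j + J)) u0"
   using conv LIMSEQ_ignore_initial_segment[of _ 0 J] unfolding L1loc_conv_def by auto
  have sp: "spanning TYPE('b) C Wb (prec_ge ?Om (u (j + J)) t)" for j using span t J[of "j + J"] by auto
  have "A/e >= 0" "t <= 1" using A0 e t dl0 by auto
  then show "hausdorff 1 {s\<in>S1. ~ (hausdorff DIM('b) {x\<in>slice \<Phi> s. ~ (\<exists>T1 T2. x \<in> ess_bd T1 \<inter> ess_bd T2 &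
    ess_disconnects (prec_ge ?Om u0 t \<union> slice \<Phi> s) T T1 T2)} = 0)} = 0"
   by (intro tube_limit[OF dim Om wg u01 lim(2) M _ conv' _ sp tube])
 qed
 with lim(1) show ?thesis by blast
qed

end
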